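(* Let $A$ be a basic finite dimensional algebra over a field with a complete set $\{e_1,e_2\}$ of primitive orthogonal idempotents, $P_i=e_iA$. Then $A$ is $g$-convex if and only if $(e_1,e_2)$ satisfies $(\mathsf L)$ or $(\mathsf R)$ and $(e_2,e_1)$ satisfies $(\mathsf L)$ or $(\mathsf R)$. More precisely, let $Q=\{a[P_1]+b[P_2]\mid a\ge0,b\le0\}$ and for vectors $u_0=[P_1],u_1,\dots,u_r=-[P_2]$ write $\Delta(u_0,\dots,u_r)=\bigcup_{t}\operatorname{conv}\{0,u_{t-1},u_t\}$. Then: (a) $\mathcal P(A)\cap Q=\Delta([P_1],-[P_2])$ iff $e_1Ae_2=0$; (b) $\mathcal P(A)\cap Q=\Delta([P_1],[P_1]-[P_2],-[P_2])$ iff $e_1Ae_2$ is non-zero, left cyclic and right cyclic; (c) $\mathcal P(A)\cap Q=\Delta([P_1],[P_1]-[P_2],[P_1]-2[P_2],-[P_2])$ iff $(e_1,e_2)$ satisfies $(\mathsf L)$ but not $(\mathsf R)$; (d) $\mathcal P(A)\cap Q=\Delta([P_1],2[P_1]-[P_2],[P_1]-[P_2],-[P_2])$ iff $(e_1,e_2)$ satisfies $(\mathsf R)$ but not $(\mathsf L)$.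
   Context: $\mathcal P(A)=\bigcup_T\operatorname{conv}\{0,[T_1],[T_2]\}\subset K_0(\operatorname{proj}A)_{\mathbb R}$ over all basic 2-term silting complexes $T=T_1\oplus T_2$ in $\mathsf{K}^{\rm b}(\operatorname{proj}A)$ (complexes in degrees $-1,0$ with $\operatorname{Hom}(T,T[\ell])=0$ for $\ell>0$ generating the category as thick subcategory); $A$ is $g$-convex if $\mathcal P(A)$ is convex. For orthogonal primitive idempotents $e\neq e'$ and $x\in eAe'$: $x$ is a left generator if $eAx=eAe'$, a right generator if $xAe'=eAe'$; $eAe'$ is left (right) cyclic if it has a left (right) generator. $L_x=\{a\in e'Ae'\mid xa\in eAx\}$, $R_x=\{a\in eAe\mid ax\in xAe'\}$. Condition $(\mathsf L)$ for $(e,e')$: $eAe'$ is left cyclic and there are $x\in eAe'$, $u\in eAe$ with $eAe=R_x+R_xu$ and $eAe'=xAe'+uxAe'$. Condition $(\mathsf R)$ for $(e,e')$: $eAe'$ is right cyclic and there are $x\in eAe'$, $u\in e'Ae'$ with $e'Ae'=L_x+uL_x$ and $eAe'=eAx+eAxu$. *)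

theory Defs
  imports "HOL-Analysis.Analysis"
begin

definition fd_algebra :: "('k::field \<Rightarrow> 'a::ring_1 \<Rightarrow> 'a) \<Rightarrow> bool" where
  "fd_algebra sc \<longleftrightarrow> vector_space sc
     \<and> (\<forall>c x y. sc c (x * y) = sc c x * y \<and> sc c (x * y) = x * sc c y)
     \<and> (\<exists>B. finite B \<and> module.span sc B = UNIV)"

definition idempotent :: "'a::ring_1 \<Rightarrow> bool" where
  "idempotent e \<longleftrightarrow> e * e = e"

definition primitive_idem :: "'a::ring_1 \<Rightarrow> bool" where
  "primitive_idem e \<longleftrightarrow> e \<noteq> 0 \<and> idempotent e \<and>
     \<not> (\<exists>f g. f \<noteq> 0 \<and> g \<noteq> 0 \<and> idempotent f \<and> idempotent g \<and> f * g = 0 \<and> g * f = 0 \<and> f + g = e)"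

definition complete_prim_orth_idems :: "'a::ring_1 \<Rightarrow> 'a \<Rightarrow> bool" where
  "complete_prim_orth_idems e1 e2 \<longleftrightarrow> primitive_idem e1 \<and> primitive_idem e2 \<and>
     e1 * e2 = 0 \<and> e2 * e1 = 0 \<and> e1 + e2 = 1"

definition corner :: "'a::ring_1 \<Rightarrow> 'a \<Rightarrow> 'a set" where
  "corner e e' = {e * a * e' | a. True}"

text \<open>Basic: P1 = e1 A and P2 = e2 A are not isomorphic (Hom(e_j A, e_i A) = e_i A e_j
 acting by left multiplication).\<close>
definition basic_alg :: "'a::ring_1 \<Rightarrow> 'a \<Rightarrow> bool" where
  "basic_alg e1 e2 \<longleftrightarrow> \<not> (\<exists>x\<in>corner e1 e2. \<exists>y\<in>corner e2 e1. x * y = e1 \<and> y * x = e2)"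

definition left_gen :: "'a::ring_1 \<Rightarrow> 'a \<Rightarrow> 'a \<Rightarrow> bool" where
  "left_gen e e' x \<longleftrightarrow> x \<in> corner e e' \<and> {e * a * x | a. True} = corner e e'"

definition right_gen :: "'a::ring_1 \<Rightarrow> 'a \<Rightarrow> 'a \<Rightarrow> bool" where
  "right_gen e e' x \<longleftrightarrow> x \<in> corner e e' \<and> {x * a * e' | a. True} = corner e e'"

definition left_cyclic :: "'a::ring_1 \<Rightarrow> 'a \<Rightarrow> bool" where
  "left_cyclic e e' \<longleftrightarrow> (\<exists>x. left_gen e e' x)"

definition right_cyclic :: "'a::ring_1 \<Rightarrow> 'a \<Rightarrow> bool" where
  "right_cyclic e e' \<longleftrightarrow> (\<exists>x. right_gen e e' x)"

definition Lx :: "'a::ring_1 \<Rightarrow> 'a \<Rightarrow> 'a \<Rightarrow> 'a set" where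
  "Lx e e' x = {a \<in> corner e' e'. x * a \<in> {e * b * x | b. True}}"

definition Rx :: "'a::ring_1 \<Rightarrow> 'a \<Rightarrow> 'a \<Rightarrow> 'a set" where
  "Rx e e' x = {a \<in> corner e e. a * x \<in> {x * b * e' | b. True}}"

definition condL :: "'a::ring_1 \<Rightarrow> 'a \<Rightarrow> bool" where
  "condL e e' \<longleftrightarrow> left_cyclic e e' \<and>
     (\<exists>x\<in>corner e e'. \<exists>u\<in>corner e e.
        corner e e = {r + s * u | r s. r \<in> Rx e e' x \<and> s \<in> Rx e e' x} \<and>
        corner e e' = {p + q | p q. p \<in> {x * a * e' | a. True} \<and> q \<in> {u * x * a * e' | a. True}})"

definition condR :: "'a::ring_1 \<Rightarrow> 'a \<Rightarrow> bool" where
  "condR e e' \<longleftrightarrow> right_cyclic e e' \<and>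
     (\<exists>x\<in>corner e e'. \<exists>u\<in>corner e' e'.
        corner e' e' = {r + u * s | r s. r \<in> Lx e e' x \<and> s \<in> Lx e e' x} \<and>
        corner e e' = {p + q | p q. p \<in> {e * a * x | a. True} \<and> q \<in> {e * a * x * u | a. True}})"

text \<open>Every finitely generated projective A-module is a direct sum of copies of P1 = e1 A
 and P2 = e2 A; it is encoded by a list of labels (True = P1, False = P2).
 A morphism from the sum indexed by src to the sum indexed by tgt is a matrix M with
 M i j in e_(tgt!i) A e_(src!j) (left multiplication), zero outside the index range.\<close>

type_synonym 'a mat = "nat \<Rightarrow> nat \<Rightarrow> 'a"

definition lab :: "'a \<Rightarrow> 'a \<Rightarrow> bool \<Rightarrow> 'a" where
  "lab e1 e2 b = (if b then e1 else e2)"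

definition hom_mat :: "'a::ring_1 \<Rightarrow> 'a \<Rightarrow> bool list \<Rightarrow> bool list \<Rightarrow> 'a mat \<Rightarrow> bool" where
  "hom_mat e1 e2 src tgt M \<longleftrightarrow> (\<forall>i j. if i < length tgt \<and> j < length src
       then M i j \<in> corner (lab e1 e2 (tgt ! i)) (lab e1 e2 (src ! j)) else M i j = 0)"

definition mmul :: "nat \<Rightarrow> 'a::ring_1 mat \<Rightarrow> 'a mat \<Rightarrow> 'a mat" where
  "mmul n M N = (\<lambda>i j. \<Sum>k<n. M i k * N k j)"

definition id_mat :: "'a::ring_1 \<Rightarrow> 'a \<Rightarrow> bool list \<Rightarrow> 'a mat" where
  "id_mat e1 e2 l = (\<lambda>i j. if i = j \<and> i < length l then lab e1 e2 (l ! i) else 0)"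

definition blk :: "nat \<Rightarrow> nat \<Rightarrow> 'a mat \<Rightarrow> 'a mat \<Rightarrow> 'a mat \<Rightarrow> 'a mat \<Rightarrow> 'a mat" where
  "blk p q A B C D = (\<lambda>i j. if i < p then (if j < q then A i j else B i (j - q))
                                    else (if j < q then C (i - p) j else D (i - p) (j - q)))"

text \<open>A (cochain) complex: objects in each degree and differentials d n : C^n \<rightarrow> C^(n+1).\<close>
type_synonym 'a cplx = "(int \<Rightarrow> bool list) \<times> (int \<Rightarrow> 'a mat)"

definition is_cplx :: "'a::ring_1 \<Rightarrow> 'a \<Rightarrow> 'a cplx \<Rightarrow> bool" where
  "is_cplx e1 e2 C \<longleftrightarrow> (\<exists>N. \<forall>n. \<bar>n\<bar> > N \<longrightarrow> fst C n = [])
     \<and> (\<forall>n. hom_mat e1 e2 (fst C n) (fst C (n + 1)) (snd C n))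
     \<and> (\<forall>n. mmul (length (fst C (n + 1))) (snd C (n + 1)) (snd C n) = (\<lambda>i j. 0))"

definition chain_map :: "'a::ring_1 \<Rightarrow> 'a \<Rightarrow> 'a cplx \<Rightarrow> 'a cplx \<Rightarrow> (int \<Rightarrow> 'a mat) \<Rightarrow> bool" where
  "chain_map e1 e2 C D f \<longleftrightarrow> (\<forall>n. hom_mat e1 e2 (fst C n) (fst D n) (f n))
     \<and> (\<forall>n. mmul (length (fst D n)) (snd D n) (f n) = mmul (length (fst C (n + 1))) (f (n + 1)) (snd C n))"

definition null_homotopic :: "'a::ring_1 \<Rightarrow> 'a \<Rightarrow> 'a cplx \<Rightarrow> 'a cplx \<Rightarrow> (int \<Rightarrow> 'a mat) \<Rightarrow> bool" where
  "null_homotopic e1 e2 C D f \<longleftrightarrow> (\<exists>h. (\<forall>n. hom_mat e1 e2 (fst C n) (fst D (n - 1)) (h n)) \<and>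
     (\<forall>n. f n = (\<lambda>i j. mmul (length (fst D (n - 1))) (snd D (n - 1)) (h n) i j
                      + mmul (length (fst C (n + 1))) (h (n + 1)) (snd C n) i j)))"

definition homotopic :: "'a::ring_1 \<Rightarrow> 'a \<Rightarrow> 'a cplx \<Rightarrow> 'a cplx \<Rightarrow> (int \<Rightarrow> 'a mat) \<Rightarrow> (int \<Rightarrow> 'a mat) \<Rightarrow> bool" where
  "homotopic e1 e2 C D f g \<longleftrightarrow> null_homotopic e1 e2 C D (\<lambda>n i j. f n i j - g n i j)"

definition comp_map :: "'a cplx \<Rightarrow> (int \<Rightarrow> 'a::ring_1 mat) \<Rightarrow> (int \<Rightarrow> 'a mat) \<Rightarrow> (int \<Rightarrow> 'a mat)" where
  "comp_map D g f = (\<lambda>n. mmul (length (fst D n)) (g n) (f n))"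

definition htpy_equiv :: "'a::ring_1 \<Rightarrow> 'a \<Rightarrow> 'a cplx \<Rightarrow> 'a cplx \<Rightarrow> bool" where
  "htpy_equiv e1 e2 C D \<longleftrightarrow> (\<exists>f g. chain_map e1 e2 C D f \<and> chain_map e1 e2 D C g \<and>
     homotopic e1 e2 C C (comp_map D g f) (\<lambda>n. id_mat e1 e2 (fst C n)) \<and>
     homotopic e1 e2 D D (comp_map C f g) (\<lambda>n. id_mat e1 e2 (fst D n)))"

definition zero_cplx :: "'a::ring_1 cplx" where
  "zero_cplx = (\<lambda>n. [], \<lambda>n i j. 0)"

definition shift :: "'a::ring_1 cplx \<Rightarrow> 'a cplx" where
  "shift C = (\<lambda>n. fst C (n + 1), \<lambda>n i j. - snd C (n + 1) i j)"

definition unshift :: "'a::ring_1 cplx \<Rightarrow> 'a cplx" where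
  "unshift C = (\<lambda>n. fst C (n - 1), \<lambda>n i j. - snd C (n - 1) i j)"

definition dsum :: "'a::ring_1 cplx \<Rightarrow> 'a cplx \<Rightarrow> 'a cplx" where
  "dsum C D = (\<lambda>n. fst C n @ fst D n,
     \<lambda>n. blk (length (fst C (n + 1))) (length (fst C n)) (snd C n) (\<lambda>i j. 0) (\<lambda>i j. 0) (snd D n))"

definition cone :: "'a::ring_1 cplx \<Rightarrow> 'a cplx \<Rightarrow> (int \<Rightarrow> 'a mat) \<Rightarrow> 'a cplx" where
  "cone C D f = (\<lambda>n. fst C (n + 1) @ fst D n,
     \<lambda>n. blk (length (fst C (n + 2))) (length (fst C (n + 1)))
            (\<lambda>i j. - snd C (n + 1) i j) (\<lambda>i j. 0) (f (n + 1)) (snd D n))"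

inductive_set thick :: "'a::ring_1 \<Rightarrow> 'a \<Rightarrow> 'a cplx set \<Rightarrow> 'a cplx set" for e1 e2 S where
  base: "C \<in> S \<Longrightarrow> C \<in> thick e1 e2 S"
| iso: "C \<in> thick e1 e2 S \<Longrightarrow> is_cplx e1 e2 D \<Longrightarrow> htpy_equiv e1 e2 D C \<Longrightarrow> D \<in> thick e1 e2 S"
| shift: "C \<in> thick e1 e2 S \<Longrightarrow> shift C \<in> thick e1 e2 S"
| unshift: "C \<in> thick e1 e2 S \<Longrightarrow> unshift C \<in> thick e1 e2 S"
| cone: "C \<in> thick e1 e2 S \<Longrightarrow> D \<in> thick e1 e2 S \<Longrightarrow> chain_map e1 e2 C D f \<Longrightarrow>
         cone C D f \<in> thick e1 e2 S"
| summand: "is_cplx e1 e2 X \<Longrightarrow> is_cplx e1 e2 Y \<Longrightarrow> dsum X Y \<in> thick e1 e2 S \<Longrightarrow>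
         X \<in> thick e1 e2 S"

definition two_term :: "'a::ring_1 \<Rightarrow> 'a \<Rightarrow> 'a cplx \<Rightarrow> bool" where
  "two_term e1 e2 C \<longleftrightarrow> is_cplx e1 e2 C \<and> (\<forall>n. n \<noteq> -1 \<and> n \<noteq> 0 \<longrightarrow> fst C n = [])"

definition silting :: "'a::ring_1 \<Rightarrow> 'a \<Rightarrow> 'a cplx \<Rightarrow> bool" where
  "silting e1 e2 T \<longleftrightarrow> is_cplx e1 e2 T
     \<and> (\<forall>l::nat. l > 0 \<longrightarrow> (\<forall>f. chain_map e1 e2 T ((shift ^^ l) T) f \<longrightarrow>
                                  null_homotopic e1 e2 T ((shift ^^ l) T) f))
     \<and> (\<forall>C. is_cplx e1 e2 C \<longrightarrow> C \<in> thick e1 e2 {T})"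

definition indecomposable :: "'a::ring_1 \<Rightarrow> 'a \<Rightarrow> 'a cplx \<Rightarrow> bool" where
  "indecomposable e1 e2 C \<longleftrightarrow> is_cplx e1 e2 C \<and> \<not> htpy_equiv e1 e2 C zero_cplx \<and>
     (\<forall>X Y. is_cplx e1 e2 X \<and> is_cplx e1 e2 Y \<and> htpy_equiv e1 e2 C (dsum X Y) \<longrightarrow>
        htpy_equiv e1 e2 X zero_cplx \<or> htpy_equiv e1 e2 Y zero_cplx)"

definition basic_silting_pair :: "'a::ring_1 \<Rightarrow> 'a \<Rightarrow> 'a cplx \<Rightarrow> 'a cplx \<Rightarrow> bool" where
  "basic_silting_pair e1 e2 T1 T2 \<longleftrightarrow> two_term e1 e2 T1 \<and> two_term e1 e2 T2 \<and>
     indecomposable e1 e2 T1 \<and> indecomposable e1 e2 T2 \<and> \<not> htpy_equiv e1 e2 T1 T2 \<and>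
     silting e1 e2 (dsum T1 T2)"

definition cnt :: "bool \<Rightarrow> bool list \<Rightarrow> real" where
  "cnt b l = real (length (filter (\<lambda>x. x = b) l))"

definition K0class :: "'a cplx \<Rightarrow> real \<times> real" where
  "K0class C = ((\<Sum>n\<in>{n. fst C n \<noteq> []}. (if even n then 1 else -1) * cnt True (fst C n)),
                (\<Sum>n\<in>{n. fst C n \<noteq> []}. (if even n then 1 else -1) * cnt False (fst C n)))"

definition gpoly :: "'a::ring_1 \<Rightarrow> 'a \<Rightarrow> (real \<times> real) set" where
  "gpoly e1 e2 = \<Union> {convex hull {0, K0class T1, K0class T2} | T1 T2. basic_silting_pair e1 e2 T1 T2}"

definition Qreg :: "(real \<times> real) set" where
  "Qreg = {(a, b). a \<ge> 0 \<and> b \<le> 0}"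

definition Delta :: "(real \<times> real) list \<Rightarrow> (real \<times> real) set" where
  "Delta us = (\<Union>t\<in>{1..<length us}. convex hull {0, us ! (t - 1), us ! t})"

end

theory Submission
  imports Defs "HOL-Library.Function_Algebras"
begin

text \<open>
  A basic two-term silting pair with a class in the interior of \<open>Qreg\<close> consists of radical two-term complexes
  \<open>P2^b \<rightarrow> P1^a\<close> with local endomorphism rings. Comparing dimensions of Hom spaces, as in King's
  stability argument, shows that such a complex is determined by its class as soon as the class lies in the cone of a
  compatible pair, and that compatible pairs of classes are bases of \<open>\<int>^2\<close>.

  If \<open>k\<close> and \<open>l\<close> are the minimal numbers of left and right generators of \<open>e1 A e2\<close>, the first
  and last triangle in \<open>Qreg\<close> have the vertices \<open>(k, -1)\<close> and \<open>(1, -l)\<close>. Convexity along the axes forces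
  \<open>k, l \<le> 2\<close>, and \<open>k = l = 2\<close> is impossible because the midpoint \<open>(3/2, -3/2)\<close> lies in no unimodular
  triangle. For \<open>k = 1\<close>, \<open>l = 2\<close> the remaining cone is a single triangle iff \<open>(1, -1)\<close> and \<open>(1, -2)\<close> are
  the classes of a compatible pair, which is condition \<open>(L)\<close>; condition \<open>(R)\<close> is the dual case.
\<close>

text \<open>The basis property of the classes of a silting pair is proved here by rank-nullity
  alone. For an object \<open>T : P2^b -> P1^a\<close> and a test object \<open>S\<close>, matrices
  from the source of \<open>T\<close> to the source of \<open>S\<close> are composed with the
  differential of \<open>S\<close>. The dimensions of domain and codomain are linear in the class of
  \<open>S\<close>, and compatibility of \<open>T\<close> with \<open>S\<close> makes the map
  surjective, so a dimension becomes the value of a linear form on classes. The field is arbitrary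
  and the residue rings of endomorphism rings are only division algebras; their dimension divides
  both codimensions and has to be cancelled before an integral form with value \<open>1\<close>
  appears.

  The reduction to \<open>P2^b -> P1^a\<close> rests on minimal complexes: a projective common to
  degree -1 of one summand and degree 0 of another gives a map to the shift that no homotopy
  reaches, because all differentials are radical. The same fact lets strict chain maps replace
  homotopy classes. The quadrant opposite to \<open>Qreg\<close> is reached by exchanging the
  idempotents, and in each of the other two the polygon is a single triangle.\<close>

section \<open>Dimension counting for finite-dimensional subspaces\<close>

locale vspace = vector_space scale for scale :: "'k::field \<Rightarrow> 'v::ab_group_add \<Rightarrow> 'v"
begin

text \<open>The function spaces \<open>nat \<Rightarrow> 'a\<close> used below are
  infinite-dimensional, so finiteness is a property of subsets and the dimension formulas carry it
  as a hypothesis.\<close>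

definition findim :: "'v set \<Rightarrow> bool" where
  "findim S \<longleftrightarrow> (\<exists>B. finite B \<and> S \<subseteq> span B)"

lemma findim_subset: "findim S \<Longrightarrow> T \<subseteq> S \<Longrightarrow> findim T"
  unfolding findim_def by blast

lemma findim_basis:
  assumes "findim S" "subspace S"
  obtains B where "B \<subseteq> S" "independent B" "finite B" "span B = S" "card B = dim S"
proof -
  obtain B0 where B0: "finite B0" "S \<subseteq> span B0" using assms(1) findim_def by auto
  obtain B where B: "B \<subseteq> S" "independent B" "S \<subseteq> span B" "card B = dim S"
    using basis_exists by blast
  have "finite B" using independent_span_bound[OF B0(1) B(2)] B(1) B0(2) by auto
  moreover have "span B = S" using B assms(2) by (simp add: span_minimal subset_antisym)
  ultimately show ?thesis using B that by blast
qed

lemma findim_extend: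
  assumes "findim S" "subspace S" "A \<subseteq> S" "independent A"
  obtains B where "A \<subseteq> B" "B \<subseteq> S" "independent B" "finite B" "span B = S" "card B = dim S"
proof -
  obtain B0 where B0: "finite B0" "S \<subseteq> span B0" using assms(1) findim_def by auto
  obtain B where B: "A \<subseteq> B" "B \<subseteq> S" "independent B" "S \<subseteq> span B"
    using maximal_independent_subset_extend[OF assms(3,4)] by blast
  have "finite B" using independent_span_bound[OF B0(1) B(3)] B(2) B0(2) by auto
  moreover have "span B = S" using B assms(2) by (simp add: span_minimal subset_antisym)
  moreover have "card B = dim S" using B basis_card_eq_dim by blast
  ultimately show ?thesis using B that by blast
qed

lemma dim_mono_findim:
  assumes "findim T" "S \<subseteq> T" "subspace S" "subspace T"
  shows "dim S \<le> dim T" "dim S = dim T \<Longrightarrow> S = T"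
proof -
  obtain B where B: "B \<subseteq> S" "independent B" "finite B" "span B = S" "card B = dim S"
    using findim_basis findim_subset assms by metis
  obtain C where C: "B \<subseteq> C" "C \<subseteq> T" "independent C" "finite C" "span C = T" "card C = dim T"
    using findim_extend[OF assms(1,4), of B] B assms(2) by auto
  show "dim S \<le> dim T" using card_mono[OF C(4,1)] B C by simp
  show "S = T" if "dim S = dim T"
  proof -
    have "B = C" using card_subset_eq[OF C(4,1)] B(5) C(6) that by simp
    then show ?thesis using B(4) C(5) by simp
  qed
qed

text \<open>If every term avoided the span of the later ones, any finite number of terms would be
  independent, adding them one by one from the back; more terms than a finite spanning set has
  elements is then impossible. Applied to the powers of an element, this feeds Fitting's
  lemma.\<close>

lemma seq_tail_span:
  fixes p :: "nat \<Rightarrow> 'v"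
  assumes "findim S" "range p \<subseteq> S"
  shows "\<exists>n. p n \<in> span (p ` {n<..})"
proof (rule ccontr)
  assume neg: "\<not> ?thesis"
  obtain B where B: "finite B" "S \<subseteq> span B" using assms(1) findim_def by auto
  have "independent (p ` {N-k..<N}) \<and> card (p ` {N-k..<N}) = k" if "k \<le> N" for N k
    using that
  proof (induction k)
    case 0 then show ?case by (simp add: independent_empty)
  next
    case (Suc k)
    let ?n = "N - Suc k"
    have eq: "{?n..<N} = insert ?n {N-k..<N}" using Suc.prems by auto
    have "p ` {N-k..<N} \<subseteq> p ` {?n<..}" using Suc.prems by auto
    then have "span (p ` {N-k..<N}) \<subseteq> span (p ` {?n<..})" by (rule span_mono)
    then have nin: "p ?n \<notin> span (p ` {N-k..<N})" using neg by blast
    then have "p ?n \<notin> p ` {N-k..<N}" by (metis span_base)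
    then show ?case using Suc independent_insertI[OF nin] by (simp add: eq)
  qed
  from this[of "Suc (card B)" "Suc (card B)"]
  have "independent (p ` {0..<Suc (card B)})" "card (p ` {0..<Suc (card B)}) = Suc (card B)" by auto
  moreover have "p ` {0..<Suc (card B)} \<subseteq> span B" using assms(2) B(2) by auto
  ultimately show False using independent_span_bound[OF B(1)] by fastforce
qed

end

locale vspace_pair = vs1: vspace s1 + vs2: vspace s2
  for s1 :: "'k::field \<Rightarrow> 'v::ab_group_add \<Rightarrow> 'v" and s2 :: "'k \<Rightarrow> 'w::ab_group_add \<Rightarrow> 'w"
begin

sublocale vector_space_pair s1 s2 ..

text \<open>Rank-nullity for the induced map from \<open>S\<close> to the quotient by
  \<open>W\<close>, without forming the quotient: the kernel is the preimage of \<open>W\<close>,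
  and the image is replaced by image plus \<open>W\<close>.\<close>

lemma rank_nullity_mod:
  assumes lin: "Vector_Spaces.linear s1 s2 f" and S: "vs1.subspace S" "vs1.findim S"
    and W: "vs2.subspace W" "vs2.findim W"
  shows "vs1.dim S + vs2.dim W
    = vs1.dim {x\<in>S. f x \<in> W} + vs2.dim {f x + w |x w. x \<in> S \<and> w \<in> W}"
proof -
  interpret f: Vector_Spaces.linear s1 s2 f by fact
  let ?K = "{x\<in>S. f x \<in> W}"
  have K: "vs1.subspace ?K"
    using S(1) W(1) by (auto simp: vs1.subspace_def vs2.subspace_def f.add f.scale f.zero)
  have finK: "vs1.findim ?K" using S(2) by (rule vs1.findim_subset) auto
  obtain BK where BK: "BK \<subseteq> ?K" "vs1.independent BK" "finite BK" "vs1.span BK = ?K"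
    "card BK = vs1.dim ?K" using vs1.findim_basis[OF finK K] .
  obtain BS where BS: "BK \<subseteq> BS" "BS \<subseteq> S" "vs1.independent BS" "finite BS" "vs1.span BS = S"
    "card BS = vs1.dim S" using vs1.findim_extend[OF S(2,1), of BK] BK by auto
  obtain BW where BW: "BW \<subseteq> W" "vs2.independent BW" "finite BW" "vs2.span BW = W"
    "card BW = vs2.dim W" using vs2.findim_basis[OF W(2,1)] .
  \<comment> \<open>The basis of \<open>S\<close> extends one of the kernel. The images of the
    additional vectors stay independent even together with a basis of \<open>W\<close>; the
    induction on \<open>D\<close> also shows that \<open>f\<close> is injective on them, hence the
    cardinality.\<close>
  have *: "vs2.independent (f ` D \<union> BW) \<and> card (f ` D \<union> BW) = card D + card BW"
    if "finite D" "D \<subseteq> BS - BK" for D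
    using that
  proof (induction D)
    case empty then show ?case using BW by simp
  next
    case (insert x D)
    have nsp: "f x \<notin> vs2.span (f ` D \<union> BW)"
    proof
      assume "f x \<in> vs2.span (f ` D \<union> BW)"
      then obtain y w where yw: "y \<in> vs1.span D" "w \<in> W" "f x = f y + w"
        unfolding vs2.span_Un BW(4) f.span_image by auto
      have "x - y \<in> S"
        using insert.prems BS vs1.span_mono[of D BS] yw(1) S(1) vs1.subspace_diff by blast
      moreover have "f (x - y) = w" using yw(3) by (simp add: f.diff)
      ultimately have "x - y \<in> vs1.span BK" using BK(4) yw(2) by auto
      then have "(x - y) + y \<in> vs1.span (BK \<union> D)"
        using yw(1) vs1.span_mono[of BK "BK \<union> D"] vs1.span_mono[of D "BK \<union> D"]
        by (intro vs1.span_add) auto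
      then have "x \<in> vs1.span (BS - {x})"
        using insert BS(1) vs1.span_mono[of "BK \<union> D" "BS - {x}"] by auto
      then show False using BS(3) insert.prems by (auto simp: vs1.dependent_def)
    qed
    then have nin: "f x \<notin> f ` D \<union> BW" by (metis vs2.span_base)
    have IH: "vs2.independent (f ` D \<union> BW)" "card (f ` D \<union> BW) = card D + card BW"
      using insert by auto
    have eq: "f ` insert x D \<union> BW = insert (f x) (f ` D \<union> BW)" by auto
    have "finite (f ` D \<union> BW)" using insert(1) BW(3) by simp
    then have "card (insert (f x) (f ` D \<union> BW)) = Suc (card D + card BW)"
      by (metis card_insert_disjoint nin IH(2))
    then show ?case
      unfolding eq using vs2.independent_insertI[OF nsp IH(1)] insert(1,2) by simp
  qed
  have D: "finite (BS - BK)" using BS by simp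
  have sp: "vs2.span (f ` (BS - BK) \<union> BW) = {f x + w |x w. x \<in> S \<and> w \<in> W}" (is "?L = ?R")
  proof
    show "?L \<subseteq> ?R"
      unfolding vs2.span_Un BW(4) f.span_image
      using vs1.span_mono[of "BS - BK" BS] BS(5) by auto
    show "?R \<subseteq> ?L"
    proof
      fix z assume "z \<in> ?R"
      then obtain x w where xw: "x \<in> S" "w \<in> W" "z = f x + w" by auto
      have "x \<in> vs1.span (BK \<union> (BS - BK))" using xw BS by (simp add: Un_absorb1)
      then obtain y y' where y: "y \<in> vs1.span BK" "y' \<in> vs1.span (BS - BK)" "x = y + y'"
        unfolding vs1.span_Un by auto
      have "f y \<in> W" using y(1) BK(4) by auto
      then have "z = f y' + (f y + w)" "f y + w \<in> W" using y xw W(1)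
        by (auto simp: f.add vs2.subspace_add)
      then show "z \<in> ?L" unfolding vs2.span_Un BW(4) f.span_image using y(2) by auto
    qed
  qed
  have "vs2.dim {f x + w |x w. x \<in> S \<and> w \<in> W} = card (BS - BK) + card BW"
    using *[OF D] vs2.dim_span_eq_card_independent sp by fastforce
  moreover have "card (BS - BK) = card BS - card BK" "card BK \<le> card BS"
    using card_Diff_subset[OF BK(3) BS(1)] card_mono[OF BS(4,1)] by simp_all
  ultimately show ?thesis using BS BK BW by simp
qed

end

lemma fun_scale_vector_space:
  "vector_space s \<Longrightarrow> vector_space (\<lambda>c (f::'i \<Rightarrow> 'v::ab_group_add) i. s c (f i))"
  unfolding vector_space_def by (auto simp: fun_eq_iff)

lemma prod_scale_vector_space:
  "vector_space s \<Longrightarrow> vector_space t \<Longrightarrow>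
    vector_space (\<lambda>c (x::'v::ab_group_add \<times> 'w::ab_group_add). (s c (fst x), t c (snd x)))"
  unfolding vector_space_def by (auto simp: prod_eq_iff)

text \<open>The power \<open>V^c\<close> as functions that vanish from index \<open>c\<close> on.
  This is the convention of \<open>hom_mat\<close>, so spaces of matrices are iterated
  powers.\<close>

definition pow_set :: "'v::zero set \<Rightarrow> nat \<Rightarrow> (nat \<Rightarrow> 'v) set" where
  "pow_set V c = {f. \<forall>j. if j < c then f j \<in> V else f j = 0}"

locale vspace_fun = vspace scale for scale :: "'k::field \<Rightarrow> 'v::ab_group_add \<Rightarrow> 'v"
begin

abbreviation fscale :: "'k \<Rightarrow> (nat \<Rightarrow> 'v) \<Rightarrow> nat \<Rightarrow> 'v" where
  "fscale \<equiv> \<lambda>c f i. scale c (f i)"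

sublocale fs: vspace fscale
  unfolding vspace_def by (rule fun_scale_vector_space) unfold_locales

sublocale pr: vspace_pair fscale scale ..

lemma subspace_pow: "subspace V \<Longrightarrow> fs.subspace (pow_set V c)"
  by (auto simp: fs.subspace_def subspace_def pow_set_def split: if_splits)

lemma findim_pow:
  assumes "findim V" shows "fs.findim (pow_set V c)"
proof -
  obtain B where B: "finite B" "V \<subseteq> span B" using assms findim_def by auto
  define sg :: "nat \<Rightarrow> 'v \<Rightarrow> nat \<Rightarrow> 'v" where "sg = (\<lambda>j v i. if i = j then v else 0)"
  let ?B = "\<Union>j<c. sg j ` B"
  have sgs: "sg j v \<in> fs.span (sg j ` B)" if "v \<in> span B" for j v
    using that
  proof (induction rule: span_induct_alt)
    case base
    have "sg j 0 = 0" by (auto simp: sg_def)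
    then show ?case by (metis fs.span_zero)
  next
    case (step k x y)
    have "sg j (scale k x + y) = fscale k (sg j x) + sg j y" by (auto simp: sg_def)
    then show ?case using step
      by (metis fs.span_add fs.span_scale fs.span_base imageI)
  qed
  have "f \<in> fs.span ?B" if f: "f \<in> pow_set V c" for f
  proof -
    have "f = (\<Sum>j<c. sg j (f j))"
    proof
      fix i
      have "(\<Sum>j<c. sg j (f j)) i = (\<Sum>j<c. sg j (f j) i)"
        by (induction c) auto
      also have "\<dots> = f i" using f by (auto simp: sg_def pow_set_def if_distrib cong: if_cong)
      finally show "f i = (\<Sum>j<c. sg j (f j)) i" by simp
    qed
    moreover have "sg j (f j) \<in> fs.span ?B" if "j < c" for j
    proof -
      have "f j \<in> span B" using f B(2) that by (auto simp: pow_set_def)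
      then show ?thesis using sgs fs.span_mono[of "sg j ` B" ?B] that by blast
    qed
    ultimately show ?thesis by (metis (no_types, lifting) fs.span_sum lessThan_iff)
  qed
  then show ?thesis using B(1) unfolding fs.findim_def by (intro exI[of _ ?B]) auto
qed

lemma dim_pow:
  assumes V: "subspace V" "findim V"
  shows "fs.dim (pow_set V c) = c * dim V"
proof (induction c)
  case 0
  have "pow_set V 0 = {0}" by (auto simp: pow_set_def)
  then have "fs.dim (pow_set V 0) = fs.dim (fs.span {})" by simp
  then show ?case using fs.dim_span_eq_card_independent[of "{}"] fs.independent_empty by simp
next
  case (Suc c)
  have lin: "Vector_Spaces.linear fscale scale (\<lambda>f. f c)"
    by unfold_locales auto
  have z: "subspace {0}" "findim {0}" by (auto simp: findim_def intro!: exI[of _ "{}"])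
  have d0: "dim {0} = 0" using dim_span_eq_card_independent[of "{}"] independent_empty by simp
  have zV: "0 \<in> V" using V(1) by (auto simp: subspace_def)
  have K: "{f \<in> pow_set V (Suc c). f c \<in> {0}} = pow_set V c"
    using zV by (auto simp: pow_set_def less_Suc_eq split: if_splits)
  have I: "{f c + w |f w. f \<in> pow_set V (Suc c) \<and> w \<in> {0}} = V"
  proof safe
    fix f assume "f \<in> pow_set V (Suc c)" then show "f c + 0 \<in> V" by (auto simp: pow_set_def)
  next
    fix v assume "v \<in> V"
    then show "\<exists>f w. v = f c + w \<and> f \<in> pow_set V (Suc c) \<and> w \<in> {0}"
      using zV by (intro exI[of _ "\<lambda>i. if i = c then v else 0"] exI[of _ 0]) (auto simp: pow_set_def)
  qed
  show ?case
    using pr.rank_nullity_mod[OF lin subspace_pow[OF V(1)] findim_pow[OF V(2)] z, of "Suc c"]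
    unfolding K I d0 Suc.IH by simp
qed

end

section \<open>Rings on a carrier set, local rings and Fitting's lemma\<close>

locale ring_on =
  fixes G :: "'v::ab_group_add set" and mul :: "'v \<Rightarrow> 'v \<Rightarrow> 'v" (infixl "\<odot>" 70) and u :: 'v
  assumes zeroG: "0 \<in> G" and addG: "x \<in> G \<Longrightarrow> y \<in> G \<Longrightarrow> x + y \<in> G"
    and uminusG: "x \<in> G \<Longrightarrow> - x \<in> G" and uG: "u \<in> G"
    and mulG: "x \<in> G \<Longrightarrow> y \<in> G \<Longrightarrow> x \<odot> y \<in> G"
    and assocG: "x \<in> G \<Longrightarrow> y \<in> G \<Longrightarrow> z \<in> G \<Longrightarrow> (x \<odot> y) \<odot> z = x \<odot> (y \<odot> z)"
    and distlG: "x \<in> G \<Longrightarrow> y \<in> G \<Longrightarrow> z \<in> G \<Longrightarrow> x \<odot> (y + z) = x \<odot> y + x \<odot> z"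
    and distrG: "x \<in> G \<Longrightarrow> y \<in> G \<Longrightarrow> z \<in> G \<Longrightarrow> (x + y) \<odot> z = x \<odot> z + y \<odot> z"
    and unitlG: "x \<in> G \<Longrightarrow> u \<odot> x = x" and unitrG: "x \<in> G \<Longrightarrow> x \<odot> u = x"
begin

definition inv_el :: "'v \<Rightarrow> bool" where
  "inv_el x \<longleftrightarrow> x \<in> G \<and> (\<exists>y\<in>G. x \<odot> y = u \<and> y \<odot> x = u)"

lemma diffG: "x \<in> G \<Longrightarrow> y \<in> G \<Longrightarrow> x - y \<in> G"
  using addG[of x "- y"] uminusG by simp

lemma mul_zeroG: "x \<in> G \<Longrightarrow> x \<odot> 0 = 0" "x \<in> G \<Longrightarrow> 0 \<odot> x = 0"
  using distlG[of x 0 0] distrG[of 0 0 x] zeroG by auto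

lemma mul_minusG: "x \<in> G \<Longrightarrow> y \<in> G \<Longrightarrow> x \<odot> (- y) = - (x \<odot> y)"
  "x \<in> G \<Longrightarrow> y \<in> G \<Longrightarrow> (- x) \<odot> y = - (x \<odot> y)"
  using distlG[of x y "-y"] distrG[of x "-x" y] uminusG mul_zeroG
  by (auto simp: eq_neg_iff_add_eq_0 add.commute)

lemma mul_diffG: "x \<in> G \<Longrightarrow> y \<in> G \<Longrightarrow> z \<in> G \<Longrightarrow> x \<odot> (y - z) = x \<odot> y - x \<odot> z"
  "x \<in> G \<Longrightarrow> y \<in> G \<Longrightarrow> z \<in> G \<Longrightarrow> (x - y) \<odot> z = x \<odot> z - y \<odot> z"
  using distlG[of x y "-z"] distrG[of x "-y" z] uminusG mul_minusG by auto

lemma mul_mid: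
  "a \<in> G \<Longrightarrow> b \<in> G \<Longrightarrow> c \<in> G \<Longrightarrow> d \<in> G \<Longrightarrow> (a \<odot> b) \<odot> (c \<odot> d) = a \<odot> ((b \<odot> c) \<odot> d)"
  by (simp add: assocG mulG)

lemma inv_el_u: "inv_el u"
  unfolding inv_el_def using uG unitlG by auto

primrec pw :: "'v \<Rightarrow> nat \<Rightarrow> 'v" where
  "pw x 0 = u" | "pw x (Suc n) = x \<odot> pw x n"

lemma pwG: "x \<in> G \<Longrightarrow> pw x n \<in> G"
  by (induction n) (auto simp: uG mulG)

lemma pw_add: "x \<in> G \<Longrightarrow> pw x (m + n) = pw x m \<odot> pw x n"
  by (induction m) (auto simp: unitlG pwG assocG)

lemma comm_pw: "x \<in> G \<Longrightarrow> y \<in> G \<Longrightarrow> x \<odot> y = y \<odot> x \<Longrightarrow> x \<odot> pw y n = pw y n \<odot> x"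
proof (induction n)
  case 0 then show ?case by (simp add: unitlG unitrG)
next
  case (Suc n)
  then show ?case by (metis assocG pw.simps(2) pwG)
qed

text \<open>The inverse is the finite geometric series \<open>s n\<close>.\<close>

lemma nilpotent_inv_el:
  assumes x: "x \<in> G" and n: "pw x n = 0" shows "inv_el (u - x)"
proof -
  define s where "s k = (\<Sum>i<k. pw x i)" for k
  have sG: "s k \<in> G" for k unfolding s_def by (induction k) (auto simp: zeroG addG pwG x)
  have "(u - x) \<odot> s k = u - pw x k \<and> s k \<odot> (u - x) = u - pw x k" for k
  proof (induction k)
    case 0 show ?case using x uG by (simp add: s_def mul_zeroG diffG)
  next
    case (Suc k)
    have "s (Suc k) = s k + pw x k" by (simp add: s_def)
    then show ?case using Suc comm_pw[OF x x refl, of k]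
      by (simp add: distlG distrG x uG diffG sG pwG mul_diffG unitlG unitrG)
  qed
  from this[of n] show ?thesis
    using n sG x uG diffG unfolding inv_el_def by auto
qed

definition nonunits :: "'v set" where "nonunits = {x \<in> G. \<not> inv_el x}"

end

text \<open>Locality is expressed through \<open>x\<close> and \<open>u - x\<close>, which makes
  sense without commutativity; that the nonunits form a two-sided ideal is derived from it.\<close>

locale local_on = ring_on +
  assumes one_neq_zero: "u \<noteq> 0"
    and local: "x \<in> G \<Longrightarrow> inv_el x \<or> inv_el (u - x)"
begin

lemma not_inv_zero: "\<not> inv_el 0"
  using one_neq_zero mul_zeroG by (auto simp: inv_el_def)

lemma zero_nonunits: "0 \<in> nonunits" using not_inv_zero zeroG by (simp add: nonunits_def)

lemma idem_trivial: assumes "x \<in> G" "x \<odot> x = x" shows "x = 0 \<or> x = u"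
proof -
  have "x \<odot> (u - x) = 0" "(u - x) \<odot> x = 0" using assms by (auto simp: mul_diffG uG unitlG unitrG)
  consider "inv_el x" | "inv_el (u - x)" using local assms by auto
  then show ?thesis
  proof cases
    case 1
    then obtain y where y: "y \<in> G" "y \<odot> x = u" by (auto simp: inv_el_def)
    have "y \<odot> (x \<odot> x) = u" using assms y by simp
    then have "u \<odot> x = u" using y assms assocG[of y x x] by simp
    then show ?thesis using assms unitlG by simp
  next
    case 2
    then obtain y where y: "y \<in> G" "y \<odot> (u - x) = u" by (auto simp: inv_el_def)
    have "y \<odot> ((u - x) \<odot> x) = 0" using \<open>(u - x) \<odot> x = 0\<close> y mul_zeroG by simp
    then have "u \<odot> x = 0" using y assms assocG[of y "u - x" x] uG diffG by simp
    then show ?thesis using assms unitlG by simp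
  qed
qed

text \<open>The product \<open>y x\<close> is idempotent, hence trivial, and the value
  \<open>0\<close> would give \<open>u = x (y x) y = 0\<close>.\<close>

lemma right_inv_inv_el: assumes "x \<in> G" "y \<in> G" "x \<odot> y = u" shows "inv_el x" "inv_el y"
proof -
  have "(y \<odot> x) \<odot> (y \<odot> x) = y \<odot> ((x \<odot> y) \<odot> x)" using assms by (simp only: mul_mid)
  then have "(y \<odot> x) \<odot> (y \<odot> x) = y \<odot> x" using assms by (simp add: unitlG)
  then consider "y \<odot> x = 0" | "y \<odot> x = u" using idem_trivial assms mulG by metis
  then have "y \<odot> x = u"
  proof cases
    case 1
    have "u = (x \<odot> y) \<odot> (x \<odot> y)" using assms uG unitlG by simp
    also have "\<dots> = x \<odot> ((y \<odot> x) \<odot> y)" by (rule mul_mid) fact+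
    also have "\<dots> = 0" using 1 assms mul_zeroG by simp
    finally show ?thesis using one_neq_zero by simp
  qed
  then show "inv_el x" "inv_el y" using assms by (auto simp: inv_el_def)
qed

lemma inv_el_mulD: assumes "x \<in> G" "y \<in> G" "inv_el (x \<odot> y)" shows "inv_el x" "inv_el y"
proof -
  obtain z where z: "z \<in> G" "x \<odot> y \<odot> z = u" "z \<odot> (x \<odot> y) = u" using assms(3) by (auto simp: inv_el_def)
  show "inv_el x" using right_inv_inv_el(1)[of x "y \<odot> z"] z assms by (simp add: assocG mulG)
  show "inv_el y" using right_inv_inv_el(2)[of "z \<odot> x" y] z assms by (simp add: assocG mulG)
qed

lemma nonunits_mul: assumes "x \<in> G" "y \<in> G" "x \<in> nonunits \<or> y \<in> nonunits" shows "x \<odot> y \<in> nonunits"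
  using assms inv_el_mulD mulG unfolding nonunits_def by blast

text \<open>An inverse \<open>z\<close> of the sum gives \<open>z x + z y = u\<close>. Locality
  makes \<open>z x\<close> or \<open>z y\<close> invertible, and then so is its right
  factor.\<close>

lemma nonunits_add: assumes "x \<in> nonunits" "y \<in> nonunits" shows "x + y \<in> nonunits"
proof -
  have G: "x \<in> G" "y \<in> G" using assms by (auto simp: nonunits_def)
  have False if inv: "inv_el (x + y)"
  proof -
    obtain z where z: "z \<in> G" "z \<odot> (x + y) = u" using inv by (auto simp: inv_el_def)
    have "u - z \<odot> x = z \<odot> y" using z G distlG[of z x y] by (simp add: algebra_simps)
    moreover have "inv_el (z \<odot> x) \<or> inv_el (u - z \<odot> x)" using local z G mulG by simp
    ultimately have "inv_el x \<or> inv_el y" using inv_el_mulD z G by metis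
    then show False using assms by (auto simp: nonunits_def)
  qed
  then show ?thesis using G addG unfolding nonunits_def by blast
qed

lemma inv_el_u_minus: "x \<in> nonunits \<Longrightarrow> inv_el (u - x)"
  using local by (auto simp: nonunits_def)

lemma nonunits_uminus: "x \<in> nonunits \<Longrightarrow> - x \<in> nonunits"
  using nonunits_mul[of "- u" x] uG uminusG unitlG mul_minusG
  by (auto simp: nonunits_def)

lemma inv_el_add_nonunit: assumes "inv_el x" "y \<in> nonunits" shows "inv_el (x + y)"
proof (rule ccontr)
  assume "\<not> inv_el (x + y)"
  then have "x + y \<in> nonunits" using assms addG by (auto simp: nonunits_def inv_el_def)
  then have "x + y + (- y) \<in> nonunits" using assms nonunits_add nonunits_uminus by blast
  then show False using assms by (auto simp: nonunits_def)
qed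

end

locale algebra_on = ring_on G mul u + vspace s
  for s :: "'k::field \<Rightarrow> 'v::ab_group_add \<Rightarrow> 'v" and G :: "'v set" and mul u +
  assumes scaleG: "x \<in> G \<Longrightarrow> s c x \<in> G" and finG: "findim G"
    and scale_mulG: "x \<in> G \<Longrightarrow> y \<in> G \<Longrightarrow> mul x (s c y) = s c (mul x y)"
      "x \<in> G \<Longrightarrow> y \<in> G \<Longrightarrow> mul (s c x) y = s c (mul x y)"
begin

text \<open>Fitting's lemma: a power of \<open>x\<close> lies in the ideal generated by its higher powers,
  which makes a suitable multiple of it an idempotent.\<close>

lemma fitting:
  assumes triv: "\<And>e. e \<in> G \<Longrightarrow> mul e e = e \<Longrightarrow> e = 0 \<or> e = u" and x: "x \<in> G"
  shows "inv_el x \<or> (\<exists>n. pw x n = 0)"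
proof -
  obtain n where n: "pw x n \<in> span (pw x ` {n<..})"
    using seq_tail_span[OF finG, of "pw x"] pwG[OF x] by (metis image_subsetI)
  \<comment> \<open>The cofactors are restricted to elements commuting with \<open>x\<close>. Powers
    of \<open>x\<close> qualify, so all later powers are captured, and the cofactor \<open>c\<close>
    obtained below can be moved past \<open>x\<close>.\<close>
  let ?S = "{mul (pw x (Suc n)) c |c. c \<in> G \<and> mul x c = mul c x}"
  have "subspace ?S"
    unfolding subspace_def
  proof (intro conjI ballI allI)
    have "0 = mul (pw x (Suc n)) 0" "mul x 0 = mul 0 x"
      using x pwG[OF x, of "Suc n"] by (simp_all add: mul_zeroG del: pw.simps)
    then show "0 \<in> ?S" using zeroG by blast
  next
    show "a + b \<in> ?S" if ab: "a \<in> ?S" "b \<in> ?S" for a b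
    proof -
      obtain c d where cd: "c \<in> G" "mul x c = mul c x" "a = mul (pw x (Suc n)) c"
        "d \<in> G" "mul x d = mul d x" "b = mul (pw x (Suc n)) d" using ab by blast
      have "a + b = mul (pw x (Suc n)) (c + d)" "c + d \<in> G" "mul x (c + d) = mul (c + d) x"
        using cd x pwG[OF x, of "Suc n"] by (simp_all add: distlG distrG addG del: pw.simps)
      then show ?thesis by blast
    qed
    show "s k a \<in> ?S" if a: "a \<in> ?S" for k a
    proof -
      obtain c where c: "c \<in> G" "mul x c = mul c x" "a = mul (pw x (Suc n)) c" using a by blast
      have "s k a = mul (pw x (Suc n)) (s k c)" "s k c \<in> G" "mul x (s k c) = mul (s k c) x"
        using c x pwG[OF x, of "Suc n"] by (simp_all add: scale_mulG scaleG del: pw.simps)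
      then show ?thesis by blast
    qed
  qed
  moreover have "pw x ` {n<..} \<subseteq> ?S"
  proof
    fix z assume "z \<in> pw x ` {n<..}"
    then obtain m where m: "m > n" "z = pw x m" by auto
    then have "z = mul (pw x (Suc n)) (pw x (m - Suc n))"
      using pw_add[OF x, of "Suc n" "m - Suc n"] by simp
    then show "z \<in> ?S" using pwG[OF x] comm_pw[OF x x refl] by blast
  qed
  ultimately have "pw x n \<in> ?S" using n span_minimal by blast
  then obtain c where c: "c \<in> G" "mul x c = mul c x" "pw x n = mul (pw x (Suc n)) c" by blast
  have xc: "mul (pw x i) (pw c j) = mul (pw c j) (pw x i)" for i j
    using comm_pw[OF pwG[OF x] c(1), of i j] comm_pw[OF c(1) x c(2)[symmetric], of i]
    by simp
  \<comment> \<open>The relation \<open>x^n = x^(n+1) c\<close> is fed into itself \<open>j\<close>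
    times. The value \<open>j = n\<close> is what makes \<open>x^n c^n\<close> idempotent.\<close>
  have pj: "pw x n = mul (pw x (n + j)) (pw c j)" for j
  proof (induction j)
    case 0 show ?case using pwG[OF x] by (simp add: unitrG)
  next
    case (Suc j)
    have "mul (pw x j) (pw x n) = pw x (n + j)"
      by (simp only: pw_add[OF x, symmetric] add.commute)
    then have "pw x n = mul (mul (pw x j) (pw x n)) (pw c j)"
      by (simp only: Suc[symmetric])
    also have "\<dots> = mul (mul (pw x j) (mul (pw x (Suc n)) c)) (pw c j)" by (simp only: c(3)[symmetric])
    also have "\<dots> = mul (mul (pw x j) (pw x (Suc n))) (mul c (pw c j))"
      using c(1) pwG[OF x] pwG[OF c(1)] by (simp add: assocG mulG del: pw.simps)
    also have "\<dots> = mul (pw x (j + Suc n)) (pw c (Suc j))"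
      using pw_add[OF x, of j "Suc n"] by simp
    finally show ?case by (simp add: add.commute)
  qed
  define e where "e = mul (pw x n) (pw c n)"
  have eG: "e \<in> G" unfolding e_def using x c pwG mulG by blast
  have P: "pw x n \<in> G" and C: "pw c n \<in> G" using x c(1) pwG by auto
  have "mul e e = mul (pw x n) (mul (mul (pw c n) (pw x n)) (pw c n))"
    unfolding e_def by (rule mul_mid) fact+
  also have "\<dots> = mul (mul (mul (pw x n) (pw x n)) (pw c n)) (pw c n)"
    unfolding xc[symmetric] by (simp only: assocG mulG P C)
  also have "\<dots> = e" unfolding e_def by (simp only: pw_add[OF x, symmetric] pj[symmetric])
  finally consider "e = 0" | "e = u" using triv eG by blast
  then show ?thesis
  proof cases
    case 1
    have "mul (pw x n) e = mul (mul (pw x n) (pw x n)) (pw c n)"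
      unfolding e_def by (simp only: assocG P C)
    also have "\<dots> = pw x n" by (simp only: pw_add[OF x, symmetric] pj[symmetric])
    finally have "pw x n = mul (pw x n) e" by simp
    then show ?thesis using 1 mul_zeroG pwG x by auto
  next
    case 2
    show ?thesis
    proof (cases n)
      case 0
      then have "mul (mul x u) c = u" using c(3)[symmetric] by simp
      then have "mul x c = u" using x by (simp add: unitrG)
      then show ?thesis using c x unfolding inv_el_def by metis
    next
      case (Suc m)
      have Q: "pw x m \<in> G" using pwG[OF x] .
      have "mul (mul x (pw x m)) (pw c n) = u" using 2 Suc unfolding e_def by simp
      then have 1: "mul x (mul (pw x m) (pw c n)) = u" by (simp only: assocG x Q C)
      have "mul x (pw c n) = mul (pw c n) x" using xc[of 1 n] x by (simp add: unitrG)
      then have "mul (mul (pw x m) (pw c n)) x = mul (pw x m) (mul x (pw c n))"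
        by (simp only: assocG x Q C)
      also have "\<dots> = mul (mul (pw x m) x) (pw c n)" by (simp only: assocG x Q C)
      also have "\<dots> = mul (mul x (pw x m)) (pw c n)" by (simp only: comm_pw[OF x x refl])
      also have "\<dots> = u" using 1 by (simp only: assocG x Q C)
      finally show ?thesis using 1 x mulG[OF Q C] unfolding inv_el_def by blast
    qed
  qed
qed

lemma local_onI:
  assumes triv: "\<And>e. e \<in> G \<Longrightarrow> mul e e = e \<Longrightarrow> e = 0 \<or> e = u" and "u \<noteq> 0"
  shows "local_on G mul u"
proof
  show "u \<noteq> 0" by fact
  show "inv_el x \<or> inv_el (u - x)" if "x \<in> G" for x
    using fitting[OF triv that] nilpotent_inv_el[OF that] by blast
qed

end

section \<open>Corners of the algebra and matrices between projectives\<close>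

lemma corner_iff:
  fixes e e' :: "'a::ring_1"
  assumes "e * e = e" "e' * e' = e'"
  shows "x \<in> corner e e' \<longleftrightarrow> e * x = x \<and> x * e' = x"
proof
  assume "x \<in> corner e e'"
  then obtain a where x: "x = e * a * e'" by (auto simp: corner_def)
  have "e * x = (e * e) * a * e'" "x * e' = e * a * (e' * e')"
    unfolding x by (simp_all only: mult.assoc)
  then show "e * x = x \<and> x * e' = x" using assms x by simp
next
  assume *: "e * x = x \<and> x * e' = x"
  then have "x = e * x * e'" by simp
  then show "x \<in> corner e e'" unfolding corner_def by blast
qed

lemma mmul_assoc: "mmul m (mmul n A B) C = mmul n A (mmul m B C)"
  unfolding mmul_def
  by (intro ext) (simp add: sum_distrib_left sum_distrib_right mult.assoc,
      subst sum.swap, simp)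

lemma mmul_add: "mmul n (A + B) C = mmul n A C + mmul n B C" "mmul n A (B + C) = mmul n A B + mmul n A C"
  unfolding mmul_def by (simp_all add: fun_eq_iff algebra_simps sum.distrib)

lemma mmul_uminus: "mmul n (- A) B = - mmul n A B" "mmul n A (- B) = - mmul n A B"
  unfolding mmul_def by (simp_all add: fun_eq_iff sum_negf)

lemma mmul_diff: "mmul n (A - B) C = mmul n A C - mmul n B C" "mmul n A (B - C) = mmul n A B - mmul n A C"
  unfolding mmul_def by (simp_all add: fun_eq_iff algebra_simps sum_subtractf)

lemma mmul_zero [simp]: "mmul n 0 A = 0" "mmul n A 0 = 0"
  unfolding mmul_def by (simp_all add: fun_eq_iff)

lemma mmul_dim_zero [simp]: "mmul 0 A B = 0"
  unfolding mmul_def by (simp add: fun_eq_iff)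

lemma sum_lessThan_add: "(\<Sum>k<m + (n::nat). f k) = (\<Sum>k<m. f k) + (\<Sum>k<n. f (m + k))"
  for f :: "nat \<Rightarrow> 'a::comm_monoid_add"
  by (induction n) (auto simp: add.assoc)

lemma chain_map_alt: "chain_map e1 e2 C D f \<longleftrightarrow> (\<forall>n. hom_mat e1 e2 (fst C n) (fst D n) (f n))
     \<and> (\<forall>n. mmul (length (fst D n)) (snd D n) (f n) = mmul (length (fst C (n + 1))) (f (n + 1)) (snd C n))"
  by (rule chain_map_def)

lemma null_homotopic_alt: "null_homotopic e1 e2 C D f \<longleftrightarrow>
   (\<exists>h. (\<forall>n. hom_mat e1 e2 (fst C n) (fst D (n - 1)) (h n)) \<and>
     (\<forall>n. f n = mmul (length (fst D (n - 1))) (snd D (n - 1)) (h n)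
                + mmul (length (fst C (n + 1))) (h (n + 1)) (snd C n)))"
  unfolding null_homotopic_def by (simp add: plus_fun_def)

lemma homotopic_alt: "homotopic e1 e2 C D f g \<longleftrightarrow> null_homotopic e1 e2 C D (f - g)"
  unfolding homotopic_def by (simp add: fun_diff_def)

lemma is_cplx_alt: "is_cplx e1 e2 C \<longleftrightarrow> (\<exists>N. \<forall>n. \<bar>n\<bar> > N \<longrightarrow> fst C n = [])
     \<and> (\<forall>n. hom_mat e1 e2 (fst C n) (fst C (n + 1)) (snd C n))
     \<and> (\<forall>n. mmul (length (fst C (n + 1))) (snd C (n + 1)) (snd C n) = 0)"
  unfolding is_cplx_def zero_fun_def by simp

locale two_idem =
  fixes e1 e2 :: "'a::ring_1"
  assumes ee: "e1 * e1 = e1" "e2 * e2 = e2" "e1 * e2 = 0" "e2 * e1 = 0" and e_sum: "e1 + e2 = 1"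
begin

abbreviation L :: "bool \<Rightarrow> 'a" where "L \<equiv> lab e1 e2"
abbreviation Co :: "bool \<Rightarrow> bool \<Rightarrow> 'a set" where "Co b c \<equiv> corner (L b) (L c)"
abbreviation hm :: "bool list \<Rightarrow> bool list \<Rightarrow> 'a mat \<Rightarrow> bool" where "hm \<equiv> hom_mat e1 e2"
abbreviation idm :: "bool list \<Rightarrow> 'a mat" where "idm \<equiv> id_mat e1 e2"
abbreviation cm where "cm \<equiv> chain_map e1 e2"
abbreviation nh where "nh \<equiv> null_homotopic e1 e2"
abbreviation hty where "hty \<equiv> homotopic e1 e2"
abbreviation heq where "heq \<equiv> htpy_equiv e1 e2"
abbreviation cx where "cx \<equiv> is_cplx e1 e2"
abbreviation idc :: "'a cplx \<Rightarrow> int \<Rightarrow> 'a mat" where "idc C \<equiv> \<lambda>n. idm (fst C n)"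

lemma L_simps [simp]: "L b * L b = L b" "b \<noteq> c \<Longrightarrow> L b * L c = 0"
  using ee by (auto simp: lab_def)

lemma L_sum: "L b + L (\<not> b) = 1"
  using e_sum by (cases b) (auto simp: lab_def add.commute)

lemma Co_iff: "x \<in> Co b c \<longleftrightarrow> L b * x = x \<and> x * L c = x"
  by (rule corner_iff) simp_all

lemma Co_zero [simp]: "0 \<in> Co b c" by (simp add: Co_iff)
lemma Co_add: "x \<in> Co b c \<Longrightarrow> y \<in> Co b c \<Longrightarrow> x + y \<in> Co b c"
  by (simp add: Co_iff distrib_left distrib_right)
lemma Co_uminus: "x \<in> Co b c \<Longrightarrow> - x \<in> Co b c" by (simp add: Co_iff)
lemma Co_diff: "x \<in> Co b c \<Longrightarrow> y \<in> Co b c \<Longrightarrow> x - y \<in> Co b c"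
  by (simp add: Co_iff algebra_simps)
lemma Co_mult: "x \<in> Co b c \<Longrightarrow> y \<in> Co c d \<Longrightarrow> x * y \<in> Co b d"
  by (simp add: Co_iff mult.assoc) (metis mult.assoc)
lemma Co_L [simp]: "L b \<in> Co b b" by (simp add: Co_iff)
lemma Co_sum: "(\<And>k. k \<in> A \<Longrightarrow> f k \<in> Co b c) \<Longrightarrow> sum f A \<in> Co b c"
  by (induction A rule: infinite_finite_induct) (auto simp: Co_add)
lemma Co_cut: "L b * x * L c \<in> Co b c" by (auto simp: corner_def)

lemma hm_iff: "hm s t M \<longleftrightarrow> (\<forall>i j. if i < length t \<and> j < length s then M i j \<in> Co (t ! i) (s ! j) else M i j = 0)"
  by (rule hom_mat_def)

lemma hmD: "hm s t M \<Longrightarrow> i < length t \<Longrightarrow> j < length s \<Longrightarrow> M i j \<in> Co (t ! i) (s ! j)"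
  and hmD0: "hm s t M \<Longrightarrow> \<not> i < length t \<or> \<not> j < length s \<Longrightarrow> M i j = 0"
  unfolding hm_iff by (meson | metis)+

lemma hmI: "(\<And>i j. i < length t \<Longrightarrow> j < length s \<Longrightarrow> M i j \<in> Co (t ! i) (s ! j)) \<Longrightarrow>
   (\<And>i j. \<not> i < length t \<or> \<not> j < length s \<Longrightarrow> M i j = 0) \<Longrightarrow> hm s t M"
  unfolding hm_iff by simp

lemma hm_zero [simp]: "hm s t 0" by (simp add: hm_iff)
lemma hm_add: "hm s t A \<Longrightarrow> hm s t B \<Longrightarrow> hm s t (A + B)"
  by (simp add: hm_iff Co_add)
lemma hm_uminus: "hm s t A \<Longrightarrow> hm s t (- A)"
  by (simp add: hm_iff Co_uminus)
lemma hm_diff: "hm s t A \<Longrightarrow> hm s t B \<Longrightarrow> hm s t (A - B)"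
  by (simp add: hm_iff Co_diff)

lemma hm_mmul:
  assumes "hm s t A" "hm r s B" "n = length s"
  shows "hm r t (mmul n A B)"
proof (rule hmI)
  fix i j assume ij: "i < length t" "j < length r"
  show "mmul n A B i j \<in> Co (t ! i) (r ! j)"
    unfolding mmul_def assms(3)
    by (rule Co_sum) (use ij assms in \<open>auto intro!: Co_mult hmD\<close>)
next
  fix i j assume ij: "\<not> i < length t \<or> \<not> j < length r"
  have "A i k * B k j = 0" for k
    using ij hmD0[OF assms(1), of i k] hmD0[OF assms(2), of k j] by fastforce
  then show "mmul n A B i j = 0" by (simp add: mmul_def)
qed

lemma hm_idm [simp]: "hm l l (idm l)"
  by (rule hmI) (auto simp: id_mat_def)

lemma mmul_idm_left: "hm s t A \<Longrightarrow> n = length t \<Longrightarrow> mmul n (idm t) A = A"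
proof (intro ext)
  fix i j assume A: "hm s t A" and n: "n = length t"
  have "mmul n (idm t) A i j = (\<Sum>k<n. if k = i then L (t ! i) * A i j else 0)"
    unfolding mmul_def id_mat_def n by (intro sum.cong) auto
  also have "\<dots> = A i j"
    using hmD[OF A, of i j] hmD0[OF A, of i j] n by (cases "j < length s") (auto simp: Co_iff)
  finally show "mmul n (idm t) A i j = A i j" .
qed

lemma mmul_idm_right: "hm s t A \<Longrightarrow> n = length s \<Longrightarrow> mmul n A (idm s) = A"
proof (intro ext)
  fix i j assume A: "hm s t A" and n: "n = length s"
  have "mmul n A (idm s) i j = (\<Sum>k<n. if k = j then A i j * L (s ! j) else 0)"
    unfolding mmul_def id_mat_def n by (intro sum.cong) auto
  also have "\<dots> = A i j"
    using hmD[OF A, of i j] hmD0[OF A, of i j] n by (cases "i < length t") (auto simp: Co_iff)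
  finally show "mmul n A (idm s) i j = A i j" .
qed

subsection \<open>The homotopy category\<close>

lemma cmD: "cm C D f \<Longrightarrow> hm (fst C n) (fst D n) (f n)"
  "cm C D f \<Longrightarrow> mmul (length (fst D n)) (snd D n) (f n) = mmul (length (fst C (n + 1))) (f (n + 1)) (snd C n)"
  by (auto simp: chain_map_alt)

lemma cxD: "cx C \<Longrightarrow> hm (fst C n) (fst C (n + 1)) (snd C n)"
  "cx C \<Longrightarrow> mmul (length (fst C (n + 1))) (snd C (n + 1)) (snd C n) = 0"
  by (auto simp: is_cplx_alt)

lemma cm_comp: assumes "cm C D f" "cm D E g" shows "cm C E (comp_map D g f)"
  unfolding chain_map_alt comp_map_def
proof (intro conjI allI)
  fix n
  show "hm (fst C n) (fst E n) (mmul (length (fst D n)) (g n) (f n))"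
    using assms cmD hm_mmul by blast
  have "mmul (length (fst E n)) (snd E n) (mmul (length (fst D n)) (g n) (f n))
    = mmul (length (fst D n)) (mmul (length (fst E n)) (snd E n) (g n)) (f n)"
    by (simp only: mmul_assoc)
  also have "\<dots> = mmul (length (fst D (n+1))) (g (n+1)) (mmul (length (fst D n)) (snd D n) (f n))"
    by (simp only: cmD(2)[OF assms(2)] mmul_assoc)
  also have "\<dots> = mmul (length (fst C (n+1))) (mmul (length (fst D (n+1))) (g (n+1)) (f (n+1))) (snd C n)"
    by (simp only: cmD(2)[OF assms(1)] mmul_assoc)
  finally show "mmul (length (fst E n)) (snd E n) (mmul (length (fst D n)) (g n) (f n)) = \<dots>" .
qed

lemma comp_assoc: "comp_map E h (comp_map D g f) = comp_map D (comp_map E h g) f"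
  by (simp add: comp_map_def mmul_assoc)

lemma comp_add: "comp_map D (g + g') f = comp_map D g f + comp_map D g' f"
  "comp_map D g (f + f') = comp_map D g f + comp_map D g f'"
  by (simp_all add: comp_map_def mmul_add fun_eq_iff[where 'a=int])

lemma comp_diff: "comp_map D (g - g') f = comp_map D g f - comp_map D g' f"
  "comp_map D g (f - f') = comp_map D g f - comp_map D g f'"
  by (simp_all add: comp_map_def mmul_diff fun_eq_iff[where 'a=int])

lemma comp_zero [simp]: "comp_map D 0 f = 0" "comp_map D g 0 = 0"
  by (simp_all add: comp_map_def fun_eq_iff[where 'a=int])

lemma comp_idc: "cm C D f \<Longrightarrow> comp_map C f (idc C) = f" "cm C D f \<Longrightarrow> comp_map D (idc D) f = f"
  using mmul_idm_right[OF cmD(1) refl, of C D f] mmul_idm_left[OF cmD(1) refl, of C D f]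
  by (simp_all add: comp_map_def)

lemma cm_idc: "cx C \<Longrightarrow> cm C C (idc C)"
  unfolding chain_map_alt using mmul_idm_right[OF cxD(1) refl, of C] mmul_idm_left[OF cxD(1) refl, of C]
  by simp

lemma cm_zero: "cm C D 0" by (simp add: chain_map_alt)

lemma cm_add: "cm C D f \<Longrightarrow> cm C D g \<Longrightarrow> cm C D (f + g)"
  by (simp add: chain_map_alt hm_add mmul_add)

lemma nh_zero: "nh C D 0"
  unfolding null_homotopic_alt by (intro exI[of _ "\<lambda>n. 0"]) simp

lemma nh_add: assumes "nh C D f" "nh C D g" shows "nh C D (f + g)"
proof -
  obtain h k where "\<forall>n. hm (fst C n) (fst D (n - 1)) (h n)" "\<forall>n. hm (fst C n) (fst D (n - 1)) (k n)"
    "\<forall>n. f n = mmul (length (fst D (n - 1))) (snd D (n - 1)) (h n)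
                + mmul (length (fst C (n + 1))) (h (n + 1)) (snd C n)"
    "\<forall>n. g n = mmul (length (fst D (n - 1))) (snd D (n - 1)) (k n)
                + mmul (length (fst C (n + 1))) (k (n + 1)) (snd C n)"
    using assms unfolding null_homotopic_alt by blast
  then show ?thesis unfolding null_homotopic_alt
    by (intro exI[of _ "h + k"]) (simp add: hm_add mmul_add algebra_simps)
qed

lemma nh_uminus: assumes "nh C D f" shows "nh C D (- f)"
proof -
  obtain h where "\<forall>n. hm (fst C n) (fst D (n - 1)) (h n)"
    "\<forall>n. f n = mmul (length (fst D (n - 1))) (snd D (n - 1)) (h n)
                + mmul (length (fst C (n + 1))) (h (n + 1)) (snd C n)"
    using assms unfolding null_homotopic_alt by blast
  then show ?thesis unfolding null_homotopic_alt
    by (intro exI[of _ "- h"]) (simp add: hm_uminus mmul_uminus algebra_simps)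
qed

lemma nh_comp_left: assumes "nh C D f" "cm D E g" shows "nh C E (comp_map D g f)"
proof -
  obtain h where h: "\<And>n. hm (fst C n) (fst D (n - 1)) (h n)"
    "\<And>n. f n = mmul (length (fst D (n - 1))) (snd D (n - 1)) (h n)
                + mmul (length (fst C (n + 1))) (h (n + 1)) (snd C n)"
    using assms(1) unfolding null_homotopic_alt by blast
  define k where "k n = mmul (length (fst D (n - 1))) (g (n - 1)) (h n)" for n
  have "hm (fst C n) (fst E (n - 1)) (k n)" for n
    unfolding k_def using h(1) cmD(1)[OF assms(2)] hm_mmul by blast
  moreover have "comp_map D g f n = mmul (length (fst E (n - 1))) (snd E (n - 1)) (k n)
      + mmul (length (fst C (n + 1))) (k (n + 1)) (snd C n)" for n
  proof -
    have "comp_map D g f n = mmul (length (fst D (n - 1))) (mmul (length (fst D n)) (g n) (snd D (n - 1))) (h n)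
      + mmul (length (fst C (n + 1))) (mmul (length (fst D n)) (g n) (h (n + 1))) (snd C n)"
      unfolding comp_map_def h(2)[of n] by (simp only: mmul_add mmul_assoc)
    moreover have "mmul (length (fst D n)) (g n) (snd D (n - 1))
        = mmul (length (fst E (n - 1))) (snd E (n - 1)) (g (n - 1))"
      using cmD(2)[OF assms(2), of "n - 1"] by simp
    ultimately show ?thesis unfolding k_def by (simp add: mmul_assoc)
  qed
  ultimately show ?thesis unfolding null_homotopic_alt by blast
qed

lemma nh_comp_right: assumes "nh D E g" "cm C D f" shows "nh C E (comp_map D g f)"
proof -
  obtain h where h: "\<And>n. hm (fst D n) (fst E (n - 1)) (h n)"
    "\<And>n. g n = mmul (length (fst E (n - 1))) (snd E (n - 1)) (h n)
                + mmul (length (fst D (n + 1))) (h (n + 1)) (snd D n)"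
    using assms(1) unfolding null_homotopic_alt by blast
  define k where "k n = mmul (length (fst D n)) (h n) (f n)" for n
  have "hm (fst C n) (fst E (n - 1)) (k n)" for n
    unfolding k_def using h(1) cmD(1)[OF assms(2)] hm_mmul by blast
  moreover have "comp_map D g f n = mmul (length (fst E (n - 1))) (snd E (n - 1)) (k n)
      + mmul (length (fst C (n + 1))) (k (n + 1)) (snd C n)" for n
    unfolding comp_map_def h(2)[of n] k_def
    by (simp only: mmul_add mmul_assoc cmD(2)[OF assms(2)])
  ultimately show ?thesis unfolding null_homotopic_alt by blast
qed

lemma hty_refl: "hty C D f f" by (simp add: homotopic_alt nh_zero)
lemma hty_sym: "hty C D f g \<Longrightarrow> hty C D g f"
  unfolding homotopic_alt using nh_uminus[of C D "f - g"] by simp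
lemma hty_trans: "hty C D f g \<Longrightarrow> hty C D g h \<Longrightarrow> hty C D f h"
  unfolding homotopic_alt using nh_add[of C D "f - g" "g - h"] by simp
lemma hty_nh: "hty C D f g \<Longrightarrow> nh C D g \<Longrightarrow> nh C D f"
  unfolding homotopic_alt using nh_add[of C D "f - g" g] by simp
lemma hty_left: "hty C D f f' \<Longrightarrow> cm D E g \<Longrightarrow> hty C E (comp_map D g f) (comp_map D g f')"
  unfolding homotopic_alt using nh_comp_left[of C D "f - f'"] by (simp add: comp_diff)
lemma hty_right: "hty D E g g' \<Longrightarrow> cm C D f \<Longrightarrow> hty C E (comp_map D g f) (comp_map D g' f)"
  unfolding homotopic_alt using nh_comp_right[of D E "g - g'"] by (simp add: comp_diff)

lemma heqE:
  assumes "heq C D"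
  obtains f g where "cm C D f" "cm D C g" "hty C C (comp_map D g f) (idc C)" "hty D D (comp_map C f g) (idc D)"
  using assms unfolding htpy_equiv_def by blast

lemma heqI: "cm C D f \<Longrightarrow> cm D C g \<Longrightarrow> hty C C (comp_map D g f) (idc C) \<Longrightarrow>
   hty D D (comp_map C f g) (idc D) \<Longrightarrow> heq C D"
  unfolding htpy_equiv_def by blast

lemma heq_refl: "cx C \<Longrightarrow> heq C C"
  using cm_idc[of C] comp_idc(1)[OF cm_idc, of C] hty_refl by (metis heqI)

lemma heq_sym: "heq C D \<Longrightarrow> heq D C"
  unfolding htpy_equiv_def by blast

lemma heq_trans: assumes "heq C D" "heq D E" shows "heq C E"
proof -
  obtain f g where fg: "cm C D f" "cm D C g" "hty C C (comp_map D g f) (idc C)" "hty D D (comp_map C f g) (idc D)"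
    using assms(1) by (rule heqE)
  obtain h k where hk: "cm D E h" "cm E D k" "hty D D (comp_map E k h) (idc D)" "hty E E (comp_map D h k) (idc E)"
    using assms(2) by (rule heqE)
  have key: "hty X X (comp_map Z (comp_map Y p' q') (comp_map Y q p)) (idc X)"
    if "cm X Y p" "cm Y X p'" "hty X X (comp_map Y p' p) (idc X)"
      "cm Y Z q" "cm Z Y q'" "hty Y Y (comp_map Z q' q) (idc Y)" for X Y Z p p' q q'
  proof -
    have "hty X Y (comp_map Y (comp_map Z q' q) p) (comp_map Y (idc Y) p)"
      using that hty_right by blast
    then have "hty X X (comp_map Y p' (comp_map Y (comp_map Z q' q) p)) (comp_map Y p' p)"
      using hty_left[OF _ that(2)] comp_idc(2)[OF that(1)] by metis
    then show ?thesis using hty_trans[OF _ that(3)] by (simp add: comp_assoc)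
  qed
  show ?thesis
    using key[OF fg(1-3) hk(1-3)] key[OF hk(2,1,4) fg(2,1,4)] cm_comp[OF fg(1) hk(1)] cm_comp[OF hk(2) fg(2)]
    by (intro heqI)
qed

text \<open>Vanishing of all morphisms from \<open>C\<close> to \<open>D\<close> in the homotopy
  category.\<close>

definition hv :: "'a cplx \<Rightarrow> 'a cplx \<Rightarrow> bool" where "hv C D \<longleftrightarrow> (\<forall>f. cm C D f \<longrightarrow> nh C D f)"

lemma hv_heq: assumes "heq C C'" "heq D D'" "hv C D" shows "hv C' D'"
  unfolding hv_def
proof (intro allI impI)
  fix f assume f: "cm C' D' f"
  obtain p p' where p: "cm C C' p" "cm C' C p'" "hty C' C' (comp_map C p p') (idc C')"
    using assms(1) by (rule heqE)
  obtain q q' where q: "cm D D' q" "cm D' D q'" "hty D' D' (comp_map D q q') (idc D')"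
    using assms(2) by (rule heqE)
  have fp: "cm C D' (comp_map C' f p)" using cm_comp[OF p(1) f] .
  have "nh C D (comp_map D' q' (comp_map C' f p))"
    using assms(3) cm_comp[OF fp q(2)] by (simp add: hv_def)
  then have "nh C' D (comp_map C (comp_map D' q' (comp_map C' f p)) p')"
    using nh_comp_right p(2) by blast
  then have n: "nh C' D' (comp_map D q (comp_map C (comp_map D' q' (comp_map C' f p)) p'))"
    using nh_comp_left q(1) by blast
  have e: "comp_map D q (comp_map C (comp_map D' q' (comp_map C' f p)) p')
    = comp_map D' (comp_map D q q') (comp_map C' f (comp_map C p p'))"
    by (simp only: comp_assoc)
  have fpp: "cm C' D' (comp_map C' f (comp_map C p p'))" using cm_comp[OF cm_comp[OF p(2,1)] f] .
  have "hty C' D' (comp_map D' (comp_map D q q') (comp_map C' f (comp_map C p p'))) (comp_map C' f (comp_map C p p'))"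
    using hty_right[OF q(3) fpp] comp_idc(2)[OF fpp] by simp
  moreover have "hty C' D' (comp_map C' f (comp_map C p p')) f"
    using hty_left[OF p(3) f] comp_idc(1)[OF f] by simp
  ultimately have "hty C' D' (comp_map D' (comp_map D q q') (comp_map C' f (comp_map C p p'))) f"
    by (rule hty_trans)
  then show "nh C' D' f" using n e hty_nh hty_sym by metis
qed

lemma cm_shift: "cm C D f \<Longrightarrow> cm (shift C) (shift D) (\<lambda>n. f (n + 1))"
  unfolding chain_map_alt shift_def
  by (auto simp: mmul_uminus[unfolded fun_Compl_def])

lemma nh_shift: assumes "nh C D f" shows "nh (shift C) (shift D) (\<lambda>n. f (n + 1))"
proof -
  obtain h where h: "\<And>n. hm (fst C n) (fst D (n - 1)) (h n)"
    "\<And>n. f n = mmul (length (fst D (n - 1))) (snd D (n - 1)) (h n)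
                + mmul (length (fst C (n + 1))) (h (n + 1)) (snd C n)"
    using assms(1) unfolding null_homotopic_alt by blast
  have s: "snd (shift C) n = - snd C (n + 1)" "fst (shift C) n = fst C (n + 1)" for C :: "'a cplx" and n
    by (simp_all add: shift_def fun_Compl_def)
  show ?thesis unfolding null_homotopic_alt s
  proof (intro exI[of _ "\<lambda>n. - h (n + 1)"] conjI allI)
    fix n
    show "hm (fst C (n + 1)) (fst D (n - 1 + 1)) (- h (n + 1))" using h(1)[of "n + 1"] hm_uminus by simp
    show "f (n + 1) = mmul (length (fst D (n - 1 + 1))) (- snd D (n - 1 + 1)) (- h (n + 1)) +
         mmul (length (fst C (n + 1 + 1))) (- h (n + 1 + 1)) (- snd C (n + 1))"
      using h(2)[of "n + 1"] by (simp add: mmul_uminus)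
  qed
qed

lemma heq_shift: assumes "heq C D" shows "heq (shift C) (shift D)"
proof -
  obtain f g where fg: "cm C D f" "cm D C g" "hty C C (comp_map D g f) (idc C)" "hty D D (comp_map C f g) (idc D)"
    using assms(1) by (rule heqE)
  have 1: "hty (shift A) (shift A) (comp_map (shift B) (\<lambda>n. q (n + 1)) (\<lambda>n. p (n + 1))) (idc (shift A))"
    if "hty A A (comp_map B q p) (idc A)" for A B p q
  proof -
    have "nh (shift A) (shift A) (\<lambda>n. (comp_map B q p - idc A) (n + 1))"
      using nh_shift that unfolding homotopic_alt by blast
    moreover have "(\<lambda>n. (comp_map B q p - idc A) (n + 1))
       = comp_map (shift B) (\<lambda>n. q (n + 1)) (\<lambda>n. p (n + 1)) - idc (shift A)"
      by (simp add: fun_eq_iff[where 'a=int] comp_map_def shift_def)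
    ultimately show ?thesis unfolding homotopic_alt by simp
  qed
  show ?thesis using heqI[OF cm_shift[OF fg(1)] cm_shift[OF fg(2)] 1[OF fg(3)] 1[OF fg(4)]] .
qed

section \<open>Direct sums of complexes as biproducts\<close>

definition prl :: "bool list \<Rightarrow> bool list \<Rightarrow> 'a mat" where "prl p q = idm p"
definition inr :: "bool list \<Rightarrow> bool list \<Rightarrow> 'a mat" where
  "inr p q = (\<lambda>i j. if length p \<le> i then idm q (i - length p) j else 0)"
definition prr :: "bool list \<Rightarrow> bool list \<Rightarrow> 'a mat" where
  "prr p q = (\<lambda>i j. if length p \<le> j then idm q i (j - length p) else 0)"

text \<open>\<open>prl p q\<close> serves both as projection onto the first summand and as its
  inclusion: the identity of \<open>p\<close>, extended by zero, has the right support in either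
  reading. Only the second summand, whose indices are displaced, has two different matrices.\<close>

lemma hm_prl: "hm (p @ q) p (prl p q)" and hm_inl: "hm p (p @ q) (prl p q)"
  and hm_inr: "hm q (p @ q) (inr p q)" and hm_prr: "hm (p @ q) q (prr p q)"
  by (rule hmI; auto simp: prl_def inr_def prr_def id_mat_def nth_append)+

lemma mmul_prl: "hm s p A \<Longrightarrow> mmul (length p) (prl p q) A = A"
  "hm p s A \<Longrightarrow> mmul (length p) A (prl p q) = A"
  by (simp_all add: prl_def mmul_idm_left mmul_idm_right)

lemma mmul_prl_prl: "mmul (length (p @ q)) (prl p q) (prl p q) = idm p"
proof (intro ext)
  fix i j
  have "mmul (length (p @ q)) (prl p q) (prl p q) i j
    = (\<Sum>k<length p. idm p i k * idm p k j) + (\<Sum>k<length q. idm p i (length p + k) * idm p (length p + k) j)"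
    unfolding mmul_def prl_def by (simp add: sum_lessThan_add)
  also have "\<dots> = mmul (length p) (idm p) (idm p) i j" by (simp add: mmul_def id_mat_def)
  also have "\<dots> = idm p i j" by (simp add: mmul_idm_left[OF hm_idm refl])
  finally show "mmul (length (p @ q)) (prl p q) (prl p q) i j = idm p i j" .
qed

lemma mmul_prr_inr: "mmul (length (p @ q)) (prr p q) (inr p q) = idm q"
proof (intro ext)
  fix i j
  have "mmul (length (p @ q)) (prr p q) (inr p q) i j = mmul (length q) (idm q) (idm q) i j"
    unfolding mmul_def prr_def inr_def by (simp add: sum_lessThan_add)
  also have "\<dots> = idm q i j" by (simp add: mmul_idm_left[OF hm_idm refl])
  finally show "mmul (length (p @ q)) (prr p q) (inr p q) i j = idm q i j" .
qed

lemma mmul_prl_inr: "mmul (length (p @ q)) (prl p q) (inr p q) = 0"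
  by (auto simp: fun_eq_iff mmul_def prl_def inr_def id_mat_def intro!: sum.neutral)

lemma mmul_prr_inl: "mmul (length (p @ q)) (prr p q) (prl p q) = 0"
  by (auto simp: fun_eq_iff mmul_def prl_def prr_def id_mat_def intro!: sum.neutral)

lemma idm_append: "idm (p @ q) = mmul (length p) (prl p q) (prl p q) + mmul (length q) (inr p q) (prr p q)"
proof (intro ext)
  fix i j
  have 1: "mmul (length p) (prl p q) (prl p q) i j = idm p i j"
    unfolding prl_def by (simp add: mmul_idm_left[OF hm_idm refl])
  have 2: "mmul (length q) (inr p q) (prr p q) i j
      = (if length p \<le> i \<and> length p \<le> j then mmul (length q) (idm q) (idm q) (i - length p) (j - length p) else 0)"
    unfolding mmul_def prr_def inr_def by auto
  have 3: "mmul (length q) (idm q) (idm q) = idm q" by (simp add: mmul_idm_left[OF hm_idm refl])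
  show "idm (p @ q) i j = (mmul (length p) (prl p q) (prl p q) + mmul (length q) (inr p q) (prr p q)) i j"
    unfolding plus_fun_apply 1 2 3 by (auto simp: id_mat_def nth_append)
qed

text \<open>Once a block diagonal matrix is a sum of composites through the summands, later facts
  about \<open>dsum\<close> follow from associativity and the biproduct relations instead of index
  calculations.\<close>

lemma blk_diag:
  assumes "hm s t A" "hm s' t' B"
  shows "blk (length t) (length s) A (\<lambda>i j. 0) (\<lambda>i j. 0) B
    = mmul (length t) (prl t t') (mmul (length s) A (prl s s'))
      + mmul (length t') (inr t t') (mmul (length s') B (prr s s'))"
proof (intro ext)
  fix i j
  have 1: "mmul (length t) (prl t t') (mmul (length s) A (prl s s')) = A"
    using assms(1) mmul_prl by simp
  have "mmul (length s') B (prr s s') k j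
     = (if length s \<le> j then mmul (length s') B (idm s') k (j - length s) else 0)" for k
    by (simp add: mmul_def prr_def)
  then have 2: "mmul (length s') B (prr s s') k j = (if length s \<le> j then B k (j - length s) else 0)" for k
    using assms(2) by (simp add: mmul_idm_right)
  have "mmul (length t') (inr t t') (mmul (length s') B (prr s s')) i j
     = (if length t \<le> i \<and> length s \<le> j then mmul (length t') (idm t') B (i - length t) (j - length s) else 0)"
    unfolding mmul_def[of "length t'"] 2
    by (cases "length t \<le> i"; cases "length s \<le> j") (simp_all add: inr_def)
  also have "\<dots> = (if length t \<le> i \<and> length s \<le> j then B (i - length t) (j - length s) else 0)"
    using assms(2) by (simp add: mmul_idm_left)
  finally show "blk (length t) (length s) A (\<lambda>i j. 0) (\<lambda>i j. 0) B i j
    = (mmul (length t) (prl t t') (mmul (length s) A (prl s s'))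
      + mmul (length t') (inr t t') (mmul (length s') B (prr s s'))) i j"
    unfolding 1 plus_fun_apply using hmD0[OF assms(1), of i j]
    by (auto simp: blk_def not_less)
qed

definition pl :: "'a cplx \<Rightarrow> 'a cplx \<Rightarrow> int \<Rightarrow> 'a mat" where "pl C D = (\<lambda>n. prl (fst C n) (fst D n))"
definition pr :: "'a cplx \<Rightarrow> 'a cplx \<Rightarrow> int \<Rightarrow> 'a mat" where "pr C D = (\<lambda>n. prr (fst C n) (fst D n))"
definition ir :: "'a cplx \<Rightarrow> 'a cplx \<Rightarrow> int \<Rightarrow> 'a mat" where "ir C D = (\<lambda>n. inr (fst C n) (fst D n))"

lemma snd_dsum:
  assumes "cx C" "cx D"
  shows "snd (dsum C D) n = mmul (length (fst C (n+1))) (pl C D (n+1)) (mmul (length (fst C n)) (snd C n) (pl C D n))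
    + mmul (length (fst D (n+1))) (ir C D (n+1)) (mmul (length (fst D n)) (snd D n) (pr C D n))"
  using blk_diag[OF cxD(1)[OF assms(1)] cxD(1)[OF assms(2)], of n n]
  by (simp add: dsum_def pl_def pr_def ir_def)

lemma fst_dsum: "fst (dsum C D) n = fst C n @ fst D n" by (simp add: dsum_def)

lemma hm_pl: "hm (fst (dsum C D) n) (fst C n) (pl C D n)" "hm (fst C n) (fst (dsum C D) n) (pl C D n)"
  and hm_pr: "hm (fst (dsum C D) n) (fst D n) (pr C D n)" and hm_ir: "hm (fst D n) (fst (dsum C D) n) (ir C D n)"
  by (simp_all only: fst_dsum pl_def pr_def ir_def hm_prl hm_inl hm_inr hm_prr)

lemma dsum_rels:
  "mmul (length (fst (dsum C D) n)) (pl C D n) (pl C D n) = idm (fst C n)"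
  "mmul (length (fst (dsum C D) n)) (pr C D n) (ir C D n) = idm (fst D n)"
  "mmul (length (fst (dsum C D) n)) (pl C D n) (ir C D n) = 0"
  "mmul (length (fst (dsum C D) n)) (pr C D n) (pl C D n) = 0"
  by (simp_all only: fst_dsum pl_def pr_def ir_def mmul_prl_prl mmul_prr_inr mmul_prl_inr mmul_prr_inl)

lemma dsum_rels_assoc:
  "mmul (length (fst (dsum C D) n)) (pl C D n) (mmul m (pl C D n) A) = mmul m (idm (fst C n)) A"
  "mmul (length (fst (dsum C D) n)) (pr C D n) (mmul m (ir C D n) A) = mmul m (idm (fst D n)) A"
  "mmul (length (fst (dsum C D) n)) (pl C D n) (mmul m (ir C D n) A) = 0"
  "mmul (length (fst (dsum C D) n)) (pr C D n) (mmul m (pl C D n) A) = 0"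
  by (simp_all only: mmul_assoc[symmetric] dsum_rels mmul_zero)

lemma dsum_maps:
  assumes "cx C" "cx D"
  shows "cm (dsum C D) C (pl C D)" "cm C (dsum C D) (pl C D)" "cm (dsum C D) D (pr C D)" "cm D (dsum C D) (ir C D)"
proof -
  note [simp] = mmul_idm_left[OF cxD(1)[OF assms(1)] refl] mmul_idm_left[OF cxD(1)[OF assms(2)] refl]
    mmul_idm_right[OF cxD(1)[OF assms(1)] refl] mmul_idm_right[OF cxD(1)[OF assms(2)] refl]
    mmul_idm_left[OF hm_pl(1) refl] mmul_idm_left[OF hm_pr(1) refl]
  have dl: "mmul (length (fst C (n+1))) (idm (fst C (n+1))) (mmul (length (fst C n)) (snd C n) (pl C D n))
     = mmul (length (fst C n)) (snd C n) (pl C D n)"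
    "mmul (length (fst D (n+1))) (idm (fst D (n+1))) (mmul (length (fst D n)) (snd D n) (pr C D n))
     = mmul (length (fst D n)) (snd D n) (pr C D n)" for n
    by (simp_all add: mmul_assoc[symmetric])
  show "cm (dsum C D) C (pl C D)" "cm (dsum C D) D (pr C D)"
    unfolding chain_map_alt by (simp_all add: hm_pl hm_pr snd_dsum[OF assms] mmul_add dsum_rels_assoc dl)
  show "cm C (dsum C D) (pl C D)" "cm D (dsum C D) (ir C D)"
    unfolding chain_map_alt by (simp_all add: hm_pl hm_ir snd_dsum[OF assms] mmul_add mmul_assoc dsum_rels)
qed

lemma dsum_comps:
  "comp_map (dsum C D) (pl C D) (pl C D) = idc C"
  "comp_map (dsum C D) (pr C D) (ir C D) = idc D"
  "comp_map (dsum C D) (pl C D) (ir C D) = 0"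
  "comp_map (dsum C D) (pr C D) (pl C D) = 0"
  "comp_map C (pl C D) (pl C D) + comp_map D (ir C D) (pr C D) = idc (dsum C D)"
proof -
  show "comp_map C (pl C D) (pl C D) + comp_map D (ir C D) (pr C D) = idc (dsum C D)"
    by (rule ext) (simp add: comp_map_def fst_dsum idm_append pl_def pr_def ir_def)
qed (rule ext, simp add: comp_map_def dsum_rels)+

lemma cx_dsum: assumes "cx C" "cx D" shows "cx (dsum C D)"
  unfolding is_cplx_alt
proof (intro conjI allI)
  obtain N M where "\<forall>n. \<bar>n\<bar> > N \<longrightarrow> fst C n = []" "\<forall>n. \<bar>n\<bar> > M \<longrightarrow> fst D n = []"
    using assms unfolding is_cplx_alt by blast
  then show "\<exists>N. \<forall>n. \<bar>n\<bar> > N \<longrightarrow> fst (dsum C D) n = []"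
    by (intro exI[of _ "max N M"]) (auto simp: fst_dsum)
  fix n
  show "hm (fst (dsum C D) n) (fst (dsum C D) (n + 1)) (snd (dsum C D) n)"
    unfolding snd_dsum[OF assms]
    by (intro hm_add hm_mmul[OF _ _ refl] hm_pl hm_pr hm_ir cxD assms)
  have a: "mmul (length (fst (dsum C D) (n+1))) (snd (dsum C D) (n+1)) (mmul (length (fst C (n+1))) (pl C D (n+1)) A)
     = mmul (length (fst C (n+1))) (mmul (length (fst C (n+1+1))) (pl C D (n+1+1)) (snd C (n+1))) A"
    "mmul (length (fst (dsum C D) (n+1))) (snd (dsum C D) (n+1)) (mmul (length (fst D (n+1))) (ir C D (n+1)) A)
     = mmul (length (fst D (n+1))) (mmul (length (fst D (n+1+1))) (ir C D (n+1+1)) (snd D (n+1))) A" for A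
    using cmD(2)[OF dsum_maps(2)[OF assms], of "n+1"] cmD(2)[OF dsum_maps(4)[OF assms], of "n+1"]
    by (simp_all add: mmul_assoc[symmetric])
  have b: "mmul (length (fst C (n+1))) (mmul m B (snd C (n+1))) (mmul k (snd C n) A) = 0"
    "mmul (length (fst D (n+1))) (mmul m B (snd D (n+1))) (mmul k (snd D n) A) = 0" for A B m k
    using cxD(2)[OF assms(1), of n] cxD(2)[OF assms(2), of n]
    by (simp_all add: mmul_assoc[of _ _ B], simp_all add: mmul_assoc[symmetric])
  show "mmul (length (fst (dsum C D) (n + 1))) (snd (dsum C D) (n + 1)) (snd (dsum C D) n) = 0"
    unfolding snd_dsum[OF assms, of n] mmul_add a b by simp
qed

subsection \<open>Thick subcategories\<close>

definition stalk :: "int \<Rightarrow> bool list \<Rightarrow> 'a cplx" where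
  "stalk m l = (\<lambda>n. if n = m then l else [], \<lambda>n. 0)"

lemma cx_stalk: "cx (stalk m l)"
  unfolding is_cplx_alt by (auto simp: stalk_def intro!: exI[of _ "\<bar>m\<bar>"])

lemma shift_stalk: "shift (stalk m l) = stalk (m - 1) l"
  by (auto simp: shift_def stalk_def fun_eq_iff)

lemma unshift_stalk: "unshift (stalk m l) = stalk (m + 1) l"
  by (auto simp: unshift_def stalk_def fun_eq_iff)

lemma cx_shift: assumes "cx C" shows "cx (shift C)"
proof -
  obtain N where N: "\<forall>n. \<bar>n\<bar> > N \<longrightarrow> fst C n = []" using assms unfolding is_cplx_alt by blast
  have s: "snd (shift C) n = - snd C (n + 1)" "fst (shift C) n = fst C (n + 1)" for n
    by (simp_all add: shift_def fun_Compl_def)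
  show ?thesis unfolding is_cplx_alt s mmul_uminus
    using N cxD[OF assms, of "_ + 1"] by (auto simp: hm_uminus intro!: exI[of _ "\<bar>N\<bar> + 1"])
qed

lemma dsum_zero: "dsum zero_cplx C = C"
  by (simp add: dsum_def zero_cplx_def blk_def prod_eq_iff)

lemma cx_zero: "cx zero_cplx"
  unfolding is_cplx_alt by (auto simp: zero_cplx_def zero_fun_def[symmetric])

text \<open>The cone of the zero map out of an unshifted stalk is a direct sum, so a list of labels
  is built up one projective at a time.\<close>

lemma stalk_in_thick:
  assumes P: "stalk 0 [True] \<in> thick e1 e2 S" "stalk 0 [False] \<in> thick e1 e2 S"
  shows "stalk m l \<in> thick e1 e2 S"
proof -
  have single: "stalk m [b] \<in> thick e1 e2 S" for m b
  proof -
    have 0: "stalk 0 [b] \<in> thick e1 e2 S" using P by (cases b) auto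
    have pos: "stalk (int k) [b] \<in> thick e1 e2 S" for k
    proof (induction k)
      case (Suc k) then show ?case using thick.unshift[OF Suc] by (simp add: unshift_stalk add.commute)
    qed (use 0 in simp)
    have neg: "stalk (- int k) [b] \<in> thick e1 e2 S" for k
    proof (induction k)
      case (Suc k)
      have "- int k - 1 = - int (Suc k)" by simp
      then show ?case using thick.shift[OF Suc] unfolding shift_stalk by metis
    qed (use 0 in simp)
    show ?thesis using pos[of "nat m"] neg[of "nat (- m)"] by (cases "m \<ge> 0") auto
  qed
  \<comment> \<open>The zero complex, needed for the empty list, enters as a direct summand.\<close>
  have "dsum zero_cplx (stalk 0 [True]) \<in> thick e1 e2 S" using P by (simp add: dsum_zero)
  then have z: "zero_cplx \<in> thick e1 e2 S" using thick.summand cx_zero cx_stalk by blast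
  show ?thesis
  proof (induction l)
    case Nil
    have "stalk m [] = zero_cplx" by (auto simp: stalk_def zero_cplx_def fun_eq_iff)
    then show ?case using z by simp
  next
    case (Cons b l)
    have u: "unshift (stalk m [b]) = stalk (m + 1) [b]" by (rule unshift_stalk)
    have "cone (stalk (m + 1) [b]) (stalk m l) 0 \<in> thick e1 e2 S"
      using thick.cone[OF single Cons cm_zero] .
    moreover have "cone (stalk (m + 1) [b]) (stalk m l) 0 = stalk m (b # l)"
      by (auto simp: cone_def stalk_def blk_def fun_eq_iff)
    ultimately show ?case by simp
  qed
qed

definition trunc :: "int \<Rightarrow> 'a cplx \<Rightarrow> 'a cplx" where
  "trunc m C = (\<lambda>n. if n \<le> m then fst C n else [], \<lambda>n. if n + 1 \<le> m then snd C n else 0)"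

text \<open>\<open>C\<close> is assembled from brutal truncations: the one at \<open>m + 1\<close>
  is the cone of the map given by the differential out of degree \<open>m\<close>, from the
  unshifted truncation at \<open>m\<close> to a stalk. The signs in \<open>unshift\<close> and
  \<open>cone\<close> cancel, so this is an equality and not just an equivalence.\<close>

lemma cx_in_thick:
  assumes P: "stalk 0 [True] \<in> thick e1 e2 S" "stalk 0 [False] \<in> thick e1 e2 S" and C: "cx C"
  shows "C \<in> thick e1 e2 S"
proof -
  obtain N where N: "\<forall>n. \<bar>n\<bar> > N \<longrightarrow> fst C n = []" using C unfolding is_cplx_alt by blast
  have d0: "snd C n = 0" if "fst C n = [] \<or> fst C (n + 1) = []" for n
    using cxD(1)[OF C, of n] that by (auto simp: hm_iff fun_eq_iff)
  have triv: "trunc (- \<bar>N\<bar> - 1) C = stalk 0 []"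
  proof -
    have "fst C n = []" if "n \<le> - \<bar>N\<bar> - 1" for n using N that by force
    then show ?thesis using d0 by (auto simp: trunc_def stalk_def fun_eq_iff)
  qed
  have "trunc m C \<in> thick e1 e2 S" if "- \<bar>N\<bar> - 1 \<le> m" for m
    using that
  proof (induction m rule: int_ge_induct)
    case base then show ?case using triv stalk_in_thick[OF P, of 0 "[]"] by simp
  next
    case (step m)
    define f :: "int \<Rightarrow> 'a mat" where "f n = (if n = m + 1 then snd C m else 0)" for n
    have f: "cm (unshift (trunc m C)) (stalk (m + 1) (fst C (m + 1))) f"
      unfolding chain_map_alt
    proof (intro conjI allI)
      fix n
      show "hm (fst (unshift (trunc m C)) n) (fst (stalk (m + 1) (fst C (m + 1))) n) (f n)"
        using cxD(1)[OF C, of m] by (auto simp: unshift_def trunc_def stalk_def f_def)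
      have "mmul (length (fst (unshift (trunc m C)) (n + 1))) (f (n + 1)) (snd (unshift (trunc m C)) n) = 0"
      proof (cases "n = m")
        case True
        have "snd (unshift (trunc m C)) m = - snd C (m - 1)"
          by (simp add: unshift_def trunc_def fun_Compl_def)
        moreover have "length (fst (unshift (trunc m C)) (m + 1)) = length (fst C m)"
          by (simp add: unshift_def trunc_def)
        ultimately show ?thesis using True cxD(2)[OF C, of "m - 1"]
          by (simp add: f_def mmul_uminus)
      qed (simp add: f_def)
      then show "mmul (length (fst (stalk (m + 1) (fst C (m + 1))) n)) (snd (stalk (m + 1) (fst C (m + 1))) n) (f n) =
         mmul (length (fst (unshift (trunc m C)) (n + 1))) (f (n + 1)) (snd (unshift (trunc m C)) n)"
        by (simp add: stalk_def)
    qed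
    have "cone (unshift (trunc m C)) (stalk (m + 1) (fst C (m + 1))) f \<in> thick e1 e2 S"
      using thick.cone[OF thick.unshift[OF step.IH] stalk_in_thick[OF P] f] .
    moreover have "cone (unshift (trunc m C)) (stalk (m + 1) (fst C (m + 1))) f = trunc (m + 1) C"
    proof (rule prod_eqI)
      show "fst (cone (unshift (trunc m C)) (stalk (m + 1) (fst C (m + 1))) f) = fst (trunc (m + 1) C)"
        by (auto simp: cone_def unshift_def trunc_def stalk_def fun_eq_iff)
      show "snd (cone (unshift (trunc m C)) (stalk (m + 1) (fst C (m + 1))) f) = snd (trunc (m + 1) C)"
      proof (intro ext)
        fix n i j
        have "snd C n i j = 0" if "\<not> i < length (fst C (n + 1)) \<or> \<not> j < length (fst C n)"
          using hmD0[OF cxD(1)[OF C, of n] that] .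
        then show "snd (cone (unshift (trunc m C)) (stalk (m + 1) (fst C (m + 1))) f) n i j = snd (trunc (m + 1) C) n i j"
          by (auto simp: cone_def unshift_def trunc_def stalk_def blk_def f_def add.commute)
      qed
    qed
    ultimately show ?case by simp
  qed
  from this[of "\<bar>N\<bar> + 1"] have "trunc (\<bar>N\<bar> + 1) C \<in> thick e1 e2 S" by simp
  moreover have "trunc (\<bar>N\<bar> + 1) C = C"
  proof (rule prod_eqI)
    have "fst C n = []" if "\<not> n \<le> \<bar>N\<bar> + 1" for n using N that by force
    then show "fst (trunc (\<bar>N\<bar> + 1) C) = fst C" by (auto simp: trunc_def fun_eq_iff)
    have "snd C n = 0" if "\<not> n + 1 \<le> \<bar>N\<bar> + 1" for n
      by (rule d0) (use N that in force)
    then show "snd (trunc (\<bar>N\<bar> + 1) C) = snd C" by (auto simp: trunc_def fun_eq_iff)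
  qed
  ultimately show ?thesis by simp
qed

end

section \<open>The radical of a basic algebra with two idempotents\<close>

locale alg_pair = two_idem e1 e2 + vspace sc
  for sc :: "'k::field \<Rightarrow> 'a::ring_1 \<Rightarrow> 'a" and e1 e2 :: 'a +
  assumes sc_mult: "sc c (x * y) = sc c x * y" "sc c (x * y) = x * sc c y"
    and findim_UNIV: "findim UNIV"
    and prim: "primitive_idem e1" "primitive_idem e2"
    and basic: "basic_alg e1 e2"
begin

lemma primL: "primitive_idem (L b)" using prim by (simp add: lab_def)

lemma L_nz: "L b \<noteq> 0" using primL[of b] by (simp add: primitive_idem_def)

lemma Co_scale: "x \<in> Co b c \<Longrightarrow> sc k x \<in> Co b c"
  by (simp add: Co_iff sc_mult[symmetric])

lemma algebra_Co: "algebra_on sc (Co b b) (*) (L b)"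
proof unfold_locales
  show "findim (Co b b)" using findim_UNIV by (rule findim_subset) simp
qed (auto simp: Co_add Co_uminus Co_mult mult.assoc distrib_left distrib_right Co_scale sc_mult[symmetric], auto simp: Co_iff)

lemma local_Co: "local_on (Co b b) (*) (L b)"
proof (rule algebra_on.local_onI[OF algebra_Co])
  fix e assume e: "e \<in> Co b b" "e * e = e"
  let ?g = "L b - e"
  have e': "L b * e = e" "e * L b = e" using e by (auto simp: Co_iff)
  have "idempotent e" "idempotent ?g" "e * ?g = 0" "?g * e = 0" "e + ?g = L b"
    using e(2) e' by (auto simp: idempotent_def algebra_simps)
  then have "e = 0 \<or> ?g = 0" using primL[of b] unfolding primitive_idem_def by blast
  then show "e = 0 \<or> e = L b" by auto
qed (rule L_nz)

sublocale lc: local_on "Co b b" "(*)" "L b" for b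
  by (rule local_Co)

text \<open>If \<open>s t\<close> were invertible, absorbing the inverse into \<open>t\<close> gives
  \<open>t'\<close> with \<open>s t' = L b\<close>, and \<open>t' s\<close> is an idempotent of the
  local ring at \<open>c\<close>. The value \<open>0\<close> contradicts
  \<open>L b \<noteq> 0\<close>; the value \<open>L c\<close> is an isomorphism between
  \<open>P1\<close> and \<open>P2\<close>, which basicness excludes.\<close>

lemma off_diag_nonunit:
  assumes s: "s \<in> Co b c" and t: "t \<in> Co c b" and bc: "b \<noteq> c"
  shows "s * t \<in> lc.nonunits b"
proof -
  have False if inv: "lc.inv_el b (s * t)"
  proof -
    obtain z where z: "z \<in> Co b b" "s * t * z = L b" using inv by (auto simp: lc.inv_el_def)
    define t' where "t' = t * z"
    have t': "t' \<in> Co c b" "s * t' = L b" using t z by (auto simp: t'_def Co_mult mult.assoc)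
    have ts: "t' * s \<in> Co c c" using Co_mult[OF t'(1) s] .
    have "t' * s * (t' * s) = t' * (s * t') * s" by (simp add: mult.assoc)
    also have "\<dots> = t' * s" using t' s by (simp add: Co_iff)
    finally consider "t' * s = 0" | "t' * s = L c" using lc.idem_trivial[OF ts] by blast
    then show False
    proof cases
      case 1
      have "L b = (s * t') * (s * t')" by (simp add: t')
      also have "\<dots> = s * (t' * s) * t'" by (simp add: mult.assoc)
      finally show False using 1 L_nz by simp
    next
      case 2
      show False using basic t' s 2 bc unfolding basic_alg_def lab_def
        by (cases b; cases c; simp; blast)
    qed
  qed
  then show ?thesis using Co_mult[OF s t] unfolding lc.nonunits_def by blast
qed

text \<open>The Jacobson radical of \<open>A\<close>. A product through the other idempotent is
  never invertible, so off-diagonal corners are unrestricted and only the diagonal corners have to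
  consist of nonunits.\<close>

definition Jac :: "'a set" where "Jac = {x. \<forall>b. L b * x * L b \<in> lc.nonunits b}"

lemma JacD: "x \<in> Jac \<Longrightarrow> L b * x * L b \<in> lc.nonunits b" by (simp add: Jac_def)

lemma Jac_zero: "0 \<in> Jac" using lc.zero_nonunits by (simp add: Jac_def)
lemma Jac_add: "x \<in> Jac \<Longrightarrow> y \<in> Jac \<Longrightarrow> x + y \<in> Jac"
  using lc.nonunits_add by (simp add: Jac_def algebra_simps)
lemma Jac_sum: "(\<And>k. k \<in> A \<Longrightarrow> f k \<in> Jac) \<Longrightarrow> sum f A \<in> Jac"
  by (induction A rule: infinite_finite_induct) (auto simp: Jac_zero Jac_add)

lemma corner_split: "L b * (x * y) * L b
   = (L b * x * L b) * (L b * y * L b) + (L b * x * L (\<not> b)) * (L (\<not> b) * y * L b)"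
proof -
  have c: "L b * x * L c * y * L b = (L b * x * L c) * (L c * y * L b)" for c
    by (simp add: mult.assoc) (metis L_simps(1) mult.assoc)
  have "L b * (x * y) * L b = L b * x * 1 * y * L b" by (simp add: mult.assoc)
  also have "\<dots> = L b * x * L b * y * L b + L b * x * L (\<not> b) * y * L b"
    unfolding L_sum[of b, symmetric] by (simp only: distrib_left distrib_right)
  finally show ?thesis unfolding c[of b] c[of "\<not> b"] .
qed

lemma Jac_mult: assumes "x \<in> Jac \<or> y \<in> Jac" shows "x * y \<in> Jac"
  unfolding Jac_def
proof (intro CollectI allI)
  fix b
  have "(L b * x * L b) * (L b * y * L b) \<in> lc.nonunits b"
    using assms JacD[of x b] JacD[of y b] by (intro lc.nonunits_mul) (auto simp: Co_cut)
  moreover have "(L b * x * L (\<not> b)) * (L (\<not> b) * y * L b) \<in> lc.nonunits b"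
    by (rule off_diag_nonunit[where c = "\<not> b"]) (simp_all add: Co_cut)
  ultimately show "L b * (x * y) * L b \<in> lc.nonunits b"
    unfolding corner_split by (rule lc.nonunits_add)
qed

lemma Jac_corner: assumes x: "x \<in> Co b b" shows "x \<in> Jac \<longleftrightarrow> x \<in> lc.nonunits b"
proof
  have bb: "L b * x * L b = x" using x by (simp add: Co_iff)
  show "x \<in> lc.nonunits b" if "x \<in> Jac" using JacD[OF that, of b] bb by simp
  show "x \<in> Jac" if n: "x \<in> lc.nonunits b"
    unfolding Jac_def
  proof (intro CollectI allI)
    fix c
    show "L c * x * L c \<in> lc.nonunits c"
    proof (cases "c = b")
      case True then show ?thesis using n bb by simp
    next
      case False
      have "L c * x * L c = L c * (L b * x * L b) * L c" using bb by simp
      also have "\<dots> = (L c * L b) * x * L b * L c" by (simp only: mult.assoc)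
      finally show ?thesis using False lc.zero_nonunits by simp
    qed
  qed
qed

lemma Jac_off: "x \<in> Co b c \<Longrightarrow> b \<noteq> c \<Longrightarrow> x \<in> Jac"
proof -
  assume x: "x \<in> Co b c" "b \<noteq> c"
  have "L d * x * L d = 0" for d
  proof -
    have "x = L b * x * L c" using x by (simp add: Co_iff)
    then have "L d * x * L d = (L d * L b) * x * (L c * L d)" by (metis mult.assoc)
    moreover have "d \<noteq> b \<or> c \<noteq> d" using x(2) by blast
    ultimately show ?thesis by auto
  qed
  then show ?thesis unfolding Jac_def using lc.zero_nonunits by simp
qed

lemma L_notin_Jac: "L b \<notin> Jac"
  using lc.inv_el_u[of b] Jac_corner[OF Co_L, of b] by (simp add: lc.nonunits_def)

lemma not_Jac_inverse:
  assumes "x \<in> Co b b" "x \<notin> Jac"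
  obtains y where "y \<in> Co b b" "x * y = L b" "y * x = L b"
  using assms Jac_corner[OF assms(1)] unfolding lc.nonunits_def lc.inv_el_def by blast

definition Jm :: "'a mat \<Rightarrow> bool" where "Jm M \<longleftrightarrow> (\<forall>i j. M i j \<in> Jac)"

lemma Jm_mmul: "Jm A \<or> Jm B \<Longrightarrow> Jm (mmul n A B)"
  unfolding Jm_def mmul_def by (auto intro!: Jac_sum Jac_mult)

lemma Jm_add: "Jm A \<Longrightarrow> Jm B \<Longrightarrow> Jm (A + B)"
  unfolding Jm_def by (simp add: Jac_add)

lemma not_Jm_idm: "Jm (idm l) \<Longrightarrow> l = []"
proof (rule ccontr)
  assume "Jm (idm l)" "l \<noteq> []"
  then have "idm l 0 0 \<in> Jac" "0 < length l" by (auto simp: Jm_def)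
  then show False using L_notin_Jac by (simp add: id_mat_def)
qed

end

subsection \<open>Two-term complexes\<close>

definition tt :: "bool list \<Rightarrow> bool list \<Rightarrow> 'a::ring_1 mat \<Rightarrow> 'a cplx" where
  "tt s t d = (\<lambda>n. if n = -1 then s else if n = 0 then t else [], \<lambda>n. if n = -1 then d else 0)"

definition mp :: "'a::ring_1 mat \<Rightarrow> 'a mat \<Rightarrow> int \<Rightarrow> 'a mat" where
  "mp q p = (\<lambda>n. if n = -1 then q else if n = 0 then p else 0)"

lemma fst_tt: "fst (tt s t d) n = (if n = -1 then s else if n = 0 then t else [])"
  and snd_tt: "snd (tt s t d) n = (if n = -1 then d else 0)"
  by (simp_all add: tt_def)

lemma K0class_tt: "K0class (tt s t d) = (cnt True t - cnt True s, cnt False t - cnt False s)"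
proof -
  have *: "(\<Sum>n\<in>{n::int. fst (tt s t d) n \<noteq> []}. (if even n then 1 else -1) * cnt b (fst (tt s t d) n))
      = cnt b t - cnt b s" for b
  proof -
    have "(\<Sum>n\<in>{n::int. fst (tt s t d) n \<noteq> []}. (if even n then 1 else -1) * cnt b (fst (tt s t d) n))
      = (\<Sum>n\<in>{-1, 0::int}. (if even n then 1 else -1) * cnt b (fst (tt s t d) n))"
      by (rule sum.mono_neutral_left) (auto simp: fst_tt cnt_def split: if_splits)
    also have "\<dots> = cnt b t - cnt b s" by (simp add: fst_tt)
    finally show ?thesis .
  qed
  show ?thesis unfolding K0class_def * ..
qed

context two_idem
begin

lemma cx_tt: "hm s t d \<Longrightarrow> cx (tt s t d)"
  unfolding is_cplx_alt by (auto simp: fst_tt snd_tt intro!: exI[of _ 1])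

lemma two_term_tt: "hm s t d \<Longrightarrow> two_term e1 e2 (tt s t d)"
  unfolding two_term_def using cx_tt by (simp add: fst_tt)

lemma two_termE:
  assumes "two_term e1 e2 C"
  obtains s t d where "hm s t d" "C = tt s t d"
proof
  have cx: "cx C" and z: "\<And>n. n \<noteq> -1 \<Longrightarrow> n \<noteq> 0 \<Longrightarrow> fst C n = []"
    using assms by (auto simp: two_term_def)
  show "hm (fst C (-1)) (fst C 0) (snd C (-1))" using cxD(1)[OF cx, of "-1"] by simp
  have "snd C n = 0" if "n \<noteq> -1" for n
  proof -
    have "fst C n = [] \<or> fst C (n + 1) = []"
      using z[of n] z[of 1] that by (cases "n = 0") auto
    then show ?thesis using cxD(1)[OF cx, of n] by (auto simp: hm_iff fun_eq_iff)
  qed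
  then show "C = tt (fst C (-1)) (fst C 0) (snd C (-1))"
    using z by (auto simp: tt_def prod_eq_iff fun_eq_iff)
qed

lemma hm_empty: "hm [] t M \<longleftrightarrow> M = 0" "hm s [] M \<longleftrightarrow> M = 0"
  by (auto simp: hm_iff fun_eq_iff)

lemma cm_tt_iff: "cm (tt s t d) (tt s' t' d') f \<longleftrightarrow>
  (\<exists>q p. f = mp q p \<and> hm s s' q \<and> hm t t' p \<and> mmul (length s') d' q = mmul (length t) p d)"
proof
  assume f: "cm (tt s t d) (tt s' t' d') f"
  have "f n = 0" if "n \<noteq> -1" "n \<noteq> 0" for n
    using cmD(1)[OF f, of n] that by (simp add: fst_tt hm_empty)
  then have "f = mp (f (-1)) (f 0)" by (auto simp: mp_def)
  moreover have "hm s s' (f (-1))" "hm t t' (f 0)"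
    using cmD(1)[OF f, of "-1"] cmD(1)[OF f, of 0] by (simp_all add: fst_tt)
  moreover have "mmul (length s') d' (f (-1)) = mmul (length t) (f 0) d"
    using cmD(2)[OF f, of "-1"] by (simp add: fst_tt snd_tt)
  ultimately show "\<exists>q p. f = mp q p \<and> hm s s' q \<and> hm t t' p \<and> mmul (length s') d' q = mmul (length t) p d"
    by blast
next
  assume "\<exists>q p. f = mp q p \<and> hm s s' q \<and> hm t t' p \<and> mmul (length s') d' q = mmul (length t) p d"
  then show "cm (tt s t d) (tt s' t' d') f"
    unfolding chain_map_alt by (auto simp: mp_def fst_tt snd_tt)
qed

lemma nh_tt_iff: "nh (tt s t d) (tt s' t' d') f \<longleftrightarrow>
  (\<exists>h. hm t s' h \<and> f = mp (mmul (length t) h d) (mmul (length s') d' h))"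
proof
  assume "nh (tt s t d) (tt s' t' d') f"
  then obtain h where h: "\<And>n. hm (fst (tt s t d) n) (fst (tt s' t' d') (n - 1)) (h n)"
    "\<And>n. f n = mmul (length (fst (tt s' t' d') (n - 1))) (snd (tt s' t' d') (n - 1)) (h n)
           + mmul (length (fst (tt s t d) (n + 1))) (h (n + 1)) (snd (tt s t d) n)"
    unfolding null_homotopic_alt by blast
  have "hm t s' (h 0)" using h(1)[of 0] by (simp add: fst_tt)
  moreover have "f n = mp (mmul (length t) (h 0) d) (mmul (length s') d' (h 0)) n" for n
    unfolding h(2)[of n] by (auto simp: mp_def fst_tt snd_tt)
  ultimately show "\<exists>h. hm t s' h \<and> f = mp (mmul (length t) h d) (mmul (length s') d' h)" by blast
next
  assume "\<exists>h. hm t s' h \<and> f = mp (mmul (length t) h d) (mmul (length s') d' h)"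
  then obtain h where "hm t s' h" "f = mp (mmul (length t) h d) (mmul (length s') d' h)" by blast
  then show "nh (tt s t d) (tt s' t' d') f"
    unfolding null_homotopic_alt
    by (intro exI[of _ "\<lambda>n. if n = 0 then h else 0"]) (auto simp: mp_def fst_tt snd_tt)
qed

text \<open>The elementary form of \<open>Hom(T, T'[1]) = 0\<close>: such maps are arbitrary
  matrices from degree -1 of \<open>T\<close> to degree 0 of \<open>T'\<close>, and a homotopy
  contributes one composite with each of the two differentials.\<close>

definition cmp :: "bool list \<Rightarrow> bool list \<Rightarrow> 'a mat \<Rightarrow> bool list \<Rightarrow> bool list \<Rightarrow> 'a mat \<Rightarrow> bool" where
  "cmp s t d s' t' d' \<longleftrightarrow> (\<forall>f. hm s t' f \<longrightarrow> (\<exists>p q. hm t t' p \<and> hm s s' q \<and>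
     f = mmul (length t) p d + mmul (length s') d' q))"

lemma fst_shift: "fst (shift C) n = fst C (n + 1)" and snd_shift: "snd (shift C) n = - snd C (n + 1)"
  by (simp_all add: shift_def fun_Compl_def)

lemma hv_shift_tt_iff: "hv (tt s t d) (shift (tt s' t' d')) \<longleftrightarrow> cmp s t d s' t' d'"
proof
  assume hv: "hv (tt s t d) (shift (tt s' t' d'))"
  show "cmp s t d s' t' d'"
    unfolding cmp_def
  proof (intro allI impI)
    fix f assume f: "hm s t' f"
    have "cm (tt s t d) (shift (tt s' t' d')) (mp f 0)"
      unfolding chain_map_alt fst_shift snd_shift using f by (auto simp: mp_def fst_tt snd_tt)
    then have "nh (tt s t d) (shift (tt s' t' d')) (mp f 0)" using hv by (simp add: hv_def)
    then obtain h where h: "\<And>n. hm (fst (tt s t d) n) (fst (tt s' t' d') (n - 1 + 1)) (h n)"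
      "\<And>n. mp f 0 n = mmul (length (fst (tt s' t' d') (n - 1 + 1))) (- snd (tt s' t' d') (n - 1 + 1)) (h n)
           + mmul (length (fst (tt s t d) (n + 1))) (h (n + 1)) (snd (tt s t d) n)"
      unfolding null_homotopic_alt fst_shift snd_shift by blast
    have "hm t t' (h 0)" "hm s s' (- h (-1))" using h(1)[of 0] h(1)[of "-1"] by (simp_all add: fst_tt hm_uminus)
    moreover have "f = mmul (length t) (h 0) d + mmul (length s') d' (- h (-1))"
      using h(2)[of "-1"] by (simp add: mp_def fst_tt snd_tt mmul_uminus)
    ultimately show "\<exists>p q. hm t t' p \<and> hm s s' q \<and> f = mmul (length t) p d + mmul (length s') d' q" by blast
  qed
next
  assume c: "cmp s t d s' t' d'"
  show "hv (tt s t d) (shift (tt s' t' d'))"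
    unfolding hv_def
  proof (intro allI impI)
    fix f assume f: "cm (tt s t d) (shift (tt s' t' d')) f"
    have z: "f n = 0" if "n \<noteq> -1" for n
      using cmD(1)[OF f, of n] that by (auto simp: fst_tt fst_shift hm_empty split: if_splits)
    have "hm s t' (f (-1))" using cmD(1)[OF f, of "-1"] by (simp add: fst_tt fst_shift)
    then obtain p q where pq: "hm t t' p" "hm s s' q" "f (-1) = mmul (length t) p d + mmul (length s') d' q"
      using c unfolding cmp_def by blast
    \<comment> \<open>The sign at \<open>q\<close> compensates the negated differential of
      \<open>shift\<close>.\<close>
    then show "nh (tt s t d) (shift (tt s' t' d')) f"
      unfolding null_homotopic_alt fst_shift snd_shift
      by (intro exI[of _ "mp (- q) p"]) (auto simp: mp_def fst_tt snd_tt z hm_uminus mmul_uminus add.commute)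
  qed
qed

lemma shift_pow: "fst ((shift ^^ l) C) n = fst C (n + int l)"
  by (induction l arbitrary: n) (simp_all add: fst_shift algebra_simps)

text \<open>A two-term complex and a shift of another one by at least two have no common nonzero
  degree, so the rigidity condition of \<open>silting\<close> concerns the first shift only.\<close>

lemma hv_shift_pow_tt: assumes "l \<ge> 2" shows "hv (tt s t d) ((shift ^^ l) (tt s' t' d'))"
  unfolding hv_def
proof (intro allI impI)
  fix f assume f: "cm (tt s t d) ((shift ^^ l) (tt s' t' d')) f"
  have "f n = 0" for n
    using cmD(1)[OF f, of n] assms by (auto simp: fst_tt shift_pow hm_empty split: if_splits)
  then have "f = 0" by auto
  then show "nh (tt s t d) ((shift ^^ l) (tt s' t' d')) f" using nh_zero by simp
qed

lemma dsum_tt: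
  "dsum (tt s t d) (tt s' t' d') = tt (s @ s') (t @ t') (blk (length t) (length s) d (\<lambda>i j. 0) (\<lambda>i j. 0) d')"
  by (auto simp: dsum_def tt_def fun_eq_iff blk_def)

lemma shift_dsum: "shift (dsum C D) = dsum (shift C) (shift D)"
  by (auto simp: dsum_def shift_def fun_eq_iff blk_def)

lemma hv_dsum_left:
  assumes "cx C" "cx D"
  shows "hv (dsum C D) E \<longleftrightarrow> hv C E \<and> hv D E"
proof (intro iffI conjI)
  note m = dsum_maps[OF assms]
  show "hv C E" if h: "hv (dsum C D) E"
    unfolding hv_def
  proof (intro allI impI)
    fix f assume f: "cm C E f"
    have "nh (dsum C D) E (comp_map C f (pl C D))" using h cm_comp[OF m(1) f] by (simp add: hv_def)
    then have "nh C E (comp_map (dsum C D) (comp_map C f (pl C D)) (pl C D))" using m(2) by (rule nh_comp_right)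
    then show "nh C E f" using dsum_comps(1)[of C D] comp_idc(1)[OF f] by (simp add: comp_assoc[symmetric])
  qed
  show "hv D E" if h: "hv (dsum C D) E"
    unfolding hv_def
  proof (intro allI impI)
    fix f assume f: "cm D E f"
    have "nh (dsum C D) E (comp_map D f (pr C D))" using h cm_comp[OF m(3) f] by (simp add: hv_def)
    then have "nh D E (comp_map (dsum C D) (comp_map D f (pr C D)) (ir C D))" using m(4) by (rule nh_comp_right)
    then show "nh D E f" using dsum_comps(2)[of C D] comp_idc(1)[OF f] by (simp add: comp_assoc[symmetric])
  qed
  show "hv (dsum C D) E" if h: "hv C E \<and> hv D E"
    unfolding hv_def
  proof (intro allI impI)
    fix f assume f: "cm (dsum C D) E f"
    have "f = comp_map (dsum C D) f (comp_map C (pl C D) (pl C D) + comp_map D (ir C D) (pr C D))"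
      using comp_idc(1)[OF f] by (simp add: dsum_comps)
    also have "\<dots> = comp_map C (comp_map (dsum C D) f (pl C D)) (pl C D)
        + comp_map D (comp_map (dsum C D) f (ir C D)) (pr C D)"
      by (simp only: comp_add comp_assoc)
    finally have e: "f = \<dots>" .
    have "nh (dsum C D) E (comp_map C (comp_map (dsum C D) f (pl C D)) (pl C D))"
      using h cm_comp[OF m(2) f] m(1) nh_comp_right unfolding hv_def by blast
    moreover have "nh (dsum C D) E (comp_map D (comp_map (dsum C D) f (ir C D)) (pr C D))"
      using h cm_comp[OF m(4) f] m(3) nh_comp_right unfolding hv_def by blast
    ultimately show "nh (dsum C D) E f" using e nh_add by metis
  qed
qed

lemma hv_dsum_right:
  assumes "cx C" "cx D"
  shows "hv E (dsum C D) \<longleftrightarrow> hv E C \<and> hv E D"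
proof (intro iffI conjI)
  note m = dsum_maps[OF assms]
  show "hv E C" if h: "hv E (dsum C D)"
    unfolding hv_def
  proof (intro allI impI)
    fix f assume f: "cm E C f"
    have "nh E (dsum C D) (comp_map C (pl C D) f)" using h cm_comp[OF f m(2)] by (simp add: hv_def)
    then have "nh E C (comp_map (dsum C D) (pl C D) (comp_map C (pl C D) f))" using m(1) by (rule nh_comp_left)
    then show "nh E C f" using dsum_comps(1)[of C D] comp_idc(2)[OF f] by (simp add: comp_assoc)
  qed
  show "hv E D" if h: "hv E (dsum C D)"
    unfolding hv_def
  proof (intro allI impI)
    fix f assume f: "cm E D f"
    have "nh E (dsum C D) (comp_map D (ir C D) f)" using h cm_comp[OF f m(4)] by (simp add: hv_def)
    then have "nh E D (comp_map (dsum C D) (pr C D) (comp_map D (ir C D) f))" using m(3) by (rule nh_comp_left)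
    then show "nh E D f" using dsum_comps(2)[of C D] comp_idc(2)[OF f] by (simp add: comp_assoc)
  qed
  show "hv E (dsum C D)" if h: "hv E C \<and> hv E D"
    unfolding hv_def
  proof (intro allI impI)
    fix f assume f: "cm E (dsum C D) f"
    have "f = comp_map (dsum C D) (comp_map C (pl C D) (pl C D) + comp_map D (ir C D) (pr C D)) f"
      using comp_idc(2)[OF f] by (simp add: dsum_comps)
    also have "\<dots> = comp_map C (pl C D) (comp_map (dsum C D) (pl C D) f)
        + comp_map D (ir C D) (comp_map (dsum C D) (pr C D) f)"
      by (simp only: comp_add comp_assoc)
    finally have e: "f = \<dots>" .
    have "nh E (dsum C D) (comp_map C (pl C D) (comp_map (dsum C D) (pl C D) f))"
      using h cm_comp[OF f m(1)] m(2) nh_comp_left unfolding hv_def by blast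
    moreover have "nh E (dsum C D) (comp_map D (ir C D) (comp_map (dsum C D) (pr C D) f))"
      using h cm_comp[OF f m(3)] m(4) nh_comp_left unfolding hv_def by blast
    ultimately show "nh E (dsum C D) f" using e nh_add by metis
  qed
qed

lemma hv_shift_dsum_tt:
  assumes "hm s t d" "hm s' t' d'"
  shows "hv (dsum (tt s t d) (tt s' t' d')) (shift (dsum (tt s t d) (tt s' t' d'))) \<longleftrightarrow>
    cmp s t d s t d \<and> cmp s t d s' t' d' \<and> cmp s' t' d' s t d \<and> cmp s' t' d' s' t' d'"
  using cx_tt[OF assms(1)] cx_tt[OF assms(2)]
  by (auto simp: shift_dsum hv_dsum_left hv_dsum_right cx_shift hv_shift_tt_iff)

lemma indec_heq:
  assumes "indecomposable e1 e2 C" "heq C D" "cx D"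
  shows "indecomposable e1 e2 D"
proof -
  have "heq D X \<Longrightarrow> heq C X" for X using heq_trans[OF assms(2)] .
  then show ?thesis using assms unfolding indecomposable_def by blast
qed

end

section \<open>Objects \<open>P2^b -> P1^a\<close>, their morphisms and endomorphism rings\<close>

inductive_set acl :: "'v::ab_group_add set \<Rightarrow> 'v set" for G where
  zero: "0 \<in> acl G"
| add: "g \<in> G \<Longrightarrow> x \<in> acl G \<Longrightarrow> g + x \<in> acl G"

lemma acl_base: "g \<in> G \<Longrightarrow> g \<in> acl G"
  using acl.add[OF _ acl.zero] by fastforce

lemma acl_plus: "x \<in> acl G \<Longrightarrow> y \<in> acl G \<Longrightarrow> x + y \<in> acl G"
  by (induction x rule: acl.induct) (auto simp: add.assoc intro: acl.add)

lemma acl_map: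
  assumes "x \<in> acl G" "\<And>g. g \<in> G \<Longrightarrow> f g \<in> acl H" "f 0 = 0" "\<And>x y. f (x + y) = f x + f y"
  shows "f x \<in> acl H"
  using assms(1) by (induction rule: acl.induct) (auto simp: assms acl.zero acl_plus)

lemma acl_min:
  assumes "x \<in> acl G" "G \<subseteq> M" "0 \<in> M" "\<And>x y. x \<in> M \<Longrightarrow> y \<in> M \<Longrightarrow> x + y \<in> M"
  shows "x \<in> M"
  using assms(1) by (induction rule: acl.induct) (use assms in auto)

text \<open>\<open>(a, b, d)\<close> stands for the two-term complex \<open>d : P2^b \<rightarrow> P1^a\<close>, whose class is \<open>a [P1] - b [P2]\<close>.\<close>

type_synonym 'a ob = "nat \<times> nat \<times> 'a mat"

definition na :: "'a ob \<Rightarrow> nat" where "na T = fst T"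
definition nb :: "'a ob \<Rightarrow> nat" where "nb T = fst (snd T)"
definition df :: "'a ob \<Rightarrow> 'a mat" where "df T = snd (snd T)"
definition sl :: "'a ob \<Rightarrow> bool list" where "sl T = replicate (nb T) False"
definition tl :: "'a ob \<Rightarrow> bool list" where "tl T = replicate (na T) True"

lemma length_sl [simp]: "length (sl T) = nb T" "length (tl T) = na T"
  by (simp_all add: sl_def tl_def)

text \<open>A row vector times a matrix. A row over a corner is a morphism from a power of one
  projective to another, and \<open>rm\<close> precomposes it with the matrix.\<close>

definition rm :: "nat \<Rightarrow> (nat \<Rightarrow> 'a::ring_1) \<Rightarrow> 'a mat \<Rightarrow> nat \<Rightarrow> 'a" where
  "rm n r M = (\<lambda>j. \<Sum>k<n. r k * M k j)"

lemma mmul_row: "mmul n A M i = rm n (A i) M"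
  by (simp add: mmul_def rm_def)

lemma rm_assoc: "rm n (rm m r A) B = rm m r (mmul n A B)"
  using mmul_assoc[of n m "\<lambda>_. r" A B] mmul_row[of n "mmul m (\<lambda>_. r) A" B 0]
    mmul_row[of m "\<lambda>_. r" A 0] mmul_row[of m "\<lambda>_. r" "mmul n A B" 0] by simp

lemma rm_add: "rm n (r + r') M = rm n r M + rm n r' M" "rm n r (M + M') = rm n r M + rm n r M'"
  by (simp_all add: rm_def fun_eq_iff algebra_simps sum.distrib)

lemma rm_diff: "rm n (r - r') M = rm n r M - rm n r' M" "rm n r (M - M') = rm n r M - rm n r M'"
  by (simp_all add: rm_def fun_eq_iff algebra_simps sum_subtractf)

lemma rm_zero [simp]: "rm n 0 M = 0" "rm n r 0 = 0"
  by (simp_all add: rm_def fun_eq_iff)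

lemma rm_sum: "rm n r M = (\<Sum>k<n. (\<lambda>j. r k * M k j))"
  by (rule ext) (induction n, simp_all add: rm_def)

lemma (in vspace) findim_zero: "findim {0}"
  unfolding findim_def by (intro exI[of _ "{}"]) simp

lemma vspace_prod:
  assumes "vspace s" "vspace t"
  shows "vspace (\<lambda>c (x::'v::ab_group_add \<times> 'w::ab_group_add). (s c (fst x), t c (snd x)))"
  using assms prod_scale_vector_space unfolding vspace_def by blast

context alg_pair
begin

sublocale r: vspace_fun sc ..
abbreviation "sv \<equiv> \<lambda>c (f::nat \<Rightarrow> 'a) i. sc c (f i)"
sublocale m: vspace_fun sv
  unfolding vspace_fun_def by (rule r.fs.vspace_axioms)
abbreviation "sm \<equiv> \<lambda>c (f::nat \<Rightarrow> nat \<Rightarrow> 'a) i. sv c (f i)"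
sublocale mm: vspace_pair sm sm ..

abbreviation "FF \<equiv> Co False False"
abbreviation "XX \<equiv> Co True False"
abbreviation "EE \<equiv> Co True True"

lemma Co_subspace: "subspace (Co b c)"
  unfolding subspace_def by (simp add: Co_add Co_scale)

lemma Co_findim: "findim (Co b c)"
  using findim_UNIV by (rule findim_subset) simp

lemma pow_Co: "r.fs.subspace (pow_set (Co b c) n)" "r.fs.findim (pow_set (Co b c) n)"
  using r.subspace_pow[OF Co_subspace] r.findim_pow[OF Co_findim] by auto

lemma hm_pow: "hm (replicate b x) (replicate c y) M \<longleftrightarrow> M \<in> pow_set (pow_set (Co y x) b) c"
  unfolding hm_iff pow_set_def by (auto simp: fun_eq_iff)

lemma rm_mem:
  assumes "r \<in> pow_set (Co x y) m" "hm (replicate n z) (replicate m y) A"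
  shows "rm m r A \<in> pow_set (Co x z) n"
proof -
  have "rm m r A j \<in> Co x z" if "j < n" for j
    unfolding rm_def using assms hmD[OF assms(2)] that
    by (intro Co_sum Co_mult[of _ _ y]) (auto simp: pow_set_def)
  moreover have "rm m r A j = 0" if "\<not> j < n" for j
    unfolding rm_def using hmD0[OF assms(2)] that by simp
  ultimately show ?thesis by (simp add: pow_set_def)
qed

definition ok :: "'a ob \<Rightarrow> bool" where "ok T \<longleftrightarrow> hm (sl T) (tl T) (df T)"
text \<open>\<open>cmpo T U\<close> says that every map from \<open>T\<close> to the shift of \<open>U\<close> is null-homotopic.\<close>

definition cmpo :: "'a ob \<Rightarrow> 'a ob \<Rightarrow> bool" where
  "cmpo T U \<longleftrightarrow> cmp (sl T) (tl T) (df T) (sl U) (tl U) (df U)"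
text \<open>Strict chain maps, not homotopy classes, so that dimensions of honest matrix spaces can
  be compared. Null-homotopic endomorphisms have entries in \<open>Jac\<close> and are radical when
  the endomorphism ring is local; this is why isomorphism and indecomposability can be tested on
  strict maps.\<close>

definition mor :: "'a ob \<Rightarrow> 'a ob \<Rightarrow> ('a mat \<times> 'a mat) set" where
  "mor T U = {(q, p). hm (sl T) (sl U) q \<and> hm (tl T) (tl U) p \<and> mmul (nb U) (df U) q = mmul (na T) p (df T)}"
definition mulp :: "'a ob \<Rightarrow> 'a mat \<times> 'a mat \<Rightarrow> 'a mat \<times> 'a mat \<Rightarrow> 'a mat \<times> 'a mat" where
  "mulp U g f = (mmul (nb U) (fst g) (fst f), mmul (na U) (snd g) (snd f))"
definition one :: "'a ob \<Rightarrow> 'a mat \<times> 'a mat" where "one T = (idm (sl T), idm (tl T))"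

lemma mor_iff: "f \<in> mor T U \<longleftrightarrow> hm (sl T) (sl U) (fst f) \<and> hm (tl T) (tl U) (snd f) \<and>
    mmul (nb U) (df U) (fst f) = mmul (na T) (snd f) (df T)"
  by (cases f) (simp add: mor_def)

lemma mor_comp: "f \<in> mor T U \<Longrightarrow> g \<in> mor U S \<Longrightarrow> mulp U g f \<in> mor T S"
  unfolding mor_iff mulp_def
  by (auto intro!: hm_mmul simp: mmul_assoc[symmetric]) (metis mmul_assoc)

lemma mulp_assoc: "mulp T (mulp U h g) f = mulp U h (mulp T g f)"
  by (simp add: mulp_def mmul_assoc)

lemma one_mor: "ok T \<Longrightarrow> one T \<in> mor T T"
  unfolding mor_iff one_def ok_def by (simp add: mmul_idm_left mmul_idm_right)

lemma mulp_one: "f \<in> mor T U \<Longrightarrow> mulp T f (one T) = f" "f \<in> mor T U \<Longrightarrow> mulp U (one U) f = f"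
  unfolding mor_iff mulp_def one_def by (auto simp: mmul_idm_left mmul_idm_right prod_eq_iff)

lemma mor_add: "f \<in> mor T U \<Longrightarrow> g \<in> mor T U \<Longrightarrow> f + g \<in> mor T U"
  unfolding mor_iff by (simp add: hm_add mmul_add)
lemma mor_uminus: "f \<in> mor T U \<Longrightarrow> - f \<in> mor T U"
  unfolding mor_iff by (simp add: hm_uminus mmul_uminus)
lemma mor_zero: "0 \<in> mor T U" unfolding mor_iff by simp

lemma ring_on_mor: assumes "ok T" shows "ring_on (mor T T) (mulp T) (one T)"
proof
  show "mulp T x (y + z) = mulp T x y + mulp T x z" "mulp T (x + y) z = mulp T x z + mulp T y z" for x y z
    by (simp_all add: mulp_def mmul_add)
qed (use assms in \<open>auto simp: mor_add mor_uminus mor_zero one_mor mor_comp mulp_assoc mulp_one\<close>)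

lemma mmul_scale: "mmul n (sm c A) B = sm c (mmul n A B)" "mmul n A (sm c B) = sm c (mmul n A B)"
  by (auto simp: mmul_def fun_eq_iff scale_sum_right sc_mult)
    (simp_all add: sc_mult(2)[symmetric] sc_mult(1)[symmetric])

lemma rm_scale: "rm n (sv c r) B = sv c (rm n r B)" "rm n r (sm c B) = sv c (rm n r B)"
  by (auto simp: rm_def fun_eq_iff scale_sum_right sc_mult)
    (simp_all add: sc_mult(2)[symmetric] sc_mult(1)[symmetric])

lemma hm_scale: "hm s t A \<Longrightarrow> hm s t (sm c A)"
  by (simp add: hm_iff Co_scale)

abbreviation "sp \<equiv> \<lambda>c (x::'a mat \<times> 'a mat). (sm c (fst x), sm c (snd x))"

lemma mor_scale: "f \<in> mor T U \<Longrightarrow> sp c f \<in> mor T U"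
  unfolding mor_iff using hm_scale mmul_scale by simp

lemma algebra_on_mor: assumes "ok T" shows "algebra_on sp (mor T T) (mulp T) (one T)"
proof -
  interpret P: vspace sp by (rule vspace_prod) unfold_locales
  interpret R: ring_on "mor T T" "mulp T" "one T" by (rule ring_on_mor) fact
  have f1: "m.fs.findim {q. hm (sl T) (sl T) q}" "m.fs.findim {p. hm (tl T) (tl T) p}"
    unfolding sl_def tl_def hm_pow using m.findim_pow[OF pow_Co(2)] by auto
  obtain A B where A: "finite A" "{q. hm (sl T) (sl T) q} \<subseteq> m.fs.span A"
    and B: "finite B" "{p. hm (tl T) (tl T) p} \<subseteq> m.fs.span B"
    using f1 unfolding m.fs.findim_def by auto
  let ?C = "(\<lambda>a. (a, 0)) ` A \<union> (\<lambda>b. (0, b)) ` B"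
  have a: "(q, 0) \<in> P.span ?C" if "q \<in> m.fs.span A" for q
    using that
  proof (induction rule: m.fs.span_induct_alt)
    case base show ?case unfolding zero_prod_def[symmetric] by (rule P.span_zero)
  next
    case (step c x y)
    have eq: "(sm c x + y, 0) = sp c (x, 0) + (y, 0)" by (simp add: fun_eq_iff)
    show ?case unfolding eq
      by (rule P.span_add[OF P.span_scale[OF P.span_base] step(2)]) (use step(1) in blast)
  qed
  have b: "(0, q) \<in> P.span ?C" if "q \<in> m.fs.span B" for q
    using that
  proof (induction rule: m.fs.span_induct_alt)
    case base show ?case unfolding zero_prod_def[symmetric] by (rule P.span_zero)
  next
    case (step c x y)
    have eq: "(0, sm c x + y) = sp c (0, x) + (0, y)" by (simp add: fun_eq_iff)
    show ?case unfolding eq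
      by (rule P.span_add[OF P.span_scale[OF P.span_base] step(2)]) (use step(1) in blast)
  qed
  show ?thesis
  proof
    have "f \<in> P.span ?C" if "f \<in> mor T T" for f
    proof -
      have "fst f \<in> m.fs.span A" "snd f \<in> m.fs.span B" using A B that by (auto simp: mor_iff)
      then have "(fst f, 0) + (0, snd f) \<in> P.span ?C" using a b by (intro P.span_add) auto
      then show ?thesis by simp
    qed
    then show "P.findim (mor T T)" unfolding P.findim_def using A B by (intro exI[of _ ?C]) auto
    show "mulp T x (sp c y) = sp c (mulp T x y)" "mulp T (sp c x) y = sp c (mulp T x y)" for x y c
      unfolding mulp_def fst_conv snd_conv mmul_scale by simp_all
  qed (rule mor_scale)
qed

definition loc :: "'a ob \<Rightarrow> bool" where "loc T \<longleftrightarrow> ok T \<and> local_on (mor T T) (mulp T) (one T)"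
definition rad :: "'a ob \<Rightarrow> ('a mat \<times> 'a mat) set" where
  "rad T = ring_on.nonunits (mor T T) (mulp T) (one T)"
definition unt :: "'a ob \<Rightarrow> 'a mat \<times> 'a mat \<Rightarrow> bool" where
  "unt T f \<longleftrightarrow> f \<in> mor T T \<and> (\<exists>g\<in>mor T T. mulp T f g = one T \<and> mulp T g f = one T)"
definition iso :: "'a ob \<Rightarrow> 'a ob \<Rightarrow> bool" where
  "iso T U \<longleftrightarrow> (\<exists>f\<in>mor T U. \<exists>g\<in>mor U T. mulp U g f = one T \<and> mulp T f g = one U)"

lemma locD:
  assumes "loc T"
  shows "ok T" "f \<in> mor T T \<Longrightarrow> f \<notin> rad T \<Longrightarrow> unt T f" "f \<in> rad T \<Longrightarrow> f \<in> mor T T \<and> \<not> unt T f"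
    "f \<in> rad T \<Longrightarrow> g \<in> rad T \<Longrightarrow> f + g \<in> rad T" "f \<in> rad T \<Longrightarrow> - f \<in> rad T" "0 \<in> rad T"
    "f \<in> rad T \<Longrightarrow> g \<in> mor T T \<Longrightarrow> mulp T f g \<in> rad T" "f \<in> rad T \<Longrightarrow> g \<in> mor T T \<Longrightarrow> mulp T g f \<in> rad T"
    "f \<in> rad T \<Longrightarrow> unt T (one T - f)" "one T \<noteq> 0"
    "f \<in> mor T T \<Longrightarrow> mulp T f f = f \<Longrightarrow> f = 0 \<or> f = one T"
    "unt T f \<Longrightarrow> g \<in> rad T \<Longrightarrow> unt T (f + g)"
proof -
  interpret local_on "mor T T" "mulp T" "one T" using assms by (simp add: loc_def)
  have u: "unt T f = inv_el f" for f by (simp add: unt_def inv_el_def)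
  have n: "f \<in> rad T \<longleftrightarrow> f \<in> mor T T \<and> \<not> unt T f" for f by (simp add: rad_def nonunits_def u)
  have nn: "rad T = nonunits" by (simp add: rad_def)
  show "ok T" using assms by (simp add: loc_def)
  show "f \<in> mor T T \<Longrightarrow> f \<notin> rad T \<Longrightarrow> unt T f" "f \<in> rad T \<Longrightarrow> f \<in> mor T T \<and> \<not> unt T f" using n by blast+
  show "f \<in> rad T \<Longrightarrow> g \<in> rad T \<Longrightarrow> f + g \<in> rad T" unfolding nn by (rule nonunits_add)
  show "f \<in> rad T \<Longrightarrow> - f \<in> rad T" unfolding nn by (rule nonunits_uminus)
  show "0 \<in> rad T" unfolding nn by (rule zero_nonunits)
  show "f \<in> rad T \<Longrightarrow> g \<in> mor T T \<Longrightarrow> mulp T f g \<in> rad T" "f \<in> rad T \<Longrightarrow> g \<in> mor T T \<Longrightarrow> mulp T g f \<in> rad T"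
    using nonunits_mul n unfolding nn by blast+
  show "f \<in> rad T \<Longrightarrow> unt T (one T - f)" unfolding nn u by (rule inv_el_u_minus)
  show "one T \<noteq> 0" by (rule one_neq_zero)
  show "f \<in> mor T T \<Longrightarrow> mulp T f f = f \<Longrightarrow> f = 0 \<or> f = one T" by (rule idem_trivial)
  show "unt T f \<Longrightarrow> g \<in> rad T \<Longrightarrow> unt T (f + g)" unfolding nn u by (rule inv_el_add_nonunit)
qed

lemma locI:
  assumes "ok T" "one T \<noteq> 0" "\<And>f. f \<in> mor T T \<Longrightarrow> mulp T f f = f \<Longrightarrow> f = 0 \<or> f = one T"
  shows "loc T"
  unfolding loc_def using algebra_on.local_onI[OF algebra_on_mor[OF assms(1)] assms(3,2)] assms(1) by blast

text \<open>\<open>f\<close> becomes a split monomorphism with left inverse \<open>g'\<close>, and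
  the idempotent \<open>f g'\<close> of \<open>U\<close> is trivial by locality. It is not
  \<open>0\<close>, since \<open>one T = g' (f g') f\<close> is nonzero.\<close>

lemma unt_comp_iso:
  assumes T: "loc T" and U: "loc U" and f: "f \<in> mor T U" and g: "g \<in> mor U T" and u: "unt T (mulp U g f)"
  shows "iso T U"
proof -
  obtain h where h: "h \<in> mor T T" "mulp T (mulp U g f) h = one T" "mulp T h (mulp U g f) = one T"
    using u by (auto simp: unt_def)
  define g' where "g' = mulp T h g"
  have g': "g' \<in> mor U T" "mulp U g' f = one T" using mor_comp[OF g h(1)] h(3) by (auto simp: g'_def mulp_assoc)
  let ?e = "mulp T f g'"
  have e: "?e \<in> mor U U" using mor_comp[OF g'(1) f] .
  have "mulp U ?e ?e = mulp T f (mulp T (mulp U g' f) g')" by (simp add: mulp_assoc)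
  also have "\<dots> = ?e" using g' mulp_one(2)[OF g'(1)] by simp
  finally consider "?e = 0" | "?e = one U" using locD(11)[OF U e] by blast
  then show ?thesis
  proof cases
    case 1
    have "one T = mulp T (one T) (one T)" using mulp_one(1)[OF one_mor[OF locD(1)[OF T]]] by simp
    also have "\<dots> = mulp U g' (mulp U ?e f)"
      unfolding g'(2)[symmetric] by (simp only: mulp_assoc)
    also have "\<dots> = 0" using 1 by (simp add: mulp_def zero_prod_def)
    finally show ?thesis using locD(10)[OF T] by simp
  next
    case 2
    then show ?thesis using f g' unfolding iso_def by blast
  qed
qed

subsection \<open>The torsion argument\<close>

text \<open>Applying \<open>Hom(_, P2)\<close> and \<open>Hom(_, P1)\<close> to the source of \<open>T\<close> gives \<open>rows\<close> and \<open>xrows\<close>; \<open>VG R\<close> and \<open>WG T R\<close> are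
  the parts coming from the morphisms in \<open>R\<close>, with codimensions \<open>cV\<close> and \<open>cW\<close>. The linear form
  \<open>\<theta>(a, b) = a * cW - b * cV\<close> is nonnegative on targets of \<open>R\<close> and negative on a rigid \<open>T\<close> not generated by
  \<open>R\<close>. Hence \<open>T\<close> cannot lie in the cone of a compatible pair unless it is generated by that pair.\<close>

definition rows :: "nat \<Rightarrow> (nat \<Rightarrow> 'a) set" where "rows b = pow_set FF b"
definition xrows :: "nat \<Rightarrow> (nat \<Rightarrow> 'a) set" where "xrows b = pow_set XX b"
definition erows :: "nat \<Rightarrow> (nat \<Rightarrow> 'a) set" where "erows b = pow_set EE b"

type_synonym (in -) 'b gens = "('b ob \<times> 'b mat \<times> 'b mat) set"

definition VG :: "'a gens \<Rightarrow> (nat \<Rightarrow> 'a) set" where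
  "VG R = acl {rm (nb U) r (fst f) |U f r. (U, f) \<in> R \<and> r \<in> rows (nb U)}"
text \<open>Modulo the rows through \<open>df T\<close>, the space \<open>xrows\<close> is
  \<open>Hom(T, P1[1])\<close>; \<open>WG\<close> is the preimage of the part of it that is
  generated by \<open>R\<close>.\<close>

definition WG :: "'a ob \<Rightarrow> 'a gens \<Rightarrow> (nat \<Rightarrow> 'a) set" where
  "WG T R = acl ({rm (nb U) x (fst f) |U f x. (U, f) \<in> R \<and> x \<in> xrows (nb U)}
     \<union> {rm (na T) r (df T) |r. r \<in> erows (na T)})"
definition gens_ok :: "'a ob \<Rightarrow> 'a gens \<Rightarrow> bool" where
  "gens_ok T R \<longleftrightarrow> ok T \<and> (\<forall>(U, f)\<in>R. f \<in> mor T U)"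

lemma rows_space: "r.fs.subspace (rows b)" "r.fs.findim (rows b)" "r.fs.subspace (xrows b)" "r.fs.findim (xrows b)"
  unfolding rows_def xrows_def using pow_Co by auto

text \<open>\<open>acl\<close> forms finite sums without coefficients; scalars are absorbed by the
  generators.\<close>

lemma acl_subspace:
  assumes "\<And>g c. g \<in> G \<Longrightarrow> sv c g \<in> G" shows "r.fs.subspace (acl G)"
  unfolding r.fs.subspace_def
proof (intro conjI ballI allI)
  show "sv c x \<in> acl G" if "x \<in> acl G" for x c
    by (rule acl_map[OF that]) (auto simp: acl_base assms fun_eq_iff scale_right_distrib)
qed (auto intro: acl.zero acl_plus)

lemma VG_subset: assumes "gens_ok T R" shows "VG R \<subseteq> rows (nb T)"
proof
  fix x assume x: "x \<in> VG R"
  show "x \<in> rows (nb T)"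
    using x[unfolded VG_def]
  proof (rule acl_min)
    show "{rm (nb U) r (fst f) |U f r. (U, f) \<in> R \<and> r \<in> rows (nb U)} \<subseteq> rows (nb T)"
      using assms unfolding gens_ok_def rows_def by (auto intro!: rm_mem simp: mor_iff sl_def)
  qed (use rows_space(1)[of "nb T"] in \<open>auto simp: r.fs.subspace_def\<close>)
qed

lemma WG_subset: assumes "gens_ok T R" shows "WG T R \<subseteq> xrows (nb T)"
proof
  fix x assume x: "x \<in> WG T R"
  show "x \<in> xrows (nb T)"
    using x[unfolded WG_def]
  proof (rule acl_min)
    show "{rm (nb U) x (fst f) |U f x. (U, f) \<in> R \<and> x \<in> xrows (nb U)}
     \<union> {rm (na T) r (df T) |r. r \<in> erows (na T)} \<subseteq> xrows (nb T)"
      using assms unfolding gens_ok_def xrows_def erows_def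
      by (auto intro!: rm_mem simp: mor_iff sl_def tl_def ok_def)
  qed (use rows_space(3)[of "nb T"] in \<open>auto simp: r.fs.subspace_def\<close>)
qed

lemma VG_subspace: "r.fs.subspace (VG R)" and WG_subspace: "r.fs.subspace (WG T R)"
proof -
  have s: "sv c r \<in> pow_set (Co b d) n" if "r \<in> pow_set (Co b d) n" for r c b d n
    using that pow_Co(1)[of b d n] by (simp add: r.fs.subspace_def)
  show "r.fs.subspace (VG R)" unfolding VG_def
  proof (rule acl_subspace)
    fix g c assume "g \<in> {rm (nb U) x (fst f) |U f x. (U, f) \<in> R \<and> x \<in> rows (nb U)}"
    then obtain U f x where "(U, f) \<in> R" "x \<in> rows (nb U)" "g = rm (nb U) x (fst f)" by blast
    then have "sv c g = rm (nb U) (sv c x) (fst f)" "sv c x \<in> rows (nb U)" "(U, f) \<in> R"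
      using rm_scale(1) s by (auto simp: rows_def)
    then show "sv c g \<in> {rm (nb U) x (fst f) |U f x. (U, f) \<in> R \<and> x \<in> rows (nb U)}" by blast
  qed
  show "r.fs.subspace (WG T R)" unfolding WG_def
  proof (rule acl_subspace, elim UnE)
    fix g c assume "g \<in> {rm (nb U) x (fst f) |U f x. (U, f) \<in> R \<and> x \<in> xrows (nb U)}"
    then obtain U f x where "(U, f) \<in> R" "x \<in> xrows (nb U)" "g = rm (nb U) x (fst f)" by blast
    then have "sv c g = rm (nb U) (sv c x) (fst f)" "sv c x \<in> xrows (nb U)" "(U, f) \<in> R"
      using rm_scale(1) s by (auto simp: xrows_def)
    then show "sv c g \<in> {rm (nb U) x (fst f) |U f x. (U, f) \<in> R \<and> x \<in> xrows (nb U)}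
     \<union> {rm (na T) r (df T) |r. r \<in> erows (na T)}" by blast
  next
    fix g c assume "g \<in> {rm (na T) r (df T) |r. r \<in> erows (na T)}"
    then obtain x where "x \<in> erows (na T)" "g = rm (na T) x (df T)" by blast
    then have "sv c g = rm (na T) (sv c x) (df T)" "sv c x \<in> erows (na T)"
      using rm_scale(1) s by (auto simp: erows_def)
    then show "sv c g \<in> {rm (nb U) x (fst f) |U f x. (U, f) \<in> R \<and> x \<in> xrows (nb U)}
     \<union> {rm (na T) r (df T) |r. r \<in> erows (na T)}" by blast
  qed
qed

lemma lmul_VG: "c \<in> FF \<Longrightarrow> v \<in> VG R \<Longrightarrow> (\<lambda>j. c * v j) \<in> VG R"
  and lmul_VG_WG: "x \<in> XX \<Longrightarrow> v \<in> VG R \<Longrightarrow> (\<lambda>j. x * v j) \<in> WG T R"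
proof -
  have e: "(\<lambda>j. c * rm n r A j) = rm n (\<lambda>k. c * r k) A" for c n r A
    by (simp add: rm_def fun_eq_iff sum_distrib_left mult.assoc)
  have p: "(\<lambda>k. c * r k) \<in> pow_set (Co x z) n" if "c \<in> Co x y" "r \<in> pow_set (Co y z) n" for c x y z r n
    using that by (auto simp: pow_set_def Co_mult)
  show "(\<lambda>j. c * v j) \<in> VG R" if "c \<in> FF" "v \<in> VG R"
    unfolding VG_def
    by (rule acl_map[OF that(2)[unfolded VG_def], of "\<lambda>v j. c * v j"])
      (use that(1) p e in \<open>fastforce simp: rows_def fun_eq_iff distrib_left intro!: acl_base\<close>)+
  show "(\<lambda>j. x * v j) \<in> WG T R" if "x \<in> XX" "v \<in> VG R"
    unfolding WG_def
    by (rule acl_map[OF that(2)[unfolded VG_def], of "\<lambda>v j. x * v j"])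
      (use that(1) p e in \<open>fastforce simp: rows_def xrows_def fun_eq_iff distrib_left intro!: acl_base\<close>)+
qed

lemma rm_VG:
  assumes "r \<in> rows n" "q \<in> pow_set (VG R) n" shows "rm n r q \<in> VG R"
proof -
  have "(\<Sum>k<n. (\<lambda>j. r k * q k j)) \<in> VG R"
    by (intro r.fs.subspace_sum[OF VG_subspace] lmul_VG) (use assms in \<open>auto simp: rows_def pow_set_def\<close>)
  then show ?thesis by (simp add: rm_sum)
qed

lemma rm_VG_WG:
  assumes "r \<in> xrows n" "q \<in> pow_set (VG R) n" shows "rm n r q \<in> WG T R"
proof -
  have "(\<Sum>k<n. (\<lambda>j. r k * q k j)) \<in> WG T R"
    by (intro r.fs.subspace_sum[OF WG_subspace] lmul_VG_WG) (use assms in \<open>auto simp: xrows_def pow_set_def\<close>)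
  then show ?thesis by (simp add: rm_sum)
qed

lemma rm_df_WG: "r \<in> erows (na T) \<Longrightarrow> rm (na T) r (df T) \<in> WG T R"
  unfolding WG_def by (rule acl_base) blast

definition cV :: "'a ob \<Rightarrow> 'a gens \<Rightarrow> int" where "cV T R = int (r.fs.dim (rows (nb T))) - int (r.fs.dim (VG R))"
definition cW :: "'a ob \<Rightarrow> 'a gens \<Rightarrow> int" where "cW T R = int (r.fs.dim (xrows (nb T))) - int (r.fs.dim (WG T R))"
text \<open>The kernel of composition with \<open>df S\<close>, taken modulo \<open>WG\<close>. It
  contains the source components of all chain maps from \<open>T\<close> to \<open>S\<close> as well
  as all matrices over \<open>VG\<close>, and the argument measures by how much it exceeds the
  latter.\<close>

definition KG :: "'a ob \<Rightarrow> 'a gens \<Rightarrow> 'a ob \<Rightarrow> 'a mat set" where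
  "KG T R S = {q \<in> pow_set (rows (nb T)) (nb S). mmul (nb S) (df S) q \<in> pow_set (WG T R) (na S)}"

lemma linear_mmul: "Vector_Spaces.linear sm sm (mmul n D)"
  by unfold_locales (auto simp: mmul_add mmul_scale)

lemma linear_rm: "Vector_Spaces.linear sm sv (rm n v)"
  by unfold_locales (auto simp: rm_add rm_scale)

lemma mats_rows: "hm (sl T) (sl S) q \<longleftrightarrow> q \<in> pow_set (rows (nb T)) (nb S)"
  "hm (sl T) (tl S) x \<longleftrightarrow> x \<in> pow_set (xrows (nb T)) (na S)"
  "hm (tl T) (tl S) p \<longleftrightarrow> p \<in> pow_set (erows (na T)) (na S)"
  by (simp_all add: sl_def tl_def hm_pow rows_def xrows_def erows_def)

lemma pow_mem: "M \<in> pow_set V n \<Longrightarrow> i < n \<Longrightarrow> M i \<in> V" and pow_mem0: "M \<in> pow_set V n \<Longrightarrow> \<not> i < n \<Longrightarrow> M i = 0"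
  by (metis (mono_tags, lifting) mem_Collect_eq pow_set_def)+

lemma powI: "(\<And>i. i < n \<Longrightarrow> M i \<in> V) \<Longrightarrow> (\<And>i. \<not> i < n \<Longrightarrow> M i = 0) \<Longrightarrow> M \<in> pow_set V n"
  by (simp add: pow_set_def)

text \<open>This is rank-nullity for \<open>q \<mapsto> df S q\<close> modulo the power of
  \<open>WG\<close>. The image always lies among the matrices over \<open>xrows\<close>, which gives
  the inequality. Under \<open>cmpo T S\<close> every such matrix is \<open>df S q\<close> plus rows
  through \<open>df T\<close>, and these rows are in \<open>WG\<close>, which gives
  equality.\<close>

lemma KG_dim:
  assumes R: "gens_ok T R" and S: "ok S"
  shows "int (nb S) * cV T R - int (na S) * cW T R \<le> int (m.fs.dim (KG T R S)) - int (nb S) * int (r.fs.dim (VG R))"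
    and "cmpo T S \<Longrightarrow>
      int (nb S) * cV T R - int (na S) * cW T R = int (m.fs.dim (KG T R S)) - int (nb S) * int (r.fs.dim (VG R))"
    and "pow_set (VG R) (nb S) \<subseteq> KG T R S"
    and "m.fs.subspace (KG T R S)" "m.fs.findim (KG T R S)"
proof -
  let ?A = "pow_set (rows (nb T)) (nb S)" and ?W = "pow_set (WG T R) (na S)" and ?B = "pow_set (xrows (nb T)) (na S)"
  let ?I = "{mmul (nb S) (df S) q + w |q w. q \<in> ?A \<and> w \<in> ?W}"
  have A: "m.fs.subspace ?A" "m.fs.findim ?A" "m.fs.dim ?A = nb S * r.fs.dim (rows (nb T))"
    using rows_space m.subspace_pow m.findim_pow m.dim_pow by auto
  have B: "m.fs.subspace ?B" "m.fs.findim ?B" "m.fs.dim ?B = na S * r.fs.dim (xrows (nb T))"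
    using rows_space m.subspace_pow m.findim_pow m.dim_pow by auto
  have fW: "r.fs.findim (WG T R)" using rows_space(4) WG_subset[OF R] r.fs.findim_subset by blast
  have W: "m.fs.subspace ?W" "m.fs.findim ?W" "m.fs.dim ?W = na S * r.fs.dim (WG T R)"
    using WG_subspace fW m.subspace_pow m.findim_pow m.dim_pow by auto
  have WB: "?W \<subseteq> ?B" using WG_subset[OF R] by (auto simp: pow_set_def)
  have AB: "mmul (nb S) (df S) q \<in> ?B" if "q \<in> ?A" for q
    using that S unfolding mats_rows[symmetric] ok_def by (intro hm_mmul) auto
  have IB: "?I \<subseteq> ?B" using AB WB B(1) by (auto simp: m.fs.subspace_def)
  have Isub: "m.fs.subspace ?I"
  proof -
    have "m.fs.subspace (mmul (nb S) (df S) ` ?A)"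
      by (rule mm.linear_subspace_image[OF linear_mmul A(1)])
    then have "m.fs.subspace {x + y |x y. x \<in> mmul (nb S) (df S) ` ?A \<and> y \<in> ?W}"
      using W(1) by (rule m.fs.subspace_sums)
    moreover have "{x + y |x y. x \<in> mmul (nb S) (df S) ` ?A \<and> y \<in> ?W} = ?I" by blast
    ultimately show ?thesis by simp
  qed
  have rn: "m.fs.dim ?A + m.fs.dim ?W = m.fs.dim (KG T R S) + m.fs.dim ?I"
    unfolding KG_def by (rule mm.rank_nullity_mod[OF linear_mmul A(1,2) W(1,2)])
  have dI: "m.fs.dim ?I \<le> m.fs.dim ?B" by (rule m.fs.dim_mono_findim(1)[OF B(2) IB Isub B(1)])
  have rn': "int (nb S) * int (r.fs.dim (rows (nb T))) + int (na S) * int (r.fs.dim (WG T R))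
     = int (m.fs.dim (KG T R S)) + int (m.fs.dim ?I)"
    using rn unfolding A(3) W(3) by (simp only: of_nat_mult[symmetric] of_nat_add[symmetric] of_nat_eq_iff)
  have dI': "int (m.fs.dim ?I) \<le> int (na S) * int (r.fs.dim (xrows (nb T)))"
    using dI unfolding B(3) by (simp only: of_nat_mult[symmetric] of_nat_le_iff)
  show "int (nb S) * cV T R - int (na S) * cW T R \<le> int (m.fs.dim (KG T R S)) - int (nb S) * int (r.fs.dim (VG R))"
    unfolding cV_def cW_def right_diff_distrib using rn' dI' by linarith
  show "int (nb S) * cV T R - int (na S) * cW T R = int (m.fs.dim (KG T R S)) - int (nb S) * int (r.fs.dim (VG R))"
    if c: "cmpo T S"
  proof -
    have "?B \<subseteq> ?I"
    proof
      fix x assume "x \<in> ?B"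
      then have "hm (sl T) (tl S) x" unfolding mats_rows .
      then obtain p q where pq: "hm (tl T) (tl S) p" "hm (sl T) (sl S) q"
        "x = mmul (na T) p (df T) + mmul (nb S) (df S) q"
        using c unfolding cmpo_def cmp_def length_sl by blast
      have "mmul (na T) p (df T) \<in> ?W"
      proof (rule powI)
        fix i assume "i < na S"
        then have "p i \<in> erows (na T)" using pq(1) unfolding mats_rows by (rule pow_mem[rotated])
        then show "mmul (na T) p (df T) i \<in> WG T R" unfolding mmul_row by (rule rm_df_WG)
      next
        fix i assume "\<not> i < na S"
        then have "p i = 0" using pq(1) unfolding mats_rows by (rule pow_mem0[rotated])
        then show "mmul (na T) p (df T) i = 0" unfolding mmul_row by simp
      qed
      moreover have "q \<in> ?A" using pq(2) unfolding mats_rows .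
      moreover have "x = mmul (nb S) (df S) q + mmul (na T) p (df T)" using pq(3) by (simp add: add.commute)
      ultimately show "x \<in> ?I" by blast
    qed
    then have "?I = ?B" using IB by blast
    then have "int (m.fs.dim ?I) = int (na S) * int (r.fs.dim (xrows (nb T)))"
      using B(3) by (simp only: of_nat_mult[symmetric])
    then show ?thesis
      unfolding cV_def cW_def right_diff_distrib using rn' by linarith
  qed
  show "pow_set (VG R) (nb S) \<subseteq> KG T R S"
  proof
    fix q assume q: "q \<in> pow_set (VG R) (nb S)"
    then have qA: "q \<in> ?A" using VG_subset[OF R] by (auto simp: pow_set_def)
    have dS: "df S \<in> pow_set (xrows (nb S)) (na S)" using S unfolding ok_def mats_rows .
    have "mmul (nb S) (df S) q \<in> ?W"
    proof (rule powI)
      fix i assume i: "i < na S"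
      have "df S i \<in> xrows (nb S)" by (rule pow_mem[OF dS i])
      then show "mmul (nb S) (df S) q i \<in> WG T R" unfolding mmul_row using q by (rule rm_VG_WG)
    next
      fix i assume i: "\<not> i < na S"
      have "df S i = 0" by (rule pow_mem0[OF dS i])
      then show "mmul (nb S) (df S) q i = 0" unfolding mmul_row by simp
    qed
    then show "q \<in> KG T R S" using qA by (simp add: KG_def)
  qed
  show "m.fs.subspace (KG T R S)"
  proof -
    have "KG T R S = ?A \<inter> (mmul (nb S) (df S) -` ?W)" by (auto simp: KG_def)
    moreover have "m.fs.subspace (mmul (nb S) (df S) -` ?W)"
      by (rule mm.linear_subspace_vimage[OF linear_mmul W(1)])
    ultimately show ?thesis using m.fs.subspace_inter[OF A(1)] by simp
  qed
  show "m.fs.findim (KG T R S)" using A(2) by (rule m.fs.findim_subset) (auto simp: KG_def)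
qed

sublocale rr: vspace_pair sv sv ..

definition Rf :: "'a ob set \<Rightarrow> 'a ob \<Rightarrow> 'a gens" where
  "Rf A T = {(S, f). S \<in> A \<and> f \<in> mor T S}"

lemma rm_idm: "v \<in> pow_set (Co z False) (nb T) \<Longrightarrow> rm (nb T) v (idm (sl T)) = v"
  "v \<in> erows (na T) \<Longrightarrow> rm (na T) v (idm (tl T)) = v"
proof -
  show "rm (nb T) v (idm (sl T)) = v" if v: "v \<in> pow_set (Co z False) (nb T)"
  proof -
    have "hm (sl T) (replicate 1 z) (\<lambda>i. if i = 0 then v else 0)"
      unfolding sl_def hm_pow using v by (auto simp: pow_set_def)
    then have "mmul (nb T) (\<lambda>i. if i = 0 then v else 0) (idm (sl T)) 0 = v"
      using mmul_idm_right[of "sl T" "replicate 1 z"] by simp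
    then show ?thesis unfolding mmul_row by simp
  qed
  show "rm (na T) v (idm (tl T)) = v" if v: "v \<in> erows (na T)"
  proof -
    have "hm (tl T) (replicate 1 True) (\<lambda>i. if i = 0 then v else 0)"
      unfolding tl_def hm_pow using v by (auto simp: pow_set_def erows_def)
    then have "mmul (na T) (\<lambda>i. if i = 0 then v else 0) (idm (tl T)) 0 = v"
      using mmul_idm_right[of "tl T" "replicate 1 True"] by simp
    then show ?thesis unfolding mmul_row by simp
  qed
qed

lemma VG_base: "(U, f) \<in> R \<Longrightarrow> r \<in> rows (nb U) \<Longrightarrow> rm (nb U) r (fst f) \<in> VG R"
  unfolding VG_def by (rule acl_base) blast

lemma WG_base: "(U, f) \<in> R \<Longrightarrow> r \<in> xrows (nb U) \<Longrightarrow> rm (nb U) r (fst f) \<in> WG T R"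
  unfolding WG_def by (rule acl_base) blast

lemma rows_mat: "hm (sl T) (sl S) q \<Longrightarrow> i < nb S \<Longrightarrow> q i \<in> rows (nb T)"
  unfolding mats_rows by (rule pow_mem)

lemma mor_mats: "f \<in> mor T S \<Longrightarrow> hm (sl T) (sl S) (fst f)" "f \<in> mor T S \<Longrightarrow> hm (tl T) (tl S) (snd f)"
  "f \<in> mor T S \<Longrightarrow> mmul (nb S) (df S) (fst f) = mmul (na T) (snd f) (df T)"
  by (simp_all add: mor_iff)

lemma rm_mor: "f \<in> mor T S \<Longrightarrow> r \<in> rows (nb S) \<Longrightarrow> rm (nb S) r (fst f) \<in> rows (nb T)"
  using mor_mats(1)[of f T S] unfolding rows_def sl_def by (rule rm_mem[rotated])

lemma mor_rows:
  assumes "(S, f) \<in> R" "f \<in> mor T S"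
  shows "fst f \<in> pow_set (VG R) (nb S)"
proof (rule powI)
  note h = mor_mats(1)[OF assms(2)]
  fix i assume i: "i < nb S"
  have "fst f i = mmul (nb S) (idm (sl S)) (fst f) i" using mmul_idm_left[OF h] by simp
  also have "\<dots> = rm (nb S) (idm (sl S) i) (fst f)" by (rule mmul_row)
  also have "\<dots> \<in> VG R" by (rule VG_base[OF assms(1) rows_mat[OF hm_idm i]])
  finally show "fst f i \<in> VG R" .
next
  fix i assume "\<not> i < nb S"
  then show "fst f i = 0" using mor_mats(1)[OF assms(2)] unfolding mats_rows by (rule pow_mem0[rotated])
qed

definition sg :: "nat \<Rightarrow> (nat \<Rightarrow> 'a) \<Rightarrow> 'a mat" where "sg i v = (\<lambda>k. if k = i then v else 0)"

lemma sg_simps: "sg i (x + y) = sg i x + sg i y" "sg i 0 = 0" "mmul n (sg i x) A = sg i (rm n x A)"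
proof -
  show "mmul n (sg i x) A = sg i (rm n x A)" by (rule ext) (simp add: mmul_row sg_def)
qed (auto simp: sg_def fun_eq_iff)

lemma sg_pow: "v \<in> V \<Longrightarrow> i < n \<Longrightarrow> 0 \<in> V \<Longrightarrow> sg i v \<in> pow_set V n"
  by (simp add: pow_set_def sg_def)

lemma sg_sum: "w \<in> pow_set V n \<Longrightarrow> w = (\<Sum>i<n. sg i (w i))"
proof (rule ext)
  fix k assume w: "w \<in> pow_set V n"
  have "(\<Sum>i<n. sg i (w i)) k = (\<Sum>i<n. sg i (w i) k)" by (induction n) auto
  also have "\<dots> = (\<Sum>i<n. if i = k then w i else 0)" by (rule sum.cong) (auto simp: sg_def)
  also have "\<dots> = w k" using pow_mem0[OF w, of k] by simp
  finally show "w k = (\<Sum>i<n. sg i (w i)) k" by simp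
qed

definition good :: "'a ob \<Rightarrow> 'a gens \<Rightarrow> 'a ob \<Rightarrow> 'a mat \<Rightarrow> bool" where
  "good T R S w \<longleftrightarrow> (\<exists>s\<in>pow_set (VG R) (nb S). \<exists>p. hm (tl T) (tl S) p \<and>
      w = mmul (nb S) (df S) s + mmul (na T) p (df T))"

lemma good_add: assumes "good T R S w" "good T R S w'" shows "good T R S (w + w')"
proof -
  obtain s p s' p' where *: "s \<in> pow_set (VG R) (nb S)" "hm (tl T) (tl S) p"
    "w = mmul (nb S) (df S) s + mmul (na T) p (df T)"
    "s' \<in> pow_set (VG R) (nb S)" "hm (tl T) (tl S) p'"
    "w' = mmul (nb S) (df S) s' + mmul (na T) p' (df T)"
    using assms unfolding good_def by blast
  have "w + w' = mmul (nb S) (df S) (s + s') + mmul (na T) (p + p') (df T)"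
    unfolding * mmul_add by (simp add: algebra_simps)
  moreover have "s + s' \<in> pow_set (VG R) (nb S)"
    by (rule m.fs.subspace_add[OF m.subspace_pow[OF VG_subspace]]) fact+
  ultimately show ?thesis unfolding good_def using hm_add[OF *(2,5)] by blast
qed

lemma good_zero: "good T R S 0"
  unfolding good_def
  by (intro bexI[of _ 0] exI[of _ 0]) (use m.fs.subspace_0[OF m.subspace_pow[OF VG_subspace]] in auto)

lemma good_sum: "(\<And>i. i \<in> A \<Longrightarrow> good T R S (f i)) \<Longrightarrow> good T R S (sum f A)"
  by (induction A rule: infinite_finite_induct) (simp_all add: good_zero good_add)

text \<open>For a row \<open>x f\<close> with \<open>f : T -> U\<close>, compatibility of
  \<open>U\<close> with \<open>S\<close> decomposes \<open>x\<close> into a part through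
  \<open>df U\<close> and a part through \<open>df S\<close>. As \<open>f\<close> is a chain map,
  the first part becomes a multiple of \<open>df T\<close>, and the second has its rows in
  \<open>VG\<close>. Rows through \<open>df T\<close> are good with \<open>s = 0\<close>.\<close>

lemma good_WG:
  assumes R: "gens_ok T R" and S: "ok S" and c: "\<forall>(U, f)\<in>R. cmpo U S"
    and v: "v \<in> WG T R" and i: "i < na S"
  shows "good T R S (sg i v)"
proof -
  have "v \<in> {v. good T R S (sg i v)}"
    using v[unfolded WG_def]
  proof (rule acl_min)
    show "{rm (nb U) x (fst f) |U f x. (U, f) \<in> R \<and> x \<in> xrows (nb U)}
     \<union> {rm (na T) r (df T) |r. r \<in> erows (na T)} \<subseteq> {v. good T R S (sg i v)}"
    proof (intro subsetI CollectI, elim UnE)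
      fix v assume "v \<in> {rm (nb U) x (fst f) |U f x. (U, f) \<in> R \<and> x \<in> xrows (nb U)}"
      then obtain U f x where ufx: "(U, f) \<in> R" "x \<in> xrows (nb U)" "v = rm (nb U) x (fst f)" by blast
      have f: "f \<in> mor T U" using R ufx(1) unfolding gens_ok_def by blast
      have "hm (sl U) (tl S) (sg i x)"
        unfolding mats_rows by (rule sg_pow) (use ufx(2) i r.fs.subspace_0[OF rows_space(3)] in simp_all)
      then obtain p s where ps: "hm (tl U) (tl S) p" "hm (sl U) (sl S) s"
        "sg i x = mmul (na U) p (df U) + mmul (nb S) (df S) s"
        using c ufx(1) unfolding cmpo_def cmp_def length_sl by blast
      have "sg i v = mmul (nb U) (sg i x) (fst f)" unfolding ufx sg_simps ..
      also have "\<dots> = mmul (na U) p (mmul (nb U) (df U) (fst f)) + mmul (nb S) (df S) (mmul (nb U) s (fst f))"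
        unfolding ps(3) mmul_add mmul_assoc ..
      also have "\<dots> = mmul (nb S) (df S) (mmul (nb U) s (fst f)) + mmul (na T) (mmul (na U) p (snd f)) (df T)"
        unfolding mor_mats(3)[OF f] mmul_assoc by (rule add.commute)
      finally have e: "sg i v = \<dots>" .
      have "mmul (nb U) s (fst f) \<in> pow_set (VG R) (nb S)"
      proof (rule powI)
        fix k assume "k < nb S"
        then show "mmul (nb U) s (fst f) k \<in> VG R"
          unfolding mmul_row by (rule VG_base[OF ufx(1) rows_mat[OF ps(2)]])
      next
        fix k assume "\<not> k < nb S"
        then have "s k = 0" using ps(2) unfolding mats_rows by (rule pow_mem0[rotated])
        then show "mmul (nb U) s (fst f) k = 0" unfolding mmul_row by simp
      qed
      moreover have "hm (tl T) (tl S) (mmul (na U) p (snd f))"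
        using ps(1) mor_mats(2)[OF f] by (rule hm_mmul) simp
      ultimately show "good T R S (sg i v)" unfolding good_def using e by blast
    next
      fix v assume "v \<in> {rm (na T) r (df T) |r. r \<in> erows (na T)}"
      then obtain r where r: "r \<in> erows (na T)" "v = rm (na T) r (df T)" by blast
      have "hm (tl T) (tl S) (sg i r)"
        unfolding mats_rows by (rule sg_pow) (use r i r.fs.subspace_0[OF pow_Co(1)] in \<open>simp_all add: erows_def\<close>)
      moreover have "sg i v = mmul (nb S) (df S) 0 + mmul (na T) (sg i r) (df T)"
        unfolding r sg_simps by simp
      moreover have "0 \<in> pow_set (VG R) (nb S)" by (rule m.fs.subspace_0[OF m.subspace_pow[OF VG_subspace]])
      ultimately show "good T R S (sg i v)" unfolding good_def by blast
    qed
  qed (simp_all add: sg_simps good_zero good_add)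
  then show ?thesis by simp
qed

text \<open>Correcting \<open>q\<close> by a matrix over \<open>VG\<close> makes
  \<open>df S q\<close> factor through \<open>df T\<close>, and such a factorization is exactly the
  target component of a chain map.\<close>

lemma KG_lift:
  assumes R: "gens_ok T R" and S: "ok S" and c: "\<forall>(U, f)\<in>R. cmpo U S"
    and q: "q \<in> KG T R S"
  obtains f where "f \<in> mor T S" "q - fst f \<in> pow_set (VG R) (nb S)"
proof -
  let ?w = "mmul (nb S) (df S) q"
  have w: "?w \<in> pow_set (WG T R) (na S)" and qm: "hm (sl T) (sl S) q"
    using q unfolding KG_def mats_rows by auto
  have "good T R S (\<Sum>i<na S. sg i (?w i))"
    by (rule good_sum, rule good_WG[OF R S c pow_mem[OF w]]) auto
  then have "good T R S ?w" using sg_sum[OF w] by simp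
  then obtain s p where sp: "s \<in> pow_set (VG R) (nb S)" "hm (tl T) (tl S) p"
    "?w = mmul (nb S) (df S) s + mmul (na T) p (df T)" unfolding good_def by blast
  have "hm (sl T) (sl S) s" unfolding mats_rows using sp(1) VG_subset[OF R] by (auto simp: pow_set_def)
  then have "(q - s, p) \<in> mor T S"
    unfolding mor_iff using sp qm by (simp add: hm_diff mmul_diff)
  moreover have "q - fst (q - s, p) \<in> pow_set (VG R) (nb S)" using sp(1) by simp
  ultimately show ?thesis using that by blast
qed

lemma mor_KG: assumes "gens_ok T R" "f \<in> mor T S" shows "fst f \<in> KG T R S"
proof -
  have "mmul (nb S) (df S) (fst f) \<in> pow_set (WG T R) (na S)"
    unfolding mor_mats(3)[OF assms(2)]
  proof (rule powI)
    have p: "snd f \<in> pow_set (erows (na T)) (na S)" using mor_mats(2)[OF assms(2)] unfolding mats_rows .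
    show "mmul (na T) (snd f) (df T) i \<in> WG T R" if "i < na S" for i
      unfolding mmul_row by (rule rm_df_WG[OF pow_mem[OF p that]])
    show "mmul (na T) (snd f) (df T) i = 0" if "\<not> i < na S" for i
      unfolding mmul_row pow_mem0[OF p that] by simp
  qed
  then show ?thesis using mor_mats(1)[OF assms(2)] unfolding KG_def mats_rows by simp
qed

lemma VG_findim: "gens_ok T R \<Longrightarrow> r.fs.findim (VG R)"
  using rows_space(2) VG_subset r.fs.findim_subset by blast

lemma dim_pow_VG: "gens_ok T R \<Longrightarrow> m.fs.dim (pow_set (VG R) n) = n * r.fs.dim (VG R)"
  by (rule m.dim_pow[OF VG_subspace VG_findim])

lemma KG_eq_VG:
  assumes R: "gens_ok T R" and S: "ok S" and c: "\<forall>(U, f)\<in>R. cmpo U S"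
    and all: "\<forall>f\<in>mor T S. (S, f) \<in> R"
  shows "KG T R S = pow_set (VG R) (nb S)"
proof
  show "KG T R S \<subseteq> pow_set (VG R) (nb S)"
  proof
    fix q assume "q \<in> KG T R S"
    then obtain f where f: "f \<in> mor T S" "q - fst f \<in> pow_set (VG R) (nb S)" using KG_lift[OF R S c] by blast
    have "q - fst f + fst f \<in> pow_set (VG R) (nb S)"
      by (rule m.fs.subspace_add[OF m.subspace_pow[OF VG_subspace] f(2) mor_rows[OF bspec[OF all f(1)] f(1)]])
    then show "q \<in> pow_set (VG R) (nb S)" by simp
  qed
qed (rule KG_dim(3)[OF R S])

text \<open>When all morphisms to \<open>S\<close> belong to \<open>R\<close>, the chain maps
  produced by \<open>KG_lift\<close> have rows in \<open>VG\<close> as well, so the right side of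
  the inequality in \<open>KG_dim\<close> vanishes.\<close>

lemma theta_le:
  assumes R: "gens_ok T R" and S: "ok S" and c: "\<forall>(U, f)\<in>R. cmpo U S"
    and all: "\<forall>f\<in>mor T S. (S, f) \<in> R"
  shows "int (nb S) * cV T R \<le> int (na S) * cW T R"
  using KG_dim(1)[OF R S] unfolding KG_eq_VG[OF assms] dim_pow_VG[OF R] by simp

lemma theta_ge:
  assumes R: "gens_ok T R" and S: "ok S" and c: "cmpo T S"
  shows "int (na S) * cW T R \<le> int (nb S) * cV T R"
proof -
  have "m.fs.dim (pow_set (VG R) (nb S)) \<le> m.fs.dim (KG T R S)"
    by (rule m.fs.dim_mono_findim(1)[OF KG_dim(5)[OF R S] KG_dim(3)[OF R S] m.subspace_pow[OF VG_subspace] KG_dim(4)[OF R S]])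
  then have "int (nb S) * int (r.fs.dim (VG R)) \<le> int (m.fs.dim (KG T R S))"
    unfolding dim_pow_VG[OF R] by (simp only: of_nat_mult[symmetric] of_nat_le_iff)
  then show ?thesis using KG_dim(2)[OF R S c] by linarith
qed

text \<open>Equality would force \<open>KG T R T\<close> to consist of the matrices over
  \<open>VG\<close>. The identity of \<open>T\<close> is one of its elements, so \<open>VG\<close>
  would contain all rows.\<close>

lemma theta_pos:
  assumes R: "gens_ok T R" and c: "cmpo T T" and n: "VG R \<noteq> rows (nb T)"
  shows "int (na T) * cW T R < int (nb T) * cV T R"
proof -
  have T: "ok T" using R by (simp add: gens_ok_def)
  have "int (na T) * cW T R \<noteq> int (nb T) * cV T R"
  proof
    assume "int (na T) * cW T R = int (nb T) * cV T R"
    then have "int (m.fs.dim (KG T R T)) = int (nb T) * int (r.fs.dim (VG R))"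
      using KG_dim(2)[OF R T c] by linarith
    then have "m.fs.dim (pow_set (VG R) (nb T)) = m.fs.dim (KG T R T)"
      unfolding dim_pow_VG[OF R] by (simp only: of_nat_mult[symmetric] of_nat_eq_iff)
    then have "pow_set (VG R) (nb T) = KG T R T"
      by (rule m.fs.dim_mono_findim(2)[OF KG_dim(5)[OF R T] KG_dim(3)[OF R T] m.subspace_pow[OF VG_subspace] KG_dim(4)[OF R T]])
    then have i: "idm (sl T) \<in> pow_set (VG R) (nb T)"
      using mor_KG[OF R one_mor[OF T]] by (simp add: one_def)
    have "rows (nb T) \<subseteq> VG R"
    proof
      fix v assume v: "v \<in> rows (nb T)"
      then have "rm (nb T) v (idm (sl T)) \<in> VG R" using i by (rule rm_VG)
      then show "v \<in> VG R" using rm_idm(1) v unfolding rows_def by metis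
    qed
    then show False using n VG_subset[OF R] by blast
  qed
  then show ?thesis using theta_ge[OF R T c] by linarith
qed

lemma gens_ok_Rf: "ok T \<Longrightarrow> gens_ok T (Rf A T)"
  unfolding gens_ok_def Rf_def by auto

text \<open>The form is built from all morphisms of \<open>U\<close> to the pair; \<open>k\<close>
  clears denominators in the relation that places the class of \<open>U\<close> in the cone.\<close>

lemma rigid_generated_by_pair:
  assumes ok: "ok U" "ok T1" "ok T2"
    and c: "cmpo T1 T1" "cmpo T1 T2" "cmpo T2 T1" "cmpo T2 T2" "cmpo U U"
    and w: "k > 0" "k * na U = \<alpha> * na T1 + \<beta> * na T2" "k * nb U = \<alpha> * nb T1 + \<beta> * nb T2"
  shows "VG (Rf {T1, T2} U) = rows (nb U)"
proof (rule ccontr)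
  let ?R = "Rf {T1, T2} U"
  assume n: "VG ?R \<noteq> rows (nb U)"
  note R = gens_ok_Rf[OF ok(1), of "{T1, T2}"]
  have 0: "int (na U) * cW U ?R < int (nb U) * cV U ?R" by (rule theta_pos[OF R c(5) n])
  have 1: "int (nb T1) * cV U ?R \<le> int (na T1) * cW U ?R" "int (nb T2) * cV U ?R \<le> int (na T2) * cW U ?R"
    by (rule theta_le[OF R]; use ok c in \<open>auto simp: Rf_def\<close>)+
  have wi: "int k * int (na U) = int \<alpha> * int (na T1) + int \<beta> * int (na T2)"
    "int k * int (nb U) = int \<alpha> * int (nb T1) + int \<beta> * int (nb T2)"
    using w(2,3) by (simp_all only: of_nat_mult[symmetric] of_nat_add[symmetric])
  have "int k * (int (na U) * cW U ?R) < int k * (int (nb U) * cV U ?R)" using 0 w(1) by simp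
  moreover have "int k * (int (nb U) * cV U ?R) = int \<alpha> * (int (nb T1) * cV U ?R) + int \<beta> * (int (nb T2) * cV U ?R)"
    unfolding mult.assoc[symmetric] wi by (simp add: distrib_right)
  moreover have "int k * (int (na U) * cW U ?R) = int \<alpha> * (int (na T1) * cW U ?R) + int \<beta> * (int (na T2) * cW U ?R)"
    unfolding mult.assoc[symmetric] wi by (simp add: distrib_right)
  moreover have "int \<alpha> * (int (nb T1) * cV U ?R) \<le> int \<alpha> * (int (na T1) * cW U ?R)"
    "int \<beta> * (int (nb T2) * cV U ?R) \<le> int \<beta> * (int (na T2) * cW U ?R)"
    using 1 by (simp_all add: mult_left_mono)
  ultimately show False by linarith
qed

text \<open>Here the form is built from all morphisms of \<open>T1\<close> to \<open>U\<close>. It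
  is nonnegative at \<open>U\<close>, negative at \<open>T1\<close>, and by compatibility
  nonpositive at \<open>T2\<close>, which contradicts the cone relation because
  \<open>\<alpha> > 0\<close>.\<close>

lemma pair_generated_by_rigid:
  assumes ok: "ok U" "ok T1" "ok T2"
    and c: "cmpo T1 T1" "cmpo T1 T2" "cmpo U U"
    and w: "\<alpha> > 0" "k * na U = \<alpha> * na T1 + \<beta> * na T2" "k * nb U = \<alpha> * nb T1 + \<beta> * nb T2"
  shows "VG (Rf {U} T1) = rows (nb T1)"
proof (rule ccontr)
  let ?R = "Rf {U} T1"
  assume n: "VG ?R \<noteq> rows (nb T1)"
  note R = gens_ok_Rf[OF ok(2), of "{U}"]
  have 0: "int (na T1) * cW T1 ?R < int (nb T1) * cV T1 ?R" by (rule theta_pos[OF R c(1) n])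
  have 1: "int (nb U) * cV T1 ?R \<le> int (na U) * cW T1 ?R"
    by (rule theta_le[OF R]) (use ok c in \<open>auto simp: Rf_def\<close>)
  have 2: "int (na T2) * cW T1 ?R \<le> int (nb T2) * cV T1 ?R" by (rule theta_ge[OF R ok(3) c(2)])
  have wi: "int k * int (na U) = int \<alpha> * int (na T1) + int \<beta> * int (na T2)"
    "int k * int (nb U) = int \<alpha> * int (nb T1) + int \<beta> * int (nb T2)"
    using w(2,3) by (simp_all only: of_nat_mult[symmetric] of_nat_add[symmetric])
  have "int k * (int (nb U) * cV T1 ?R) \<le> int k * (int (na U) * cW T1 ?R)" using 1 by (simp add: mult_left_mono)
  moreover have "int k * (int (nb U) * cV T1 ?R) = int \<alpha> * (int (nb T1) * cV T1 ?R) + int \<beta> * (int (nb T2) * cV T1 ?R)"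
    unfolding mult.assoc[symmetric] wi by (simp add: distrib_right)
  moreover have "int k * (int (na U) * cW T1 ?R) = int \<alpha> * (int (na T1) * cW T1 ?R) + int \<beta> * (int (na T2) * cW T1 ?R)"
    unfolding mult.assoc[symmetric] wi by (simp add: distrib_right)
  moreover have "int \<alpha> * (int (na T1) * cW T1 ?R) < int \<alpha> * (int (nb T1) * cV T1 ?R)" using 0 w(1) by simp
  moreover have "int \<beta> * (int (na T2) * cW T1 ?R) \<le> int \<beta> * (int (nb T2) * cV T1 ?R)" using 2 by (simp add: mult_left_mono)
  ultimately show False by linarith
qed

subsection \<open>Nakayama's lemma for the radical of a local endomorphism ring\<close>

definition stable :: "'a ob \<Rightarrow> (nat \<Rightarrow> 'a) set \<Rightarrow> bool" where
  "stable T M \<longleftrightarrow> (\<forall>v\<in>M. \<forall>f\<in>mor T T. rm (nb T) v (fst f) \<in> M)"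

lemma add_orbit:
  assumes M: "r.fs.subspace M" "stable T M" and T: "ok T"
  shows "r.fs.subspace {rm (nb T) g q + x |q x. q \<in> fst ` mor T T \<and> x \<in> M}"
    and "stable T {rm (nb T) g q + x |q x. q \<in> fst ` mor T T \<and> x \<in> M}"
    and "M \<subseteq> {rm (nb T) g q + x |q x. q \<in> fst ` mor T T \<and> x \<in> M}"
proof -
  let ?N = "{rm (nb T) g q + x |q x. q \<in> fst ` mor T T \<and> x \<in> M}"
  have I: "rm (nb T) g (fst f) + x \<in> ?N" if "f \<in> mor T T" "x \<in> M" for f x using that by blast
  have E: "\<exists>f x. y = rm (nb T) g (fst f) + x \<and> f \<in> mor T T \<and> x \<in> M" if "y \<in> ?N" for y
    using that by blast
  have z: "fst (0::'a mat \<times> 'a mat) = 0" by simp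
  show sub: "M \<subseteq> ?N"
  proof
    fix x assume "x \<in> M"
    then show "x \<in> ?N" using I[OF mor_zero, of x] by simp
  qed
  show "r.fs.subspace ?N"
    unfolding r.fs.subspace_def
  proof (intro conjI ballI allI)
    show "0 \<in> ?N" using sub r.fs.subspace_0[OF M(1)] by blast
    show "y + y' \<in> ?N" if yy: "y \<in> ?N" "y' \<in> ?N" for y y'
    proof -
      obtain f x f' x' where *: "y = rm (nb T) g (fst f) + x" "f \<in> mor T T" "x \<in> M"
        "y' = rm (nb T) g (fst f') + x'" "f' \<in> mor T T" "x' \<in> M" using E[OF yy(1)] E[OF yy(2)] by blast
      have "y + y' = rm (nb T) g (fst (f + f')) + (x + x')" unfolding * by (simp add: rm_add algebra_simps)
      then show ?thesis using I[OF mor_add[OF *(2,5)] r.fs.subspace_add[OF M(1) *(3,6)]] by simp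
    qed
    show "sv c y \<in> ?N" if y: "y \<in> ?N" for c y
    proof -
      obtain f x where *: "y = rm (nb T) g (fst f) + x" "f \<in> mor T T" "x \<in> M" using E[OF y] by blast
      have "sv c y = rm (nb T) g (fst (sp c f)) + sv c x"
        unfolding * fst_conv rm_scale by (simp add: fun_eq_iff scale_right_distrib)
      then show ?thesis using I[OF mor_scale[OF *(2)] r.fs.subspace_scale[OF M(1) *(3)]] by simp
    qed
  qed
  show "stable T ?N"
    unfolding stable_def
  proof (intro ballI)
    fix y h assume y: "y \<in> ?N" and h: "h \<in> mor T T"
    obtain f x where *: "y = rm (nb T) g (fst f) + x" "f \<in> mor T T" "x \<in> M" using E[OF y] by blast
    have e: "rm (nb T) y (fst h) = rm (nb T) g (fst (mulp T f h)) + rm (nb T) x (fst h)"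
      unfolding * rm_add rm_assoc mulp_def by simp
    have "rm (nb T) x (fst h) \<in> M" using M(2) *(3) h unfolding stable_def by blast
    then show "rm (nb T) y (fst h) \<in> ?N"
      unfolding e by (rule I[OF mor_comp[OF h *(2)]])
  qed
qed

text \<open>The rows form a right module over the endomorphism ring. Let \<open>M\<close> be a
  proper submodule above \<open>Z\<close> of largest dimension. A product \<open>v f\<close> outside
  \<open>M\<close> with \<open>f\<close> radical gives \<open>v = v f h + x\<close> with
  \<open>x \<in> M\<close>, and inverting \<open>1 - f h\<close> puts \<open>v\<close> into
  \<open>M\<close>.\<close>

lemma nakayama:
  assumes T: "loc T" and Z: "Z \<subseteq> rows (nb T)" "r.fs.subspace Z" "stable T Z"
    and gen: "rows (nb T) \<subseteq> acl (Z \<union> {rm (nb T) v (fst f) |v f. v \<in> rows (nb T) \<and> f \<in> rad T})"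
  shows "Z = rows (nb T)"
proof (rule ccontr)
  assume nZ: "Z \<noteq> rows (nb T)"
  note okT = locD(1)[OF T]
  define P where "P M \<longleftrightarrow> Z \<subseteq> M \<and> M \<subseteq> rows (nb T) \<and> M \<noteq> rows (nb T) \<and> r.fs.subspace M \<and> stable T M" for M
  have bound: "r.fs.dim M \<le> r.fs.dim (rows (nb T))" if "P M" for M
    using that r.fs.dim_mono_findim(1)[OF rows_space(2) _ _ rows_space(1)] by (simp add: P_def)
  have "P Z" using Z nZ by (simp add: P_def)
  then have "\<exists>M. P M \<and> (\<forall>N. P N \<longrightarrow> r.fs.dim N \<le> r.fs.dim M)"
    by (rule ex_has_greatest_nat[where b = "Suc (r.fs.dim (rows (nb T)))"]) (simp add: bound less_Suc_eq_le)
  then obtain M where M0: "P M \<and> (\<forall>N. P N \<longrightarrow> r.fs.dim N \<le> r.fs.dim M)" ..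
  have M: "P M" "\<And>N. P N \<Longrightarrow> r.fs.dim N \<le> r.fs.dim M" using M0 by simp_all
  have Ms: "r.fs.subspace M" "stable T M" "M \<subseteq> rows (nb T)" "Z \<subseteq> M" "M \<noteq> rows (nb T)" using M(1) by (auto simp: P_def)
  have "\<exists>v f. v \<in> rows (nb T) \<and> f \<in> rad T \<and> rm (nb T) v (fst f) \<notin> M"
  proof (rule ccontr)
    assume "\<nexists>v f. v \<in> rows (nb T) \<and> f \<in> rad T \<and> rm (nb T) v (fst f) \<notin> M"
    then have G: "Z \<union> {rm (nb T) v (fst f) |v f. v \<in> rows (nb T) \<and> f \<in> rad T} \<subseteq> M" using Ms(4) by blast
    have "rows (nb T) \<subseteq> M"
    proof
      fix x assume "x \<in> rows (nb T)"
      then have "x \<in> acl (Z \<union> {rm (nb T) v (fst f) |v f. v \<in> rows (nb T) \<and> f \<in> rad T})" using gen by blast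
      then show "x \<in> M" by (rule acl_min[OF _ G r.fs.subspace_0[OF Ms(1)] r.fs.subspace_add[OF Ms(1)]])
    qed
    then show False using Ms by blast
  qed
  then obtain v f where vf: "v \<in> rows (nb T)" "f \<in> rad T" "rm (nb T) v (fst f) \<notin> M" by blast
  have f: "f \<in> mor T T" using locD(3)[OF T vf(2)] by blast
  let ?g = "rm (nb T) v (fst f)"
  let ?N = "{rm (nb T) ?g q + x |q x. q \<in> fst ` mor T T \<and> x \<in> M}"
  note N = add_orbit[OF Ms(1,2) okT, of ?g]
  have gr: "?g \<in> rows (nb T)" using rm_mor[OF f vf(1)] .
  have "rm (nb T) ?g (idm (sl T)) = ?g" by (rule rm_idm(1)[where z = False]) (use gr in \<open>simp add: rows_def\<close>)
  then have "?g = rm (nb T) ?g (fst (one T)) + 0" by (simp add: one_def)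
  then have gN: "?g \<in> ?N" using one_mor[OF okT] r.fs.subspace_0[OF Ms(1)] by blast
  have Nrows: "?N \<subseteq> rows (nb T)"
  proof
    fix y assume "y \<in> ?N"
    then obtain h x where "h \<in> mor T T" "x \<in> M" "y = rm (nb T) ?g (fst h) + x" by blast
    then show "y \<in> rows (nb T)" using rm_mor gr Ms(3) r.fs.subspace_add[OF rows_space(1)] by blast
  qed
  have "?N = rows (nb T)"
  proof (rule ccontr)
    assume neq: "?N \<noteq> rows (nb T)"
    have "P ?N" unfolding P_def by (intro conjI Nrows N(1,2) subset_trans[OF Ms(4) N(3)] neq)
    then have "r.fs.dim ?N \<le> r.fs.dim M" by (rule M(2))
    moreover have fN: "r.fs.findim ?N" using rows_space(2) Nrows by (rule r.fs.findim_subset)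
    moreover have "r.fs.dim M \<le> r.fs.dim ?N" by (rule r.fs.dim_mono_findim(1)[OF fN N(3) Ms(1) N(1)])
    ultimately have "M = ?N" by (intro r.fs.dim_mono_findim(2)[OF fN N(3) Ms(1) N(1)] antisym)
    then show False using gN vf(3) by simp
  qed
  then have "v \<in> ?N" using vf(1) by simp
  then obtain h x where hx: "h \<in> mor T T" "x \<in> M" "v = rm (nb T) ?g (fst h) + x" by blast
  let ?k = "mulp T f h"
  have k: "?k \<in> rad T" using locD(7)[OF T vf(2) hx(1)] .
  obtain i where i: "i \<in> mor T T" "mulp T (one T - ?k) i = one T"
    using locD(9)[OF T k] by (auto simp: unt_def)
  have vi: "rm (nb T) v (idm (sl T)) = v" using rm_idm(1) vf(1) unfolding rows_def by metis
  have vk: "v = rm (nb T) v (fst ?k) + x" using hx(3) by (simp only: rm_assoc mulp_def fst_conv)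
  have "rm (nb T) v (fst (one T - ?k)) = v - rm (nb T) v (fst ?k)"
    by (simp add: rm_diff one_def vi)
  also have "\<dots> = x" using vk by (metis add_diff_cancel_left')
  finally have vx: "rm (nb T) v (fst (one T - ?k)) = x" .
  have "v = rm (nb T) v (fst (mulp T (one T - ?k) i))" unfolding i(2) by (simp add: one_def vi)
  also have "\<dots> = rm (nb T) x (fst i)" unfolding vx[symmetric] rm_assoc by (simp add: mulp_def)
  finally have v: "v = rm (nb T) x (fst i)" .
  have "rm (nb T) x (fst i) \<in> M" using Ms(2) hx(2) i(1) unfolding stable_def by blast
  then have "v \<in> M" unfolding v[symmetric] .
  then show False using vf(3) f Ms(2) unfolding stable_def by blast
qed

lemma rows_zero: assumes "rows (nb T) \<subseteq> {0}" shows "nb T = 0"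
proof (rule ccontr)
  assume "nb T \<noteq> 0"
  then have "idm (sl T) 0 \<in> rows (nb T)" using rows_mat[OF hm_idm, of 0 T] by simp
  then have "idm (sl T) 0 0 = 0" using assms by auto
  then show False using \<open>nb T \<noteq> 0\<close> L_nz by (simp add: id_mat_def)
qed

lemma nakayama_zero:
  assumes T: "loc T" and gen: "rows (nb T) \<subseteq> acl {rm (nb T) v (fst f) |v f. v \<in> rows (nb T) \<and> f \<in> rad T}"
  shows "nb T = 0"
proof -
  have "{0} = rows (nb T)"
  proof (rule nakayama[OF T])
    show "{0} \<subseteq> rows (nb T)" using r.fs.subspace_0[OF rows_space(1)] by simp
    show "r.fs.subspace {0}" by (rule r.fs.subspace_single_0)
    show "stable T {0}" by (simp add: stable_def)
    show "rows (nb T) \<subseteq> acl ({0} \<union> {rm (nb T) v (fst f) |v f. v \<in> rows (nb T) \<and> f \<in> rad T})"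
    proof
      fix x assume "x \<in> rows (nb T)"
      then have "x \<in> acl {rm (nb T) v (fst f) |v f. v \<in> rows (nb T) \<and> f \<in> rad T}" using gen by blast
      then show "x \<in> acl ({0} \<union> {rm (nb T) v (fst f) |v f. v \<in> rows (nb T) \<and> f \<in> rad T})"
        by (rule acl_min) (auto intro: acl_base acl.zero acl_plus)
    qed
  qed
  then show ?thesis using rows_zero by blast
qed

text \<open>Generation in both directions expresses every row of \<open>T\<close> through round
  trips from \<open>T\<close> to members of \<open>A\<close> and back. If all of these are radical,
  Nakayama leaves no rows.\<close>

lemma trace_zero:
  assumes T: "loc T" and full: "VG (Rf A T) = rows (nb T)"
    and A: "\<And>U. U \<in> A \<Longrightarrow> VG (Rf {T} U) = rows (nb U)"
    and comp: "\<And>U f g. U \<in> A \<Longrightarrow> f \<in> mor T U \<Longrightarrow> g \<in> mor U T \<Longrightarrow> mulp U g f \<in> rad T"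
  shows "nb T = 0"
proof (rule nakayama_zero[OF T], rule subsetI)
  let ?G = "{rm (nb T) v (fst f) |v f. v \<in> rows (nb T) \<and> f \<in> rad T}"
  fix x assume "x \<in> rows (nb T)"
  then have "x \<in> acl {rm (nb U) r (fst f) |U f r. (U, f) \<in> Rf A T \<and> r \<in> rows (nb U)}"
    using full by (simp add: VG_def)
  then show "x \<in> acl ?G"
  proof (rule acl_min)
    show "{rm (nb U) r (fst f) |U f r. (U, f) \<in> Rf A T \<and> r \<in> rows (nb U)} \<subseteq> acl ?G"
    proof
      fix y assume "y \<in> {rm (nb U) r (fst f) |U f r. (U, f) \<in> Rf A T \<and> r \<in> rows (nb U)}"
      then obtain U f r where *: "U \<in> A" "f \<in> mor T U" "r \<in> rows (nb U)" "y = rm (nb U) r (fst f)"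
        unfolding Rf_def by blast
      have "r \<in> acl {rm (nb S) v (fst g) |S g v. (S, g) \<in> Rf {T} U \<and> v \<in> rows (nb S)}"
        using A[OF *(1)] *(3) by (simp add: VG_def)
      then show "y \<in> acl ?G"
        unfolding *(4)
      proof (rule acl_map)
        fix s assume "s \<in> {rm (nb S) v (fst g) |S g v. (S, g) \<in> Rf {T} U \<and> v \<in> rows (nb S)}"
        then obtain g v where s: "g \<in> mor U T" "v \<in> rows (nb T)" "s = rm (nb T) v (fst g)"
          unfolding Rf_def by blast
        have "rm (nb U) s (fst f) = rm (nb T) v (fst (mulp U g f))" unfolding s by (simp add: rm_assoc mulp_def)
        then show "rm (nb U) s (fst f) \<in> acl ?G" using comp[OF *(1,2) s(1)] s(2) by (intro acl_base) blast
      qed (rule rm_zero(1), rule rm_add(1))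
    qed
  qed (auto intro: acl.zero acl_plus)
qed

text \<open>Without a source the endomorphisms are square matrices over \<open>EE\<close>, and the
  matrix unit \<open>p\<close> is a nontrivial idempotent as soon as the size is at least
  \<open>2\<close>.\<close>

lemma nb_zero:
  assumes T: "loc T" and b: "nb T = 0"
  shows "na T = 1" "df T = 0"
proof -
  have sl: "sl T = []" using b by (simp add: sl_def)
  show d: "df T = 0" using locD(1)[OF T] unfolding ok_def sl hm_empty .
  have "na T \<noteq> 0"
  proof
    assume "na T = 0"
    then have "tl T = []" by (simp add: tl_def)
    then have "one T = 0" by (simp add: one_def sl id_mat_def zero_prod_def zero_fun_def)
    then show False using locD(10)[OF T] by simp
  qed
  moreover have "\<not> na T \<ge> 2"
  proof
    assume n: "na T \<ge> 2"
    define p :: "'a mat" where "p = (\<lambda>i j. if i = 0 \<and> j = 0 then L True else 0)"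
    have "hm (tl T) (tl T) p" using n by (intro hmI) (auto simp: p_def tl_def)
    then have m: "(0, p) \<in> mor T T" by (simp add: mor_iff d)
    have "mmul (na T) p p = p"
    proof (intro ext)
      fix i j
      have "mmul (na T) p p i j = (\<Sum>k<na T. if k = 0 then p i 0 * p 0 j else 0)"
        unfolding mmul_def by (rule sum.cong) (auto simp: p_def)
      also have "\<dots> = p i 0 * p 0 j" using n by simp
      also have "\<dots> = p i j" by (simp add: p_def)
      finally show "mmul (na T) p p i j = p i j" .
    qed
    then have "mulp T (0, p) (0, p) = (0, p)" by (simp add: mulp_def)
    then consider "(0, p) = (0::'a mat \<times> 'a mat)" | "(0, p) = one T" using locD(11)[OF T m] by blast
    then show False
    proof cases
      case 1
      then have "p 0 0 = 0" by (simp add: zero_prod_def)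
      then show False using L_nz by (simp add: p_def)
    next
      case 2
      then have "p 1 1 = idm (tl T) 1 1" by (simp add: one_def)
      then show False using L_nz n by (simp add: p_def id_mat_def)
    qed
  qed
  ultimately show "na T = 1" by linarith
qed

lemma iso_refl: "ok T \<Longrightarrow> iso T T"
  unfolding iso_def using one_mor mulp_one(1) by metis

lemma ob_eq: "na T = na U \<Longrightarrow> nb T = nb U \<Longrightarrow> df T = df U \<Longrightarrow> T = U"
  by (simp add: na_def nb_def df_def prod_eq_iff)

lemma nb_zero_iso: "loc T \<Longrightarrow> loc U \<Longrightarrow> nb T = 0 \<Longrightarrow> nb U = 0 \<Longrightarrow> iso T U"
  using nb_zero[of T] nb_zero[of U] ob_eq[of T U] iso_refl locD(1) by metis

text \<open>Inside the cone, \<open>U\<close> and the pair generate each other. If \<open>U\<close>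
  were isomorphic to neither member, all round trips would be radical by
  \<open>unt_comp_iso\<close>, and \<open>trace_zero\<close> applies.\<close>

lemma rigid_in_open_cone_iso:
  assumes l: "loc U" "loc T1" "loc T2"
    and c: "cmpo T1 T1" "cmpo T1 T2" "cmpo T2 T1" "cmpo T2 T2" "cmpo U U"
    and w: "k > 0" "\<alpha> > 0" "\<beta> > 0" "k * na U = \<alpha> * na T1 + \<beta> * na T2" "k * nb U = \<alpha> * nb T1 + \<beta> * nb T2"
  shows "iso U T1 \<or> iso U T2"
proof (rule ccontr)
  assume n: "\<not> ?thesis"
  note ok = locD(1)[OF l(1)] locD(1)[OF l(2)] locD(1)[OF l(3)]
  have f: "VG (Rf {T1, T2} U) = rows (nb U)" by (rule rigid_generated_by_pair[OF ok c w(1,4,5)])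
  have f1: "VG (Rf {U} T1) = rows (nb T1)" by (rule pair_generated_by_rigid[OF ok c(1,2,5) w(2,4,5)])
  have f2: "VG (Rf {U} T2) = rows (nb T2)"
    by (rule pair_generated_by_rigid[OF ok(1,3,2) c(4,3,5) w(3), of k \<alpha>]) (use w in auto)
  have "nb U = 0"
  proof (rule trace_zero[OF l(1) f])
    show "VG (Rf {U} S) = rows (nb S)" if "S \<in> {T1, T2}" for S using that f1 f2 by blast
    show "mulp S g h \<in> rad U" if "S \<in> {T1, T2}" "h \<in> mor U S" "g \<in> mor S U" for S g h
      using unt_comp_iso[OF l(1) _ that(2,3)] that(1) n l locD(2)[OF l(1) mor_comp[OF that(2,3)]] by blast
  qed
  \<comment> \<open>A relation with positive weights makes \<open>nb T1\<close> vanish together with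
    \<open>nb U\<close>, and local objects without source are all isomorphic to
    \<open>P1\<close>.\<close>
  then have "nb T1 = 0" using w by simp
  then show False using nb_zero_iso[OF l(1,2) \<open>nb U = 0\<close>] n by blast
qed

lemma rigid_in_cone_iso:
  assumes l: "loc U" "loc T1" "loc T2"
    and c: "cmpo T1 T1" "cmpo T1 T2" "cmpo T2 T1" "cmpo T2 T2" "cmpo U U"
    and w: "k > 0" "\<alpha> + \<beta> > 0" "k * na U = \<alpha> * na T1 + \<beta> * na T2" "k * nb U = \<alpha> * nb T1 + \<beta> * nb T2"
  shows "iso U T1 \<or> iso U T2"
proof -
  consider "\<alpha> > 0" "\<beta> > 0" | "\<alpha> = 0" "\<beta> > 0" | "\<beta> = 0" "\<alpha> > 0" using w(2) by auto
  then show ?thesis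
  proof cases
    case 1 then show ?thesis using rigid_in_open_cone_iso[OF l c w(1) _ _ w(3,4)] by blast
  next
    \<comment> \<open>On a boundary ray the pair is \<open>T2\<close> taken twice. Its weight is
      then counted twice, so \<open>k\<close> is doubled.\<close>
    case 2
    then show ?thesis
      using rigid_in_open_cone_iso[OF l(1,3,3) c(4,4,4,4,5), of "2 * k" \<beta> \<beta>] w by auto
  next
    case 3
    then show ?thesis
      using rigid_in_open_cone_iso[OF l(1,2,2) c(1,1,1,1,5), of "2 * k" \<alpha> \<alpha>] w by auto
  qed
qed

lemma linear_rm_left: "Vector_Spaces.linear sv sv (\<lambda>v. rm n v A)"
  by unfold_locales (auto simp: rm_add rm_scale)

lemma dim_inj_le:
  assumes f: "Vector_Spaces.linear sv sv f" and A: "r.fs.subspace A" "r.fs.findim A"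
    and B: "r.fs.subspace B" "r.fs.findim B" "f ` A \<subseteq> B" and inj: "\<And>x. x \<in> A \<Longrightarrow> f x = 0 \<Longrightarrow> x = 0"
  shows "r.fs.dim A \<le> r.fs.dim B"
proof -
  have K: "{x \<in> A. f x \<in> {0}} = {0}"
    using inj r.fs.subspace_0[OF A(1)] rr.linear_0[OF f] by auto
  have I: "{f x + w |x w. x \<in> A \<and> w \<in> {0}} = f ` A" by auto
  have "r.fs.dim {0} = 0"
    using r.fs.dim_span_eq_card_independent[of "{}"] r.fs.independent_empty by simp
  then have "r.fs.dim A = r.fs.dim (f ` A)"
    using rr.rank_nullity_mod[OF f A r.fs.subspace_single_0 r.fs.findim_zero] unfolding K I by simp
  also have "\<dots> \<le> r.fs.dim B"
    by (rule r.fs.dim_mono_findim(1)[OF B(2,3) rr.linear_subspace_image[OF f A(1)] B(1)])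
  finally show ?thesis .
qed

lemma dim_Co_pos: "dim (Co b b) > 0"
proof (rule ccontr)
  assume "\<not> ?thesis"
  moreover have "dim {0} = 0" using dim_span_eq_card_independent[of "{}"] independent_empty by simp
  ultimately have "{0} = Co b b"
    using dim_mono_findim(2)[OF Co_findim[of b b], of "{0}"] Co_subspace[of b b] subspace_single_0 by simp
  then show False using Co_L[of b] L_nz[of b] by blast
qed

text \<open>A retract embeds the rows on both sides by injective linear maps, and the dimensions of
  the row spaces are proportional to \<open>nb\<close> and \<open>na\<close>.\<close>

lemma split_le:
  assumes f: "f \<in> mor T U" and g: "g \<in> mor U T" and c: "mulp U g f = one T"
  shows "nb T \<le> nb U" "na T \<le> na U"
proof -
  have 1: "rm (nb U) (rm (nb T) v (fst g)) (fst f) = v" if "v \<in> rows (nb T)" for v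
    using rm_idm(1)[of v False T] that arg_cong[OF c, of fst]
    by (simp add: rm_assoc mulp_def one_def rows_def)
  have 2: "rm (na U) (rm (na T) v (snd g)) (snd f) = v" if "v \<in> erows (na T)" for v
    using rm_idm(2)[of v T] that arg_cong[OF c, of snd]
    by (simp add: rm_assoc mulp_def one_def)
  have "r.fs.dim (rows (nb T)) \<le> r.fs.dim (rows (nb U))"
  proof (rule dim_inj_le[OF linear_rm_left rows_space(1,2,1,2)])
    show "(\<lambda>v. rm (nb T) v (fst g)) ` rows (nb T) \<subseteq> rows (nb U)" using rm_mor[OF g] by blast
    show "x = 0" if "x \<in> rows (nb T)" "rm (nb T) x (fst g) = 0" for x using 1[OF that(1)] that(2) by simp
  qed
  then show "nb T \<le> nb U"
    using dim_Co_pos[of False] unfolding rows_def r.dim_pow[OF Co_subspace Co_findim] by simp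
  have "r.fs.dim (erows (na T)) \<le> r.fs.dim (erows (na U))"
    unfolding erows_def
  proof (rule dim_inj_le[OF linear_rm_left pow_Co pow_Co])
    show "(\<lambda>v. rm (na T) v (snd g)) ` pow_set EE (na T) \<subseteq> pow_set EE (na U)"
      using mor_mats(2)[OF g] unfolding tl_def by (auto intro: rm_mem)
    show "x = 0" if "x \<in> pow_set EE (na T)" "rm (na T) x (snd g) = 0" for x
      using 2 that unfolding erows_def by fastforce
  qed
  then show "na T \<le> na U"
    using dim_Co_pos[of True] unfolding erows_def r.dim_pow[OF Co_subspace Co_findim] by simp
qed

lemma iso_ab: "iso T U \<Longrightarrow> na T = na U \<and> nb T = nb U"
  unfolding iso_def using split_le by (metis antisym)

subsection \<open>Compatible pairs span the lattice\<close>

definition Rr :: "'a ob set \<Rightarrow> 'a ob \<Rightarrow> 'a gens" where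
  "Rr A T = Rf A T \<union> {(T, f) |f. f \<in> rad T}"

text \<open>For a local \<open>T\<close> with \<open>nb T > 0\<close>, an endomorphism with zero
  source component is not invertible, so passing to source components loses nothing modulo the
  radical and this is the dimension of the residue division ring.\<close>

definition delta :: "'a ob \<Rightarrow> nat" where
  "delta T = m.fs.dim (fst ` mor T T) - m.fs.dim (fst ` rad T)"

lemma unt_inverse: "loc T \<Longrightarrow> f \<in> mor T T \<Longrightarrow> f \<notin> rad T \<Longrightarrow>
   \<exists>g\<in>mor T T. mulp T f g = one T \<and> mulp T g f = one T"
  using locD(2) unfolding unt_def by blast

lemma endo_space:
  assumes T: "loc T"
  shows "m.fs.subspace (fst ` mor T T)" "m.fs.subspace (fst ` rad T)" "m.fs.findim (fst ` mor T T)"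
    "fst ` rad T \<subseteq> fst ` mor T T"
proof -
  have scale: "sp c f \<in> rad T" if f: "f \<in> rad T" for c f
  proof -
    have fm: "f \<in> mor T T" using locD(3)[OF T f] by blast
    have o: "one T \<in> mor T T" by (rule one_mor[OF locD(1)[OF T]])
    have "mulp T f (sp c (one T)) = sp c f"
      unfolding mulp_def fst_conv snd_conv mmul_scale using mulp_one(1)[OF fm] by (simp add: mulp_def prod_eq_iff)
    then show ?thesis using locD(7)[OF T f mor_scale[OF o]] by metis
  qed
  show "m.fs.subspace (fst ` mor T T)"
    unfolding m.fs.subspace_def
  proof (intro conjI ballI allI)
    show "0 \<in> fst ` mor T T" using mor_zero by (metis fst_zero imageI)
    show "x + y \<in> fst ` mor T T" if xy: "x \<in> fst ` mor T T" "y \<in> fst ` mor T T" for x y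
    proof -
      obtain f g where "f \<in> mor T T" "g \<in> mor T T" "x = fst f" "y = fst g" using xy by blast
      then show ?thesis using mor_add by (metis fst_add imageI)
    qed
    show "sm c x \<in> fst ` mor T T" if x: "x \<in> fst ` mor T T" for c x
    proof -
      obtain f where "f \<in> mor T T" "x = fst f" using x by blast
      then show ?thesis using imageI[OF mor_scale[of f T T c], of fst] by simp
    qed
  qed
  show "m.fs.subspace (fst ` rad T)"
    unfolding m.fs.subspace_def
  proof (intro conjI ballI allI)
    show "0 \<in> fst ` rad T" using locD(6)[OF T] by (metis fst_zero imageI)
    show "x + y \<in> fst ` rad T" if xy: "x \<in> fst ` rad T" "y \<in> fst ` rad T" for x y
    proof -
      obtain f g where "f \<in> rad T" "g \<in> rad T" "x = fst f" "y = fst g" using xy by blast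
      then show ?thesis using locD(4)[OF T] by (metis fst_add imageI)
    qed
    show "sm c x \<in> fst ` rad T" if x: "x \<in> fst ` rad T" for c x
    proof -
      obtain f where "f \<in> rad T" "x = fst f" using x by blast
      then show ?thesis using imageI[OF scale[of f c], of fst] by simp
    qed
  qed
  have "m.fs.findim (pow_set (rows (nb T)) (nb T))" using m.findim_pow[OF rows_space(2)] .
  moreover have "fst ` mor T T \<subseteq> pow_set (rows (nb T)) (nb T)"
    using mor_mats(1)[of _ T T] unfolding mats_rows by blast
  ultimately show "m.fs.findim (fst ` mor T T)" by (rule m.fs.findim_subset)
  show "fst ` rad T \<subseteq> fst ` mor T T" using locD(3)[OF T] by blast
qed

lemma dim_rad_le: "loc T \<Longrightarrow> m.fs.dim (fst ` rad T) \<le> m.fs.dim (fst ` mor T T)"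
  using m.fs.dim_mono_findim(1) endo_space by metis

text \<open>A module killed by the radical is a vector space over the residue division ring of the
  endomorphism ring, so its dimension is a multiple of the dimension of that ring.\<close>

lemma delta_dvd:
  assumes T: "loc T" and M1: "r.fs.findim M1" "r.fs.subspace M1" "stable T M1" "M1 \<subseteq> pow_set (Co z False) (nb T)"
    and M0: "r.fs.subspace M0" "stable T M0" "M0 \<subseteq> M1"
    and rad: "\<And>v f. v \<in> M1 \<Longrightarrow> f \<in> rad T \<Longrightarrow> rm (nb T) v (fst f) \<in> M0"
  shows "\<exists>n. r.fs.dim M1 = r.fs.dim M0 + n * delta T"
  using M0 rad
proof (induction "r.fs.dim M1 - r.fs.dim M0" arbitrary: M0 rule: less_induct)
  case less
  note M0 = less.prems(1-3) and rad = less.prems(4)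
  note okT = locD(1)[OF T]
  show ?case
  proof (cases "M0 = M1")
    case True then show ?thesis by (intro exI[of _ 0]) simp
  next
    case False
    then obtain g where g: "g \<in> M1" "g \<notin> M0" using M0(3) by blast
    define N where "N = {rm (nb T) g q + x |q x. q \<in> fst ` mor T T \<and> x \<in> M0}"
    have N: "r.fs.subspace N" "stable T N" "M0 \<subseteq> N" unfolding N_def by (rule add_orbit[OF M0(1,2) okT])+
    have gi: "rm (nb T) g (idm (sl T)) = g" using rm_idm(1) g(1) M1(4) by blast
    have gN: "g \<in> N"
      unfolding N_def mem_Collect_eq
    proof (intro exI conjI)
      show "g = rm (nb T) g (fst (one T)) + 0" using gi by (simp add: one_def)
      show "fst (one T) \<in> fst ` mor T T" using one_mor[OF okT] by (rule imageI)
      show "0 \<in> M0" by (rule r.fs.subspace_0[OF M0(1)])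
    qed
    have NM: "N \<subseteq> M1"
    proof
      fix y assume "y \<in> N"
      then obtain h x where hx: "h \<in> mor T T" "x \<in> M0" "y = rm (nb T) g (fst h) + x" unfolding N_def by blast
      have "rm (nb T) g (fst h) \<in> M1" using M1(3) g(1) hx(1) unfolding stable_def by blast
      moreover have "x \<in> M1" using hx(2) M0(3) by blast
      ultimately show "y \<in> M1" unfolding hx(3) by (rule r.fs.subspace_add[OF M1(2)])
    qed
    have fM0: "r.fs.findim M0" using M1(1) M0(3) by (rule r.fs.findim_subset)
    have fN: "r.fs.findim N" using M1(1) NM by (rule r.fs.findim_subset)
    \<comment> \<open>The annihilator of \<open>g\<close> modulo \<open>M0\<close> is exactly the
      radical: an invertible \<open>f\<close> with \<open>g f\<close> in \<open>M0\<close> would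
      bring \<open>g\<close> back into \<open>M0\<close>. Hence adding the orbit of \<open>g\<close>
      raises the dimension by \<open>delta T\<close>.\<close>
    have K: "{q \<in> fst ` mor T T. rm (nb T) g q \<in> M0} = fst ` rad T"
    proof
      show "fst ` rad T \<subseteq> {q \<in> fst ` mor T T. rm (nb T) g q \<in> M0}"
        using rad[OF g(1)] locD(3)[OF T] by blast
      show "{q \<in> fst ` mor T T. rm (nb T) g q \<in> M0} \<subseteq> fst ` rad T"
      proof
        fix q assume "q \<in> {q \<in> fst ` mor T T. rm (nb T) g q \<in> M0}"
        then obtain f where f: "f \<in> mor T T" "q = fst f" "rm (nb T) g (fst f) \<in> M0" by blast
        have "f \<in> rad T"
        proof (rule ccontr)
          assume "f \<notin> rad T"
          then obtain h where h: "h \<in> mor T T" "mulp T f h = one T" using unt_inverse[OF T f(1)] by blast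
          have "rm (nb T) (rm (nb T) g (fst f)) (fst h) = rm (nb T) g (fst (mulp T f h))"
            by (simp add: rm_assoc mulp_def)
          also have "\<dots> = g" unfolding h(2) using gi by (simp add: one_def)
          finally have "g \<in> M0" using M0(2) f(3) h(1) unfolding stable_def by metis
          then show False using g(2) by blast
        qed
        then show "q \<in> fst ` rad T" using f(2) by blast
      qed
    qed
    have "m.fs.dim (fst ` mor T T) + r.fs.dim M0 = m.fs.dim (fst ` rad T) + r.fs.dim N"
      using m.pr.rank_nullity_mod[OF linear_rm endo_space(1,3)[OF T] M0(1) fM0, of "nb T" g]
      unfolding K N_def[symmetric] .
    then have dN: "r.fs.dim N = r.fs.dim M0 + delta T" using dim_rad_le[OF T] unfolding delta_def by linarith
    have "M0 \<noteq> N" using gN g(2) by blast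
    then have "r.fs.dim M0 \<noteq> r.fs.dim N" using r.fs.dim_mono_findim(2)[OF fN N(3) M0(1) N(1)] by blast
    moreover have "r.fs.dim N \<le> r.fs.dim M1" by (rule r.fs.dim_mono_findim(1)[OF M1(1) NM N(1) M1(2)])
    ultimately have lt: "r.fs.dim M1 - r.fs.dim N < r.fs.dim M1 - r.fs.dim M0" using dN by linarith
    have "\<exists>n. r.fs.dim M1 = r.fs.dim N + n * delta T"
    proof (rule less.hyps[OF lt N(1,2) NM])
      fix v f assume "v \<in> M1" "f \<in> rad T"
      then show "rm (nb T) v (fst f) \<in> N" using rad N(3) by blast
    qed
    then obtain n where "r.fs.dim M1 = r.fs.dim N + n * delta T" ..
    then have "r.fs.dim M1 = r.fs.dim M0 + Suc n * delta T" using dN by simp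
    then show ?thesis by blast
  qed
qed

lemma Rr_rad: "f \<in> rad T \<Longrightarrow> (T, f) \<in> Rr A T"
  unfolding Rr_def by blast

lemma Rr_gens: "loc T \<Longrightarrow> gens_ok T (Rr A T)"
  using gens_ok_Rf[OF locD(1), of T A] locD(3)[of T] unfolding gens_ok_def Rr_def by auto

lemma Rr_closed: assumes "loc T" "(U, f) \<in> Rr A T" "g \<in> mor T T" shows "(U, mulp T f g) \<in> Rr A T"
  using assms locD(7)[OF assms(1)] mor_comp[OF assms(3), of f U] unfolding Rr_def Rf_def by blast

lemma VG_WG_stable:
  assumes T: "loc T"
  shows "stable T (VG (Rr A T))" "stable T (WG T (Rr A T))"
proof -
  show "stable T (VG (Rr A T))"
    unfolding stable_def
  proof (intro ballI)
    fix v g assume v: "v \<in> VG (Rr A T)" and g: "g \<in> mor T T"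
    show "rm (nb T) v (fst g) \<in> VG (Rr A T)"
      unfolding VG_def
    proof (rule acl_map[OF v[unfolded VG_def]])
      fix y assume "y \<in> {rm (nb U) r (fst f) |U f r. (U, f) \<in> Rr A T \<and> r \<in> rows (nb U)}"
      then obtain U f r where *: "(U, f) \<in> Rr A T" "r \<in> rows (nb U)" "y = rm (nb U) r (fst f)" by blast
      have "rm (nb T) y (fst g) = rm (nb U) r (fst (mulp T f g))" unfolding * by (simp add: rm_assoc mulp_def)
      then show "rm (nb T) y (fst g) \<in> acl {rm (nb U) r (fst f) |U f r. (U, f) \<in> Rr A T \<and> r \<in> rows (nb U)}"
        using VG_base[OF Rr_closed[OF T *(1) g] *(2)] unfolding VG_def by simp
    qed (rule rm_zero(1), rule rm_add(1))
  qed
  show "stable T (WG T (Rr A T))"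
    unfolding stable_def
  proof (intro ballI)
    fix v g assume v: "v \<in> WG T (Rr A T)" and g: "g \<in> mor T T"
    show "rm (nb T) v (fst g) \<in> WG T (Rr A T)"
      unfolding WG_def[of T]
    proof (rule acl_map[OF v[unfolded WG_def[of T]]], unfold WG_def[of T, symmetric], elim UnE)
      fix y assume "y \<in> {rm (nb U) r (fst f) |U f r. (U, f) \<in> Rr A T \<and> r \<in> xrows (nb U)}"
      then obtain U f r where *: "(U, f) \<in> Rr A T" "r \<in> xrows (nb U)" "y = rm (nb U) r (fst f)" by blast
      have "rm (nb T) y (fst g) = rm (nb U) r (fst (mulp T f g))" unfolding * by (simp add: rm_assoc mulp_def)
      then show "rm (nb T) y (fst g) \<in> WG T (Rr A T)"
        using WG_base[OF Rr_closed[OF T *(1) g] *(2)] by simp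
    next
      fix y assume "y \<in> {rm (na T) r (df T) |r. r \<in> erows (na T)}"
      then obtain r where *: "r \<in> erows (na T)" "y = rm (na T) r (df T)" by blast
      have "rm (nb T) y (fst g) = rm (na T) (rm (na T) r (snd g)) (df T)"
        unfolding * rm_assoc mor_mats(3)[OF g] ..
      moreover have "rm (na T) r (snd g) \<in> erows (na T)"
        using *(1) mor_mats(2)[OF g] unfolding erows_def tl_def by (rule rm_mem)
      ultimately show "rm (nb T) y (fst g) \<in> WG T (Rr A T)" using rm_df_WG by simp
    qed (rule rm_zero(1), rule rm_add(1))
  qed
qed

text \<open>With the radical of \<open>T\<close> added to \<open>R\<close>, both codimensions are multiples of the dimension \<open>delta T\<close> of the
  residue division ring, and \<open>\<theta>\<close> divided by \<open>delta T\<close> takes the value \<open>-1\<close> at \<open>T\<close> and \<open>0\<close> at its partners.\<close>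

lemma dual_functional:
  assumes T: "loc T" and n: "VG (Rr A T) \<noteq> rows (nb T)" and cT: "cmpo T T"
    and A: "\<And>S. S \<in> A \<Longrightarrow> ok S \<and> cmpo T S \<and> cmpo S T" "\<And>S S'. S \<in> A \<Longrightarrow> S' \<in> A \<Longrightarrow> cmpo S S'"
  obtains x y :: int where "int (nb T) * x - int (na T) * y = 1"
    "\<And>S. S \<in> A \<Longrightarrow> int (nb S) * x - int (na S) * y = 0"
proof -
  let ?R = "Rr A T"
  note R = Rr_gens[OF T, of A] and okT = locD(1)[OF T]
  have cR: "\<forall>(U, f)\<in>?R. cmpo U S" if S: "S \<in> insert T A" for S
  proof -
    have "cmpo U S" if "(U, f) \<in> ?R" for U f
    proof -
      have "U \<in> A \<or> U = T" using that unfolding Rr_def Rf_def by blast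
      then show ?thesis using S A cT by blast
    qed
    then show ?thesis by (intro ballI case_prodI2) simp
  qed
  have r1: "rm (nb T) v (fst f) \<in> VG ?R" if "v \<in> rows (nb T)" "f \<in> rad T" for v f
    by (rule VG_base[OF Rr_rad[OF that(2)] that(1)])
  have r2: "rm (nb T) v (fst f) \<in> WG T ?R" if "v \<in> xrows (nb T)" "f \<in> rad T" for v f
    by (rule WG_base[OF Rr_rad[OF that(2)] that(1)])
  have st: "stable T (rows (nb T))" "stable T (xrows (nb T))"
    unfolding stable_def rows_def xrows_def using mor_mats(1)[of _ T T] unfolding sl_def
    by (blast intro: rm_mem)+
  obtain x0 where "r.fs.dim (rows (nb T)) = r.fs.dim (VG ?R) + x0 * delta T"
    using delta_dvd[OF T rows_space(2,1) st(1) _ VG_subspace VG_WG_stable(1)[OF T] VG_subset[OF R] r1]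
    unfolding rows_def by blast
  then have x: "cV T ?R = int x0 * int (delta T)" by (simp add: cV_def)
  obtain y0 where "r.fs.dim (xrows (nb T)) = r.fs.dim (WG T ?R) + y0 * delta T"
    using delta_dvd[OF T rows_space(4,3) st(2) _ WG_subspace VG_WG_stable(2)[OF T] WG_subset[OF R] r2]
    unfolding xrows_def by blast
  then have y: "cW T ?R = int y0 * int (delta T)" by (simp add: cW_def)
  have pos: "int (na T) * cW T ?R < int (nb T) * cV T ?R" by (rule theta_pos[OF R cT n])
  have d0: "delta T > 0" using pos unfolding x y by (cases "delta T = 0") auto
  have S0: "int (nb S) * int x0 - int (na S) * int y0 = 0" if S: "S \<in> A" for S
  proof -
    have all: "\<forall>f\<in>mor T S. (S, f) \<in> ?R" using S unfolding Rr_def Rf_def by blast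
    have "int (nb S) * cV T ?R \<le> int (na S) * cW T ?R"
      by (rule theta_le[OF R _ cR all]) (use A S in auto)
    moreover have "int (na S) * cW T ?R \<le> int (nb S) * cV T ?R"
      by (rule theta_ge[OF R]) (use A S in auto)
    ultimately have "int (nb S) * cV T ?R = int (na S) * cW T ?R" by (rule antisym)
    then have "(int (nb S) * int x0) * int (delta T) = (int (na S) * int y0) * int (delta T)"
      unfolding x y by (simp only: mult.assoc)
    then show ?thesis using d0 by simp
  qed
  have VGsub: "m.fs.subspace (pow_set (VG ?R) (nb T))" "m.fs.findim (pow_set (VG ?R) (nb T))"
    by (rule m.subspace_pow[OF VG_subspace], rule m.findim_pow[OF VG_findim[OF R]])
  \<comment> \<open>An endomorphism with all rows in \<open>VG\<close> is radical, since an inverse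
    would put every row into \<open>VG\<close>, against \<open>n\<close>.\<close>
  have K: "{q \<in> fst ` mor T T. q \<in> pow_set (VG ?R) (nb T)} = fst ` rad T"
  proof
    show "fst ` rad T \<subseteq> {q \<in> fst ` mor T T. q \<in> pow_set (VG ?R) (nb T)}"
    proof
      fix q assume "q \<in> fst ` rad T"
      then obtain f where f: "f \<in> rad T" "q = fst f" by blast
      have "(T, f) \<in> ?R" using f(1) by (rule Rr_rad)
      then show "q \<in> {q \<in> fst ` mor T T. q \<in> pow_set (VG ?R) (nb T)}"
        using mor_rows locD(3)[OF T f(1)] f(2) by blast
    qed
    show "{q \<in> fst ` mor T T. q \<in> pow_set (VG ?R) (nb T)} \<subseteq> fst ` rad T"
    proof
      fix q assume "q \<in> {q \<in> fst ` mor T T. q \<in> pow_set (VG ?R) (nb T)}"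
      then obtain f where f: "f \<in> mor T T" "q = fst f" "fst f \<in> pow_set (VG ?R) (nb T)" by blast
      have "f \<in> rad T"
      proof (rule ccontr)
        assume "f \<notin> rad T"
        then obtain h where h: "h \<in> mor T T" "mulp T h f = one T" using unt_inverse[OF T f(1)] by blast
        have "rows (nb T) \<subseteq> VG ?R"
        proof
          fix v assume v: "v \<in> rows (nb T)"
          have "rm (nb T) (rm (nb T) v (fst h)) (fst f) \<in> VG ?R" by (rule rm_VG[OF rm_mor[OF h(1) v] f(3)])
          also have "rm (nb T) (rm (nb T) v (fst h)) (fst f) = rm (nb T) v (fst (mulp T h f))"
            by (simp add: rm_assoc mulp_def)
          also have "\<dots> = v" unfolding h(2) using rm_idm(1)[of v False T] v by (simp add: one_def rows_def)
          finally show "v \<in> VG ?R" .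
        qed
        then show False using n VG_subset[OF R] by blast
      qed
      then show "q \<in> fst ` rad T" using f(2) by blast
    qed
  qed
  \<comment> \<open>By \<open>KG_lift\<close> the kernel is the sum of the endomorphisms and the
    matrices over \<open>VG\<close>. Their intersection was just identified with the radical, so the
    excess of the dimension over that of the matrices over \<open>VG\<close> is exactly
    \<open>delta T\<close>.\<close>
  have I: "{q + w |q w. q \<in> fst ` mor T T \<and> w \<in> pow_set (VG ?R) (nb T)} = KG T ?R T"
  proof (intro subset_antisym subsetI)
    fix z assume "z \<in> {q + w |q w. q \<in> fst ` mor T T \<and> w \<in> pow_set (VG ?R) (nb T)}"
    then obtain f w where fw: "f \<in> mor T T" "w \<in> pow_set (VG ?R) (nb T)" "z = fst f + w" by blast
    have "w \<in> KG T ?R T" using fw(2) KG_dim(3)[OF R okT] by blast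
    then show "z \<in> KG T ?R T" unfolding fw(3) by (rule m.fs.subspace_add[OF KG_dim(4)[OF R okT] mor_KG[OF R fw(1)]])
  next
    fix z assume "z \<in> KG T ?R T"
    then obtain f where f: "f \<in> mor T T" "z - fst f \<in> pow_set (VG ?R) (nb T)"
      using KG_lift[OF R okT cR] by blast
    have "z = fst f + (z - fst f)" by simp
    then show "z \<in> {q + w |q w. q \<in> fst ` mor T T \<and> w \<in> pow_set (VG ?R) (nb T)}" using f by blast
  qed
  have lid: "Vector_Spaces.linear sm sm (\<lambda>q. q)" by unfold_locales auto
  have "m.fs.dim (fst ` mor T T) + nb T * r.fs.dim (VG ?R) = m.fs.dim (fst ` rad T) + m.fs.dim (KG T ?R T)"
    using mm.rank_nullity_mod[OF lid endo_space(1,3)[OF T] VGsub] unfolding K I dim_pow_VG[OF R] .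
  then have "m.fs.dim (KG T ?R T) = nb T * r.fs.dim (VG ?R) + delta T"
    using dim_rad_le[OF T] unfolding delta_def by linarith
  then have "int (m.fs.dim (KG T ?R T)) = int (nb T) * int (r.fs.dim (VG ?R)) + int (delta T)"
    by (simp only: of_nat_add of_nat_mult)
  then have "int (nb T) * cV T ?R - int (na T) * cW T ?R = int (delta T)"
    using KG_dim(2)[OF R okT cT] by linarith
  then have "(int (nb T) * int x0 - int (na T) * int y0) * int (delta T) = 1 * int (delta T)"
    unfolding x y by (simp add: algebra_simps)
  then have "int (nb T) * int x0 - int (na T) * int y0 = 1" using d0 by simp
  then show ?thesis using that S0 by blast
qed

text \<open>Radical endomorphisms do not contribute to generation, by Nakayama.\<close>

lemma Rr_full:
  assumes T: "loc T" and full: "VG (Rr A T) = rows (nb T)"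
  shows "VG (Rf A T) = rows (nb T)"
proof (rule nakayama[OF T VG_subset[OF gens_ok_Rf[OF locD(1)[OF T]]] VG_subspace])
  show "stable T (VG (Rf A T))"
    unfolding stable_def
  proof (intro ballI)
    fix v g assume v: "v \<in> VG (Rf A T)" and g: "g \<in> mor T T"
    show "rm (nb T) v (fst g) \<in> VG (Rf A T)"
      unfolding VG_def
    proof (rule acl_map[OF v[unfolded VG_def]])
      fix y assume "y \<in> {rm (nb U) r (fst f) |U f r. (U, f) \<in> Rf A T \<and> r \<in> rows (nb U)}"
      then obtain U f r where *: "(U, f) \<in> Rf A T" "r \<in> rows (nb U)" "y = rm (nb U) r (fst f)" by blast
      have "rm (nb T) y (fst g) = rm (nb U) r (fst (mulp T f g))" unfolding * by (simp add: rm_assoc mulp_def)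
      moreover have "(U, mulp T f g) \<in> Rf A T" using *(1) mor_comp[OF g, of f U] unfolding Rf_def by blast
      ultimately show "rm (nb T) y (fst g) \<in> acl {rm (nb U) r (fst f) |U f r. (U, f) \<in> Rf A T \<and> r \<in> rows (nb U)}"
        using VG_base[OF _ *(2)] unfolding VG_def by simp
    qed (rule rm_zero(1), rule rm_add(1))
  qed
  let ?H = "VG (Rf A T) \<union> {rm (nb T) v (fst f) |v f. v \<in> rows (nb T) \<and> f \<in> rad T}"
  show "rows (nb T) \<subseteq> acl ?H"
  proof
    fix v assume "v \<in> rows (nb T)"
    then have "v \<in> acl {rm (nb U) r (fst f) |U f r. (U, f) \<in> Rr A T \<and> r \<in> rows (nb U)}"
      using full by (simp add: VG_def)
    then show "v \<in> acl ?H"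
    proof (rule acl_min)
      show "{rm (nb U) r (fst f) |U f r. (U, f) \<in> Rr A T \<and> r \<in> rows (nb U)} \<subseteq> acl ?H"
      proof
        fix y assume "y \<in> {rm (nb U) r (fst f) |U f r. (U, f) \<in> Rr A T \<and> r \<in> rows (nb U)}"
        then obtain U f r where *: "(U, f) \<in> Rr A T" "r \<in> rows (nb U)" "y = rm (nb U) r (fst f)" by blast
        have "y \<in> ?H"
        proof (cases "(U, f) \<in> Rf A T")
          case True then show ?thesis using VG_base[OF True *(2)] *(3) by simp
        next
          case False
          then have "U = T" "f \<in> rad T" using *(1) by (auto simp: Rr_def)
          then show ?thesis using * by blast
        qed
        then show "y \<in> acl ?H" by (rule acl_base)
      qed
    qed (auto intro: acl.zero acl_plus)
  qed
qed

text \<open>The class of a rigid local object is primitive. The form is that of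
  \<open>dual_functional\<close> without partners; the object \<open>P1\<close> is treated apart,
  because without source \<open>VG\<close> is automatically everything.\<close>

lemma single_functional:
  assumes T: "loc T" "cmpo T T"
  obtains x y :: int where "int (nb T) * x - int (na T) * y = 1"
proof (cases "nb T = 0")
  case True
  then have "int (nb T) * 0 - int (na T) * (-1) = 1" using nb_zero(1)[OF T(1)] by simp
  then show ?thesis using that by blast
next
  case False
  have "VG (Rr {} T) \<noteq> rows (nb T)"
  proof
    assume "VG (Rr {} T) = rows (nb T)"
    then have "VG (Rf {} T) = rows (nb T)" by (rule Rr_full[OF T(1)])
    moreover have "VG (Rf {} T) \<subseteq> {0}"
    proof
      fix v assume "v \<in> VG (Rf {} T)"
      then show "v \<in> {0}" unfolding VG_def by (rule acl_min) (auto simp: Rf_def)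
    qed
    ultimately show False using rows_zero False by metis
  qed
  then show ?thesis using dual_functional[OF T(1) _ T(2), of "{}"] that by blast
qed

text \<open>The form with value \<open>1\<close> at \<open>T1\<close> and \<open>0\<close> at
  \<open>T2\<close> yields \<open>D x = - na T2\<close> and \<open>D y = - nb T2\<close> for the
  determinant \<open>D\<close>. So \<open>D\<close> divides a primitive vector.\<close>

lemma compatible_pair_unimodular_aux:
  assumes l: "loc T1" "loc T2" and c: "cmpo T1 T1" "cmpo T1 T2" "cmpo T2 T1" "cmpo T2 T2"
    and n: "VG (Rr {T2} T1) \<noteq> rows (nb T1)"
  shows "\<bar>int (na T1) * int (nb T2) - int (na T2) * int (nb T1)\<bar> = 1"
proof -
  obtain x y where xy: "int (nb T1) * x - int (na T1) * y = 1" "int (nb T2) * x - int (na T2) * y = 0"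
    using dual_functional[OF l(1) n c(1)] c locD(1)[OF l(2)] by auto
  obtain x' y' where xy': "int (nb T2) * x' - int (na T2) * y' = 1" using single_functional[OF l(2) c(4)] .
  let ?D = "int (na T1) * int (nb T2) - int (na T2) * int (nb T1)"
  have "?D * x = int (na T1) * (int (nb T2) * x) - int (na T2) * (int (nb T1) * x)" by (simp add: algebra_simps)
  also have "int (nb T2) * x = int (na T2) * y" using xy(2) by simp
  also have "int (nb T1) * x = 1 + int (na T1) * y" using xy(1) by simp
  finally have Dx: "?D * x = - int (na T2)" by (simp add: algebra_simps)
  have "?D * y = int (nb T2) * (int (na T1) * y) - int (nb T1) * (int (na T2) * y)" by (simp add: algebra_simps)
  also have "int (na T2) * y = int (nb T2) * x" using xy(2) by simp
  also have "int (na T1) * y = int (nb T1) * x - 1" using xy(1) by simp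
  finally have Dy: "?D * y = - int (nb T2)" by (simp add: algebra_simps)
  have "?D dvd int (na T2)" "?D dvd int (nb T2)" using Dx Dy by (metis dvd_minus_iff dvd_triv_left)+
  then have "?D dvd int (nb T2) * x' - int (na T2) * y'" by simp
  then have "?D dvd 1" using xy' by simp
  then show ?thesis by simp
qed

text \<open>A form dual to \<open>T1\<close> or to \<open>T2\<close> exists unless each object
  generates the other; in that case \<open>trace_zero\<close> removes both sources, and two local
  objects without source are isomorphic.\<close>

lemma compatible_pair_unimodular:
  assumes l: "loc T1" "loc T2" and c: "cmpo T1 T1" "cmpo T1 T2" "cmpo T2 T1" "cmpo T2 T2"
    and n: "\<not> iso T1 T2"
  shows "\<bar>int (na T1) * int (nb T2) - int (na T2) * int (nb T1)\<bar> = 1"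
proof -
  have n': "\<not> iso T2 T1" using n unfolding iso_def by blast
  consider "VG (Rr {T2} T1) \<noteq> rows (nb T1)" | "VG (Rr {T1} T2) \<noteq> rows (nb T2)"
    | "VG (Rr {T2} T1) = rows (nb T1)" "VG (Rr {T1} T2) = rows (nb T2)" by blast
  then show ?thesis
  proof cases
    case 1 then show ?thesis by (rule compatible_pair_unimodular_aux[OF l c])
  next
    case 2
    then have "\<bar>int (na T2) * int (nb T1) - int (na T1) * int (nb T2)\<bar> = 1"
      by (rule compatible_pair_unimodular_aux[OF l(2,1) c(4,3,2,1)])
    then show ?thesis by (simp add: abs_minus_commute)
  next
    case 3
    have f: "VG (Rf {T2} T1) = rows (nb T1)" "VG (Rf {T1} T2) = rows (nb T2)"
      using Rr_full l 3 by blast+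
    have r1: "mulp T2 g h \<in> rad T1" if "h \<in> mor T1 T2" "g \<in> mor T2 T1" for g h
      using unt_comp_iso[OF l that] locD(2)[OF l(1) mor_comp[OF that]] n by blast
    have r2: "mulp T1 g h \<in> rad T2" if "h \<in> mor T2 T1" "g \<in> mor T1 T2" for g h
      using unt_comp_iso[OF l(2,1) that] locD(2)[OF l(2) mor_comp[OF that]] n' by blast
    have "nb T1 = 0" by (rule trace_zero[OF l(1) f(1)]) (use f r1 in auto)
    moreover have "nb T2 = 0" by (rule trace_zero[OF l(2) f(2)]) (use f r2 in auto)
    ultimately show ?thesis using nb_zero_iso[OF l] n by blast
  qed
qed

end

section \<open>Removing an index and Gaussian elimination\<close>

definition sk :: "nat \<Rightarrow> nat \<Rightarrow> nat" where "sk i k = (if k < i then k else Suc k)"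

definition del :: "nat \<Rightarrow> 'b list \<Rightarrow> 'b list" where "del i l = take i l @ drop (Suc i) l"

lemma length_del: "i < length l \<Longrightarrow> length (del i l) = length l - 1"
  by (simp add: del_def)

lemma nth_del: "i < length l \<Longrightarrow> k < length l - 1 \<Longrightarrow> del i l ! k = l ! sk i k"
  by (auto simp: del_def sk_def nth_append min_def)

lemma sk_less: "i < n \<Longrightarrow> k < n - 1 \<Longrightarrow> sk i k < n"
  by (auto simp: sk_def)

lemma sk_neq: "sk i k \<noteq> i" by (simp add: sk_def)

lemma sk_inj: "sk i k = sk i l \<longleftrightarrow> k = l" by (auto simp: sk_def)

lemma sk_surj: assumes "j \<noteq> i" "j < n" "i < n" obtains k where "k < n - 1" "j = sk i k"
proof (cases "j < i")
  case True then show ?thesis using that[of j] assms by (auto simp: sk_def)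
next
  case False then show ?thesis using that[of "j - 1"] assms by (auto simp: sk_def)
qed

lemma sum_sk:
  fixes f :: "nat \<Rightarrow> 'b::comm_monoid_add"
  assumes "i < n"
  shows "(\<Sum>k<n. f k) = f i + (\<Sum>k<n - 1. f (sk i k))"
proof -
  have "inj_on (sk i) {..<n - 1}" by (auto simp: inj_on_def sk_inj)
  moreover have "sk i ` {..<n - 1} = {..<n} - {i}"
  proof
    show "sk i ` {..<n - 1} \<subseteq> {..<n} - {i}" using sk_less[OF assms] sk_neq[of i] by auto
    show "{..<n} - {i} \<subseteq> sk i ` {..<n - 1}"
    proof
      fix x assume "x \<in> {..<n} - {i}"
      then obtain k where "k < n - 1" "x = sk i k" using sk_surj[of x i n] assms by auto
      then show "x \<in> sk i ` {..<n - 1}" by blast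
    qed
  qed
  ultimately have "(\<Sum>k<n - 1. f (sk i k)) = sum f ({..<n} - {i})"
    by (metis (no_types, lifting) sum.reindex_cong)
  then show ?thesis using assms by (simp add: sum.remove)
qed

lemma cnt_del: "i < length l \<Longrightarrow> cnt b l = cnt b (del i l) + (if l ! i = b then 1 else 0)"
proof -
  assume i: "i < length l"
  have "l = take i l @ l ! i # drop (Suc i) l" by (rule id_take_nth_drop[OF i])
  then have "cnt b l = cnt b (take i l @ l ! i # drop (Suc i) l)" by simp
  then show ?thesis by (simp add: cnt_def del_def)
qed

lemma cnt_replicate: "cnt b (replicate n c) = (if b = c then real n else 0)"
  by (simp add: cnt_def)

context two_idem
begin

lemma blk_zero: "blk p q 0 (\<lambda>i j. 0) (\<lambda>i j. 0) 0 = (0 :: 'a mat)"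
  by (auto simp: blk_def fun_eq_iff)

lemma mp_diff: "mp q p - mp q' p' = mp (q - q') (p - p')"
  by (auto simp: mp_def fun_eq_iff)

lemma mp_add: "mp q p + mp q' p' = mp (q + q') (p + p')"
  by (auto simp: mp_def fun_eq_iff)

lemma mp_eq_iff: "mp q p = mp q' p' \<longleftrightarrow> q = q' \<and> p = p'"
proof
  assume "mp q p = mp q' p'"
  then have "mp q p (-1) = mp q' p' (-1)" "mp q p 0 = mp q' p' 0" by simp_all
  then show "q = q' \<and> p = p'" by (simp add: mp_def)
qed simp

lemma mp_zero: "mp 0 0 = 0" by (auto simp: mp_def fun_eq_iff)

lemma idc_tt: "idc (tt s t d) = mp (idm s) (idm t)"
  by (auto simp: mp_def fst_tt fun_eq_iff id_mat_def)

lemma comp_mp: "comp_map (tt s t d) (mp q p) (mp q' p') = mp (mmul (length s) q q') (mmul (length t) p p')"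
  by (rule ext) (simp add: comp_map_def mp_def fst_tt)

lemma cm_mp: "cm (tt s t d) (tt s' t' d') (mp q p) \<longleftrightarrow>
   hm s s' q \<and> hm t t' p \<and> mmul (length s') d' q = mmul (length t) p d"
  unfolding cm_tt_iff mp_eq_iff by blast

lemma heq_tt:
  assumes "hm s s' q" "hm t t' p" "mmul (length s') d' q = mmul (length t) p d"
    and "hm s' s q'" "hm t' t p'" "mmul (length s) d q' = mmul (length t') p' d'"
    and "hm t s h" "mmul (length s') q' q = idm s + mmul (length t) h d" "mmul (length t') p' p = idm t + mmul (length s) d h"
    and "hm t' s' h'" "mmul (length s) q q' = idm s' + mmul (length t') h' d'" "mmul (length t) p p' = idm t' + mmul (length s') d' h'"
  shows "heq (tt s t d) (tt s' t' d')"
proof (rule heqI[of _ _ "mp q p" "mp q' p'"])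
  show "cm (tt s t d) (tt s' t' d') (mp q p)" "cm (tt s' t' d') (tt s t d) (mp q' p')"
    using assms by (simp_all add: cm_mp)
  show "hty (tt s t d) (tt s t d) (comp_map (tt s' t' d') (mp q' p') (mp q p)) (idc (tt s t d))"
    unfolding homotopic_alt comp_mp idc_tt mp_diff nh_tt_iff using assms by auto
  show "hty (tt s' t' d') (tt s' t' d') (comp_map (tt s t d) (mp q p) (mp q' p')) (idc (tt s' t' d'))"
    unfolding homotopic_alt comp_mp idc_tt mp_diff nh_tt_iff using assms by auto
qed

lemma mmul_big: "hm s t A \<Longrightarrow> length s \<le> N \<Longrightarrow> mmul (length s) A B = mmul N A B"
proof (intro ext)
  fix i j assume A: "hm s t A" and N: "length s \<le> N"
  show "mmul (length s) A B i j = mmul N A B i j"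
    unfolding mmul_def using N hmD0[OF A, of i] by (intro sum.mono_neutral_left) auto
qed

text \<open>\<open>Pj\<close> and \<open>Ij\<close> project to and include the summands other than
  the one at \<open>j\<close>; \<open>Rj\<close> and \<open>Cj\<close> do the same for that single
  summand. Together they split the identity of \<open>s\<close>.\<close>

definition Pj :: "nat \<Rightarrow> bool list \<Rightarrow> 'a mat" where
  "Pj j s = (\<lambda>k l. if k < length s - 1 \<and> l = sk j k then L (s ! l) else 0)"
definition Ij :: "nat \<Rightarrow> bool list \<Rightarrow> 'a mat" where
  "Ij j s = (\<lambda>l k. if k < length s - 1 \<and> l = sk j k then L (s ! l) else 0)"
definition Cj :: "nat \<Rightarrow> bool list \<Rightarrow> 'a mat" where
  "Cj j s = (\<lambda>l k. if k = 0 \<and> l = j then L (s ! j) else 0)"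
definition Rj :: "nat \<Rightarrow> bool list \<Rightarrow> 'a mat" where
  "Rj j s = (\<lambda>k l. if k = 0 \<and> l = j then L (s ! j) else 0)"

lemma hm_PI:
  assumes "j < length s"
  shows "hm s (del j s) (Pj j s)" "hm (del j s) s (Ij j s)" "hm [s ! j] s (Cj j s)" "hm s [s ! j] (Rj j s)"
  using assms sk_less[of j "length s"]
  by (auto intro!: hmI simp: Pj_def Ij_def Cj_def Rj_def length_del nth_del)

lemma rel_PI:
  assumes j: "j < length s"
  shows "mmul (length s) (Pj j s) (Ij j s) = idm (del j s)"
    "mmul (length s) (Rj j s) (Cj j s) = idm [s ! j]"
    "mmul (length s) (Pj j s) (Cj j s) = 0" "mmul (length s) (Rj j s) (Ij j s) = 0"
    "mmul (length (del j s)) (Ij j s) (Pj j s) + mmul (length [s ! j]) (Cj j s) (Rj j s) = idm s"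
proof -
  show "mmul (length s) (Pj j s) (Ij j s) = idm (del j s)"
  proof (intro ext)
    fix k l
    have "mmul (length s) (Pj j s) (Ij j s) k l
      = (\<Sum>m<length s. if m = sk j k then (if k < length s - 1 \<and> l = k then L (s ! m) else 0) else 0)"
      unfolding mmul_def Pj_def Ij_def by (rule sum.cong) (auto simp: sk_inj)
    also have "\<dots> = idm (del j s) k l"
      using j sk_less[OF j, of k] by (auto simp: id_mat_def length_del nth_del)
    finally show "mmul (length s) (Pj j s) (Ij j s) k l = idm (del j s) k l" .
  qed
  show "mmul (length s) (Rj j s) (Cj j s) = idm [s ! j]"
  proof (intro ext)
    fix k l
    have "mmul (length s) (Rj j s) (Cj j s) k l
      = (\<Sum>m<length s. if m = j then (if k = 0 \<and> l = 0 then L (s ! j) else 0) else 0)"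
      unfolding mmul_def Rj_def Cj_def by (rule sum.cong) auto
    also have "\<dots> = idm [s ! j] k l" using j by (auto simp: id_mat_def)
    finally show "mmul (length s) (Rj j s) (Cj j s) k l = idm [s ! j] k l" .
  qed
  show "mmul (length s) (Pj j s) (Cj j s) = 0" "mmul (length s) (Rj j s) (Ij j s) = 0"
    using sk_neq[of j] sk_neq[of j, symmetric]
    by (auto simp: fun_eq_iff mmul_def Pj_def Cj_def Rj_def Ij_def intro!: sum.neutral)
  show "mmul (length (del j s)) (Ij j s) (Pj j s) + mmul (length [s ! j]) (Cj j s) (Rj j s) = idm s"
  proof (intro ext)
    fix k l
    have 1: "mmul (length (del j s)) (Ij j s) (Pj j s) k l
      = (\<Sum>m<length s - 1. if k = sk j m \<and> l = sk j m then L (s ! k) else 0)"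
      unfolding mmul_def Pj_def Ij_def length_del[OF j] by (rule sum.cong) auto
    have 2: "mmul (length [s ! j]) (Cj j s) (Rj j s) k l = (if k = j \<and> l = j then L (s ! k) else 0)"
      by (simp add: mmul_def Cj_def Rj_def)
    have "(mmul (length (del j s)) (Ij j s) (Pj j s) + mmul (length [s ! j]) (Cj j s) (Rj j s)) k l
      = (\<Sum>m<length s. if k = m \<and> l = m then L (s ! k) else 0)"
      unfolding plus_fun_apply 1 2 sum_sk[OF j, of "\<lambda>m. if k = m \<and> l = m then L (s ! k) else 0"] by simp
    also have "\<dots> = (\<Sum>m<length s. if m = k then (if l = k then L (s ! k) else 0) else 0)"
      by (rule sum.cong) auto
    also have "\<dots> = idm s k l" by (auto simp: id_mat_def)
    finally show "(mmul (length (del j s)) (Ij j s) (Pj j s) + mmul (length [s ! j]) (Cj j s) (Rj j s)) k l = idm s k l" .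
  qed
qed

text \<open>Gaussian elimination of an invertible entry. To calculate without tracking sizes, all products
  are taken with a common large size \<open>N\<close>.\<close>

lemma gauss_elim:
  assumes d: "hm s t d" and i: "i < length t" and j: "j < length s" and b: "t ! i = s ! j"
    and w: "w \<in> Co (s ! j) (s ! j)" "d i j * w = L (s ! j)" "w * d i j = L (s ! j)"
  obtains d' where "hm (del j s) (del i t) d'" "heq (tt s t d) (tt (del j s) (del i t) d')"
proof -
  define N where "N = length s + length t + 1"
  let ?b = "[s ! j]"
  let ?s = "del j s" and ?t = "del i t"
  let ?P = "Pj j s" and ?I = "Ij j s" and ?C = "Cj j s" and ?R = "Rj j s"
  let ?P' = "Pj i t" and ?I' = "Ij i t" and ?C' = "Cj i t" and ?R' = "Rj i t"
  define W where "W = (\<lambda>(k::nat) (l::nat). if k = 0 \<and> l = 0 then w else 0)"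
  define mu (infixl "\<bullet>\<bullet>" 70) where "mu = (mmul N :: 'a mat \<Rightarrow> 'a mat \<Rightarrow> 'a mat)"
  have big: "mmul (length a) A B = A \<bullet>\<bullet> B" if "hm a c A" "length a \<le> N" for a c A B
    unfolding mu_def by (rule mmul_big[OF that])
  have hW: "hm ?b ?b W" using w(1) by (intro hmI) (auto simp: W_def)
  have lens: "length s \<le> N" "length t \<le> N" "length ?s \<le> N" "length ?t \<le> N" "length ?b \<le> N"
    using i j by (auto simp: N_def length_del)
  note hs = hm_PI[OF j] and ht = hm_PI[OF i, unfolded b]
  have as: "(A \<bullet>\<bullet> B) \<bullet>\<bullet> D = A \<bullet>\<bullet> (B \<bullet>\<bullet> D)" for A B D unfolding mu_def by (rule mmul_assoc)
  have ad: "(A + B) \<bullet>\<bullet> D = A \<bullet>\<bullet> D + B \<bullet>\<bullet> D" "A \<bullet>\<bullet> (B + D) = A \<bullet>\<bullet> B + A \<bullet>\<bullet> D" for A B D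
    unfolding mu_def by (rule mmul_add)+
  have di: "(A - B) \<bullet>\<bullet> D = A \<bullet>\<bullet> D - B \<bullet>\<bullet> D" "A \<bullet>\<bullet> (B - D) = A \<bullet>\<bullet> B - A \<bullet>\<bullet> D" for A B D
    unfolding mu_def by (rule mmul_diff)+
  have un: "(- A) \<bullet>\<bullet> D = - (A \<bullet>\<bullet> D)" "A \<bullet>\<bullet> (- D) = - (A \<bullet>\<bullet> D)" for A D
    unfolding mu_def by (rule mmul_uminus)+
  have ze: "0 \<bullet>\<bullet> A = 0" "A \<bullet>\<bullet> 0 = 0" for A unfolding mu_def by simp_all
  have idl: "idm c \<bullet>\<bullet> A = A" if "hm a c A" "length c \<le> N" for a c A
    using mmul_idm_left[OF that(1) refl] big[OF hm_idm that(2)] by simp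
  have idr: "A \<bullet>\<bullet> idm a = A" if "hm a c A" "length a \<le> N" for a c A
    using mmul_idm_right[OF that(1) refl] big[OF that] by simp
  have rs: "?P \<bullet>\<bullet> ?I = idm ?s" "?R \<bullet>\<bullet> ?C = idm ?b" "?P \<bullet>\<bullet> ?C = 0" "?R \<bullet>\<bullet> ?I = 0" "?I \<bullet>\<bullet> ?P + ?C \<bullet>\<bullet> ?R = idm s"
    using rel_PI[OF j] by (simp_all only: big[OF hs(1) lens(1)] big[OF hs(2) lens(3)] big[OF hs(3) lens(5)] big[OF hs(4) lens(1)])
  have rt: "?P' \<bullet>\<bullet> ?I' = idm ?t" "?R' \<bullet>\<bullet> ?C' = idm ?b" "?P' \<bullet>\<bullet> ?C' = 0" "?R' \<bullet>\<bullet> ?I' = 0" "?I' \<bullet>\<bullet> ?P' + ?C' \<bullet>\<bullet> ?R' = idm t"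
    using rel_PI[OF i, unfolded b]
    by (simp_all only: big[OF ht(1) lens(2)] big[OF ht(2) lens(4)] big[OF ht(3) lens(5)] big[OF ht(4) lens(2)])
  have Rd: "?R' \<bullet>\<bullet> d = (\<lambda>k l. if k = 0 then d i l else 0)"
  proof (intro ext)
    fix k l
    have "(?R' \<bullet>\<bullet> d) k l = (\<Sum>m<N. if m = i then (if k = 0 then L (t ! i) * d i l else 0) else 0)"
      unfolding mu_def mmul_def Rj_def by (rule sum.cong) auto
    also have "\<dots> = (if k = 0 then L (t ! i) * d i l else 0)" using i by (simp add: N_def)
    also have "L (t ! i) * d i l = d i l"
      using hmD[OF d i, of l] hmD0[OF d, of i l] by (cases "l < length s") (auto simp: Co_iff)
    finally show "(?R' \<bullet>\<bullet> d) k l = (if k = 0 then d i l else 0)" .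
  qed
  have RdC: "?R' \<bullet>\<bullet> (d \<bullet>\<bullet> ?C) = (\<lambda>k l. if k = 0 \<and> l = 0 then d i j else 0)"
  proof (intro ext)
    fix k l
    have "(?R' \<bullet>\<bullet> (d \<bullet>\<bullet> ?C)) k l = ((\<lambda>k l. if k = 0 then d i l else 0) \<bullet>\<bullet> ?C) k l"
      unfolding as[symmetric] Rd ..
    also have "\<dots> = (\<Sum>m<N. if m = j then (if k = 0 \<and> l = 0 then d i j * L (s ! j) else 0) else 0)"
      unfolding mu_def mmul_def Cj_def by (rule sum.cong) auto
    also have "\<dots> = (if k = 0 \<and> l = 0 then d i j * L (s ! j) else 0)" using j by (simp add: N_def)
    also have "d i j * L (s ! j) = d i j" using hmD[OF d i j] by (simp add: Co_iff)
    finally show "(?R' \<bullet>\<bullet> (d \<bullet>\<bullet> ?C)) k l = (if k = 0 \<and> l = 0 then d i j else 0)" .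
  qed
  have W1: "W \<bullet>\<bullet> (?R' \<bullet>\<bullet> (d \<bullet>\<bullet> ?C)) = idm ?b" "?R' \<bullet>\<bullet> (d \<bullet>\<bullet> (?C \<bullet>\<bullet> W)) = idm ?b"
  proof -
    have e: "A \<bullet>\<bullet> B = (\<lambda>k l. if k = 0 \<and> l = 0 then x * y else 0)"
      if A: "A = (\<lambda>k l. if k = 0 \<and> l = 0 then x else 0)" and B: "B = (\<lambda>k l. if k = 0 \<and> l = 0 then y else 0)" for A B x y
    proof (intro ext)
      fix k l
      have "(A \<bullet>\<bullet> B) k l = (\<Sum>m<N. if m = 0 then (if k = 0 \<and> l = 0 then x * y else 0) else 0)"
        unfolding mu_def mmul_def A B by (rule sum.cong) auto
      then show "(A \<bullet>\<bullet> B) k l = (if k = 0 \<and> l = 0 then x * y else 0)" by (simp add: N_def)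
    qed
    show "W \<bullet>\<bullet> (?R' \<bullet>\<bullet> (d \<bullet>\<bullet> ?C)) = idm ?b"
      unfolding RdC e[OF W_def refl] w by (auto simp: id_mat_def fun_eq_iff)
    have "?R' \<bullet>\<bullet> (d \<bullet>\<bullet> (?C \<bullet>\<bullet> W)) = (?R' \<bullet>\<bullet> (d \<bullet>\<bullet> ?C)) \<bullet>\<bullet> W" by (simp only: as)
    then show "?R' \<bullet>\<bullet> (d \<bullet>\<bullet> (?C \<bullet>\<bullet> W)) = idm ?b"
      unfolding RdC e[OF refl W_def] w by (auto simp: id_mat_def fun_eq_iff)
  qed
  \<comment> \<open>\<open>H\<close> inverts \<open>d\<close> along the chosen entry, and
    \<open>d'\<close> is the Schur complement. On the large complex \<open>- H\<close> is the
    homotopy; on the small one the composite is strictly the identity.\<close>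
  define H where "H = ?C \<bullet>\<bullet> (W \<bullet>\<bullet> ?R')"
  define d' where "d' = ?P' \<bullet>\<bullet> (d \<bullet>\<bullet> ?I) - ?P' \<bullet>\<bullet> (d \<bullet>\<bullet> (H \<bullet>\<bullet> (d \<bullet>\<bullet> ?I)))"
  define p where "p = ?P' - ?P' \<bullet>\<bullet> (d \<bullet>\<bullet> H)"
  define q' where "q' = ?I - H \<bullet>\<bullet> (d \<bullet>\<bullet> ?I)"
  have hb: "hm a e (A \<bullet>\<bullet> B)" if "hm c e A" "hm a c B" "length c \<le> N" for a c e A B
    using hm_mmul[OF that(1,2) refl] big[OF that(1,3)] by simp
  have hH: "hm t s H" unfolding H_def using hs ht hW lens by (meson hb)
  have hd': "hm ?s ?t d'" unfolding d'_def using hs ht hH d lens by (meson hb hm_diff)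
  have hp: "hm t ?t p" unfolding p_def using hs ht hH d lens by (meson hb hm_diff)
  have hq': "hm ?s s q'" unfolding q'_def using hs ht hH d lens by (meson hb hm_diff)
  have HdC: "H \<bullet>\<bullet> (d \<bullet>\<bullet> ?C) = ?C"
    unfolding H_def as W1 using idr[OF hs(3) lens(5)] by simp
  have RdH: "?R' \<bullet>\<bullet> (d \<bullet>\<bullet> H) = ?R'"
  proof -
    have "?R' \<bullet>\<bullet> (d \<bullet>\<bullet> H) = (?R' \<bullet>\<bullet> (d \<bullet>\<bullet> (?C \<bullet>\<bullet> W))) \<bullet>\<bullet> ?R'" unfolding H_def by (simp only: as)
    also have "\<dots> = ?R'" unfolding W1 by (rule idl[OF ht(4) lens(5)])
    finally show ?thesis .
  qed
  have IP: "?I \<bullet>\<bullet> ?P = idm s - ?C \<bullet>\<bullet> ?R" "?I' \<bullet>\<bullet> ?P' = idm t - ?C' \<bullet>\<bullet> ?R'"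
    using rs(5) rt(5) by (metis add_diff_cancel_right')+
  have dI: "d \<bullet>\<bullet> (?I \<bullet>\<bullet> ?P) = d - d \<bullet>\<bullet> (?C \<bullet>\<bullet> ?R)"
    unfolding IP di idr[OF d lens(1)] ..
  have PH: "?P \<bullet>\<bullet> H = 0" unfolding H_def as[symmetric] rs(3) ze ..
  have HI: "H \<bullet>\<bullet> ?I' = 0" unfolding H_def as rt(4) ze ..
  have HdCR: "H \<bullet>\<bullet> (d \<bullet>\<bullet> (?C \<bullet>\<bullet> ?R)) = ?C \<bullet>\<bullet> ?R"
    using arg_cong[OF HdC, of "\<lambda>x. x \<bullet>\<bullet> ?R"] unfolding as .
  have 1: "d' \<bullet>\<bullet> ?P = p \<bullet>\<bullet> d"
    unfolding d'_def p_def di as dI HdCR by simp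
  have CRd: "?C' \<bullet>\<bullet> (?R' \<bullet>\<bullet> (d \<bullet>\<bullet> (H \<bullet>\<bullet> A))) = ?C' \<bullet>\<bullet> (?R' \<bullet>\<bullet> A)" for A
    using arg_cong[OF RdH, of "\<lambda>x. ?C' \<bullet>\<bullet> (x \<bullet>\<bullet> A)"] unfolding as .
  have IPd: "?I' \<bullet>\<bullet> (?P' \<bullet>\<bullet> (d \<bullet>\<bullet> A)) = d \<bullet>\<bullet> A - ?C' \<bullet>\<bullet> (?R' \<bullet>\<bullet> (d \<bullet>\<bullet> A))" for A
  proof -
    have "?I' \<bullet>\<bullet> (?P' \<bullet>\<bullet> (d \<bullet>\<bullet> A)) = (?I' \<bullet>\<bullet> ?P') \<bullet>\<bullet> (d \<bullet>\<bullet> A)" by (simp only: as)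
    also have "\<dots> = (idm t \<bullet>\<bullet> d) \<bullet>\<bullet> A - ?C' \<bullet>\<bullet> (?R' \<bullet>\<bullet> (d \<bullet>\<bullet> A))" unfolding IP di as ..
    finally show ?thesis unfolding idl[OF d lens(2)] .
  qed
  have 2: "d \<bullet>\<bullet> q' = ?I' \<bullet>\<bullet> d'"
    unfolding d'_def q'_def di IPd CRd by simp
  have 3: "q' \<bullet>\<bullet> ?P = idm s + (- H) \<bullet>\<bullet> d"
    unfolding q'_def di as dI HdCR un unfolding IP by simp
  have 4: "?I' \<bullet>\<bullet> p = idm t + d \<bullet>\<bullet> (- H)"
  proof -
    have "?I' \<bullet>\<bullet> p = ?I' \<bullet>\<bullet> ?P' - (d \<bullet>\<bullet> H - ?C' \<bullet>\<bullet> (?R' \<bullet>\<bullet> (d \<bullet>\<bullet> H)))"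
      unfolding p_def di IPd ..
    also have "\<dots> = idm t - ?C' \<bullet>\<bullet> ?R' - (d \<bullet>\<bullet> H - ?C' \<bullet>\<bullet> ?R')" unfolding RdH IP ..
    finally show ?thesis unfolding un by simp
  qed
  have 5: "?P \<bullet>\<bullet> q' = idm ?s" unfolding q'_def di as[symmetric] PH rs ze by simp
  have 6: "p \<bullet>\<bullet> ?I' = idm ?t" unfolding p_def di as HI rt ze by simp
  have "heq (tt s t d) (tt ?s ?t d')"
  proof (rule heq_tt[OF hs(1) hp _ hq' ht(2) _ hm_uminus[OF hH] _ _ hm_zero])
    show "mmul (length ?s) d' ?P = mmul (length t) p d" using 1 by (simp only: big[OF hd' lens(3)] big[OF hp lens(2)])
    show "mmul (length s) d q' = mmul (length ?t) ?I' d'" using 2 by (simp only: big[OF d lens(1)] big[OF ht(2) lens(4)])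
    show "mmul (length ?s) q' ?P = idm s + mmul (length t) (- H) d"
      using 3 by (simp only: big[OF hq' lens(3)] big[OF hm_uminus[OF hH] lens(2)])
    show "mmul (length ?t) ?I' p = idm t + mmul (length s) d (- H)"
      using 4 by (simp only: big[OF ht(2) lens(4)] big[OF d lens(1)])
    show "mmul (length s) ?P q' = idm ?s + mmul (length ?t) 0 d'" using 5 by (simp add: big[OF hs(1) lens(1)])
    show "mmul (length t) p ?I' = idm ?t + mmul (length ?s) d' 0" using 6 by (simp add: big[OF hp lens(2)])
  qed
  then show ?thesis using that hd' by blast
qed

end

section \<open>Minimal complexes, sign coherence and indecomposability\<close>

context alg_pair
begin

text \<open>An entry outside \<open>Jac\<close> joins equal labels, as off-diagonal corners are
  radical, and is invertible. Eliminating it removes the same label from both degrees, which leaves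
  the class unchanged.\<close>

lemma minimal_exists:
  assumes "hm s t d"
  shows "\<exists>s' t' d'. hm s' t' d' \<and> Jm d' \<and> heq (tt s t d) (tt s' t' d') \<and> K0class (tt s t d) = K0class (tt s' t' d')"
  using assms
proof (induction "length s" arbitrary: s t d rule: less_induct)
  case less
  show ?case
  proof (cases "Jm d")
    case True then show ?thesis using less.prems heq_refl cx_tt by blast
  next
    case False
    then obtain i j where ij: "d i j \<notin> Jac" by (auto simp: Jm_def)
    have "i < length t \<and> j < length s"
      by (rule ccontr) (use hmD0[OF less.prems, of i j] Jac_zero ij in auto)
    then have il: "i < length t" "j < length s" by auto
    have b: "t ! i = s ! j" using hmD[OF less.prems il] Jac_off ij by blast
    then have c: "d i j \<in> Co (s ! j) (s ! j)" using hmD[OF less.prems il] by simp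
    obtain w where "w \<in> Co (s ! j) (s ! j)" "d i j * w = L (s ! j)" "w * d i j = L (s ! j)"
      using not_Jac_inverse[OF c ij] by blast
    then obtain d' where d': "hm (del j s) (del i t) d'" "heq (tt s t d) (tt (del j s) (del i t) d')"
      using gauss_elim[OF less.prems il b] by blast
    have "length (del j s) < length s" using il by (simp add: length_del)
    from less.hyps[OF this d'(1)] obtain s' t' d'' where *: "hm s' t' d''" "Jm d''"
      "heq (tt (del j s) (del i t) d') (tt s' t' d'')" "K0class (tt (del j s) (del i t) d') = K0class (tt s' t' d'')" by blast
    have "K0class (tt s t d) = K0class (tt (del j s) (del i t) d')"
      unfolding K0class_tt using cnt_del[OF il(1)] cnt_del[OF il(2)] b by auto
    then show ?thesis using * heq_trans[OF d'(2) *(3)] by metis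
  qed
qed

text \<open>A contraction writes the identities of both degrees as products with \<open>d\<close>,
  hence with entries in \<open>Jac\<close>, which is impossible for a nonempty list.\<close>

lemma not_heq_zero:
  assumes "hm s t d" "Jm d" "heq (tt s t d) zero_cplx"
  shows "s = [] \<and> t = []"
proof -
  obtain f g where fg: "cm (tt s t d) zero_cplx f" "cm zero_cplx (tt s t d) g"
    "hty (tt s t d) (tt s t d) (comp_map zero_cplx g f) (idc (tt s t d))"
    using assms(3) by (rule heqE)
  have "comp_map zero_cplx g f = 0" by (auto simp: comp_map_def zero_cplx_def)
  then have "nh (tt s t d) (tt s t d) (idc (tt s t d))"
    using fg(3) nh_uminus[of "tt s t d" "tt s t d" "0 - idc (tt s t d)"] unfolding homotopic_alt by simp
  then obtain h where "idm s = mmul (length t) h d" "idm t = mmul (length s) d h"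
    unfolding idc_tt nh_tt_iff mp_eq_iff by blast
  then have "Jm (idm s)" "Jm (idm t)" using Jm_mmul assms(2) by metis+
  then show ?thesis using not_Jm_idm by blast
qed

lemma tt_empty: "tt [] [] 0 = zero_cplx"
  by (auto simp: tt_def zero_cplx_def fun_eq_iff)

text \<open>A common label gives a matrix unit from degree -1 to degree 0. Between minimal complexes
  homotopies only produce entries in \<open>Jac\<close>, and \<open>L b\<close> is not one of
  them.\<close>

lemma sign_coherent:
  assumes d: "hm s t d" "Jm d" "hm s' t' d'" "Jm d'" and c: "cmp s t d s' t' d'"
  shows "set s \<inter> set t' = {}"
proof (rule ccontr)
  assume "set s \<inter> set t' \<noteq> {}"
  then obtain x where "x \<in> set s" "x \<in> set t'" by blast
  then obtain i j where ij: "j < length s" "i < length t'" "s ! j = t' ! i" by (metis in_set_conv_nth)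
  define f :: "'a mat" where "f = (\<lambda>k l. if k = i \<and> l = j then L (s ! j) else 0)"
  have "hm s t' f" using ij by (intro hmI) (auto simp: f_def)
  then obtain p q where "f = mmul (length t) p d + mmul (length s') d' q" using c unfolding cmp_def by blast
  then have "Jm f" using d Jm_mmul Jm_add by metis
  then have "f i j \<in> Jac" by (simp add: Jm_def)
  then show False using L_notin_Jac by (simp add: f_def)
qed

lemma one_sided_indec:
  assumes i: "indecomposable e1 e2 C" and C: "C = tt [] t 0 \<or> C = tt t [] 0"
  shows "\<exists>b. t = [b]"
proof (cases t)
  case Nil
  then have "C = zero_cplx" using C tt_empty by auto
  then show ?thesis using i heq_refl[OF cx_zero] unfolding indecomposable_def by simp
next
  case (Cons b l)
  have J0: "Jm 0" by (simp add: Jm_def Jac_zero)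
  have "l = []"
  proof -
    obtain X Y where XY: "C = dsum X Y" "X = tt [] [b] 0 \<and> Y = tt [] l 0 \<or> X = tt [b] [] 0 \<and> Y = tt l [] 0"
    proof -
      have "dsum (tt [] [b] 0) (tt [] l 0) = tt [] (b # l) (0 :: 'a mat)"
        "dsum (tt [b] [] 0) (tt l [] 0) = tt (b # l) [] (0 :: 'a mat)"
        by (simp_all add: dsum_tt blk_zero)
      then show ?thesis using C that unfolding Cons by metis
    qed
    then have cx: "cx X" "cx Y" using cx_tt[OF hm_zero] by auto
    have "heq C (dsum X Y)" unfolding XY(1) by (rule heq_refl[OF cx_dsum[OF cx]])
    then have "heq X zero_cplx \<or> heq Y zero_cplx" using i cx unfolding indecomposable_def by blast
    then show ?thesis using XY(2) not_heq_zero[OF hm_zero J0] by blast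
  qed
  then show ?thesis using Cons by simp
qed

text \<open>The last unknown is eliminated: \<open>L b - \<pi> r r\<close> is invertible, and the
  coefficients after substitution stay in \<open>Jac\<close>.\<close>

lemma nakayama_elements:
  fixes r :: nat
  assumes "\<forall>i<r. \<forall>j<r. \<pi> i j \<in> Co b b \<and> \<pi> i j \<in> Jac"
    and "\<forall>i<r. g i \<in> Co b b \<and> g i = (\<Sum>j<r. \<pi> i j * g j)"
  shows "\<forall>i<r. g i = 0"
  using assms
proof (induction r arbitrary: \<pi>)
  case 0 then show ?case by simp
next
  case (Suc r)
  have "\<pi> r r \<in> lc.nonunits b" using Suc.prems(1) Jac_corner by blast
  then obtain v where v: "v \<in> Co b b" "v * (L b - \<pi> r r) = L b"
    using lc.inv_el_u_minus unfolding lc.inv_el_def by blast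
  have gi: "g i \<in> Co b b" "g i = (\<Sum>j<r. \<pi> i j * g j) + \<pi> i r * g r" if "i < Suc r" for i
    using Suc.prems(2) that unfolding sum.lessThan_Suc by blast+
  note gr = gi[OF lessI]
  have "(L b - \<pi> r r) * g r = g r - \<pi> r r * g r" using gr(1) by (simp add: algebra_simps Co_iff)
  also have "\<dots> = (\<Sum>j<r. \<pi> r j * g j)" unfolding diff_eq_eq by (rule gr(2))
  finally have "v * (L b - \<pi> r r) * g r = v * (\<Sum>j<r. \<pi> r j * g j)" by (simp add: mult.assoc)
  then have gr': "g r = v * (\<Sum>j<r. \<pi> r j * g j)" using v(2) gr(1) by (simp add: Co_iff)
  let ?p = "\<lambda>i j. \<pi> i j + \<pi> i r * v * \<pi> r j"
  have "\<forall>i<r. \<forall>j<r. ?p i j \<in> Co b b \<and> ?p i j \<in> Jac"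
    using Suc.prems(1) v(1) by (auto intro!: Co_add Jac_add Co_mult[of _ b b] Jac_mult)
  moreover have "\<forall>i<r. g i \<in> Co b b \<and> g i = (\<Sum>j<r. ?p i j * g j)"
  proof (intro allI impI conjI)
    fix i assume i: "i < r"
    show "g i \<in> Co b b" using gi(1) i by simp
    have "g i = (\<Sum>j<r. \<pi> i j * g j) + \<pi> i r * g r" by (rule gi(2)) (use i in simp)
    also have "\<pi> i r * g r = (\<Sum>j<r. \<pi> i r * v * \<pi> r j * g j)"
      by (subst gr') (simp add: sum_distrib_left mult.assoc)
    finally show "g i = (\<Sum>j<r. ?p i j * g j)" by (simp add: distrib_right sum.distrib)
  qed
  ultimately have z: "\<forall>i<r. g i = 0" by (rule Suc.IH)
  then have "g r = 0" using gr' by simp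
  then show ?case using z by (simp add: less_Suc_eq)
qed

abbreviation rp :: "nat \<Rightarrow> bool \<Rightarrow> bool list" where "rp n x \<equiv> replicate n x"

text \<open>Each column of \<open>P\<close> is a solution of \<open>g = P g\<close>, to which the
  elimination applies.\<close>

lemma idem_Jm_zero:
  assumes P: "hm (rp n x) (rp n x) P" "mmul n P P = P" "Jm P"
  shows "P = 0"
proof (intro ext)
  fix i j
  show "P i j = 0 i j"
  proof (cases "i < n \<and> j < n")
    case False then show ?thesis using hmD0[OF P(1), of i j] by auto
  next
    case True
    have co: "P k l \<in> Co x x" if "k < n" "l < n" for k l using hmD[OF P(1), of k l] that by simp
    have "\<forall>k<n. P k j = 0"
    proof (rule nakayama_elements[of n P x])
      show "\<forall>i<n. \<forall>j<n. P i j \<in> Co x x \<and> P i j \<in> Jac" using co P(3) by (simp add: Jm_def)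
      show "\<forall>i<n. P i j \<in> Co x x \<and> P i j = (\<Sum>k<n. P i k * P k j)"
        using co True fun_cong[OF fun_cong[OF P(2)]] by (simp add: mmul_def)
    qed
    then show ?thesis using True by simp
  qed
qed

text \<open>Idempotent matrices over a local ring split: in a factorization \<open>P = A B\<close> of least inner size,
  \<open>B A\<close> is the identity.\<close>

lemma split_idem:
  assumes P: "hm (rp n x) (rp n x) P" "mmul n P P = P"
  obtains r A B where "hm (rp r x) (rp n x) A" "hm (rp n x) (rp r x) B" "mmul r A B = P" "mmul n B A = idm (rp r x)"
proof -
  define Q where "Q r \<longleftrightarrow> (\<exists>A B. hm (rp r x) (rp n x) A \<and> hm (rp n x) (rp r x) B \<and> mmul r A B = P)" for r
  have "Q n" unfolding Q_def using P by blast
  then obtain r where r: "Q r" "\<And>r'. r' < r \<Longrightarrow> \<not> Q r'" by (metis exists_least_iff)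
  obtain A0 B0 where AB0: "hm (rp r x) (rp n x) A0" "hm (rp n x) (rp r x) B0" "mmul r A0 B0 = P"
    using r(1) unfolding Q_def by blast
  define A where "A = mmul n P A0"
  define B where "B = mmul n B0 P"
  have hA: "hm (rp r x) (rp n x) A" unfolding A_def by (rule hm_mmul[OF P(1) AB0(1)]) simp
  have hB: "hm (rp n x) (rp r x) B" unfolding B_def by (rule hm_mmul[OF AB0(2) P(1)]) simp
  have AB: "mmul r A B = P"
  proof -
    have "mmul r A B = mmul n P (mmul n (mmul r A0 B0) P)" unfolding A_def B_def by (simp only: mmul_assoc)
    then show ?thesis using AB0(3) P(2) by simp
  qed
  have PA: "mmul n P A = A" unfolding A_def using P(2) by (simp add: mmul_assoc[symmetric])
  let ?I = "idm (rp r x)"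
  have lr: "length (rp r x) = r" "length (rp n x) = n" by simp_all
  \<comment> \<open>The matrix \<open>\<rho>\<close> is idempotent and satisfies
    \<open>A \<rho> = 0\<close>. If it is nonzero, it has an invertible entry, and the corresponding
    column expresses one column of \<open>A\<close> by the others, against the minimality of
    \<open>r\<close>.\<close>
  define \<rho> where "\<rho> = ?I - mmul n B A"
  have hBA: "hm (rp r x) (rp r x) (mmul n B A)" by (rule hm_mmul[OF hB hA]) simp
  have h\<rho>: "hm (rp r x) (rp r x) \<rho>" unfolding \<rho>_def by (rule hm_diff[OF hm_idm hBA])
  have I: "mmul r ?I C = C" if "hm s (rp r x) C" for s C using mmul_idm_left[OF that] by simp
  have I': "mmul r C ?I = C" if "hm (rp r x) s C" for s C using mmul_idm_right[OF that] by simp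
  have A\<rho>: "mmul r A \<rho> = 0"
    unfolding \<rho>_def mmul_diff I'[OF hA] using PA AB by (simp add: mmul_assoc[symmetric])
  have "mmul r (mmul n B A) \<rho> = 0" unfolding mmul_assoc A\<rho> by simp
  then have \<rho>\<rho>: "mmul r \<rho> \<rho> = \<rho>" using I[OF h\<rho>] by (subst (1) \<rho>_def) (simp add: mmul_diff)
  have "mmul n B A = ?I"
  proof (rule ccontr)
    assume "mmul n B A \<noteq> ?I"
    then have "\<rho> \<noteq> 0" by (metis \<rho>_def eq_iff_diff_eq_0)
    then have "\<not> Jm \<rho>" using idem_Jm_zero[OF h\<rho> \<rho>\<rho>] by blast
    then obtain i j where ij: "\<rho> i j \<notin> Jac" by (auto simp: Jm_def)
    then have "i < r \<and> j < r" using hmD0[OF h\<rho>, of i j] Jac_zero by (metis lr(1))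
    then have il: "i < r" "j < r" by auto
    obtain w where w: "w \<in> Co x x" "\<rho> i j * w = L x"
      using not_Jac_inverse[OF _ ij] hmD[OF h\<rho>, of i j] il by auto
    \<comment> \<open>\<open>A'\<close> omits column \<open>i\<close> of \<open>A\<close>, and
      \<open>S\<close> rebuilds it: column \<open>i\<close> of \<open>S\<close> holds the
      coefficients read off from \<open>A \<rho> = 0\<close>.\<close>
    define A' where "A' = (\<lambda>k l. if l < r - 1 then A k (sk i l) else 0)"
    define S where "S = (\<lambda>l m. if l < r - 1 \<and> m < r then
       (if m = i then - (\<rho> (sk i l) j * w) else if m = sk i l then L x else 0) else 0)"
    have hA': "hm (rp (r - 1) x) (rp n x) A'"
      using hmD[OF hA] hmD0[OF hA] sk_less[OF il(1)] by (intro hmI) (auto simp: A'_def)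
    have hS: "hm (rp r x) (rp (r - 1) x) S"
      using hmD[OF h\<rho>] il w(1) sk_less[OF il(1)]
      by (intro hmI) (auto simp: S_def intro!: Co_uminus Co_mult[of _ x x])
    have "mmul (r - 1) A' S = A"
    proof (intro ext)
      fix k m
      show "mmul (r - 1) A' S k m = A k m"
      proof (cases "k < n \<and> m < r")
        case False
        then have "mmul (r - 1) A' S k m = 0"
          using hmD0[OF hm_mmul[OF hA' hS], of "r - 1" k m] by auto
        moreover have "A k m = 0" using hmD0[OF hA, of k m] False by auto
        ultimately show ?thesis by simp
      next
        case True
        have aco: "A k l \<in> Co x x" if "l < r" for l using hmD[OF hA, of k l] that True by simp
        show ?thesis
        proof (cases "m = i")
          case True
          have "0 = mmul r A \<rho> k j" unfolding A\<rho> by simp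
          also have "\<dots> = A k i * \<rho> i j + (\<Sum>l<r - 1. A k (sk i l) * \<rho> (sk i l) j)"
            unfolding mmul_def by (rule sum_sk[OF il(1)])
          finally have "A k i * \<rho> i j = - (\<Sum>l<r - 1. A k (sk i l) * \<rho> (sk i l) j)"
            by (metis add_eq_0_iff2)
          then have "A k i * \<rho> i j * w = - (\<Sum>l<r - 1. A k (sk i l) * \<rho> (sk i l) j) * w" by simp
          moreover have "A k i * \<rho> i j * w = A k i" using w(2) aco[OF il(1)] by (simp add: mult.assoc Co_iff)
          ultimately have "A k i = (\<Sum>l<r - 1. - (A k (sk i l) * \<rho> (sk i l) j * w))"
            by (simp add: sum_distrib_right sum_negf)
          also have "\<dots> = mmul (r - 1) A' S k m"
            unfolding mmul_def by (rule sum.cong) (use True il in \<open>auto simp: A'_def S_def mult.assoc\<close>)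
          finally show ?thesis using True by simp
        next
          case False
          then obtain l0 where l0: "l0 < r - 1" "m = sk i l0"
            using sk_surj[of m i r] \<open>k < n \<and> m < r\<close> il by blast
          have "mmul (r - 1) A' S k m = (\<Sum>l<r - 1. if l = l0 then A k m * L x else 0)"
            unfolding mmul_def
            by (rule sum.cong) (use l0 False \<open>k < n \<and> m < r\<close> sk_inj in \<open>auto simp: A'_def S_def\<close>)
          also have "\<dots> = A k m" using l0(1) aco[of m] \<open>k < n \<and> m < r\<close> by (simp add: Co_iff)
          finally show ?thesis .
        qed
      qed
    qed
    then have "mmul (r - 1) A' (mmul r S B) = P" using AB by (simp add: mmul_assoc[symmetric])
    moreover have "hm (rp n x) (rp (r - 1) x) (mmul r S B)" by (rule hm_mmul[OF hS hB]) simp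
    ultimately have "Q (r - 1)" unfolding Q_def using hA' by blast
    then show False using r(2)[of "r - 1"] il by simp
  qed
  then show ?thesis using that hA hB AB by blast
qed

definition ctt :: "'a ob \<Rightarrow> 'a cplx" where "ctt T = tt (sl T) (tl T) (df T)"

lemma cm_ctt: "cm (ctt T) (ctt U) f \<longleftrightarrow> (\<exists>q p. f = mp q p \<and> (q, p) \<in> mor T U)"
  unfolding ctt_def cm_tt_iff mor_def by simp

lemma cm_ctt_mp: "cm (ctt T) (ctt U) (mp (fst f) (snd f)) \<longleftrightarrow> f \<in> mor T U"
  unfolding ctt_def cm_mp mor_iff by simp

lemma comp_ctt: "comp_map (ctt U) (mp (fst g) (snd g)) (mp (fst f) (snd f)) = mp (fst (mulp U g f)) (snd (mulp U g f))"
  unfolding ctt_def comp_mp mulp_def by simp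

lemma idc_ctt: "idc (ctt T) = mp (fst (one T)) (snd (one T))"
  unfolding ctt_def idc_tt one_def by simp

lemma cx_ctt: "ok T \<Longrightarrow> cx (ctt T)"
  unfolding ok_def ctt_def by (rule cx_tt)

text \<open>These objects are automatically minimal, because their entries lie in an off-diagonal
  corner.\<close>

lemma ok_Jm: "ok T \<Longrightarrow> Jm (df T)"
  unfolding Jm_def
proof (intro allI)
  fix i j assume "ok T"
  then have h: "hm (sl T) (tl T) (df T)" by (simp add: ok_def)
  show "df T i j \<in> Jac"
  proof (cases "i < na T \<and> j < nb T")
    case True
    then have "df T i j \<in> XX" using hmD[OF h, of i j] by (simp add: sl_def tl_def)
    then show ?thesis by (rule Jac_off) simp
  next
    case False then show ?thesis using hmD0[OF h, of i j] Jac_zero by auto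
  qed
qed

lemma one_zero_iff: "one T = 0 \<longleftrightarrow> na T = 0 \<and> nb T = 0"
proof
  assume "one T = 0"
  then have "Jm (idm (sl T))" "Jm (idm (tl T))" by (auto simp: one_def zero_prod_def Jm_def Jac_zero)
  then have "sl T = []" "tl T = []" using not_Jm_idm by blast+
  then show "na T = 0 \<and> nb T = 0" by (simp add: sl_def tl_def)
next
  assume "na T = 0 \<and> nb T = 0"
  then show "one T = 0" by (simp add: one_def sl_def tl_def id_mat_def zero_prod_def zero_fun_def)
qed

lemma nh_ctt:
  assumes "ok T" "ok U" "nh (ctt T) (ctt U) (mp (fst f) (snd f))"
  shows "Jm (fst f)" "Jm (snd f)"
proof -
  obtain h where "fst f = mmul (length (tl T)) h (df T)" "snd f = mmul (length (sl U)) (df U) h"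
    using assms(3) unfolding ctt_def nh_tt_iff mp_eq_iff by blast
  then show "Jm (fst f)" "Jm (snd f)" using Jm_mmul ok_Jm assms by metis+
qed

lemma Jm_rad:
  assumes T: "loc T" and f: "f \<in> mor T T" "Jm (fst f)" "Jm (snd f)"
  shows "f \<in> rad T"
proof (rule ccontr)
  assume "f \<notin> rad T"
  then obtain g where "mulp T f g = one T" using unt_inverse[OF T f(1)] by blast
  then have "idm (sl T) = mmul (nb T) (fst f) (fst g)" "idm (tl T) = mmul (na T) (snd f) (snd g)"
    by (auto simp: mulp_def one_def)
  then have "Jm (idm (sl T))" "Jm (idm (tl T))" using Jm_mmul f by metis+
  then have "sl T = []" "tl T = []" using not_Jm_idm by blast+
  then have "one T = 0" unfolding one_zero_iff by (simp add: sl_def tl_def)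
  then show False using locD(10)[OF T] by simp
qed

text \<open>Homotopies between these objects are radical, so the composite of the two maps is the
  identity up to a radical term and therefore invertible.\<close>

lemma heq_iso:
  assumes T: "loc T" and U: "loc U" and h: "heq (ctt T) (ctt U)"
  shows "iso T U"
proof -
  obtain f g where fg: "cm (ctt T) (ctt U) f" "cm (ctt U) (ctt T) g"
    "hty (ctt T) (ctt T) (comp_map (ctt U) g f) (idc (ctt T))" using h by (rule heqE)
  obtain F G where F: "f = mp (fst F) (snd F)" "F \<in> mor T U" and G: "g = mp (fst G) (snd G)" "G \<in> mor U T"
    using fg(1,2) unfolding cm_ctt by (metis fst_conv snd_conv)
  let ?N = "mulp U G F - one T"
  have "nh (ctt T) (ctt T) (mp (fst ?N) (snd ?N))"
    using fg(3) unfolding homotopic_alt F G comp_ctt idc_ctt mp_diff by simp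
  then have J: "Jm (fst ?N)" "Jm (snd ?N)" using nh_ctt locD(1)[OF T] by blast+
  have o: "one T \<in> mor T T" by (rule one_mor[OF locD(1)[OF T]])
  have "?N \<in> mor T T" using mor_add[OF mor_comp[OF F(2) G(2)] mor_uminus[OF o]] by simp
  then have "?N \<in> rad T" using Jm_rad[OF T] J by blast
  moreover have "unt T (one T)" unfolding unt_def using o mulp_one(1)[OF o] by blast
  ultimately have "unt T (one T + ?N)" using locD(12)[OF T] by blast
  then have "unt T (mulp U G F)" by simp
  then show ?thesis using unt_comp_iso[OF T U F(2) G(2)] by blast
qed

lemma iso_heq:
  assumes "iso T U" shows "heq (ctt T) (ctt U)"
proof -
  obtain f g where fg: "f \<in> mor T U" "g \<in> mor U T" "mulp U g f = one T" "mulp T f g = one U"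
    using assms unfolding iso_def by blast
  show ?thesis
    by (rule heqI[of _ _ "mp (fst f) (snd f)" "mp (fst g) (snd g)"])
      (use fg hty_refl in \<open>simp_all add: cm_ctt_mp comp_ctt idc_ctt\<close>)
qed

lemma heq_dsumI:
  assumes X: "cx X" and Y: "cx Y" and m: "cm T X f1" "cm T Y f2" "cm X T g1" "cm Y T g2"
    and r: "comp_map T f1 g1 = idc X" "comp_map T f2 g2 = idc Y" "comp_map T f1 g2 = 0" "comp_map T f2 g1 = 0"
      "comp_map X g1 f1 + comp_map Y g2 f2 = idc T"
  shows "heq T (dsum X Y)"
proof -
  note d = dsum_maps[OF X Y]
  let ?f = "comp_map X (pl X Y) f1 + comp_map Y (ir X Y) f2"
  let ?g = "comp_map X g1 (pl X Y) + comp_map Y g2 (pr X Y)"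
  have f: "cm T (dsum X Y) ?f" by (intro cm_add cm_comp[OF m(1) d(2)] cm_comp[OF m(2) d(4)])
  have g: "cm (dsum X Y) T ?g" by (intro cm_add cm_comp[OF d(1) m(3)] cm_comp[OF d(3) m(4)])
  have l: "comp_map (dsum X Y) (comp_map A a b) c = comp_map A a (comp_map (dsum X Y) b c)" for A a b c
    by (simp only: comp_assoc)
  have e1: "comp_map (dsum X Y) (pl X Y) ?f = f1" "comp_map (dsum X Y) (pr X Y) ?f = f2"
    unfolding comp_add comp_assoc dsum_comps comp_idc(2)[OF m(1)] comp_idc(2)[OF m(2)] by simp_all
  have "comp_map (dsum X Y) ?g ?f = idc T"
    unfolding comp_add(1) l e1 using r(5) .
  moreover have "comp_map T ?f ?g = idc (dsum X Y)"
  proof -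
    have e2: "comp_map T f1 ?g = pl X Y" "comp_map T f2 ?g = pr X Y"
      unfolding comp_add comp_assoc r comp_idc(2)[OF d(1)] comp_idc(2)[OF d(3)] by simp_all
    have "comp_map T ?f ?g = comp_map X (pl X Y) (comp_map T f1 ?g) + comp_map Y (ir X Y) (comp_map T f2 ?g)"
      unfolding comp_add(1)[of T] by (simp only: comp_assoc)
    then show ?thesis unfolding e2 dsum_comps .
  qed
  ultimately show ?thesis using heqI[OF f g] hty_refl by metis
qed

text \<open>An idempotent chain map splits in each degree by \<open>split_idem\<close>, and the
  splittings turn \<open>ctt T\<close> into a direct sum of two minimal complexes. One of them is
  contractible, hence empty, so the idempotent is trivial; Fitting's lemma then gives
  locality.\<close>

lemma indec_loc:
  assumes T: "ok T" and i: "indecomposable e1 e2 (ctt T)"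
  shows "loc T"
proof (rule locI[OF T])
  show "one T \<noteq> 0"
  proof
    assume "one T = 0"
    then have z: "na T = 0" "nb T = 0" unfolding one_zero_iff by auto
    then have "sl T = []" "tl T = []" by (simp_all add: sl_def tl_def)
    moreover from this have "df T = 0" using T unfolding ok_def by (simp add: hm_empty)
    ultimately have "ctt T = zero_cplx" unfolding ctt_def by (simp add: tt_empty)
    then show False using i heq_refl[OF cx_zero] unfolding indecomposable_def by simp
  qed
  fix f assume f: "f \<in> mor T T" "mulp T f f = f"
  define g where "g = one T - f"
  note o = one_mor[OF T]
  have g: "g \<in> mor T T" unfolding g_def using mor_add[OF o mor_uminus[OF f(1)]] by simp
  interpret R: ring_on "mor T T" "mulp T" "one T" by (rule ring_on_mor[OF T])
  have fg: "mulp T f g = 0" "mulp T g f = 0" "mulp T g g = g"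
    using f o by (simp_all add: g_def R.mul_diffG R.diffG mulp_one)
  have split: "\<exists>r r' A B A' B'. hm (rp r True) (tl T) A \<and> hm (tl T) (rp r True) B \<and> mmul r A B = snd h
      \<and> mmul (na T) B A = idm (rp r True) \<and> hm (rp r' False) (sl T) A' \<and> hm (sl T) (rp r' False) B'
      \<and> mmul r' A' B' = fst h \<and> mmul (nb T) B' A' = idm (rp r' False)"
    if h: "h \<in> mor T T" "mulp T h h = h" for h
  proof -
    have "mmul (na T) (snd h) (snd h) = snd h" "mmul (nb T) (fst h) (fst h) = fst h"
      using h(2) by (auto simp: mulp_def prod_eq_iff)
    note sq = this
    obtain r' A' B' where 1: "hm (rp r' False) (rp (nb T) False) A'" "hm (rp (nb T) False) (rp r' False) B'"
      "mmul r' A' B' = fst h" "mmul (nb T) B' A' = idm (rp r' False)"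
      by (rule split_idem[OF mor_mats(1)[OF h(1), unfolded sl_def] sq(2)])
    obtain r A B where 2: "hm (rp r True) (rp (na T) True) A" "hm (rp (na T) True) (rp r True) B"
      "mmul r A B = snd h" "mmul (na T) B A = idm (rp r True)"
      by (rule split_idem[OF mor_mats(2)[OF h(1), unfolded tl_def] sq(1)])
    show ?thesis unfolding sl_def tl_def
      by (rule exI[of _ r], rule exI[of _ r'], rule exI[of _ A], rule exI[of _ B], rule exI[of _ A'], rule exI[of _ B'])
        (intro conjI 1 2)
  qed
  obtain r s A B C D where f1: "hm (rp r True) (tl T) A" "hm (tl T) (rp r True) B" "mmul r A B = snd f"
      "mmul (na T) B A = idm (rp r True)" "hm (rp s False) (sl T) C" "hm (sl T) (rp s False) D"
      "mmul s C D = fst f" "mmul (nb T) D C = idm (rp s False)"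
    using split[OF f] by blast
  obtain r' s' A' B' C' D' where g1: "hm (rp r' True) (tl T) A'" "hm (tl T) (rp r' True) B'" "mmul r' A' B' = snd g"
      "mmul (na T) B' A' = idm (rp r' True)" "hm (rp s' False) (sl T) C'" "hm (sl T) (rp s' False) D'"
      "mmul s' C' D' = fst g" "mmul (nb T) D' C' = idm (rp s' False)"
    using split[OF g fg(3)] by blast
  define X where "X = tt (rp s False) (rp r True) (mmul (na T) B (mmul (nb T) (df T) C))"
  define Y where "Y = tt (rp s' False) (rp r' True) (mmul (na T) B' (mmul (nb T) (df T) C'))"
  have hd: "hm (sl T) (tl T) (df T)" using T by (simp add: ok_def)
  have piece: "cm (ctt T) (tt (rp s False) (rp r True) (mmul (na T) B (mmul (nb T) (df T) C))) (mp D B)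
      \<and> cm (tt (rp s False) (rp r True) (mmul (na T) B (mmul (nb T) (df T) C))) (ctt T) (mp C A)
      \<and> hm (rp s False) (rp r True) (mmul (na T) B (mmul (nb T) (df T) C))
      \<and> Jm (mmul (na T) B (mmul (nb T) (df T) C))"
    if h: "h \<in> mor T T" and a: "hm (rp r True) (tl T) A" "hm (tl T) (rp r True) B" "mmul r A B = snd h"
      "mmul (na T) B A = idm (rp r True)" "hm (rp s False) (sl T) C" "hm (sl T) (rp s False) D"
      "mmul s C D = fst h" "mmul (nb T) D C = idm (rp s False)" for h A B C D r s
  proof -
    let ?d = "mmul (na T) B (mmul (nb T) (df T) C)"
    have hd': "hm (rp s False) (rp r True) ?d"
      by (rule hm_mmul[OF a(2) hm_mmul[OF hd a(5)]]) simp_all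
    have "mmul s ?d D = mmul (na T) B (mmul (nb T) (df T) (mmul s C D))" by (simp only: mmul_assoc)
    also have "\<dots> = mmul (na T) B (mmul (na T) (mmul r A B) (df T))" unfolding a(3,7) mor_mats(3)[OF h] ..
    also have "\<dots> = mmul r (mmul (na T) B A) (mmul (na T) B (df T))" by (simp only: mmul_assoc)
    also have "\<dots> = mmul (na T) B (df T)"
      unfolding a(4) by (rule mmul_idm_left[OF hm_mmul[OF a(2) hd]]) simp_all
    finally have 1: "mmul s ?d D = mmul (na T) B (df T)" .
    have "mmul r A ?d = mmul (na T) (mmul r A B) (mmul (nb T) (df T) C)" by (simp only: mmul_assoc)
    also have "\<dots> = mmul (nb T) (mmul (na T) (snd h) (df T)) C" unfolding a(3) by (simp only: mmul_assoc)
    also have "\<dots> = mmul (nb T) (mmul (nb T) (df T) (fst h)) C" unfolding mor_mats(3)[OF h] ..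
    also have "\<dots> = mmul s (mmul (nb T) (df T) C) (mmul (nb T) D C)"
      unfolding a(7)[symmetric] by (simp only: mmul_assoc)
    also have "\<dots> = mmul (nb T) (df T) C"
      unfolding a(8) by (rule mmul_idm_right[OF hm_mmul[OF hd a(5)]]) simp_all
    finally have 2: "mmul r A ?d = mmul (nb T) (df T) C" .
    have "Jm ?d" by (rule Jm_mmul, rule disjI2, rule Jm_mmul, rule disjI1, rule ok_Jm[OF T])
    then show ?thesis unfolding ctt_def cm_mp using a hd' 1 2 by simp
  qed
  note pX = piece[OF f(1) f1, folded X_def] and pY = piece[OF g g1, folded Y_def]
  have cx: "cx X" "cx Y" unfolding X_def Y_def using pX pY by (auto intro: cx_tt)
  have cross: "mmul (nb T) D C' = 0" "mmul (na T) B A' = 0" "mmul (nb T) D' C = 0" "mmul (na T) B' A = 0"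
  proof -
    \<comment> \<open>Inserting the identities \<open>b a\<close> and \<open>b' a'\<close> on the
      two sides exposes the product of the two orthogonal idempotents in the middle.\<close>
    have gen: "mmul n b a' = 0"
      if "hm (rp n x) (rp k x) b" "hm (rp k x) (rp n x) a" "hm (rp k' x) (rp n x) a'" "hm (rp n x) (rp k' x) b'"
        "mmul n b a = idm (rp k x)" "mmul n b' a' = idm (rp k' x)" "mmul n (mmul k a b) (mmul k' a' b') = 0"
      for n b a' k x a k' b'
    proof -
      have "mmul n b a' = mmul k (mmul n b a) (mmul n b a')"
        unfolding that(5) by (rule mmul_idm_left[OF hm_mmul[OF that(1,3)], symmetric]) simp_all
      also have "\<dots> = mmul k' (mmul k (mmul n b a) (mmul n b a')) (mmul n b' a')"
        unfolding that(6) by (rule mmul_idm_right[OF hm_mmul[OF hm_mmul[OF that(1,2)] hm_mmul[OF that(1,3)]], symmetric]) simp_all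
      also have "\<dots> = mmul n b (mmul n (mmul n (mmul k a b) (mmul k' a' b')) a')"
        by (simp only: mmul_assoc)
      finally show ?thesis unfolding that(7) by simp
    qed
    have z: "mmul (nb T) (fst f) (fst g) = 0" "mmul (na T) (snd f) (snd g) = 0"
      "mmul (nb T) (fst g) (fst f) = 0" "mmul (na T) (snd g) (snd f) = 0"
      using fg by (auto simp: mulp_def zero_prod_def)
    show "mmul (nb T) D C' = 0"
      by (rule gen[of _ False s _ C s' _ D']) (use f1 g1 z in \<open>simp_all add: sl_def\<close>)
    show "mmul (na T) B A' = 0"
      by (rule gen[of _ True r _ A r' _ B']) (use f1 g1 z in \<open>simp_all add: tl_def\<close>)
    show "mmul (nb T) D' C = 0"
      by (rule gen[of _ False s' _ C' s _ D]) (use f1 g1 z in \<open>simp_all add: sl_def\<close>)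
    show "mmul (na T) B' A = 0"
      by (rule gen[of _ True r' _ A' r _ B]) (use f1 g1 z in \<open>simp_all add: tl_def\<close>)
  qed
  have "heq (ctt T) (dsum X Y)"
  proof (rule heq_dsumI[OF cx, of _ "mp D B" "mp D' B'" "mp C A" "mp C' A'"])
    show "cm (ctt T) X (mp D B)" "cm (ctt T) Y (mp D' B')" "cm X (ctt T) (mp C A)" "cm Y (ctt T) (mp C' A')"
      using pX pY by auto
    show "comp_map (ctt T) (mp D B) (mp C A) = idc X" "comp_map (ctt T) (mp D' B') (mp C' A') = idc Y"
      unfolding X_def Y_def ctt_def comp_mp idc_tt using f1 g1 by simp_all
    show "comp_map (ctt T) (mp D B) (mp C' A') = 0" "comp_map (ctt T) (mp D' B') (mp C A) = 0"
      unfolding ctt_def comp_mp using cross by (simp_all add: mp_zero)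
    have "fst f + fst g = idm (sl T)" "snd f + snd g = idm (tl T)" by (simp_all add: g_def one_def)
    then show "comp_map X (mp C A) (mp D B) + comp_map Y (mp C' A') (mp D' B') = idc (ctt T)"
      unfolding X_def Y_def ctt_def comp_mp idc_tt mp_add using f1 g1 by simp
  qed
  then have "heq X zero_cplx \<or> heq Y zero_cplx" using i cx unfolding indecomposable_def by blast
  then show "f = 0 \<or> f = one T"
  proof
    assume "heq X zero_cplx"
    then have "s = 0" "r = 0" using not_heq_zero pX unfolding X_def by fastforce+
    then have "f = 0" using f1 by (simp add: prod_eq_iff)
    then show ?thesis ..
  next
    assume "heq Y zero_cplx"
    then have "s' = 0" "r' = 0" using not_heq_zero pY unfolding Y_def by fastforce+
    then have "g = 0" using g1 by (simp add: prod_eq_iff)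
    then show ?thesis by (simp add: g_def)
  qed
qed

lemma idm_Nil: "idm [] = 0" by (auto simp: id_mat_def fun_eq_iff)

lemma null_id_zero: assumes "cx Y" "nh Y Y (idc Y)" shows "heq Y zero_cplx"
proof (rule heqI[of _ _ 0 0])
  have "idc zero_cplx = 0" by (auto simp: zero_cplx_def id_mat_def fun_eq_iff)
  then show "hty zero_cplx zero_cplx (comp_map Y 0 0) (idc zero_cplx)" by (simp add: hty_refl)
  show "hty Y Y (comp_map zero_cplx 0 0) (idc Y)"
    using nh_uminus[OF assms(2)] by (simp add: homotopic_alt)
qed (rule cm_zero)+

text \<open>If the round trip of \<open>T\<close> through \<open>X\<close> has a right inverse, the
  identity of \<open>Y\<close> factors up to homotopy through the composite
  \<open>X -> T -> Y\<close>, which is null-homotopic.\<close>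

lemma unit_kills:
  assumes Y: "cx Y" and f: "cm T X fX" "cm T Y fY" "cm X T gX" "cm Y T gY"
    and z: "nh X Y (comp_map T fY gX)" and o: "hty Y Y (comp_map T fY gY) (idc Y)"
    and S: "cm T T S" "comp_map T (comp_map X gX fX) S = idc T"
  shows "heq Y zero_cplx"
proof (rule null_id_zero[OF Y])
  have "gY = comp_map T (comp_map T (comp_map X gX fX) S) gY" unfolding S(2) using comp_idc(2)[OF f(4)] by simp
  then have "comp_map T fY gY = comp_map X (comp_map T fY gX) (comp_map T fX (comp_map T S gY))"
    by (metis comp_assoc)
  moreover have "nh Y Y (comp_map X (comp_map T fY gX) (comp_map T fX (comp_map T S gY)))"
    by (rule nh_comp_right[OF z cm_comp[OF cm_comp[OF f(4) S(1)] f(1)]])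
  ultimately show "nh Y Y (idc Y)" using hty_nh[OF hty_sym[OF o]] by simp
qed

text \<open>The round trips of \<open>T\<close> through \<open>X\<close> and through
  \<open>Y\<close> add up to the identity modulo the radical. Locality makes one of them invertible,
  and \<open>unit_kills\<close> removes the other summand.\<close>

lemma loc_indec:
  assumes T: "loc T" shows "indecomposable e1 e2 (ctt T)"
  unfolding indecomposable_def
proof (intro conjI allI impI)
  note ok = locD(1)[OF T]
  show "cx (ctt T)" by (rule cx_ctt[OF ok])
  show "\<not> heq (ctt T) zero_cplx"
  proof
    assume "heq (ctt T) zero_cplx"
    then have "sl T = [] \<and> tl T = []" unfolding ctt_def
      using not_heq_zero ok ok_Jm[OF ok] unfolding ok_def by blast
    then have "one T = 0" unfolding one_zero_iff by (simp add: sl_def tl_def)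
    then show False using locD(10)[OF T] by simp
  qed
  fix X Y assume "cx X \<and> cx Y \<and> heq (ctt T) (dsum X Y)"
  then have X: "cx X" and Y: "cx Y" and h: "heq (ctt T) (dsum X Y)" by auto
  obtain f g where fg: "cm (ctt T) (dsum X Y) f" "cm (dsum X Y) (ctt T) g"
    "hty (ctt T) (ctt T) (comp_map (dsum X Y) g f) (idc (ctt T))"
    "hty (dsum X Y) (dsum X Y) (comp_map (ctt T) f g) (idc (dsum X Y))" using h by (rule heqE)
  note d = dsum_maps[OF X Y]
  define fX where "fX = comp_map (dsum X Y) (pl X Y) f"
  define fY where "fY = comp_map (dsum X Y) (pr X Y) f"
  define gX where "gX = comp_map (dsum X Y) g (pl X Y)"
  define gY where "gY = comp_map (dsum X Y) g (ir X Y)"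
  have m: "cm (ctt T) X fX" "cm (ctt T) Y fY" "cm X (ctt T) gX" "cm Y (ctt T) gY"
    unfolding fX_def fY_def gX_def gY_def using cm_comp fg d by blast+
  have mid: "hty A B (comp_map (ctt T) (comp_map (dsum X Y) v f) (comp_map (dsum X Y) g w)) (comp_map (dsum X Y) v w)"
    if "cm A (dsum X Y) w" "cm (dsum X Y) B v" for A B v w
  proof -
    have "hty A (dsum X Y) (comp_map (dsum X Y) (comp_map (ctt T) f g) w) w"
      using hty_right[OF fg(4) that(1)] comp_idc(2)[OF that(1)] by simp
    from hty_left[OF this that(2)] show ?thesis by (simp only: comp_assoc)
  qed
  have YX: "nh X Y (comp_map (ctt T) fY gX)" and XY: "nh Y X (comp_map (ctt T) fX gY)"
    using mid[OF d(2,3)] mid[OF d(4,1)] unfolding dsum_comps homotopic_alt fX_def fY_def gX_def gY_def by simp_all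
  have XX: "hty X X (comp_map (ctt T) fX gX) (idc X)" and YY: "hty Y Y (comp_map (ctt T) fY gY) (idc Y)"
    using mid[OF d(2,1)] mid[OF d(4,3)] unfolding dsum_comps fX_def fY_def gX_def gY_def by simp_all
  have sum: "comp_map X gX fX + comp_map Y gY fY = comp_map (dsum X Y) g f"
  proof -
    have "comp_map (dsum X Y) g f = comp_map (dsum X Y) g (comp_map (dsum X Y) (idc (dsum X Y)) f)"
      using comp_idc(2)[OF fg(1)] by simp
    also have "\<dots> = comp_map X gX fX + comp_map Y gY fY"
      unfolding dsum_comps(5)[symmetric] comp_add fX_def fY_def gX_def gY_def by (simp only: comp_assoc)
    finally show ?thesis by simp
  qed
  obtain A where A: "comp_map X gX fX = mp (fst A) (snd A)" "A \<in> mor T T"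
    using cm_comp[OF m(1,3)] unfolding cm_ctt by (metis fst_conv snd_conv)
  obtain B where B: "comp_map Y gY fY = mp (fst B) (snd B)" "B \<in> mor T T"
    using cm_comp[OF m(2,4)] unfolding cm_ctt by (metis fst_conv snd_conv)
  have o: "one T \<in> mor T T" by (rule one_mor[OF ok])
  let ?N = "A + B - one T"
  have "nh (ctt T) (ctt T) (mp (fst ?N) (snd ?N))"
    using fg(3) unfolding homotopic_alt sum[symmetric] A(1) B(1) idc_ctt mp_diff mp_add by simp
  then have J: "Jm (fst ?N)" "Jm (snd ?N)" using nh_ctt[OF ok ok] by blast+
  have "?N \<in> mor T T" using mor_add[OF mor_add[OF A(2) B(2)] mor_uminus[OF o]] by simp
  then have N: "?N \<in> rad T" using Jm_rad[OF T] J by blast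
  have "A \<notin> rad T \<or> B \<notin> rad T"
  proof (rule ccontr)
    assume "\<not> ?thesis"
    then have "A + B + (- ?N) \<in> rad T" using locD(4,5)[OF T] N by blast
    then have "one T \<in> rad T" by simp
    moreover have "unt T (one T)" unfolding unt_def using o mulp_one(1)[OF o] by blast
    ultimately show False using locD(3)[OF T] by blast
  qed
  then show "heq X zero_cplx \<or> heq Y zero_cplx"
  proof
    assume "A \<notin> rad T"
    then obtain S where S: "S \<in> mor T T" "mulp T A S = one T" using unt_inverse[OF T A(2)] by blast
    have "heq Y zero_cplx"
    proof (rule unit_kills[OF Y m YX YY])
      show "cm (ctt T) (ctt T) (mp (fst S) (snd S))" using S(1) by (simp only: cm_ctt_mp)
      show "comp_map (ctt T) (comp_map X gX fX) (mp (fst S) (snd S)) = idc (ctt T)"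
        unfolding A(1) comp_ctt S(2) idc_ctt ..
    qed
    then show ?thesis ..
  next
    assume "B \<notin> rad T"
    then obtain S where S: "S \<in> mor T T" "mulp T B S = one T" using unt_inverse[OF T B(2)] by blast
    have "heq X zero_cplx"
    proof (rule unit_kills[OF X m(2,1,4,3) XY XX])
      show "cm (ctt T) (ctt T) (mp (fst S) (snd S))" using S(1) by (simp only: cm_ctt_mp)
      show "comp_map (ctt T) (comp_map Y gY fY) (mp (fst S) (snd S)) = idc (ctt T)"
        unfolding B(1) comp_ctt S(2) idc_ctt ..
    qed
    then show ?thesis ..
  qed
qed

definition gvec :: "'a ob \<Rightarrow> real \<times> real" where "gvec U = (real (na U), - real (nb U))"

lemma K0class_ctt: "K0class (ctt U) = gvec U"
  unfolding ctt_def K0class_tt gvec_def by (simp add: sl_def tl_def cnt_replicate)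

lemma all_eq_replicate: "set l \<subseteq> {b} \<Longrightarrow> l = replicate (length l) b"
  by (induction l) auto

definition gpair :: "'a ob \<Rightarrow> 'a ob \<Rightarrow> bool" where
  "gpair U1 U2 \<longleftrightarrow> loc U1 \<and> loc U2 \<and> cmpo U1 U1 \<and> cmpo U1 U2 \<and> cmpo U2 U1 \<and> cmpo U2 U2 \<and> \<not> iso U1 U2"

text \<open>Sign coherence, applied to all four ordered pairs of minimal representatives, shows that
  no label occurs in both degrees. This leaves four patterns; outside \<open>P2^b -> P1^a\<close>
  bounds on the classes are enough.\<close>

lemma silting_cases:
  assumes "basic_silting_pair e1 e2 T1 T2"
  shows "(\<exists>U1 U2. gpair U1 U2 \<and> K0class T1 = gvec U1 \<and> K0class T2 = gvec U2)
    \<or> (\<forall>T\<in>{T1, T2}. fst (K0class T) \<le> 0 \<and> snd (K0class T) \<ge> 0)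
    \<or> (\<forall>T\<in>{T1, T2}. K0class T \<in> {(1, 0), (0, 1)})
    \<or> (\<forall>T\<in>{T1, T2}. K0class T \<in> {(-1, 0), (0, -1)})"
proof -
  have b: "two_term e1 e2 T1" "two_term e1 e2 T2" "indecomposable e1 e2 T1" "indecomposable e1 e2 T2"
    "\<not> heq T1 T2" "silting e1 e2 (dsum T1 T2)" using assms by (auto simp: basic_silting_pair_def)
  have cxT: "cx T1" "cx T2" using b(3,4) by (auto simp: indecomposable_def)
  have "hv (dsum T1 T2) ((shift ^^ 1) (dsum T1 T2))"
    using b(6) unfolding silting_def hv_def by (metis zero_less_one)
  then have hv: "hv T1 (shift T1)" "hv T1 (shift T2)" "hv T2 (shift T1)" "hv T2 (shift T2)"
    using cxT by (simp_all add: shift_dsum hv_dsum_left hv_dsum_right cx_shift cx_dsum)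
  have red: "\<exists>s t d. hm s t d \<and> Jm d \<and> heq T (tt s t d) \<and> K0class T = K0class (tt s t d)"
    if T: "two_term e1 e2 T" for T
  proof -
    obtain s t d where "hm s t d" "T = tt s t d" using T by (rule two_termE)
    then show ?thesis using minimal_exists by blast
  qed
  obtain s1 t1 d1 where m1: "hm s1 t1 d1" "Jm d1" "heq T1 (tt s1 t1 d1)" "K0class T1 = K0class (tt s1 t1 d1)"
    using red[OF b(1)] by blast
  obtain s2 t2 d2 where m2: "hm s2 t2 d2" "Jm d2" "heq T2 (tt s2 t2 d2)" "K0class T2 = K0class (tt s2 t2 d2)"
    using red[OF b(2)] by blast
  have i: "indecomposable e1 e2 (tt s1 t1 d1)" "indecomposable e1 e2 (tt s2 t2 d2)"
    using indec_heq b m1 m2 cx_tt by blast+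
  have c: "cmp s1 t1 d1 s1 t1 d1" "cmp s1 t1 d1 s2 t2 d2" "cmp s2 t2 d2 s1 t1 d1" "cmp s2 t2 d2 s2 t2 d2"
    using hv hv_heq m1(3) m2(3) heq_shift unfolding hv_shift_tt_iff[symmetric] by blast+
  have nh': "\<not> heq (tt s1 t1 d1) (tt s2 t2 d2)"
    using b(5) m1(3) m2(3) heq_trans heq_sym by blast
  have disj: "set s1 \<inter> set t1 = {}" "set s1 \<inter> set t2 = {}" "set s2 \<inter> set t1 = {}" "set s2 \<inter> set t2 = {}"
    using sign_coherent m1(1,2) m2(1,2) c by blast+
  let ?S = "set s1 \<union> set s2" and ?R = "set t1 \<union> set t2"
  have SR: "?S \<inter> ?R = {}" using disj by blast
  consider "?S \<subseteq> {False}" "?R \<subseteq> {True}" | "?S \<subseteq> {True}" "?R \<subseteq> {False}" | "?S = {}" | "?R = {}"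
  proof -
    have "True \<notin> ?S \<or> True \<notin> ?R" "False \<notin> ?S \<or> False \<notin> ?R" using SR by blast+
    moreover have "A \<subseteq> {False}" if "True \<notin> A" for A using that by (metis (full_types) insertI1 subsetI)
    moreover have "A \<subseteq> {True}" if "False \<notin> A" for A using that by (metis (full_types) insertI1 subsetI)
    moreover have "A = {}" if "True \<notin> A" "False \<notin> A" for A using that by (metis (full_types) equals0I)
    ultimately show ?thesis using that by metis
  qed
  then show ?thesis
  proof cases
    case 1
    define U1 where "U1 = (length t1, length s1, d1)"
    define U2 where "U2 = (length t2, length s2, d2)"
    have e: "sl U1 = s1" "tl U1 = t1" "df U1 = d1" "sl U2 = s2" "tl U2 = t2" "df U2 = d2"
      using 1 all_eq_replicate[of s1 False] all_eq_replicate[of t1 True] all_eq_replicate[of s2 False] all_eq_replicate[of t2 True]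
      by (simp_all add: U1_def U2_def sl_def tl_def na_def nb_def df_def)
    have ok: "ok U1" "ok U2" using m1 m2 by (simp_all add: ok_def e)
    have ct: "ctt U1 = tt s1 t1 d1" "ctt U2 = tt s2 t2 d2" by (simp_all add: ctt_def e)
    have "loc U1" "loc U2" using indec_loc ok i unfolding ct[symmetric] by blast+
    moreover have "\<not> iso U1 U2" using iso_heq nh' unfolding ct[symmetric] by blast
    ultimately have "gpair U1 U2" unfolding gpair_def cmpo_def e using c by blast
    then show ?thesis using m1(4) m2(4) K0class_ctt unfolding ct[symmetric] by metis
  next
    case 2
    have "fst (K0class (tt s t d)) \<le> 0 \<and> snd (K0class (tt s t d)) \<ge> 0" if "set s \<subseteq> {True}" "set t \<subseteq> {False}" for s t :: "bool list" and d :: "'a mat"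
    proof -
      have "K0class (tt (replicate (length s) True) (replicate (length t) False) d) = (- real (length s), real (length t))"
        unfolding K0class_tt by (simp add: cnt_replicate)
      then show ?thesis using all_eq_replicate[OF that(1)] all_eq_replicate[OF that(2)] by simp
    qed
    then show ?thesis using 2 m1(4) m2(4) by simp
  next
    case 3
    have "K0class (tt s t d) \<in> {(1, 0), (0, 1)}" if "s = []" "indecomposable e1 e2 (tt s t d)" "hm s t d" for s t d
    proof -
      have "d = 0" using that by (simp add: hm_empty)
      then have "\<exists>x. t = [x]" using that(1) by (intro one_sided_indec[OF that(2)]) simp
      then obtain x where "t = [x]" ..
      then show ?thesis using that(1) by (cases x) (simp_all add: K0class_tt cnt_def)
    qed
    then show ?thesis using 3 i m1 m2 by simp
  next
    case 4
    have "K0class (tt s t d) \<in> {(-1, 0), (0, -1)}" if "t = []" "indecomposable e1 e2 (tt s t d)" "hm s t d" for s t d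
    proof -
      have "d = 0" using that by (simp add: hm_empty)
      then have "\<exists>x. s = [x]" using that(1) by (intro one_sided_indec[OF that(2)]) simp
      then obtain x where "s = [x]" ..
      then show ?thesis using that(1) by (cases x) (simp_all add: K0class_tt cnt_def)
    qed
    then show ?thesis using 4 i m1 m2 by simp
  qed
qed

subsection \<open>Silting pairs from compatible pairs\<close>

lemma thick_dsum:
  assumes "cx X" "cx Y" "dsum X Y \<in> thick e1 e2 S"
  shows "X \<in> thick e1 e2 S" "Y \<in> thick e1 e2 S"
proof -
  show "X \<in> thick e1 e2 S" using thick.summand assms by blast
  note d = dsum_maps[OF assms(2,1)]
  have "heq (dsum Y X) (dsum X Y)"
  proof (rule heq_dsumI[OF assms(1,2) d(3,1,4,2)])
    show "comp_map X (ir Y X) (pr Y X) + comp_map Y (pl Y X) (pl Y X) = idc (dsum Y X)"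
      using dsum_comps(5)[of Y X] by (simp only: add.commute)
  qed (simp_all only: dsum_comps)
  then have "dsum Y X \<in> thick e1 e2 S" using thick.iso assms cx_dsum by blast
  then show "Y \<in> thick e1 e2 S" using thick.summand assms by blast
qed

lemma stalk_append: "dsum (stalk m l) (stalk m l') = stalk m (l @ l')"
  by (auto simp: dsum_def stalk_def fun_eq_iff blk_def)

lemma stalk_tt: "stalk 0 l = tt [] l 0" "stalk (-1) l = tt l [] 0"
  by (auto simp: stalk_def tt_def fun_eq_iff)

lemma silting_pairI:
  assumes g: "gpair U1 U2"
    and P: "\<And>S. ctt U1 \<in> thick e1 e2 S \<Longrightarrow> ctt U2 \<in> thick e1 e2 S \<Longrightarrow>
      stalk 0 [True] \<in> thick e1 e2 S \<and> stalk 0 [False] \<in> thick e1 e2 S"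
  shows "basic_silting_pair e1 e2 (ctt U1) (ctt U2)"
proof -
  have l: "loc U1" "loc U2" and c: "cmpo U1 U1" "cmpo U1 U2" "cmpo U2 U1" "cmpo U2 U2" and n: "\<not> iso U1 U2"
    using g by (auto simp: gpair_def)
  note ok = locD(1)[OF l(1)] locD(1)[OF l(2)]
  have hd: "hm (sl U1) (tl U1) (df U1)" "hm (sl U2) (tl U2) (df U2)" using ok by (simp_all add: ok_def)
  let ?D = "dsum (ctt U1) (ctt U2)"
  have cxD: "cx ?D" using cx_dsum cx_ctt ok by blast
  have "hv ?D ((shift ^^ k) ?D)" if "k > 0" for k
  proof (cases "k = 1")
    case True
    have "hv ?D (shift ?D)" unfolding ctt_def hv_shift_dsum_tt[OF hd] using c unfolding cmpo_def by blast
    then show ?thesis using True by simp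
  next
    case False
    then have "k \<ge> 2" using that by simp
    then show ?thesis unfolding ctt_def dsum_tt by (rule hv_shift_pow_tt)
  qed
  moreover have "C \<in> thick e1 e2 {?D}" if "cx C" for C
  proof -
    have "?D \<in> thick e1 e2 {?D}" by (rule thick.base) simp
    then have "ctt U1 \<in> thick e1 e2 {?D}" "ctt U2 \<in> thick e1 e2 {?D}"
      using thick_dsum cx_ctt ok by blast+
    then show ?thesis using P cx_in_thick[OF _ _ that] by blast
  qed
  ultimately have "silting e1 e2 ?D" unfolding silting_def hv_def using cxD by blast
  moreover have "\<not> heq (ctt U1) (ctt U2)" using heq_iso[OF l] n by blast
  moreover have "two_term e1 e2 (ctt U1)" "two_term e1 e2 (ctt U2)"
    unfolding ctt_def using two_term_tt hd by blast+
  ultimately show ?thesis unfolding basic_silting_pair_def using loc_indec l by blast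
qed

text \<open>The identity of \<open>sl U\<close> in degree 0 is a chain map from the unshifted
  complex to the stalk of \<open>sl U\<close>. In its cone the identity block cancels and the stalk
  of \<open>tl U\<close> remains.\<close>

lemma thick_row:
  assumes U: "ok U" and P: "stalk 0 (sl U) \<in> thick e1 e2 S" and T: "ctt U \<in> thick e1 e2 S"
  shows "stalk 0 (tl U) \<in> thick e1 e2 S"
proof -
  let ?s = "sl U" and ?t = "tl U" and ?d = "df U"
  have hd: "hm ?s ?t ?d" using U by (simp add: ok_def)
  define f :: "int \<Rightarrow> 'a mat" where "f n = (if n = 0 then idm ?s else 0)" for n
  have fu: "fst (unshift C) n = fst C (n - 1)" "snd (unshift C) n = - snd C (n - 1)" for C :: "'a cplx" and n
    by (simp_all add: unshift_def fun_Compl_def)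
  have fs: "fst (stalk m l) n = (if n = m then l else [])" "snd (stalk m l) n = 0" for m n l by (simp_all add: stalk_def)
  have cf: "cm (unshift (ctt U)) (stalk 0 ?s) f"
    unfolding chain_map_alt fu fs ctt_def fst_tt snd_tt f_def by auto
  have c: "cone (unshift (ctt U)) (stalk 0 ?s) f \<in> thick e1 e2 S"
    using thick.cone[OF thick.unshift[OF T] P cf] .
  define M where "M = mmul (na U) (prl ?t ?s) ?d + mmul (nb U) (inr ?t ?s) (idm ?s)"
  have M': "M = mmul (na U) (prl ?t ?s) ?d + inr ?t ?s"
    unfolding M_def using mmul_idm_right[OF hm_inr refl, of ?s ?t] by simp
  have hM: "hm ?s (?t @ ?s) M" unfolding M'
    by (intro hm_add hm_inr hm_mmul[OF hm_inl hd]) simp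
  have e: "cone (unshift (ctt U)) (stalk 0 ?s) f = tt ?s (?t @ ?s) M"
  proof (rule prod_eqI)
    show "fst (cone (unshift (ctt U)) (stalk 0 ?s) f) = fst (tt ?s (?t @ ?s) M)"
      by (auto simp: cone_def fun_eq_iff fu fs ctt_def fst_tt)
    have Mij: "M i j = (if i < na U then ?d i j else idm ?s (i - na U) j)" for i j
    proof -
      have "mmul (na U) (prl ?t ?s) ?d = ?d" using mmul_prl(1)[OF hd, of ?s] by simp
      then show ?thesis unfolding M' inr_def using hmD0[OF hd, of i j] by auto
    qed
    show "snd (cone (unshift (ctt U)) (stalk 0 ?s) f) = snd (tt ?s (?t @ ?s) M)"
    proof (intro ext)
      fix n :: int and i j
      consider "n = -1" | "n = 0" | "n \<noteq> -1" "n \<noteq> 0" by blast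
      then show "snd (cone (unshift (ctt U)) (stalk 0 ?s) f) n i j = snd (tt ?s (?t @ ?s) M) n i j"
      proof cases
        case 1
        have "j < nb U \<or> (?d i j = 0 \<and> idm ?s (i - na U) j = 0)"
          using hmD0[OF hd, of i j] hmD0[OF hm_idm, of "i - na U" ?s j] by auto
        then show ?thesis using 1
          by (auto simp: cone_def fu fs ctt_def fst_tt snd_tt blk_def Mij f_def)
      qed (auto simp: cone_def fu fs ctt_def fst_tt snd_tt blk_def f_def)
    qed
  qed
  have "heq (tt [] ?t 0) (tt ?s (?t @ ?s) M)"
  proof (rule heq_sym, rule heq_tt[where q = 0 and p = "prl ?t ?s - mmul (nb U) ?d (prr ?t ?s)"
        and q' = 0 and p' = "prl ?t ?s" and h = "- prr ?t ?s" and h' = 0])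
    have a1: "mmul (nb U) (mmul (nb U) ?d (prr ?t ?s)) A = mmul (nb U) ?d (mmul (nb U) (prr ?t ?s) A)" for A
      by (rule mmul_assoc)
    have l: "length (?t @ ?s) = na U + nb U" by simp
    have r: "mmul (na U + nb U) (prl ?t ?s) (prl ?t ?s) = idm ?t" "mmul (na U + nb U) (prr ?t ?s) (inr ?t ?s) = idm ?s"
      "mmul (na U + nb U) (prl ?t ?s) (inr ?t ?s) = 0" "mmul (na U + nb U) (prr ?t ?s) (prl ?t ?s) = 0"
      using mmul_prl_prl[of ?t ?s] mmul_prr_inr[of ?t ?s] mmul_prl_inr[of ?t ?s] mmul_prr_inl[of ?t ?s] by simp_all
    have ra: "mmul (na U + nb U) (prl ?t ?s) (mmul k (prl ?t ?s) A) = mmul k (idm ?t) A"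
      "mmul (na U + nb U) (prr ?t ?s) (mmul k (prl ?t ?s) A) = 0" for k A
      by (simp_all only: mmul_assoc[symmetric] r mmul_zero)
    have di: "mmul (nb U) ?d (idm ?s) = ?d" "mmul (na U) (idm ?t) ?d = ?d"
      using mmul_idm_right[OF hd] mmul_idm_left[OF hd] by simp_all
    show "hm (?t @ ?s) ?t (prl ?t ?s - mmul (nb U) ?d (prr ?t ?s))"
      by (intro hm_diff hm_prl hm_mmul[OF hd hm_prr]) simp
    show "mmul (length []) 0 0 = mmul (length (?t @ ?s)) (prl ?t ?s - mmul (nb U) ?d (prr ?t ?s)) M"
      unfolding l M' mmul_diff mmul_add mmul_assoc ra r di by simp
    show "mmul (length ?s) M 0 = mmul (length ?t) (prl ?t ?s) 0" by simp
    show "mmul (length []) 0 0 = idm ?s + mmul (length (?t @ ?s)) (- prr ?t ?s) M"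
      unfolding l M' mmul_uminus mmul_add ra r by simp
    have idt: "idm (?t @ ?s) = mmul (na U) (prl ?t ?s) (prl ?t ?s) + mmul (nb U) (inr ?t ?s) (prr ?t ?s)"
      using idm_append[of ?t ?s] by simp
    show "mmul (length ?t) (prl ?t ?s) (prl ?t ?s - mmul (nb U) ?d (prr ?t ?s))
       = idm (?t @ ?s) + mmul (length ?s) M (- prr ?t ?s)"
      unfolding idt M' mmul_uminus mmul_add mmul_diff by (simp add: mmul_assoc)
    show "mmul (length (?t @ ?s)) (prl ?t ?s - mmul (nb U) ?d (prr ?t ?s)) (prl ?t ?s) = idm ?t + mmul (length []) 0 0"
      unfolding l mmul_diff mmul_assoc r by simp
  qed (auto simp: hm_inl hm_prr hm_uminus idm_Nil)
  then have "tt [] ?t 0 \<in> thick e1 e2 S" using thick.iso c cx_tt[OF hm_zero] unfolding e by blast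
  then show ?thesis by (simp add: stalk_tt)
qed

text \<open>Dually, the cone of the inclusion of the degree 0 part into \<open>ctt U\<close> is,
  after cancelling the identity block, the degree -1 part.\<close>

lemma thick_col:
  assumes U: "ok U" and P: "stalk 0 (tl U) \<in> thick e1 e2 S" and T: "ctt U \<in> thick e1 e2 S"
  shows "stalk 0 (sl U) \<in> thick e1 e2 S"
proof -
  let ?s = "sl U" and ?t = "tl U" and ?d = "df U"
  have hd: "hm ?s ?t ?d" using U by (simp add: ok_def)
  define f :: "int \<Rightarrow> 'a mat" where "f n = (if n = 0 then idm ?t else 0)" for n
  have fs: "fst (stalk m l) n = (if n = m then l else [])" "snd (stalk m l) n = 0" for m n l by (simp_all add: stalk_def)
  have cf: "cm (stalk 0 ?t) (ctt U) f"
    unfolding chain_map_alt fs ctt_def fst_tt snd_tt f_def by auto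
  have c: "cone (stalk 0 ?t) (ctt U) f \<in> thick e1 e2 S"
    using thick.cone[OF P T cf] .
  define M where "M = prl ?t ?s + mmul (nb U) ?d (prr ?t ?s)"
  have hM: "hm (?t @ ?s) ?t M" unfolding M_def
    by (intro hm_add hm_prl hm_mmul[OF hd hm_prr]) simp
  have e: "cone (stalk 0 ?t) (ctt U) f = tt (?t @ ?s) ?t M"
  proof (rule prod_eqI)
    show "fst (cone (stalk 0 ?t) (ctt U) f) = fst (tt (?t @ ?s) ?t M)"
      by (auto simp: cone_def fun_eq_iff fs ctt_def fst_tt)
    have Mij: "M i j = (if j < na U then idm ?t i j else ?d i (j - na U))" for i j
    proof -
      have "mmul (nb U) ?d (prr ?t ?s) i j = (if na U \<le> j then mmul (nb U) ?d (idm ?s) i (j - na U) else 0)"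
        by (simp add: mmul_def prr_def)
      moreover have "mmul (nb U) ?d (idm ?s) = ?d" using mmul_idm_right[OF hd] by simp
      ultimately show ?thesis unfolding M_def prl_def using hmD0[OF hm_idm, of i ?t j] by auto
    qed
    show "snd (cone (stalk 0 ?t) (ctt U) f) = snd (tt (?t @ ?s) ?t M)"
    proof (intro ext)
      fix n :: int and i j
      consider "n = -1" | "n = -2" | "n \<noteq> -1" "n \<noteq> -2" by blast
      then show "snd (cone (stalk 0 ?t) (ctt U) f) n i j = snd (tt (?t @ ?s) ?t M) n i j"
      proof cases
        case 1 then show ?thesis
          by (auto simp: cone_def fs ctt_def fst_tt snd_tt blk_def Mij f_def)
      qed (auto simp: cone_def fs ctt_def fst_tt snd_tt blk_def f_def)
    qed
  qed
  have "heq (tt ?s [] 0) (tt (?t @ ?s) ?t M)"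
  proof (rule heq_sym, rule heq_tt[where q = "prr ?t ?s" and p = 0
        and q' = "inr ?t ?s - mmul (na U) (prl ?t ?s) ?d" and p' = 0 and h = "- prl ?t ?s" and h' = 0])
    have l: "length (?t @ ?s) = na U + nb U" by simp
    have r: "mmul (na U + nb U) (prl ?t ?s) (prl ?t ?s) = idm ?t" "mmul (na U + nb U) (prr ?t ?s) (inr ?t ?s) = idm ?s"
      "mmul (na U + nb U) (prl ?t ?s) (inr ?t ?s) = 0" "mmul (na U + nb U) (prr ?t ?s) (prl ?t ?s) = 0"
      using mmul_prl_prl[of ?t ?s] mmul_prr_inr[of ?t ?s] mmul_prl_inr[of ?t ?s] mmul_prr_inl[of ?t ?s] by simp_all
    have ra: "mmul (na U + nb U) (prl ?t ?s) (mmul k (prl ?t ?s) A) = mmul k (idm ?t) A"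
      "mmul (na U + nb U) (prr ?t ?s) (mmul k (prl ?t ?s) A) = 0" for k A
      by (simp_all only: mmul_assoc[symmetric] r mmul_zero)
    have di: "mmul (nb U) ?d (idm ?s) = ?d" "mmul (na U) (idm ?t) ?d = ?d"
      using mmul_idm_right[OF hd] mmul_idm_left[OF hd] by simp_all
    show "hm ?s (?t @ ?s) (inr ?t ?s - mmul (na U) (prl ?t ?s) ?d)"
      by (intro hm_diff hm_inr hm_mmul[OF hm_inl hd]) simp
    show "mmul (length ?s) 0 (prr ?t ?s) = mmul (length ?t) 0 M" by simp
    show "mmul (length (?t @ ?s)) M (inr ?t ?s - mmul (na U) (prl ?t ?s) ?d) = mmul (length []) 0 0"
      unfolding l M_def mmul_diff mmul_add mmul_assoc ra r di by simp
    have idt: "idm (?t @ ?s) = mmul (na U) (prl ?t ?s) (prl ?t ?s) + mmul (nb U) (inr ?t ?s) (prr ?t ?s)"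
      using idm_append[of ?t ?s] by simp
    show "mmul (length ?s) (inr ?t ?s - mmul (na U) (prl ?t ?s) ?d) (prr ?t ?s)
       = idm (?t @ ?s) + mmul (length ?t) (- prl ?t ?s) M"
      unfolding idt M_def mmul_uminus mmul_add mmul_diff by (simp add: mmul_assoc)
    show "mmul (length []) 0 0 = idm ?t + mmul (length (?t @ ?s)) M (- prl ?t ?s)"
      unfolding l M_def mmul_uminus mmul_add mmul_assoc r by simp
    show "mmul (length (?t @ ?s)) (prr ?t ?s) (inr ?t ?s - mmul (na U) (prl ?t ?s) ?d) = idm ?s + mmul (length []) 0 0"
      unfolding l mmul_diff ra r by simp
  qed (auto simp: hm_inl hm_prr hm_uminus idm_Nil)
  then have "tt ?s [] 0 \<in> thick e1 e2 S" by (rule thick.iso[OF c[unfolded e] cx_tt[OF hm_zero]])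
  then have "stalk (-1) ?s \<in> thick e1 e2 S" by (simp add: stalk_tt)
  then have "unshift (stalk (-1) ?s) \<in> thick e1 e2 S" by (rule thick.unshift)
  then show ?thesis by (simp add: unshift_stalk)
qed

text \<open>The hypotheses are contraction data: \<open>F\<close> and \<open>G\<close> compare
  \<open>K\<close> with the stalk, and \<open>H\<close>, \<open>H0\<close> are the components of the
  homotopy on \<open>K\<close>.\<close>

lemma three_term:
  assumes K: "\<And>n. fst K n = (if n = -2 then [p] else if n = -1 then l else if n = 0 then [q] else [])"
    "\<And>n. snd K n = (if n = -2 then A else if n = -1 then B else 0)"
    and hm: "hm l [c] F" "hm [c] l G" "hm l [p] H" "hm [q] l H0" "length l = m"
    and r: "mmul m F A = 0" "mmul m B G = 0" "mmul m F G = idm [c]" "mmul m H A = - idm [p]"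
      "mmul 1 G F = idm l + (mmul 1 A H + mmul 1 H0 B)" "mmul m B H0 = - idm [q]"
  shows "heq K (stalk (-1) [c])"
proof -
  have fs: "fst (stalk (-1) [c]) n = (if n = -1 then [c] else [])" "snd (stalk (-1) [c]) n = 0" for n by (simp_all add: stalk_def)
  let ?F = "\<lambda>n::int. if n = -1 then F else 0" and ?G = "\<lambda>n::int. if n = -1 then G else 0"
  let ?H = "\<lambda>n::int. if n = -1 then H else if n = 0 then H0 else 0"
  have n3: "n = -2 \<or> n = -1 \<or> n = 0 \<or> (n \<noteq> -2 \<and> n \<noteq> -1 \<and> n \<noteq> 0)" for n :: int by blast
  show ?thesis
  proof (rule heqI[of _ _ ?F ?G])
    show "cm K (stalk (-1) [c]) ?F"
      unfolding chain_map_alt K fs using hm r by auto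
    show "cm (stalk (-1) [c]) K ?G"
      unfolding chain_map_alt K fs using hm r by auto
    show "hty K K (comp_map (stalk (-1) [c]) ?G ?F) (idc K)"
      unfolding homotopic_alt null_homotopic_alt
    proof (intro exI[of _ ?H] conjI allI)
      fix n :: int
      show "hm (fst K n) (fst K (n - 1)) (?H n)" unfolding K using hm by auto
      show "(comp_map (stalk (-1) [c]) ?G ?F - idc K) n =
         mmul (length (fst K (n - 1))) (snd K (n - 1)) (?H n) + mmul (length (fst K (n + 1))) (?H (n + 1)) (snd K n)"
        using n3[of n] hm(5) r(4-6) by (elim disjE) (simp_all add: comp_map_def K fs idm_Nil)
    qed
    have "comp_map K ?F ?G = idc (stalk (-1) [c])"
      by (rule ext) (simp add: comp_map_def K fs r hm(5) idm_Nil)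
    then show "hty (stalk (-1) [c]) (stalk (-1) [c]) (comp_map K ?F ?G) (idc (stalk (-1) [c]))"
      by (simp add: hty_refl)
  qed
qed

definition rowob :: "nat \<Rightarrow> (nat \<Rightarrow> 'a) \<Rightarrow> 'a ob" where
  "rowob l c = (1, l, \<lambda>i j. if i = 0 \<and> j < l then c j else 0)"
definition colob :: "nat \<Rightarrow> (nat \<Rightarrow> 'a) \<Rightarrow> 'a ob" where
  "colob k c = (k, 1, \<lambda>i j. if i < k \<and> j = 0 then c i else 0)"

lemma ob_simps [simp]: "na (rowob l c) = 1" "nb (rowob l c) = l" "na (colob k c) = k" "nb (colob k c) = 1"
  "df (rowob l c) = (\<lambda>i j. if i = 0 \<and> j < l then c j else 0)"
  "df (colob k c) = (\<lambda>i j. if i < k \<and> j = 0 then c i else 0)"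
  by (simp_all add: rowob_def colob_def na_def nb_def df_def)

lemma sl_tl_ob: "sl (rowob l c) = rp l False" "tl (rowob l c) = [True]" "sl (colob k c) = [False]" "tl (colob k c) = rp k True"
  by (simp_all add: sl_def tl_def)

lemma ok_rowob: "(\<And>j. j < l \<Longrightarrow> c j \<in> XX) \<Longrightarrow> ok (rowob l c)"
  and ok_colob: "(\<And>j. j < k \<Longrightarrow> c j \<in> XX) \<Longrightarrow> ok (colob k c)"
  unfolding ok_def sl_tl_ob ob_simps by (auto intro!: hmI)

lemmas mat_simps = mmul_def fun_eq_iff id_mat_def eval_nat_numeral lessThan_Suc less_Suc_eq nth_Cons Let_def

text \<open>The object of \<open>x\<close> maps into that of \<open>(x, y)\<close> as the first
  coordinate, with the identity on \<open>P1\<close>; the cone is \<open>P2\<close> in degree -1.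
  This gives access to the generators \<open>P1\<close>, \<open>P2\<close> from a pair in which
  neither member is a stalk.\<close>

lemma thick_1_2_row:
  assumes x: "x \<in> XX" and y: "y \<in> XX"
    and T: "ctt (rowob 1 (\<lambda>_. x)) \<in> thick e1 e2 S" "ctt (rowob 2 (\<lambda>j. if j = 0 then x else y)) \<in> thick e1 e2 S"
  shows "stalk 0 [False] \<in> thick e1 e2 S"
proof -
  let ?T1 = "rowob 1 (\<lambda>_. x)" and ?T2 = "rowob 2 (\<lambda>j. if j = 0 then x else y)"
  have r2: "rp 2 False = [False, False]" "rp 1 False = [False]" by (simp_all add: eval_nat_numeral)
  define F :: "'a mat" where "F = (\<lambda>i j. if i = 0 \<and> j = 0 then L False else 0)"
  have co: "L True * x = x" "x * L False = x" "L True * y = y" "y * L False = y" using x y by (auto simp: Co_iff)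
  have f: "cm (ctt ?T1) (ctt ?T2) (mp F (idm [True]))"
    unfolding ctt_def cm_mp sl_tl_ob r2
    by (auto simp: F_def mat_simps co intro!: hmI)
  let ?K = "cone (ctt ?T1) (ctt ?T2) (mp F (idm [True]))"
  have K: "?K \<in> thick e1 e2 S" using thick.cone[OF T f] .
  let ?l = "[True, False, False]"
  define A :: "'a mat" where "A = (\<lambda>i j. if j = 0 then (if i = 0 then - x else if i = 1 then L False else 0) else 0)"
  define B :: "'a mat" where "B = (\<lambda>i j. if i = 0 then (if j = 0 then L True else if j = 1 then x else if j = 2 then y else 0) else 0)"
  define Fm :: "'a mat" where "Fm = (\<lambda>i j. if i = 0 \<and> j = 2 then L False else 0)"
  define Gm :: "'a mat" where "Gm = (\<lambda>i j. if j = 0 then (if i = 0 then - y else if i = 2 then L False else 0) else 0)"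
  define H :: "'a mat" where "H = (\<lambda>i j. if i = 0 \<and> j = 1 then - L False else 0)"
  define H0 :: "'a mat" where "H0 = (\<lambda>i j. if i = 0 \<and> j = 0 then - L True else 0)"
  note ds = A_def B_def Fm_def Gm_def H_def H0_def
  have fK: "fst ?K n = (if n = -2 then [False] else if n = -1 then ?l else if n = 0 then [True] else [])" for n
    by (auto simp: cone_def ctt_def fst_tt sl_tl_ob r2)
  have sK: "snd ?K n = (if n = -2 then A else if n = -1 then B else 0)" for n
    by (auto simp: cone_def ctt_def fst_tt snd_tt sl_tl_ob r2 blk_def mp_def F_def A_def B_def fun_eq_iff id_mat_def)
  have "heq ?K (stalk (-1) [False])"
  proof (rule three_term[OF fK sK, of False Fm Gm H H0 3])
    show "hm ?l [False] Fm" "hm [False] ?l Gm" "hm ?l [False] H" "hm [True] ?l H0"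
      using y by (auto simp: ds less_Suc_eq nth_Cons Co_uminus split: nat.splits intro!: hmI)
    show "mmul 3 Fm A = 0" "mmul 3 B Gm = 0" "mmul 3 Fm Gm = idm [False]" "mmul 3 H A = - idm [False]"
      "mmul 1 Gm Fm = idm ?l + (mmul 1 A H + mmul 1 H0 B)" "mmul 3 B H0 = - idm [True]"
      by (auto simp: ds mat_simps co split: nat.splits)
  qed simp
  then have "stalk (-1) [False] \<in> thick e1 e2 S" using thick.iso[OF K cx_stalk] heq_sym by blast
  then have "unshift (stalk (-1) [False]) \<in> thick e1 e2 S" by (rule thick.unshift)
  then show ?thesis by (simp add: unshift_stalk)
qed

text \<open>Dually, the column \<open>(x, y)\<close> projects onto \<open>x\<close> over the
  identity of \<open>P2\<close> with kernel \<open>P1\<close> in degree 0, so the cone is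
  \<open>P1\<close> in degree -1.\<close>

lemma thick_1_2_col:
  assumes x: "x \<in> XX" and y: "y \<in> XX"
    and T: "ctt (colob 1 (\<lambda>_. x)) \<in> thick e1 e2 S" "ctt (colob 2 (\<lambda>j. if j = 0 then x else y)) \<in> thick e1 e2 S"
  shows "stalk 0 [True] \<in> thick e1 e2 S"
proof -
  let ?T1 = "colob 1 (\<lambda>_. x)" and ?T2 = "colob 2 (\<lambda>j. if j = 0 then x else y)"
  have r2: "rp 2 True = [True, True]" "rp 1 True = [True]" by (simp_all add: eval_nat_numeral)
  define F :: "'a mat" where "F = (\<lambda>i j. if i = 0 \<and> j = 0 then L True else 0)"
  have co: "L True * x = x" "x * L False = x" "L True * y = y" "y * L False = y" using x y by (auto simp: Co_iff)
  have f: "cm (ctt ?T2) (ctt ?T1) (mp (idm [False]) F)"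
    unfolding ctt_def cm_mp sl_tl_ob r2
    by (auto simp: F_def mat_simps co intro!: hmI)
  let ?K = "cone (ctt ?T2) (ctt ?T1) (mp (idm [False]) F)"
  have K: "?K \<in> thick e1 e2 S" using thick.cone[OF T(2,1) f] .
  let ?l = "[True, True, False]"
  define A :: "'a mat" where "A = (\<lambda>i j. if j = 0 then (if i = 0 then - x else if i = 1 then - y else if i = 2 then L False else 0) else 0)"
  define B :: "'a mat" where "B = (\<lambda>i j. if i = 0 then (if j = 0 then L True else if j = 2 then x else 0) else 0)"
  define Fm :: "'a mat" where "Fm = (\<lambda>i j. if i = 0 then (if j = 1 then L True else if j = 2 then y else 0) else 0)"
  define Gm :: "'a mat" where "Gm = (\<lambda>i j. if j = 0 \<and> i = 1 then L True else 0)"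
  define H :: "'a mat" where "H = (\<lambda>i j. if i = 0 \<and> j = 2 then - L False else 0)"
  define H0 :: "'a mat" where "H0 = (\<lambda>i j. if i = 0 \<and> j = 0 then - L True else 0)"
  note ds = A_def B_def Fm_def Gm_def H_def H0_def
  have fK: "fst ?K n = (if n = -2 then [False] else if n = -1 then ?l else if n = 0 then [True] else [])" for n
    by (auto simp: cone_def ctt_def fst_tt sl_tl_ob r2)
  have sK: "snd ?K n = (if n = -2 then A else if n = -1 then B else 0)" for n
    by (auto simp: cone_def ctt_def fst_tt snd_tt sl_tl_ob r2 blk_def mp_def F_def A_def B_def fun_eq_iff id_mat_def)
  have "heq ?K (stalk (-1) [True])"
  proof (rule three_term[OF fK sK, of True Fm Gm H H0 3])
    show "hm ?l [True] Fm" "hm [True] ?l Gm" "hm ?l [False] H" "hm [True] ?l H0"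
      using y by (auto simp: ds less_Suc_eq nth_Cons Co_uminus split: nat.splits intro!: hmI)
    show "mmul 3 Fm A = 0" "mmul 3 B Gm = 0" "mmul 3 Fm Gm = idm [True]" "mmul 3 H A = - idm [False]"
      "mmul 1 Gm Fm = idm ?l + (mmul 1 A H + mmul 1 H0 B)" "mmul 3 B H0 = - idm [True]"
      by (auto simp: ds mat_simps co split: nat.splits)
  qed simp
  then have "stalk (-1) [True] \<in> thick e1 e2 S" using thick.iso[OF K cx_stalk] heq_sym by blast
  then have "unshift (stalk (-1) [True]) \<in> thick e1 e2 S" by (rule thick.unshift)
  then show ?thesis by (simp add: unshift_stalk)
qed

lemma lab_simps: "lab e1 e2 True = e1" "lab e1 e2 False = e2"
  by (simp_all add: lab_def)

section \<open>Generators of \<open>e1 A e2\<close> and the two outer silting pairs\<close>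

definition gensL :: "nat \<Rightarrow> (nat \<Rightarrow> 'a) \<Rightarrow> bool" where
  "gensL k c \<longleftrightarrow> (\<forall>j<k. c j \<in> XX) \<and> (\<forall>y\<in>XX. \<exists>a. (\<forall>j<k. a j \<in> EE) \<and> y = (\<Sum>j<k. a j * c j))"
definition gensR :: "nat \<Rightarrow> (nat \<Rightarrow> 'a) \<Rightarrow> bool" where
  "gensR l c \<longleftrightarrow> (\<forall>j<l. c j \<in> XX) \<and> (\<forall>y\<in>XX. \<exists>b. (\<forall>j<l. b j \<in> FF) \<and> y = (\<Sum>j<l. c j * b j))"

lemma X_span:
  "\<exists>(n::nat) c. (\<forall>j<n. c j \<in> XX) \<and> (\<forall>y\<in>XX. \<exists>k. y = (\<Sum>j<n. sc (k j) (c j)))"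
proof -
  obtain B where B: "B \<subseteq> XX" "finite B" "span B = XX"
    using findim_basis[OF Co_findim Co_subspace] by metis
  obtain n c where c: "bij_betw c {..<n::nat} B" using B(2) ex_bij_betw_nat_finite[of B] atLeast0LessThan by metis
  have "\<exists>k. y = (\<Sum>j<n. sc (k j) (c j))" if "y \<in> XX" for y
  proof -
    have "y \<in> range (\<lambda>u. \<Sum>v\<in>B. sc (u v) v)" using that unfolding B(3)[symmetric] span_finite[OF B(2)] .
    then obtain u where "y = (\<Sum>v\<in>B. sc (u v) v)" by (rule rangeE)
    also have "\<dots> = (\<Sum>j<n. sc (u (c j)) (c j))" using sum.reindex_bij_betw[OF c, of "\<lambda>v. sc (u v) v"] by simp
    finally show ?thesis by (intro exI[of _ "\<lambda>j. u (c j)"])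
  qed
  moreover have "c j \<in> XX" if "j < n" for j using c B(1) that unfolding bij_betw_def by blast
  ultimately show ?thesis by blast
qed

lemma gens_exist: "\<exists>k c. gensL k c" "\<exists>l c. gensR l c"
proof -
  obtain n :: nat and c where c0: "(\<forall>j<n. c j \<in> XX) \<and> (\<forall>y\<in>XX. \<exists>k. y = (\<Sum>j<n. sc (k j) (c j)))"
    using X_span by (elim exE)
  have c: "\<And>j. j < n \<Longrightarrow> c j \<in> XX" "\<And>y. y \<in> XX \<Longrightarrow> \<exists>k. y = (\<Sum>j<n. sc (k j) (c j))"
    using c0 by blast+
  have L: "sc t x = sc t (L True) * x" and R: "sc t x = x * sc t (L False)" if "x \<in> XX" for t x
    using that by (simp_all add: sc_mult[symmetric] Co_iff)
  have "gensL n c" unfolding gensL_def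
  proof (intro conjI ballI allI impI)
    fix y assume "y \<in> XX"
    then obtain t where t: "y = (\<Sum>j<n. sc (t j) (c j))" using c(2) by blast
    have "y = (\<Sum>j<n. sc (t j) (L True) * c j)" unfolding t by (intro sum.cong refl L c(1)) simp
    moreover have "sc (t j) (L True) \<in> EE" for j by (intro Co_scale Co_L)
    ultimately show "\<exists>a. (\<forall>j<n. a j \<in> EE) \<and> y = (\<Sum>j<n. a j * c j)"
      by (intro exI[of _ "\<lambda>j. sc (t j) (L True)"]) blast
  qed (rule c(1))
  then show "\<exists>k c. gensL k c" by blast
  have "gensR n c" unfolding gensR_def
  proof (intro conjI ballI allI impI)
    fix y assume "y \<in> XX"
    then obtain t where t: "y = (\<Sum>j<n. sc (t j) (c j))" using c(2) by blast
    have "y = (\<Sum>j<n. c j * sc (t j) (L False))" unfolding t by (intro sum.cong refl R c(1)) simp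
    moreover have "sc (t j) (L False) \<in> FF" for j by (intro Co_scale Co_L)
    ultimately show "\<exists>a. (\<forall>j<n. a j \<in> FF) \<and> y = (\<Sum>j<n. c j * a j)"
      by (intro exI[of _ "\<lambda>j. sc (t j) (L False)"]) blast
  qed (rule c(1))
  then show "\<exists>l c. gensR l c" by blast
qed

definition numL :: nat where "numL = (LEAST k. \<exists>c. gensL k c)"
definition numR :: nat where "numR = (LEAST l. \<exists>c. gensR l c)"

lemma numL: "\<exists>c. gensL numL c" "gensL k c \<Longrightarrow> numL \<le> k"
  and numR: "\<exists>c. gensR numR c" "gensR l c \<Longrightarrow> numR \<le> l"
proof -
  show "\<exists>c. gensL numL c" unfolding numL_def using gens_exist(1) by (rule LeastI_ex)
  show "\<exists>c. gensR numR c" unfolding numR_def using gens_exist(2) by (rule LeastI_ex)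
  show "gensL k c \<Longrightarrow> numL \<le> k" unfolding numL_def by (rule Least_le) blast
  show "gensR l c \<Longrightarrow> numR \<le> l" unfolding numR_def by (rule Least_le) blast
qed

lemma cmpoI:
  assumes "\<And>f. hm (sl T) (tl U) f \<Longrightarrow> \<exists>p q. hm (tl T) (tl U) p \<and> hm (sl T) (sl U) q \<and>
     f = mmul (na T) p (df T) + mmul (nb U) (df U) q"
  shows "cmpo T U"
  unfolding cmpo_def cmp_def length_sl using assms by blast

text \<open>A generating column is a left approximation of \<open>P2\<close> by powers of
  \<open>P1\<close>: every map from \<open>P2\<close> to a power of \<open>P1\<close> factors
  through it, whatever the differential of the target.\<close>

lemma cmpo_colob: assumes c: "gensL k c" shows "cmpo (colob k c) U"
proof (rule cmpoI)
  fix f assume f: "hm (sl (colob k c)) (tl U) f"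
  have fi: "f i 0 \<in> XX" if "i < na U" for i
    using hmD[OF f, of i 0] that by (simp add: sl_tl_ob) (simp add: tl_def)
  have "\<forall>i. \<exists>a. i < na U \<longrightarrow> (\<forall>j<k. a j \<in> EE) \<and> f i 0 = (\<Sum>j<k. a j * c j)"
    using c fi unfolding gensL_def by blast
  then obtain a where a: "\<And>i. i < na U \<Longrightarrow> (\<forall>j<k. a i j \<in> EE) \<and> f i 0 = (\<Sum>j<k. a i j * c j)" by metis
  let ?p = "\<lambda>i j. if i < na U \<and> j < k then a i j else 0"
  have "hm (tl (colob k c)) (tl U) ?p"
    by (rule hmI) (use a in \<open>auto simp: tl_def\<close>)
  moreover have "f = mmul k ?p (df (colob k c))"
  proof (intro ext)
    fix i j
    show "f i j = mmul k ?p (df (colob k c)) i j"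
    proof (cases "i < na U \<and> j = 0")
      case True
      then have "mmul k ?p (df (colob k c)) i j = (\<Sum>j<k. a i j * c j)"
        unfolding mmul_def ob_simps by (intro sum.cong) auto
      then show ?thesis using a True by simp
    next
      case False
      then have "f i j = 0" using hmD0[OF f, of i j] by (auto simp: sl_tl_ob)
      moreover have "mmul k ?p (df (colob k c)) i j = 0"
        unfolding mmul_def ob_simps using False by (intro sum.neutral) auto
      ultimately show ?thesis by simp
    qed
  qed
  ultimately show "\<exists>p q. hm (tl (colob k c)) (tl U) p \<and> hm (sl (colob k c)) (sl U) q \<and>
     f = mmul (na (colob k c)) p (df (colob k c)) + mmul (nb U) (df U) q"
    by (intro exI[of _ ?p] exI[of _ 0]) simp
qed

text \<open>Dually, a generating row is a right approximation of \<open>P1\<close> by powers of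
  \<open>P2\<close>.\<close>

lemma cmpo_rowob: assumes c: "gensR l c" shows "cmpo U (rowob l c)"
proof (rule cmpoI)
  fix f assume f: "hm (sl U) (tl (rowob l c)) f"
  have fi: "f 0 i \<in> XX" if "i < nb U" for i
    using hmD[OF f, of 0 i] that by (simp add: sl_tl_ob) (simp add: sl_def)
  have "\<forall>i. \<exists>a. i < nb U \<longrightarrow> (\<forall>j<l. a j \<in> FF) \<and> f 0 i = (\<Sum>j<l. c j * a j)"
    using c fi unfolding gensR_def by blast
  then obtain a where a: "\<And>i. i < nb U \<Longrightarrow> (\<forall>j<l. a i j \<in> FF) \<and> f 0 i = (\<Sum>j<l. c j * a i j)" by metis
  let ?q = "\<lambda>j i. if i < nb U \<and> j < l then a i j else 0"
  have "hm (sl U) (sl (rowob l c)) ?q"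
    by (rule hmI) (use a in \<open>auto simp: sl_def\<close>)
  moreover have "f = mmul l (df (rowob l c)) ?q"
  proof (intro ext)
    fix j i
    show "f j i = mmul l (df (rowob l c)) ?q j i"
    proof (cases "i < nb U \<and> j = 0")
      case True
      then have "mmul l (df (rowob l c)) ?q j i = (\<Sum>j<l. c j * a i j)"
        unfolding mmul_def ob_simps by (intro sum.cong) auto
      then show ?thesis using a True by simp
    next
      case False
      then have "f j i = 0" using hmD0[OF f, of j i] by (auto simp: sl_tl_ob)
      moreover have "mmul l (df (rowob l c)) ?q j i = 0"
        unfolding mmul_def ob_simps using False by (intro sum.neutral) auto
      ultimately show ?thesis by simp
    qed
  qed
  ultimately show "\<exists>p q. hm (tl U) (tl (rowob l c)) p \<and> hm (sl U) (sl (rowob l c)) q \<and>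
     f = mmul (na U) p (df U) + mmul (nb (rowob l c)) (df (rowob l c)) q"
    by (intro exI[of _ 0] exI[of _ ?q]) simp
qed

definition P1o :: "'a ob" where "P1o = (1, 0, 0)"
definition P2o :: "'a ob" where "P2o = (0, 1, 0)"

lemma P_simps [simp]: "na P1o = 1" "nb P1o = 0" "df P1o = 0" "na P2o = 0" "nb P2o = 1" "df P2o = 0"
  "sl P1o = []" "tl P1o = [True]" "sl P2o = [False]" "tl P2o = []"
  by (simp_all add: P1o_def P2o_def na_def nb_def df_def sl_def tl_def)

lemma cmpo_P: "cmpo P1o U" "cmpo U P2o"
  by (auto intro!: cmpoI exI[of _ 0] simp: hm_empty)

lemma idem_1x1:
  assumes "hm [b] [b] p" "mmul 1 p p = p"
  shows "p = 0 \<or> p = idm [b]"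
proof -
  have p0: "p 0 0 \<in> Co b b" using hmD[OF assms(1), of 0 0] by simp
  have "p 0 0 * p 0 0 = p 0 0" using fun_cong[OF fun_cong[OF assms(2), of 0], of 0] by (simp add: mmul_def)
  then have "p 0 0 = 0 \<or> p 0 0 = L b" by (rule lc.idem_trivial[OF p0])
  moreover have e: "p i j = (if i = 0 \<and> j = 0 then p 0 0 else 0)" for i j using hmD0[OF assms(1), of i j] by auto
  have "p = 0" if z: "p 0 0 = 0"
  proof (intro ext)
    fix i j show "p i j = 0 i j" using e[of i j] z by (cases "i = 0 \<and> j = 0") auto
  qed
  moreover have "p = idm [b]" if z: "p 0 0 = L b"
  proof (intro ext)
    fix i j show "p i j = idm [b] i j" using e[of i j] z by (cases "i = 0 \<and> j = 0") (auto simp: id_mat_def)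
  qed
  ultimately show ?thesis by blast
qed

text \<open>An idempotent acts on the single source \<open>P2\<close> as \<open>0\<close> or as the
  identity, and passing to the complement one may assume \<open>0\<close>. Its other component then
  annihilates the column of generators; an invertible entry in it would make a generator redundant,
  against the minimality of \<open>numL\<close>.\<close>

lemma loc_colob:
  assumes c: "gensL numL c" shows "loc (colob numL c)"
proof (rule locI)
  let ?T = "colob numL c" and ?k = numL
  show ok: "ok ?T" using c by (auto simp: gensL_def intro: ok_colob)
  show "one ?T \<noteq> 0" unfolding one_zero_iff by simp
  have key: "h = 0" if h: "h \<in> mor ?T ?T" "mulp ?T h h = h" "fst h = 0" for h
  proof -
    have p: "hm (rp ?k True) (rp ?k True) (snd h)" using mor_mats(2)[OF h(1)] by (simp add: sl_tl_ob)
    have pp: "mmul ?k (snd h) (snd h) = snd h" using h(2) by (auto simp: mulp_def prod_eq_iff)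
    have pd: "mmul ?k (snd h) (df ?T) = 0" using mor_mats(3)[OF h(1)] h(3) by simp
    have "Jm (snd h)"
    proof (rule ccontr)
      assume "\<not> Jm (snd h)"
      then obtain i j where ij: "snd h i j \<notin> Jac" by (auto simp: Jm_def)
      then have "i < ?k \<and> j < ?k" using hmD0[OF p, of i j] Jac_zero by (metis length_replicate)
      then have il: "i < ?k" "j < ?k" by auto
      have pe: "snd h i m \<in> EE" if "m < ?k" for m using hmD[OF p, of i m] il that by simp
      obtain w where w: "w \<in> EE" "w * snd h i j = L True" using not_Jac_inverse[OF pe[OF il(2)] ij] by blast
      have cX: "c m \<in> XX" if "m < ?k" for m using c that by (simp add: gensL_def)
      have "0 = (\<Sum>m<?k. snd h i m * c m)"
        using fun_cong[OF fun_cong[OF pd, of i], of 0] by (simp add: mmul_def)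
      also have "\<dots> = snd h i j * c j + (\<Sum>m<?k - 1. snd h i (sk j m) * c (sk j m))" by (rule sum_sk[OF il(2)])
      finally have "snd h i j * c j = - (\<Sum>m<?k - 1. snd h i (sk j m) * c (sk j m))" by (metis add_eq_0_iff2)
      then have "w * snd h i j * c j = (\<Sum>m<?k - 1. - (w * snd h i (sk j m)) * c (sk j m))"
        by (simp add: mult.assoc sum_distrib_left sum_negf)
      then have cj: "c j = (\<Sum>m<?k - 1. - (w * snd h i (sk j m)) * c (sk j m))"
        using w(2) cX[OF il(2)] by (simp add: Co_iff)
      have "gensL (?k - 1) (\<lambda>m. c (sk j m))"
        unfolding gensL_def
      proof (intro conjI ballI allI impI)
        show "c (sk j m) \<in> XX" if "m < ?k - 1" for m using cX sk_less[OF il(2) that] by blast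
        fix y assume "y \<in> XX"
        then obtain a where a: "\<forall>m<?k. a m \<in> EE" "y = (\<Sum>m<?k. a m * c m)" using c unfolding gensL_def by blast
        let ?a = "\<lambda>m. a (sk j m) - a j * (w * snd h i (sk j m))"
        have "y = a j * c j + (\<Sum>m<?k - 1. a (sk j m) * c (sk j m))" unfolding a(2) by (rule sum_sk[OF il(2)])
        also have "a j * c j = (\<Sum>m<?k - 1. - (a j * (w * snd h i (sk j m)) * c (sk j m)))"
          by (subst cj) (simp add: sum_distrib_left mult.assoc)
        finally have "y = (\<Sum>m<?k - 1. ?a m * c (sk j m))"
          by (simp add: sum.distrib[symmetric] algebra_simps)
        moreover have "\<forall>m<?k - 1. ?a m \<in> EE"
          using a(1) il w(1) pe sk_less[OF il(2)] by (auto intro!: Co_diff Co_mult[of _ True True])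
        ultimately show "\<exists>a. (\<forall>j'<?k - 1. a j' \<in> EE) \<and> y = (\<Sum>j'<?k - 1. a j' * c (sk j j'))"
          by (intro exI[of _ ?a] conjI)
      qed
      then have "?k \<le> ?k - 1" by (rule numL(2))
      then show False using il by simp
    qed
    then have "snd h = 0" using idem_Jm_zero[OF p pp] by blast
    then show ?thesis using h(3) by (simp add: prod_eq_iff)
  qed
  fix f assume f: "f \<in> mor ?T ?T" "mulp ?T f f = f"
  have "fst f = 0 \<or> fst f = idm [False]"
    by (rule idem_1x1) (use mor_mats(1)[OF f(1)] f(2) in \<open>auto simp: sl_tl_ob mulp_def prod_eq_iff\<close>)
  then show "f = 0 \<or> f = one ?T"
  proof
    assume "fst f = 0" then show ?thesis using key[OF f] by blast
  next
    assume ff: "fst f = idm [False]"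
    interpret R: ring_on "mor ?T ?T" "mulp ?T" "one ?T" by (rule ring_on_mor[OF ok])
    note o = one_mor[OF ok]
    have "one ?T - f = 0"
      by (rule key) (use f o ff in \<open>auto simp: R.diffG R.mul_diffG mulp_one one_def[of ?T, THEN arg_cong[where f = fst]] sl_tl_ob\<close>)
    then show ?thesis by simp
  qed
qed

lemma loc_rowob:
  assumes c: "gensR numR c" shows "loc (rowob numR c)"
proof (rule locI)
  let ?T = "rowob numR c" and ?k = numR
  show ok: "ok ?T" using c by (auto simp: gensR_def intro: ok_rowob)
  show "one ?T \<noteq> 0" unfolding one_zero_iff by simp
  have key: "h = 0" if h: "h \<in> mor ?T ?T" "mulp ?T h h = h" "snd h = 0" for h
  proof -
    have p: "hm (rp ?k False) (rp ?k False) (fst h)" using mor_mats(1)[OF h(1)] by (simp add: sl_tl_ob)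
    have pp: "mmul ?k (fst h) (fst h) = fst h" using h(2) by (auto simp: mulp_def prod_eq_iff)
    have pd: "mmul ?k (df ?T) (fst h) = 0" using mor_mats(3)[OF h(1)] h(3) by simp
    have "Jm (fst h)"
    proof (rule ccontr)
      assume "\<not> Jm (fst h)"
      then obtain j i where ij: "fst h j i \<notin> Jac" by (auto simp: Jm_def)
      then have "i < ?k \<and> j < ?k" using hmD0[OF p, of j i] Jac_zero by (metis length_replicate)
      then have il: "i < ?k" "j < ?k" by auto
      have pe: "fst h m i \<in> FF" if "m < ?k" for m using hmD[OF p, of m i] il that by simp
      obtain w where w: "w \<in> FF" "fst h j i * w = L False" using not_Jac_inverse[OF pe[OF il(2)] ij] by blast
      have cX: "c m \<in> XX" if "m < ?k" for m using c that by (simp add: gensR_def)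
      have "0 = (\<Sum>m<?k. c m * fst h m i)"
        using fun_cong[OF fun_cong[OF pd, of 0], of i] by (simp add: mmul_def)
      also have "\<dots> = c j * fst h j i + (\<Sum>m<?k - 1. c (sk j m) * fst h (sk j m) i)" by (rule sum_sk[OF il(2)])
      finally have "c j * fst h j i = - (\<Sum>m<?k - 1. c (sk j m) * fst h (sk j m) i)" by (metis add_eq_0_iff2)
      then have "c j * fst h j i * w = (\<Sum>m<?k - 1. c (sk j m) * - (fst h (sk j m) i * w))"
        by (simp add: mult.assoc sum_distrib_right sum_negf)
      then have cj: "c j = (\<Sum>m<?k - 1. c (sk j m) * - (fst h (sk j m) i * w))"
        using w(2) cX[OF il(2)] by (simp add: Co_iff mult.assoc)
      have "gensR (?k - 1) (\<lambda>m. c (sk j m))"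
        unfolding gensR_def
      proof (intro conjI ballI allI impI)
        show "c (sk j m) \<in> XX" if "m < ?k - 1" for m using cX sk_less[OF il(2) that] by blast
        fix y assume "y \<in> XX"
        then obtain a where a: "\<forall>m<?k. a m \<in> FF" "y = (\<Sum>m<?k. c m * a m)" using c unfolding gensR_def by blast
        let ?a = "\<lambda>m. a (sk j m) - fst h (sk j m) i * w * a j"
        have "y = c j * a j + (\<Sum>m<?k - 1. c (sk j m) * a (sk j m))" unfolding a(2) by (rule sum_sk[OF il(2)])
        also have "c j * a j = (\<Sum>m<?k - 1. - (c (sk j m) * (fst h (sk j m) i * w * a j)))"
          by (subst cj) (simp add: sum_distrib_right mult.assoc)
        finally have "y = (\<Sum>m<?k - 1. c (sk j m) * ?a m)"
          by (simp add: sum.distrib[symmetric] algebra_simps)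
        moreover have "\<forall>m<?k - 1. ?a m \<in> FF"
          using a(1) il w(1) pe sk_less[OF il(2)] by (auto intro!: Co_diff Co_mult[of _ False False])
        ultimately show "\<exists>a. (\<forall>j'<?k - 1. a j' \<in> FF) \<and> y = (\<Sum>j'<?k - 1. c (sk j j') * a j')"
          by (intro exI[of _ ?a] conjI)
      qed
      then have "?k \<le> ?k - 1" by (rule numR(2))
      then show False using il by simp
    qed
    then have "fst h = 0" using idem_Jm_zero[OF p pp] by blast
    then show ?thesis using h(3) by (simp add: prod_eq_iff)
  qed
  fix f assume f: "f \<in> mor ?T ?T" "mulp ?T f f = f"
  have "snd f = 0 \<or> snd f = idm [True]"
    by (rule idem_1x1) (use mor_mats(2)[OF f(1)] f(2) in \<open>auto simp: sl_tl_ob mulp_def prod_eq_iff\<close>)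
  then show "f = 0 \<or> f = one ?T"
  proof
    assume "snd f = 0" then show ?thesis using key[OF f] by blast
  next
    assume ff: "snd f = idm [True]"
    interpret R: ring_on "mor ?T ?T" "mulp ?T" "one ?T" by (rule ring_on_mor[OF ok])
    note o = one_mor[OF ok]
    have "one ?T - f = 0"
      by (rule key) (use f o ff in \<open>auto simp: R.diffG R.mul_diffG mulp_one one_def[of ?T, THEN arg_cong[where f = snd]] sl_tl_ob\<close>)
    then show ?thesis by simp
  qed
qed

lemma loc_P: "loc P1o" "loc P2o"
proof -
  have ok: "ok P1o" "ok P2o" by (simp_all add: ok_def)
  show "loc P1o"
  proof (rule locI[OF ok(1)])
    fix f assume f: "f \<in> mor P1o P1o" "mulp P1o f f = f"
    have "fst f = 0" using mor_mats(1)[OF f(1)] by (simp add: hm_empty)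
    moreover have "snd f = 0 \<or> snd f = idm [True]"
      by (rule idem_1x1) (use mor_mats(2)[OF f(1)] f(2) in \<open>auto simp: mulp_def prod_eq_iff\<close>)
    ultimately show "f = 0 \<or> f = one P1o" by (auto simp: one_def prod_eq_iff idm_Nil)
  qed (simp add: one_zero_iff)
  show "loc P2o"
  proof (rule locI[OF ok(2)])
    fix f assume f: "f \<in> mor P2o P2o" "mulp P2o f f = f"
    have "snd f = 0" using mor_mats(2)[OF f(1)] by (simp add: hm_empty)
    moreover have "fst f = 0 \<or> fst f = idm [False]"
      by (rule idem_1x1) (use mor_mats(1)[OF f(1)] f(2) in \<open>auto simp: mulp_def prod_eq_iff\<close>)
    ultimately show "f = 0 \<or> f = one P2o" by (auto simp: one_def prod_eq_iff idm_Nil)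
  qed (simp add: one_zero_iff)
qed

lemma gpairI:
  assumes "loc U1" "loc U2" "cmpo U1 U1" "cmpo U1 U2" "cmpo U2 U1" "cmpo U2 U2" "na U1 \<noteq> na U2 \<or> nb U1 \<noteq> nb U2"
  shows "gpair U1 U2"
  unfolding gpair_def using assms iso_ab by blast

lemma stalk_rep: assumes "stalk m [b] \<in> thick e1 e2 S" shows "stalk m (rp k b) \<in> thick e1 e2 S"
proof (induction k)
  case 0
  have "dsum zero_cplx (stalk m [b]) \<in> thick e1 e2 S" using assms by (simp add: dsum_zero)
  then have z: "zero_cplx \<in> thick e1 e2 S" using thick.summand cx_zero cx_stalk by blast
  have "stalk m [] = zero_cplx" by (auto simp: stalk_def zero_cplx_def fun_eq_iff)
  then show ?case using z by simp
next
  case (Suc k)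
  have "stalk (m + 1) [b] \<in> thick e1 e2 S" using thick.unshift[OF assms] by (simp add: unshift_stalk)
  then have "cone (stalk (m + 1) [b]) (stalk m (rp k b)) 0 \<in> thick e1 e2 S"
    using thick.cone[OF _ Suc cm_zero] by blast
  moreover have "cone (stalk (m + 1) [b]) (stalk m (rp k b)) 0 = stalk m (b # rp k b)"
    by (auto simp: cone_def stalk_def blk_def fun_eq_iff)
  ultimately show ?case by simp
qed

lemma ctt_P: "ctt P1o = stalk 0 [True]" "ctt P2o = stalk (-1) [False]"
  by (simp_all add: ctt_def stalk_tt)

lemma unshift_thick: "stalk (-1) l \<in> thick e1 e2 S \<Longrightarrow> stalk 0 l \<in> thick e1 e2 S"
  using thick.unshift[of "stalk (-1) l"] by (simp add: unshift_stalk)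

text \<open>This is the left mutation of \<open>A\<close> at \<open>P2\<close>: the column is the
  cone of a minimal left approximation of \<open>P2\<close> by powers of \<open>P1\<close>.\<close>

lemma gpair_first:
  assumes c: "gensL numL c"
  shows "gpair P1o (colob numL c)" "basic_silting_pair e1 e2 (ctt P1o) (ctt (colob numL c))"
proof -
  show g: "gpair P1o (colob numL c)"
    by (rule gpairI) (use loc_P loc_colob[OF c] cmpo_P cmpo_colob[OF c] in auto)
  show "basic_silting_pair e1 e2 (ctt P1o) (ctt (colob numL c))"
  proof (rule silting_pairI[OF g])
    fix S assume S: "ctt P1o \<in> thick e1 e2 S" "ctt (colob numL c) \<in> thick e1 e2 S"
    have 1: "stalk 0 [True] \<in> thick e1 e2 S" using S(1) by (simp only: ctt_P)
    have "stalk 0 (sl (colob numL c)) \<in> thick e1 e2 S"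
      by (rule thick_col[OF locD(1)[OF loc_colob[OF c]] _ S(2)]) (use stalk_rep[OF 1] in \<open>simp add: sl_tl_ob\<close>)
    then show "stalk 0 [True] \<in> thick e1 e2 S \<and> stalk 0 [False] \<in> thick e1 e2 S" using 1 by (simp add: sl_tl_ob)
  qed
qed

text \<open>This is the right mutation of \<open>A[1]\<close> at \<open>P1[1]\<close>, built from a
  minimal right approximation by powers of \<open>P2[1]\<close>.\<close>

lemma gpair_last:
  assumes c: "gensR numR c"
  shows "gpair (rowob numR c) P2o" "basic_silting_pair e1 e2 (ctt (rowob numR c)) (ctt P2o)"
proof -
  show g: "gpair (rowob numR c) P2o"
    by (rule gpairI) (use loc_P loc_rowob[OF c] cmpo_P cmpo_rowob[OF c] in auto)
  show "basic_silting_pair e1 e2 (ctt (rowob numR c)) (ctt P2o)"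
  proof (rule silting_pairI[OF g])
    fix S assume S: "ctt (rowob numR c) \<in> thick e1 e2 S" "ctt P2o \<in> thick e1 e2 S"
    have 1: "stalk 0 [False] \<in> thick e1 e2 S" using S(2) unshift_thick by (simp only: ctt_P)
    have "stalk 0 (tl (rowob numR c)) \<in> thick e1 e2 S"
      by (rule thick_row[OF locD(1)[OF loc_rowob[OF c]] _ S(1)]) (use stalk_rep[OF 1] in \<open>simp add: sl_tl_ob\<close>)
    then show "stalk 0 [True] \<in> thick e1 e2 S \<and> stalk 0 [False] \<in> thick e1 e2 S" using 1 by (simp add: sl_tl_ob)
  qed
qed

lemma gpair_cone:
  assumes g: "gpair T1 T2" and U: "loc U" "cmpo U U"
    and w: "\<alpha> + \<beta> > 0" "na U = \<alpha> * na T1 + \<beta> * na T2" "nb U = \<alpha> * nb T1 + \<beta> * nb T2"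
  shows "iso U T1 \<or> iso U T2"
  using rigid_in_cone_iso[OF U(1), of T1 T2 1 \<alpha> \<beta>] g U(2) w unfolding gpair_def by simp

lemma loc_nonzero: "loc U \<Longrightarrow> na U + nb U > 0"
  using locD(10)[of U] one_zero_iff[of U] by auto

text \<open>The weights are the coordinates of the class in the basis \<open>(1, 0)\<close>,
  \<open>(numL, 1)\<close>. Their sum is positive because a local object is nonzero.\<close>

lemma first_cone:
  assumes c: "gensL numL c" and U: "loc U" "cmpo U U" "numL * nb U \<le> na U"
  shows "iso U P1o \<or> iso U (colob numL c)"
proof (rule gpair_cone[OF gpair_first(1)[OF c] U(1,2), of "na U - numL * nb U" "nb U"])
  show "0 < na U - numL * nb U + nb U" using loc_nonzero[OF U(1)] by (cases "nb U = 0") auto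
qed (use U(3) in \<open>simp_all add: mult.commute\<close>)

lemma last_cone:
  assumes c: "gensR numR c" and U: "loc U" "cmpo U U" "numR * na U \<le> nb U"
  shows "iso U (rowob numR c) \<or> iso U P2o"
proof (rule gpair_cone[OF gpair_last(1)[OF c] U(1,2), of "na U" "nb U - numR * na U"])
  show "0 < na U + (nb U - numR * na U)" using loc_nonzero[OF U(1)] by (cases "na U = 0") auto
qed (use U(3) in \<open>simp_all add: mult.commute\<close>)

lemma cmpo_iso:
  assumes "ok T" "ok U" "iso T T'" "iso U U'" "cmpo T U"
  shows "cmpo T' U'"
  using hv_heq[OF iso_heq[OF assms(3)] heq_shift[OF iso_heq[OF assms(4)]]] assms(5)
  unfolding ctt_def hv_shift_tt_iff cmpo_def .

section \<open>The conditions (L) and (R) in terms of generators\<close>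

lemma left_multiples: "x \<in> XX \<Longrightarrow> {e1 * a * x | a. True} = (\<lambda>a. a * x) ` EE"
proof (intro subset_antisym subsetI)
  fix y assume x: "x \<in> XX" and "y \<in> {e1 * a * x | a. True}"
  then obtain a where a: "y = e1 * a * x" by blast
  have "L True * x = x" using x by (simp add: Co_iff)
  then have "y = (L True * a * L True) * x" unfolding a by (metis mult.assoc lab_simps(1))
  then show "y \<in> (\<lambda>a. a * x) ` EE" using Co_cut by blast
next
  fix y assume "y \<in> (\<lambda>a. a * x) ` EE"
  then obtain a where a: "a \<in> EE" "y = a * x" by blast
  then have "L True * a = a" by (simp add: Co_iff)
  then have "y = e1 * a * x" unfolding a(2) lab_simps by simp
  then show "y \<in> {e1 * a * x | a. True}" by blast
qed

lemma right_multiples: "x \<in> XX \<Longrightarrow> {x * a * e2 | a. True} = (\<lambda>b. x * b) ` FF"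
proof (intro subset_antisym subsetI)
  fix y assume x: "x \<in> XX" and "y \<in> {x * a * e2 | a. True}"
  then obtain a where a: "y = x * a * e2" by blast
  have "x * L False = x" using x by (simp add: Co_iff)
  then have "y = x * (L False * a * L False)" unfolding a by (metis mult.assoc lab_simps(2))
  then show "y \<in> (\<lambda>b. x * b) ` FF" using Co_cut by blast
next
  fix y assume "y \<in> (\<lambda>b. x * b) ` FF"
  then obtain b where b: "b \<in> FF" "y = x * b" by blast
  then have "b * L False = b" by (simp add: Co_iff)
  then have "y = x * b * e2" unfolding b(2) lab_simps by (simp add: mult.assoc)
  then show "y \<in> {x * a * e2 | a. True}" by blast
qed

lemma corners: "corner e1 e2 = XX" "corner e1 e1 = EE" "corner e2 e2 = FF"
  by (simp_all add: lab_simps)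

lemma EE_XX_mult: "a \<in> EE \<Longrightarrow> x \<in> XX \<Longrightarrow> a * x \<in> XX" and XX_FF_mult: "x \<in> XX \<Longrightarrow> b \<in> FF \<Longrightarrow> x * b \<in> XX"
  and EE_mult: "a \<in> EE \<Longrightarrow> c \<in> EE \<Longrightarrow> a * c \<in> EE" and FF_mult: "b \<in> FF \<Longrightarrow> d \<in> FF \<Longrightarrow> b * d \<in> FF"
  by (rule Co_mult; assumption)+

lemma gens1: "gensL 1 c \<longleftrightarrow> c 0 \<in> XX \<and> (\<forall>y\<in>XX. \<exists>a\<in>EE. y = a * c 0)"
  "gensR 1 c \<longleftrightarrow> c 0 \<in> XX \<and> (\<forall>y\<in>XX. \<exists>b\<in>FF. y = c 0 * b)"
proof -
  have e: "(\<exists>f. f (0::nat) \<in> A \<and> Q (f 0)) \<longleftrightarrow> (\<exists>x\<in>A. Q x)" for A :: "'a set" and Q by auto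
  have s: "(\<Sum>j<1. f j) = f (0::nat)" for f :: "nat \<Rightarrow> 'a" by simp
  have a: "(\<forall>j<1. P j) \<longleftrightarrow> P (0::nat)" for P by simp
  show "gensL 1 c \<longleftrightarrow> c 0 \<in> XX \<and> (\<forall>y\<in>XX. \<exists>a\<in>EE. y = a * c 0)"
    unfolding gensL_def s a e[of EE "\<lambda>a. y = a * c 0" for y] ..
  show "gensR 1 c \<longleftrightarrow> c 0 \<in> XX \<and> (\<forall>y\<in>XX. \<exists>b\<in>FF. y = c 0 * b)"
    unfolding gensR_def s a e[of FF "\<lambda>a. y = c 0 * a" for y] ..
qed

lemma gens2: "gensL 2 c \<longleftrightarrow> c 0 \<in> XX \<and> c 1 \<in> XX \<and> (\<forall>y\<in>XX. \<exists>a\<in>EE. \<exists>b\<in>EE. y = a * c 0 + b * c 1)"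
  "gensR 2 c \<longleftrightarrow> c 0 \<in> XX \<and> c 1 \<in> XX \<and> (\<forall>y\<in>XX. \<exists>a\<in>FF. \<exists>b\<in>FF. y = c 0 * a + c 1 * b)"
proof -
  have s: "(\<Sum>j<2. f j) = f 0 + f (1::nat)" for f :: "nat \<Rightarrow> 'a" by (simp add: eval_nat_numeral)
  have a: "(\<forall>j<2. P j) \<longleftrightarrow> P 0 \<and> P (1::nat)" for P by (auto simp: less_2_cases_iff)
  have e: "(\<exists>f. (f (0::nat) \<in> A \<and> f 1 \<in> A) \<and> Q (f 0) (f 1)) \<longleftrightarrow> (\<exists>x\<in>A. \<exists>y\<in>A. Q x y)" for A :: "'a set" and Q
  proof
    assume "\<exists>x\<in>A. \<exists>y\<in>A. Q x y"
    then obtain x y where "x \<in> A" "y \<in> A" "Q x y" by blast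
    then show "\<exists>f. (f (0::nat) \<in> A \<and> f 1 \<in> A) \<and> Q (f 0) (f 1)"
      by (intro exI[of _ "\<lambda>j. if j = 0 then x else y"]) simp
  qed blast
  show "gensL 2 c \<longleftrightarrow> c 0 \<in> XX \<and> c 1 \<in> XX \<and> (\<forall>y\<in>XX. \<exists>a\<in>EE. \<exists>b\<in>EE. y = a * c 0 + b * c 1)"
    unfolding gensL_def s a e[of EE "\<lambda>a b. y = a * c 0 + b * c 1" for y] by simp
  show "gensR 2 c \<longleftrightarrow> c 0 \<in> XX \<and> c 1 \<in> XX \<and> (\<forall>y\<in>XX. \<exists>a\<in>FF. \<exists>b\<in>FF. y = c 0 * a + c 1 * b)"
    unfolding gensR_def s a e[of FF "\<lambda>a b. y = c 0 * a + c 1 * b" for y] by simp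
qed

lemma gens0: "gensL 0 c \<longleftrightarrow> XX = {0}" "gensR 0 c \<longleftrightarrow> XX = {0}"
  unfolding gensL_def gensR_def using Co_zero[of True False] by auto

lemma num_zero: "numL = 0 \<longleftrightarrow> XX = {0}" "numR = 0 \<longleftrightarrow> XX = {0}"
  using numL(1) numL(2)[of 0] numR(1) numR(2)[of 0] gens0 by (metis le_zero_eq)+

lemma left_cyclic_iff: "left_cyclic e1 e2 \<longleftrightarrow> (\<exists>x. gensL 1 (\<lambda>_. x))"
proof -
  have "left_gen e1 e2 x \<longleftrightarrow> gensL 1 (\<lambda>_. x)" for x
  proof -
    have "left_gen e1 e2 x \<longleftrightarrow> x \<in> XX \<and> (\<lambda>a. a * x) ` EE = XX"
      unfolding left_gen_def corners using left_multiples by metis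
    also have "\<dots> \<longleftrightarrow> gensL 1 (\<lambda>_. x)" unfolding gens1 using EE_XX_mult by blast
    finally show ?thesis .
  qed
  then show ?thesis by (simp add: left_cyclic_def)
qed

lemma right_cyclic_iff: "right_cyclic e1 e2 \<longleftrightarrow> (\<exists>x. gensR 1 (\<lambda>_. x))"
proof -
  have "right_gen e1 e2 x \<longleftrightarrow> gensR 1 (\<lambda>_. x)" for x
  proof -
    have "right_gen e1 e2 x \<longleftrightarrow> x \<in> XX \<and> (\<lambda>b. x * b) ` FF = XX"
      unfolding right_gen_def corners using right_multiples by metis
    also have "\<dots> \<longleftrightarrow> gensR 1 (\<lambda>_. x)" unfolding gens1 using XX_FF_mult by blast
    finally show ?thesis .
  qed
  then show ?thesis by (simp add: right_cyclic_def)
qed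

text \<open>The bound is an inequality because for \<open>XX = {0}\<close> the element
  \<open>0\<close> is a generator while the minimal number of generators is
  \<open>0\<close>.\<close>

lemma cyclic_num: "left_cyclic e1 e2 \<longleftrightarrow> numL \<le> 1" "right_cyclic e1 e2 \<longleftrightarrow> numR \<le> 1"
proof -
  have z: "gensL 1 (\<lambda>_. 0)" "gensR 1 (\<lambda>_. 0)" if "XX = {0}" unfolding gens1 that by (auto intro: exI[of _ 0])
  have cL: "gensL 1 c \<Longrightarrow> gensL 1 (\<lambda>_. c 0)" and cR: "gensR 1 c \<Longrightarrow> gensR 1 (\<lambda>_. c 0)" for c
    unfolding gens1 by simp_all
  show "left_cyclic e1 e2 \<longleftrightarrow> numL \<le> 1"
    unfolding left_cyclic_iff using numL z(1) num_zero(1) cL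
    by (metis le_zero_eq le_SucE One_nat_def)
  show "right_cyclic e1 e2 \<longleftrightarrow> numR \<le> 1"
    unfolding right_cyclic_iff using numR z(2) num_zero(2) cR
    by (metis le_zero_eq le_SucE One_nat_def)
qed

text \<open>The existential part of \<open>(L)\<close>, written with elements of the corners;
  \<open>condL_iff\<close> adds left cyclicity.\<close>

definition LL :: "'a \<Rightarrow> 'a \<Rightarrow> bool" where
  "LL x u \<longleftrightarrow> x \<in> XX \<and> u \<in> EE \<and>
    (\<forall>a\<in>EE. \<exists>r\<in>EE. \<exists>s\<in>EE. (\<exists>b\<in>FF. r * x = x * b) \<and> (\<exists>b\<in>FF. s * x = x * b) \<and> a = r + s * u) \<and>
    (\<forall>y\<in>XX. \<exists>b\<in>FF. \<exists>b'\<in>FF. y = x * b + u * x * b')"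
definition RR :: "'a \<Rightarrow> 'a \<Rightarrow> bool" where
  "RR x u \<longleftrightarrow> x \<in> XX \<and> u \<in> FF \<and>
    (\<forall>a\<in>FF. \<exists>r\<in>FF. \<exists>s\<in>FF. (\<exists>b\<in>EE. x * r = b * x) \<and> (\<exists>b\<in>EE. x * s = b * x) \<and> a = r + u * s) \<and>
    (\<forall>y\<in>XX. \<exists>b\<in>EE. \<exists>b'\<in>EE. y = b * x + b' * x * u)"

lemma sum_images: "y \<in> {p + q | p q. p \<in> f ` A \<and> q \<in> g ` A} \<longleftrightarrow> (\<exists>b\<in>A. \<exists>b'\<in>A. y = f b + g b')"
  for y :: 'a by blast

lemma condL_iff: "condL e1 e2 \<longleftrightarrow> numL \<le> 1 \<and> (\<exists>x u. LL x u)"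
proof -
  have "(EE = {r + s * u | r s. r \<in> Rx e1 e2 x \<and> s \<in> Rx e1 e2 x} \<and>
        XX = {p + q | p q. p \<in> {x * a * e2 | a. True} \<and> q \<in> {u * x * a * e2 | a. True}}) \<longleftrightarrow> LL x u"
    if x: "x \<in> XX" and u: "u \<in> EE" for x u
  proof -
    have R: "Rx e1 e2 x = {r \<in> EE. \<exists>b\<in>FF. r * x = x * b}"
      unfolding Rx_def corners right_multiples[OF x] by blast
    have 1: "EE = {r + s * u | r s. r \<in> Rx e1 e2 x \<and> s \<in> Rx e1 e2 x} \<longleftrightarrow>
      (\<forall>a\<in>EE. \<exists>r\<in>EE. \<exists>s\<in>EE. (\<exists>b\<in>FF. r * x = x * b) \<and> (\<exists>b\<in>FF. s * x = x * b) \<and> a = r + s * u)"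
    proof -
      have "{r + s * u | r s. r \<in> Rx e1 e2 x \<and> s \<in> Rx e1 e2 x} \<subseteq> EE"
        unfolding R using u EE_mult Co_add by blast
      then have "EE = {r + s * u | r s. r \<in> Rx e1 e2 x \<and> s \<in> Rx e1 e2 x} \<longleftrightarrow>
        (\<forall>a\<in>EE. a \<in> {r + s * u | r s. r \<in> Rx e1 e2 x \<and> s \<in> Rx e1 e2 x})" by blast
      then show ?thesis unfolding R by blast
    qed
    have ux: "{u * x * a * e2 | a. True} = (\<lambda>b. u * x * b) ` FF" by (rule right_multiples[OF EE_XX_mult[OF u x]])
    have 2: "XX = {p + q | p q. p \<in> {x * a * e2 | a. True} \<and> q \<in> {u * x * a * e2 | a. True}} \<longleftrightarrow>
      (\<forall>y\<in>XX. \<exists>b\<in>FF. \<exists>b'\<in>FF. y = x * b + u * x * b')"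
    proof -
      have "{p + q | p q. p \<in> {x * a * e2 | a. True} \<and> q \<in> {u * x * a * e2 | a. True}} \<subseteq> XX"
        unfolding right_multiples[OF x] ux using XX_FF_mult x EE_XX_mult[OF u x] Co_add by blast
      then have "XX = {p + q | p q. p \<in> {x * a * e2 | a. True} \<and> q \<in> {u * x * a * e2 | a. True}} \<longleftrightarrow>
        (\<forall>y\<in>XX. y \<in> {p + q | p q. p \<in> {x * a * e2 | a. True} \<and> q \<in> {u * x * a * e2 | a. True}})" by blast
      then show ?thesis unfolding right_multiples[OF x] ux sum_images .
    qed
    show ?thesis unfolding 1 2 LL_def using x u by blast
  qed
  then have "(\<exists>x\<in>XX. \<exists>u\<in>EE. EE = {r + s * u | r s. r \<in> Rx e1 e2 x \<and> s \<in> Rx e1 e2 x} \<and>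
        XX = {p + q | p q. p \<in> {x * a * e2 | a. True} \<and> q \<in> {u * x * a * e2 | a. True}}) \<longleftrightarrow> (\<exists>x\<in>XX. \<exists>u\<in>EE. LL x u)"
    by (intro bex_cong refl)
  also have "\<dots> \<longleftrightarrow> (\<exists>x u. LL x u)" unfolding LL_def by blast
  finally show ?thesis unfolding condL_def corners cyclic_num by simp
qed

lemma condR_iff: "condR e1 e2 \<longleftrightarrow> numR \<le> 1 \<and> (\<exists>x u. RR x u)"
proof -
  have "(FF = {r + u * s | r s. r \<in> Lx e1 e2 x \<and> s \<in> Lx e1 e2 x} \<and>
        XX = {p + q | p q. p \<in> {e1 * a * x | a. True} \<and> q \<in> {e1 * a * x * u | a. True}}) \<longleftrightarrow> RR x u"
    if x: "x \<in> XX" and u: "u \<in> FF" for x u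
  proof -
    have R: "Lx e1 e2 x = {r \<in> FF. \<exists>b\<in>EE. x * r = b * x}"
      unfolding Lx_def corners left_multiples[OF x] by blast
    have 1: "FF = {r + u * s | r s. r \<in> Lx e1 e2 x \<and> s \<in> Lx e1 e2 x} \<longleftrightarrow>
      (\<forall>a\<in>FF. \<exists>r\<in>FF. \<exists>s\<in>FF. (\<exists>b\<in>EE. x * r = b * x) \<and> (\<exists>b\<in>EE. x * s = b * x) \<and> a = r + u * s)"
    proof -
      have "{r + u * s | r s. r \<in> Lx e1 e2 x \<and> s \<in> Lx e1 e2 x} \<subseteq> FF"
        unfolding R using u FF_mult Co_add by blast
      then have "FF = {r + u * s | r s. r \<in> Lx e1 e2 x \<and> s \<in> Lx e1 e2 x} \<longleftrightarrow>
        (\<forall>a\<in>FF. a \<in> {r + u * s | r s. r \<in> Lx e1 e2 x \<and> s \<in> Lx e1 e2 x})" by blast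
      then show ?thesis unfolding R by blast
    qed
    have "{e1 * a * x * u | a. True} = {e1 * a * (x * u) | a. True}" by (simp add: mult.assoc)
    then have ux: "{e1 * a * x * u | a. True} = (\<lambda>b. b * x * u) ` EE"
      unfolding left_multiples[OF XX_FF_mult[OF x u]] by (simp add: mult.assoc)
    have 2: "XX = {p + q | p q. p \<in> {e1 * a * x | a. True} \<and> q \<in> {e1 * a * x * u | a. True}} \<longleftrightarrow>
      (\<forall>y\<in>XX. \<exists>b\<in>EE. \<exists>b'\<in>EE. y = b * x + b' * x * u)"
    proof -
      have "{p + q | p q. p \<in> {e1 * a * x | a. True} \<and> q \<in> {e1 * a * x * u | a. True}} \<subseteq> XX"
        unfolding left_multiples[OF x] ux using XX_FF_mult[OF _ u] x EE_XX_mult Co_add by blast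
      then have "XX = {p + q | p q. p \<in> {e1 * a * x | a. True} \<and> q \<in> {e1 * a * x * u | a. True}} \<longleftrightarrow>
        (\<forall>y\<in>XX. y \<in> {p + q | p q. p \<in> {e1 * a * x | a. True} \<and> q \<in> {e1 * a * x * u | a. True}})" by blast
      then show ?thesis unfolding left_multiples[OF x] ux sum_images .
    qed
    show ?thesis unfolding 1 2 RR_def using x u by blast
  qed
  then have "(\<exists>x\<in>XX. \<exists>u\<in>FF. FF = {r + u * s | r s. r \<in> Lx e1 e2 x \<and> s \<in> Lx e1 e2 x} \<and>
        XX = {p + q | p q. p \<in> {e1 * a * x | a. True} \<and> q \<in> {e1 * a * x * u | a. True}}) \<longleftrightarrow> (\<exists>x\<in>XX. \<exists>u\<in>FF. RR x u)"
    by (intro bex_cong refl)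
  also have "\<dots> \<longleftrightarrow> (\<exists>x u. RR x u)" unfolding RR_def by blast
  finally show ?thesis unfolding condR_def corners cyclic_num by simp
qed

text \<open>For a right generator \<open>z\<close> the set \<open>R_z\<close> is the whole corner
  \<open>EE\<close>, so \<open>u = 0\<close> satisfies the remaining part of \<open>(L)\<close>. A
  left generator does the same for \<open>(R)\<close>.\<close>

lemma cyclic_conds:
  assumes "numL \<le> 1" "numR \<le> 1" shows "condL e1 e2" "condR e1 e2"
proof -
  obtain x where x: "gensL 1 (\<lambda>_. x)" using assms(1) unfolding cyclic_num[symmetric] left_cyclic_iff by blast
  obtain z where z: "gensR 1 (\<lambda>_. z)" using assms(2) unfolding cyclic_num[symmetric] right_cyclic_iff by blast
  have "LL z 0" unfolding LL_def
  proof (intro conjI ballI)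
    show "z \<in> XX" "0 \<in> EE" using z unfolding gens1 by simp_all
    fix a assume a: "a \<in> EE"
    have "\<exists>b\<in>FF. a * z = z * b" using z EE_XX_mult[OF a] unfolding gens1 by simp
    moreover have "0 * z = z * 0" by simp
    ultimately show "\<exists>r\<in>EE. \<exists>s\<in>EE. (\<exists>b\<in>FF. r * z = z * b) \<and> (\<exists>b\<in>FF. s * z = z * b) \<and> a = r + s * 0"
      using a Co_zero by (intro bexI[of _ a] bexI[of _ 0]) auto
  next
    fix y assume "y \<in> XX"
    then obtain b where "b \<in> FF" "y = z * b" using z unfolding gens1 by auto
    then show "\<exists>b\<in>FF. \<exists>b'\<in>FF. y = z * b + 0 * z * b'" using Co_zero by auto
  qed
  then show "condL e1 e2" unfolding condL_iff using assms by blast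
  have "RR x 0" unfolding RR_def
  proof (intro conjI ballI)
    show "x \<in> XX" "0 \<in> FF" using x unfolding gens1 by simp_all
    fix a assume a: "a \<in> FF"
    have "\<exists>b\<in>EE. x * a = b * x" using x XX_FF_mult[OF _ a] unfolding gens1 by simp
    moreover have "x * 0 = 0 * x" by simp
    ultimately show "\<exists>r\<in>FF. \<exists>s\<in>FF. (\<exists>b\<in>EE. x * r = b * x) \<and> (\<exists>b\<in>EE. x * s = b * x) \<and> a = r + 0 * s"
      using a Co_zero by (intro bexI[of _ a] bexI[of _ 0]) auto
  next
    fix y assume "y \<in> XX"
    then obtain b where "b \<in> EE" "y = b * x" using x unfolding gens1 by auto
    then show "\<exists>b\<in>EE. \<exists>b'\<in>EE. y = b * x + b' * x * 0" using Co_zero by auto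
  qed
  then show "condR e1 e2" unfolding condR_iff using assms by blast
qed

lemma nakayama_left: assumes "r \<in> EE" "r \<in> Jac" "x \<in> XX" "x = r * x" shows "x = 0"
proof -
  have "r \<in> lc.nonunits True" using assms Jac_corner by blast
  then obtain v where v: "v * (L True - r) = L True" using lc.inv_el_u_minus unfolding lc.inv_el_def by blast
  have "(L True - r) * x = 0" using assms(3,4) by (simp add: Co_iff left_diff_distrib)
  then have "v * (L True - r) * x = 0" by (simp add: mult.assoc)
  then show ?thesis using v assms(3) by (simp add: Co_iff)
qed

lemma nakayama_right: assumes "r \<in> FF" "r \<in> Jac" "x \<in> XX" "x = x * r" shows "x = 0"
proof -
  have "r \<in> lc.nonunits False" using assms Jac_corner by blast
  then obtain v where v: "(L False - r) * v = L False" using lc.inv_el_u_minus unfolding lc.inv_el_def by blast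
  have "x * (L False - r) = 0" using assms(3,4) by (simp add: Co_iff right_diff_distrib)
  then have "x * ((L False - r) * v) = 0" by (simp add: mult.assoc[symmetric])
  then show ?thesis using v assms(3) by (simp add: Co_iff)
qed

lemma row_col_1: "rowob 1 (\<lambda>_. x) = colob 1 (\<lambda>_. x)"
  by (auto simp: rowob_def colob_def fun_eq_iff)

text \<open>The \<open>x\<close> of condition \<open>(L)\<close> is itself a left generator. Write
  \<open>x = \<rho> x0\<close> with a left generator \<open>x0\<close>. Right factors can be moved
  to the left of \<open>x0\<close>, so a radical \<open>\<rho>\<close> would give
  \<open>x0 = r x0\<close> with \<open>r\<close> in \<open>Jac\<close> and hence
  \<open>x0 = 0\<close>, against \<open>numL = 1\<close>.\<close>

lemma LL_gens:
  assumes l: "LL x u" and n: "numL = 1"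
  shows "gensL 1 (\<lambda>_. x)" "gensR 2 (\<lambda>j. if j = 0 then x else u * x)"
proof -
  have x: "x \<in> XX" and u: "u \<in> EE" and gen: "\<And>y. y \<in> XX \<Longrightarrow> \<exists>b\<in>FF. \<exists>b'\<in>FF. y = x * b + u * x * b'"
    using l by (auto simp: LL_def)
  show "gensR 2 (\<lambda>j. if j = 0 then x else u * x)" unfolding gens2 using x EE_XX_mult[OF u x] gen by simp
  obtain c where c: "gensL 1 c" using numL(1) unfolding n by blast
  define x0 where "x0 = c 0"
  have x0: "x0 \<in> XX" "\<And>y. y \<in> XX \<Longrightarrow> \<exists>a\<in>EE. y = a * x0" using c unfolding gens1 x0_def by auto
  obtain \<rho> where \<rho>: "\<rho> \<in> EE" "x = \<rho> * x0" using x0(2)[OF x] by blast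
  have "\<rho> \<notin> Jac"
  proof
    assume J: "\<rho> \<in> Jac"
    obtain b b' where b: "b \<in> FF" "b' \<in> FF" "x0 = x * b + u * x * b'" using gen[OF x0(1)] by blast
    obtain f where f: "f \<in> EE" "x0 * b = f * x0" using x0(2)[OF XX_FF_mult[OF x0(1) b(1)]] by blast
    obtain f' where f': "f' \<in> EE" "x0 * b' = f' * x0" using x0(2)[OF XX_FF_mult[OF x0(1) b(2)]] by blast
    have "x0 = \<rho> * (x0 * b) + u * \<rho> * (x0 * b')" using b(3) unfolding \<rho>(2) by (simp add: mult.assoc)
    also have "\<dots> = (\<rho> * f + u * \<rho> * f') * x0" unfolding f(2) f'(2) by (simp add: mult.assoc distrib_right)
    finally have "x0 = (\<rho> * f + u * \<rho> * f') * x0" .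
    moreover have "\<rho> * f + u * \<rho> * f' \<in> Jac"
      by (rule Jac_add[OF Jac_mult[OF disjI1] Jac_mult[OF disjI1[OF Jac_mult[OF disjI2]]]]) (rule J)+
    moreover have "\<rho> * f + u * \<rho> * f' \<in> EE"
      by (rule Co_add[OF EE_mult[OF \<rho>(1) f(1)] EE_mult[OF EE_mult[OF u \<rho>(1)] f'(1)]])
    ultimately have "x0 = 0" using nakayama_left x0(1) by blast
    then have "XX = {0}" using x0(2) Co_zero by force
    then show False using num_zero(1) n by simp
  qed
  then obtain w where w: "w \<in> EE" "w * \<rho> = L True" using not_Jac_inverse[OF \<rho>(1)] by blast
  have "w * x = x0" unfolding \<rho>(2) mult.assoc[symmetric] w(2) using x0(1) by (simp add: Co_iff)
  then have "\<exists>a\<in>EE. y = a * x" if y: "y \<in> XX" for y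
  proof -
    obtain a where a: "a \<in> EE" "y = a * x0" using x0(2)[OF y] by blast
    then have "y = (a * w) * x" using \<open>w * x = x0\<close> by (simp add: mult.assoc)
    then show ?thesis using EE_mult[OF a(1) w(1)] by blast
  qed
  then show "gensL 1 (\<lambda>_. x)" unfolding gens1 using x by blast
qed

lemma RR_gens:
  assumes l: "RR x u" and n: "numR = 1"
  shows "gensR 1 (\<lambda>_. x)" "gensL 2 (\<lambda>j. if j = 0 then x else x * u)"
proof -
  have x: "x \<in> XX" and u: "u \<in> FF" and gen: "\<And>y. y \<in> XX \<Longrightarrow> \<exists>b\<in>EE. \<exists>b'\<in>EE. y = b * x + b' * x * u"
    using l by (auto simp: RR_def)
  show "gensL 2 (\<lambda>j. if j = 0 then x else x * u)" unfolding gens2 using x XX_FF_mult[OF x u] gen by (simp add: mult.assoc)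
  obtain c where c: "gensR 1 c" using numR(1) unfolding n by blast
  define x0 where "x0 = c 0"
  have x0: "x0 \<in> XX" "\<And>y. y \<in> XX \<Longrightarrow> \<exists>a\<in>FF. y = x0 * a" using c unfolding gens1 x0_def by auto
  obtain \<rho> where \<rho>: "\<rho> \<in> FF" "x = x0 * \<rho>" using x0(2)[OF x] by blast
  have "\<rho> \<notin> Jac"
  proof
    assume J: "\<rho> \<in> Jac"
    obtain b b' where b: "b \<in> EE" "b' \<in> EE" "x0 = b * x + b' * x * u" using gen[OF x0(1)] by blast
    obtain f where f: "f \<in> FF" "b * x0 = x0 * f" using x0(2)[OF EE_XX_mult[OF b(1) x0(1)]] by blast
    obtain f' where f': "f' \<in> FF" "b' * x0 = x0 * f'" using x0(2)[OF EE_XX_mult[OF b(2) x0(1)]] by blast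
    have "x0 = (b * x0) * \<rho> + (b' * x0) * \<rho> * u" using b(3) unfolding \<rho>(2) by (simp add: mult.assoc)
    also have "\<dots> = x0 * (f * \<rho> + f' * \<rho> * u)" unfolding f(2) f'(2) by (simp add: mult.assoc distrib_left)
    finally have "x0 = x0 * (f * \<rho> + f' * \<rho> * u)" .
    moreover have "f * \<rho> + f' * \<rho> * u \<in> Jac"
      by (rule Jac_add[OF Jac_mult[OF disjI2] Jac_mult[OF disjI1[OF Jac_mult[OF disjI2]]]]) (rule J)+
    moreover have "f * \<rho> + f' * \<rho> * u \<in> FF"
      by (rule Co_add[OF FF_mult[OF f(1) \<rho>(1)] FF_mult[OF FF_mult[OF f'(1) \<rho>(1)] u]])
    ultimately have "x0 = 0" using nakayama_right x0(1) by blast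
    then have "XX = {0}" using x0(2) Co_zero by force
    then show False using num_zero(2) n by simp
  qed
  then obtain w where w: "w \<in> FF" "\<rho> * w = L False" using not_Jac_inverse[OF \<rho>(1)] by blast
  have xw: "x * w = x0" unfolding \<rho>(2) mult.assoc w(2) using x0(1) by (simp add: Co_iff)
  have "\<exists>a\<in>FF. y = x * a" if y: "y \<in> XX" for y
  proof -
    obtain a where a: "a \<in> FF" "y = x0 * a" using x0(2)[OF y] by blast
    then have "y = x * (w * a)" using xw by (simp add: mult.assoc[symmetric])
    then show ?thesis using FF_mult[OF w(1) a(1)] by blast
  qed
  then show "gensR 1 (\<lambda>_. x)" unfolding gens1 using x by blast
qed

lemma cmpo_row2_1:
  assumes "d 0 \<in> XX" "d 1 \<in> XX" "x \<in> XX"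
  shows "cmpo (rowob 2 d) (colob 1 (\<lambda>_. x)) \<longleftrightarrow>
    (\<forall>p\<in>XX. \<forall>q\<in>XX. \<exists>m\<in>EE. \<exists>b\<in>FF. \<exists>b'\<in>FF. p = m * d 0 + x * b \<and> q = m * d 1 + x * b')" (is "?A \<longleftrightarrow> ?B")
proof
  have r2: "rp 2 False = [False, False]" "rp 1 True = [True]" by (simp_all add: eval_nat_numeral)
  assume A: ?A
  show ?B
  proof (intro ballI)
    fix p q assume pq: "p \<in> XX" "q \<in> XX"
    define f :: "'a mat" where "f = (\<lambda>i j. if i = 0 then (if j = 0 then p else if j = 1 then q else 0) else 0)"
    have "hm [False, False] [True] f" using pq by (auto simp: f_def less_Suc_eq intro!: hmI)
    then obtain P Q where PQ: "hm [True] [True] P" "hm [False, False] [False] Q"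
      "f = mmul 1 P (df (rowob 2 d)) + mmul 1 (df (colob 1 (\<lambda>_. x))) Q"
      using A unfolding cmpo_def cmp_def sl_tl_ob r2 by auto
    have "P 0 0 \<in> EE" "Q 0 0 \<in> FF" "Q 0 1 \<in> FF" using hmD[OF PQ(1), of 0 0] hmD[OF PQ(2), of 0 0] hmD[OF PQ(2), of 0 1] by auto
    moreover have "p = P 0 0 * d 0 + x * Q 0 0" "q = P 0 0 * d 1 + x * Q 0 1"
      using fun_cong[OF fun_cong[OF PQ(3), of 0], of 0] fun_cong[OF fun_cong[OF PQ(3), of 0], of 1]
      by (simp_all add: f_def mmul_def)
    ultimately show "\<exists>m\<in>EE. \<exists>b\<in>FF. \<exists>b'\<in>FF. p = m * d 0 + x * b \<and> q = m * d 1 + x * b'" by blast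
  qed
next
  have r2: "rp 2 False = [False, False]" "rp 1 True = [True]" by (simp_all add: eval_nat_numeral)
  assume B: ?B
  show ?A
  proof (rule cmpoI, unfold sl_tl_ob r2 ob_simps)
    fix f assume f: "hm [False, False] [True] f"
    have "f 0 0 \<in> XX" "f 0 1 \<in> XX" using hmD[OF f, of 0 0] hmD[OF f, of 0 1] by auto
    then obtain m b b' where *: "m \<in> EE" "b \<in> FF" "b' \<in> FF" "f 0 0 = m * d 0 + x * b" "f 0 1 = m * d 1 + x * b'"
      using B by blast
    let ?P = "\<lambda>(i::nat) (j::nat). if i = 0 \<and> j = 0 then m else 0"
    let ?Q = "\<lambda>(i::nat) (j::nat). if i = 0 then (if j = 0 then b else if j = 1 then b' else 0) else 0"
    have "hm [True] [True] ?P" "hm [False, False] [False] ?Q" using * by (auto simp: less_Suc_eq intro!: hmI)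
    moreover have "f = mmul 1 ?P (\<lambda>i j. if i = 0 \<and> j < 2 then d j else 0) + mmul 1 (\<lambda>i j. if i < 1 \<and> j = 0 then x else 0) ?Q"
    proof (intro ext)
      fix i j :: nat
      consider "i = 0" "j = 0" | "i = 0" "j = 1" | "i \<noteq> 0 \<or> j \<ge> 2" by linarith
      then show "f i j = (mmul 1 ?P (\<lambda>i j. if i = 0 \<and> j < 2 then d j else 0) + mmul 1 (\<lambda>i j. if i < 1 \<and> j = 0 then x else 0) ?Q) i j"
        by cases (use * hmD0[OF f, of i j] in \<open>auto simp: mmul_def\<close>)
    qed
    ultimately show "\<exists>p q. hm [True] [True] p \<and> hm [False, False] [False] q \<and>
      f = mmul 1 p (\<lambda>i j. if i = 0 \<and> j < 2 then d j else 0) + mmul 1 (\<lambda>i j. if i < 1 \<and> j = 0 then x else 0) q" by blast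
  qed
qed

lemma cmpo_1_col2:
  assumes "d 0 \<in> XX" "d 1 \<in> XX" "x \<in> XX"
  shows "cmpo (rowob 1 (\<lambda>_. x)) (colob 2 d) \<longleftrightarrow>
    (\<forall>p\<in>XX. \<forall>q\<in>XX. \<exists>m\<in>FF. \<exists>b\<in>EE. \<exists>b'\<in>EE. p = d 0 * m + b * x \<and> q = d 1 * m + b' * x)" (is "?A \<longleftrightarrow> ?B")
proof
  have r2: "rp 2 True = [True, True]" "rp 1 False = [False]" by (simp_all add: eval_nat_numeral)
  assume A: ?A
  show ?B
  proof (intro ballI)
    fix p q assume pq: "p \<in> XX" "q \<in> XX"
    define f :: "'a mat" where "f = (\<lambda>i j. if j = 0 then (if i = 0 then p else if i = 1 then q else 0) else 0)"
    have "hm [False] [True, True] f" using pq by (auto simp: f_def less_Suc_eq intro!: hmI)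
    then obtain P Q where PQ: "hm [True] [True, True] P" "hm [False] [False] Q"
      "f = mmul 1 P (df (rowob 1 (\<lambda>_. x))) + mmul 1 (df (colob 2 d)) Q"
      using A unfolding cmpo_def cmp_def sl_tl_ob r2 by auto
    have "P 0 0 \<in> EE" "P 1 0 \<in> EE" "Q 0 0 \<in> FF" using hmD[OF PQ(1), of 0 0] hmD[OF PQ(1), of 1 0] hmD[OF PQ(2), of 0 0] by auto
    moreover have "p = d 0 * Q 0 0 + P 0 0 * x" "q = d 1 * Q 0 0 + P 1 0 * x"
      using fun_cong[OF fun_cong[OF PQ(3), of 0], of 0] fun_cong[OF fun_cong[OF PQ(3), of 1], of 0]
      by (simp_all add: f_def mmul_def add.commute)
    ultimately show "\<exists>m\<in>FF. \<exists>b\<in>EE. \<exists>b'\<in>EE. p = d 0 * m + b * x \<and> q = d 1 * m + b' * x" by blast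
  qed
next
  have r2: "rp 2 True = [True, True]" "rp 1 False = [False]" by (simp_all add: eval_nat_numeral)
  assume B: ?B
  show ?A
  proof (rule cmpoI, unfold sl_tl_ob r2 ob_simps)
    fix f assume f: "hm [False] [True, True] f"
    have "f 0 0 \<in> XX" "f 1 0 \<in> XX" using hmD[OF f, of 0 0] hmD[OF f, of 1 0] by auto
    then obtain m b b' where *: "m \<in> FF" "b \<in> EE" "b' \<in> EE" "f 0 0 = d 0 * m + b * x" "f 1 0 = d 1 * m + b' * x"
      using B by blast
    let ?Q = "\<lambda>(i::nat) (j::nat). if i = 0 \<and> j = 0 then m else 0"
    let ?P = "\<lambda>(i::nat) (j::nat). if j = 0 then (if i = 0 then b else if i = 1 then b' else 0) else 0"
    have "hm [True] [True, True] ?P" "hm [False] [False] ?Q" using * by (auto simp: less_Suc_eq intro!: hmI)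
    moreover have "f = mmul 1 ?P (\<lambda>i j. if i = 0 \<and> j < 1 then x else 0) + mmul 1 (\<lambda>i j. if i < 2 \<and> j = 0 then d i else 0) ?Q"
    proof (intro ext)
      fix i j :: nat
      consider "i = 0" "j = 0" | "i = 1" "j = 0" | "j \<noteq> 0 \<or> i \<ge> 2" by linarith
      then show "f i j = (mmul 1 ?P (\<lambda>i j. if i = 0 \<and> j < 1 then x else 0) + mmul 1 (\<lambda>i j. if i < 2 \<and> j = 0 then d i else 0) ?Q) i j"
        by cases (use * hmD0[OF f, of i j] in \<open>auto simp: mmul_def add.commute\<close>)
    qed
    ultimately show "\<exists>p q. hm [True] [True, True] p \<and> hm [False] [False] q \<and>
      f = mmul 1 p (\<lambda>i j. if i = 0 \<and> j < 1 then x else 0) + mmul 1 (\<lambda>i j. if i < 2 \<and> j = 0 then d i else 0) q" by blast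
  qed
qed

text \<open>This is where condition \<open>(L)\<close> comes from: the two-term objects with matrices \<open>(x, u x) : P2^2 \<rightarrow> P1\<close> and
  \<open>x : P2 \<rightarrow> P1\<close> are compatible exactly because \<open>EE = Rx + Rx u\<close>.\<close>

lemma LL_cmpo:
  assumes l: "LL x u" and g: "gensL 1 (\<lambda>_. x)"
  shows "cmpo (rowob 2 (\<lambda>j. if j = 0 then x else u * x)) (colob 1 (\<lambda>_. x))"
proof -
  have x: "x \<in> XX" and u: "u \<in> EE" using l by (auto simp: LL_def)
  have G: "\<And>y. y \<in> XX \<Longrightarrow> \<exists>a\<in>EE. y = a * x" using g unfolding gens1 by auto
  have *: "\<exists>m\<in>EE. \<exists>b\<in>FF. \<exists>b'\<in>FF. p = m * x + x * b \<and> q = m * (u * x) + x * b'" if pq: "p \<in> XX" "q \<in> XX" for p q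
  proof -
    obtain a c where ac: "a \<in> EE" "p = a * x" "c \<in> EE" "q = c * x" using G pq by blast
    \<comment> \<open>From \<open>c = a u + r + s u\<close> the choice \<open>m = a + s\<close>
      gives \<open>q = m u x + r x\<close> and \<open>p = m x - s x\<close>, and both
      \<open>r x\<close> and \<open>s x\<close> lie in \<open>x FF\<close>.\<close>
    have "c - a * u \<in> EE" using ac u EE_mult Co_diff by blast
    then obtain r s b b' where rs: "r \<in> EE" "s \<in> EE" "b \<in> FF" "r * x = x * b" "b' \<in> FF" "s * x = x * b'" "c - a * u = r + s * u"
      using l unfolding LL_def by blast
    have "p = (a + s) * x + x * (- b')" unfolding ac(2) by (simp add: distrib_right rs(6)[symmetric])
    moreover have "c = r + (a + s) * u" using rs(7) by (simp add: algebra_simps)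
    then have "q = (a + s) * (u * x) + x * b" unfolding ac(4) rs(4)[symmetric] by (simp add: distrib_right mult.assoc add.commute)
    moreover have "a + s \<in> EE" "- b' \<in> FF" using ac rs Co_add Co_uminus by auto
    ultimately show ?thesis using rs(3) by blast
  qed
  show ?thesis by (subst cmpo_row2_1) (use x EE_XX_mult[OF u x] * in auto)
qed

lemma RR_cmpo:
  assumes l: "RR x u" and g: "gensR 1 (\<lambda>_. x)"
  shows "cmpo (rowob 1 (\<lambda>_. x)) (colob 2 (\<lambda>j. if j = 0 then x else x * u))"
proof -
  have x: "x \<in> XX" and u: "u \<in> FF" using l by (auto simp: RR_def)
  have G: "\<And>y. y \<in> XX \<Longrightarrow> \<exists>a\<in>FF. y = x * a" using g unfolding gens1 by auto
  have *: "\<exists>m\<in>FF. \<exists>b\<in>EE. \<exists>b'\<in>EE. p = x * m + b * x \<and> q = (x * u) * m + b' * x" if pq: "p \<in> XX" "q \<in> XX" for p q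
  proof -
    obtain a c where ac: "a \<in> FF" "p = x * a" "c \<in> FF" "q = x * c" using G pq by blast
    have "c - u * a \<in> FF" using ac u FF_mult Co_diff by blast
    then obtain r s b b' where rs: "r \<in> FF" "s \<in> FF" "b \<in> EE" "x * r = b * x" "b' \<in> EE" "x * s = b' * x" "c - u * a = r + u * s"
      using l unfolding RR_def by blast
    have "p = x * (a + s) + (- b') * x" unfolding ac(2) by (simp add: distrib_left rs(6)[symmetric])
    moreover have "c = r + u * (a + s)" using rs(7) by (simp add: algebra_simps)
    then have "q = (x * u) * (a + s) + b * x" unfolding ac(4) rs(4)[symmetric] by (simp add: distrib_left mult.assoc add.commute)
    moreover have "a + s \<in> FF" "- b' \<in> EE" using ac rs Co_add Co_uminus by auto
    ultimately show ?thesis using rs(3) by blast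
  qed
  show ?thesis by (subst cmpo_1_col2) (use x XX_FF_mult[OF x u] * in auto)
qed

lemma gpair_L:
  assumes l: "LL x u" and n: "numL = 1" "numR = 2"
  shows "gpair (colob 1 (\<lambda>_. x)) (rowob 2 (\<lambda>j. if j = 0 then x else u * x))"
    "basic_silting_pair e1 e2 (ctt (colob 1 (\<lambda>_. x))) (ctt (rowob 2 (\<lambda>j. if j = 0 then x else u * x)))"
proof -
  note g = LL_gens[OF l n(1)]
  let ?U = "colob 1 (\<lambda>_. x)" and ?V = "rowob 2 (\<lambda>j. if j = 0 then x else u * x)"
  have lo: "loc ?U" "loc ?V" using loc_colob[of "\<lambda>_. x"] loc_rowob[of "\<lambda>j. if j = 0 then x else u * x"] g n by simp_all
  show gp: "gpair ?U ?V"
    by (rule gpairI[OF lo]) (use cmpo_colob[OF g(1)] cmpo_rowob[OF g(2)] LL_cmpo[OF l g(1)] in auto)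
  show "basic_silting_pair e1 e2 (ctt ?U) (ctt ?V)"
  proof (rule silting_pairI[OF gp])
    fix S assume S: "ctt ?U \<in> thick e1 e2 S" "ctt ?V \<in> thick e1 e2 S"
    have x: "x \<in> XX" "u * x \<in> XX" using l EE_XX_mult by (auto simp: LL_def)
    have F: "stalk 0 [False] \<in> thick e1 e2 S" by (rule thick_1_2_row[OF x]) (use S[folded row_col_1] in simp_all)
    have "stalk 0 (tl ?U) \<in> thick e1 e2 S" by (rule thick_row[OF locD(1)[OF lo(1)] _ S(1)]) (use F in \<open>simp add: sl_tl_ob\<close>)
    then show "stalk 0 [True] \<in> thick e1 e2 S \<and> stalk 0 [False] \<in> thick e1 e2 S" using F by (simp add: sl_tl_ob)
  qed
qed

lemma gpair_R:
  assumes l: "RR x u" and n: "numR = 1" "numL = 2"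
  shows "gpair (rowob 1 (\<lambda>_. x)) (colob 2 (\<lambda>j. if j = 0 then x else x * u))"
    "basic_silting_pair e1 e2 (ctt (rowob 1 (\<lambda>_. x))) (ctt (colob 2 (\<lambda>j. if j = 0 then x else x * u)))"
proof -
  note g = RR_gens[OF l n(1)]
  let ?U = "rowob 1 (\<lambda>_. x)" and ?V = "colob 2 (\<lambda>j. if j = 0 then x else x * u)"
  have lo: "loc ?U" "loc ?V" using loc_rowob[of "\<lambda>_. x"] loc_colob[of "\<lambda>j. if j = 0 then x else x * u"] g n by simp_all
  show gp: "gpair ?U ?V"
    by (rule gpairI[OF lo]) (use cmpo_rowob[OF g(1)] cmpo_colob[OF g(2)] RR_cmpo[OF l g(1)] in auto)
  show "basic_silting_pair e1 e2 (ctt ?U) (ctt ?V)"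
  proof (rule silting_pairI[OF gp])
    fix S assume S: "ctt ?U \<in> thick e1 e2 S" "ctt ?V \<in> thick e1 e2 S"
    have x: "x \<in> XX" "x * u \<in> XX" using l XX_FF_mult by (auto simp: RR_def)
    have F: "stalk 0 [True] \<in> thick e1 e2 S" by (rule thick_1_2_col[OF x]) (use S[unfolded row_col_1] in simp_all)
    have "stalk 0 (sl ?U) \<in> thick e1 e2 S" by (rule thick_col[OF locD(1)[OF lo(1)] _ S(1)]) (use F in \<open>simp add: sl_tl_ob\<close>)
    then show "stalk 0 [True] \<in> thick e1 e2 S \<and> stalk 0 [False] \<in> thick e1 e2 S" using F by (simp add: sl_tl_ob)
  qed
qed

text \<open>The classes determine the objects: \<open>U1\<close> is given by a left generator
  \<open>x\<close> and \<open>U2\<close> by two right generators \<open>s x\<close>,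
  \<open>t x\<close>. By Nakayama \<open>s\<close> or \<open>t\<close> is invertible, and
  \<open>u\<close> is the inverse of that one times the other.\<close>

lemma gpair_imp_LL:
  assumes g: "gpair U1 U2" and ab: "na U1 = 1" "nb U1 = 1" "na U2 = 1" "nb U2 = 2" and n: "numL = 1" "numR = 2"
  shows "\<exists>x u. LL x u"
proof -
  have l: "loc U1" "loc U2" and c: "cmpo U1 U1" "cmpo U2 U1" "cmpo U2 U2" using g by (auto simp: gpair_def)
  obtain cc where cc: "gensL 1 cc" using numL(1) unfolding n by blast
  obtain d where d: "gensR 2 d" using numR(1) unfolding n by blast
  have "iso U1 P1o \<or> iso U1 (colob 1 cc)" using first_cone[of cc U1] cc l c ab n by simp
  then have i1: "iso U1 (colob 1 cc)" using iso_ab[of U1 P1o] ab by auto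
  have "iso U2 (rowob 2 d) \<or> iso U2 P2o" using last_cone[of d U2] d l c ab n by simp
  then have i2: "iso U2 (rowob 2 d)" using iso_ab[of U2 P2o] ab by auto
  have c21: "cmpo (rowob 2 d) (colob 1 cc)" using cmpo_iso[OF locD(1)[OF l(2)] locD(1)[OF l(1)] i2 i1 c(2)] .
  define x where "x = cc 0"
  have "colob 1 cc = colob 1 (\<lambda>_. x)" by (auto simp: colob_def x_def fun_eq_iff)
  have x: "x \<in> XX" "\<And>y. y \<in> XX \<Longrightarrow> \<exists>a\<in>EE. y = a * x" using cc unfolding gens1 x_def by auto
  have dX: "d 0 \<in> XX" "d 1 \<in> XX" and dgen: "\<And>y. y \<in> XX \<Longrightarrow> \<exists>a\<in>FF. \<exists>b\<in>FF. y = d 0 * a + d 1 * b"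
    using d unfolding gens2 by auto
  have cm: "\<And>p q. p \<in> XX \<Longrightarrow> q \<in> XX \<Longrightarrow> \<exists>m\<in>EE. \<exists>b\<in>FF. \<exists>b'\<in>FF. p = m * d 0 + x * b \<and> q = m * d 1 + x * b'"
    using c21 unfolding \<open>colob 1 cc = colob 1 (\<lambda>_. x)\<close> cmpo_row2_1[OF dX x(1)] by blast
  have main: "\<exists>u. LL x u"
    if s: "s \<in> EE" "y = s * x" and t: "t \<in> EE" "z = t * x" and sJ: "s \<notin> Jac"
      and gen: "\<And>v. v \<in> XX \<Longrightarrow> \<exists>a\<in>FF. \<exists>b\<in>FF. v = y * a + z * b"
      and cm: "\<And>q. q \<in> XX \<Longrightarrow> \<exists>m\<in>EE. \<exists>b\<in>FF. \<exists>b'\<in>FF. 0 = m * y + x * b \<and> q = m * z + x * b'" for s t y z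
  proof -
    obtain w where w: "w \<in> EE" "w * s = L True" "s * w = L True" using not_Jac_inverse[OF s(1) sJ] by blast
    define u where "u = w * t"
    have u: "u \<in> EE" unfolding u_def using EE_mult[OF w(1) t(1)] .
    have wy: "w * y = x" unfolding s(2) mult.assoc[symmetric] w(2) using x(1) by (simp add: Co_iff)
    have wz: "w * z = u * x" unfolding t(2) u_def by (simp add: mult.assoc)
    have "LL x u" unfolding LL_def
    proof (intro conjI ballI x(1) u)
      fix a assume a: "a \<in> EE"
      \<comment> \<open>Compatibility is applied to the pair \<open>(0, a x)\<close>. The first
        entry puts \<open>m s\<close> into \<open>R_x\<close>, the second puts
        \<open>a - m t\<close> there, and \<open>m t = (m s) u\<close> since
        \<open>u = w t\<close>.\<close>
      obtain m b b' where m: "m \<in> EE" "b \<in> FF" "b' \<in> FF" "0 = m * y + x * b" "a * x = m * z + x * b'"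
        using cm[OF EE_XX_mult[OF a x(1)]] by blast
      let ?s = "m * s" and ?r = "a - m * t"
      have "?s * x = x * (- b)" using m(4) unfolding s(2) by (simp add: mult.assoc eq_neg_iff_add_eq_0)
      moreover have "?r * x = x * b'" using m(5) unfolding t(2) by (simp add: left_diff_distrib mult.assoc)
      moreover have "a = ?r + ?s * u"
      proof -
        have "?s * u = m * (s * w) * t" unfolding u_def by (simp only: mult.assoc)
        also have "\<dots> = m * t" unfolding w(3) using m(1) by (simp add: Co_iff)
        finally show ?thesis by simp
      qed
      moreover have "?s \<in> EE" "?r \<in> EE" "- b \<in> FF" using m s t a EE_mult Co_diff Co_uminus by auto
      ultimately show "\<exists>r\<in>EE. \<exists>s\<in>EE. (\<exists>b\<in>FF. r * x = x * b) \<and> (\<exists>b\<in>FF. s * x = x * b) \<and> a = r + s * u"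
        using m(3) by blast
    next
      fix v assume v: "v \<in> XX"
      \<comment> \<open>The generation hypothesis is used for \<open>s v\<close>, because
        multiplication by \<open>w\<close> restores \<open>v\<close> and turns \<open>y\<close>,
        \<open>z\<close> into \<open>x\<close>, \<open>u x\<close>.\<close>
      obtain a b where ab: "a \<in> FF" "b \<in> FF" "s * v = y * a + z * b" using gen[OF EE_XX_mult[OF s(1) v]] by blast
      have "v = w * (s * v)" unfolding mult.assoc[symmetric] w(2) using v by (simp add: Co_iff)
      also have "\<dots> = (w * y) * a + (w * z) * b" unfolding ab(3) by (simp add: distrib_left mult.assoc)
      finally show "\<exists>b\<in>FF. \<exists>b'\<in>FF. v = x * b + u * x * b'" unfolding wy wz using ab by blast
    qed
    then show ?thesis by blast
  qed
  obtain s t where st: "s \<in> EE" "d 0 = s * x" "t \<in> EE" "d 1 = t * x" using x(2) dX by blast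
  have "s \<notin> Jac \<or> t \<notin> Jac"
  proof (rule ccontr)
    assume "\<not> ?thesis"
    then have J: "s \<in> Jac" "t \<in> Jac" by auto
    obtain a b where ab: "a \<in> FF" "b \<in> FF" "x = d 0 * a + d 1 * b" using dgen[OF x(1)] by blast
    obtain f where f: "f \<in> EE" "x * a = f * x" using x(2)[OF XX_FF_mult[OF x(1) ab(1)]] by blast
    obtain f' where f': "f' \<in> EE" "x * b = f' * x" using x(2)[OF XX_FF_mult[OF x(1) ab(2)]] by blast
    have "x = s * (x * a) + t * (x * b)" using ab(3) unfolding st(2,4) by (simp add: mult.assoc)
    also have "\<dots> = (s * f + t * f') * x" unfolding f(2) f'(2) by (simp add: mult.assoc distrib_right)
    finally have "x = (s * f + t * f') * x" .
    moreover have "s * f + t * f' \<in> Jac" using J by (intro Jac_add Jac_mult) auto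
    moreover have "s * f + t * f' \<in> EE" using st f f' EE_mult Co_add by auto
    ultimately have "x = 0" using nakayama_left x(1) by blast
    then have "XX = {0}" using x(2) Co_zero by force
    then show False using num_zero(1) n by simp
  qed
  then have "\<exists>u. LL x u"
  proof
    assume "s \<notin> Jac"
    then show ?thesis using main[OF st(1,2,3,4) _ dgen] cm[OF Co_zero] by blast
  next
    assume tJ: "t \<notin> Jac"
    show ?thesis
    proof (rule main[OF st(3,4,1,2) tJ])
      show "\<exists>a\<in>FF. \<exists>b\<in>FF. v = d 1 * a + d 0 * b" if "v \<in> XX" for v using dgen[OF that] add.commute by metis
      show "\<exists>m\<in>EE. \<exists>b\<in>FF. \<exists>b'\<in>FF. 0 = m * d 1 + x * b \<and> q = m * d 0 + x * b'" if "q \<in> XX" for q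
        using cm[OF that Co_zero] by blast
    qed
  qed
  then show ?thesis by blast
qed

lemma gpair_imp_RR:
  assumes g: "gpair U1 U2" and ab: "na U1 = 1" "nb U1 = 1" "na U2 = 2" "nb U2 = 1" and n: "numR = 1" "numL = 2"
  shows "\<exists>x u. RR x u"
proof -
  have l: "loc U1" "loc U2" and c: "cmpo U1 U1" "cmpo U1 U2" "cmpo U2 U2" using g by (auto simp: gpair_def)
  obtain cc where cc: "gensR 1 cc" using numR(1) unfolding n by blast
  obtain d where d: "gensL 2 d" using numL(1) unfolding n by blast
  have "iso U1 (rowob 1 cc) \<or> iso U1 P2o" using last_cone[of cc U1] cc l c ab n by simp
  then have i1: "iso U1 (rowob 1 cc)" using iso_ab[of U1 P2o] ab by auto
  have "iso U2 P1o \<or> iso U2 (colob 2 d)" using first_cone[of d U2] d l c ab n by simp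
  then have i2: "iso U2 (colob 2 d)" using iso_ab[of U2 P1o] ab by auto
  have c21: "cmpo (rowob 1 cc) (colob 2 d)" using cmpo_iso[OF locD(1)[OF l(1)] locD(1)[OF l(2)] i1 i2 c(2)] .
  define x where "x = cc 0"
  have "rowob 1 cc = rowob 1 (\<lambda>_. x)" by (auto simp: rowob_def x_def fun_eq_iff)
  have x: "x \<in> XX" "\<And>y. y \<in> XX \<Longrightarrow> \<exists>a\<in>FF. y = x * a" using cc unfolding gens1 x_def by auto
  have dX: "d 0 \<in> XX" "d 1 \<in> XX" and dgen: "\<And>y. y \<in> XX \<Longrightarrow> \<exists>a\<in>EE. \<exists>b\<in>EE. y = a * d 0 + b * d 1"
    using d unfolding gens2 by auto
  have cm: "\<And>p q. p \<in> XX \<Longrightarrow> q \<in> XX \<Longrightarrow> \<exists>m\<in>FF. \<exists>b\<in>EE. \<exists>b'\<in>EE. p = d 0 * m + b * x \<and> q = d 1 * m + b' * x"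
    using c21 unfolding \<open>rowob 1 cc = rowob 1 (\<lambda>_. x)\<close> cmpo_1_col2[OF dX x(1)] by blast
  have main: "\<exists>u. RR x u"
    if s: "s \<in> FF" "y = x * s" and t: "t \<in> FF" "z = x * t" and sJ: "s \<notin> Jac"
      and gen: "\<And>v. v \<in> XX \<Longrightarrow> \<exists>a\<in>EE. \<exists>b\<in>EE. v = a * y + b * z"
      and cm: "\<And>q. q \<in> XX \<Longrightarrow> \<exists>m\<in>FF. \<exists>b\<in>EE. \<exists>b'\<in>EE. 0 = y * m + b * x \<and> q = z * m + b' * x" for s t y z
  proof -
    obtain w where w: "w \<in> FF" "w * s = L False" "s * w = L False" using not_Jac_inverse[OF s(1) sJ] by blast
    define u where "u = t * w"
    have u: "u \<in> FF" unfolding u_def using FF_mult[OF t(1) w(1)] .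
    have wy: "y * w = x" unfolding s(2) mult.assoc w(3) using x(1) by (simp add: Co_iff)
    have wz: "z * w = x * u" unfolding t(2) u_def by (simp add: mult.assoc)
    have "RR x u" unfolding RR_def
    proof (intro conjI ballI x(1) u)
      fix a assume a: "a \<in> FF"
      obtain m b b' where m: "m \<in> FF" "b \<in> EE" "b' \<in> EE" "0 = y * m + b * x" "x * a = z * m + b' * x"
        using cm[OF XX_FF_mult[OF x(1) a]] by blast
      let ?s = "s * m" and ?r = "a - t * m"
      have "x * ?s = (- b) * x" using m(4) unfolding s(2) by (simp add: mult.assoc eq_neg_iff_add_eq_0)
      moreover have "x * ?r = b' * x" using m(5) unfolding t(2) by (simp add: right_diff_distrib mult.assoc)
      moreover have "a = ?r + u * ?s"
      proof -
        have "u * ?s = t * ((w * s) * m)" unfolding u_def by (simp only: mult.assoc)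
        also have "\<dots> = t * m" unfolding w(2) using m(1) by (simp add: Co_iff)
        finally show ?thesis by simp
      qed
      moreover have "?s \<in> FF" "?r \<in> FF" "- b \<in> EE" using m s t a FF_mult Co_diff Co_uminus by auto
      ultimately show "\<exists>r\<in>FF. \<exists>s\<in>FF. (\<exists>b\<in>EE. x * r = b * x) \<and> (\<exists>b\<in>EE. x * s = b * x) \<and> a = r + u * s"
        using m(3) by blast
    next
      fix v assume v: "v \<in> XX"
      obtain a b where ab: "a \<in> EE" "b \<in> EE" "v * s = a * y + b * z" using gen[OF XX_FF_mult[OF v s(1)]] by blast
      have "v = (v * s) * w" unfolding mult.assoc w(3) using v by (simp add: Co_iff)
      also have "\<dots> = a * (y * w) + b * (z * w)" unfolding ab(3) by (simp add: distrib_right mult.assoc)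
      finally have "v = a * x + b * x * u" unfolding wy wz by (simp add: mult.assoc)
      then show "\<exists>b\<in>EE. \<exists>b'\<in>EE. v = b * x + b' * x * u" using ab(1,2) by blast
    qed
    then show ?thesis by blast
  qed
  obtain s t where st: "s \<in> FF" "d 0 = x * s" "t \<in> FF" "d 1 = x * t" using x(2) dX by blast
  have "s \<notin> Jac \<or> t \<notin> Jac"
  proof (rule ccontr)
    assume "\<not> ?thesis"
    then have J: "s \<in> Jac" "t \<in> Jac" by auto
    obtain a b where ab: "a \<in> EE" "b \<in> EE" "x = a * d 0 + b * d 1" using dgen[OF x(1)] by blast
    obtain f where f: "f \<in> FF" "a * x = x * f" using x(2)[OF EE_XX_mult[OF ab(1) x(1)]] by blast
    obtain f' where f': "f' \<in> FF" "b * x = x * f'" using x(2)[OF EE_XX_mult[OF ab(2) x(1)]] by blast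
    have "x = (a * x) * s + (b * x) * t" using ab(3) unfolding st(2,4) by (simp add: mult.assoc)
    also have "\<dots> = x * (f * s + f' * t)" unfolding f(2) f'(2) by (simp add: mult.assoc distrib_left)
    finally have "x = x * (f * s + f' * t)" .
    moreover have "f * s + f' * t \<in> Jac" using J by (intro Jac_add Jac_mult) auto
    moreover have "f * s + f' * t \<in> FF" using st f f' FF_mult Co_add by auto
    ultimately have "x = 0" using nakayama_right x(1) by blast
    then have "XX = {0}" using x(2) Co_zero by force
    then show False using num_zero(2) n by simp
  qed
  then have "\<exists>u. RR x u"
  proof
    assume "s \<notin> Jac"
    then show ?thesis using main[OF st(1,2,3,4) _ dgen] cm[OF Co_zero] by blast
  next
    assume tJ: "t \<notin> Jac"
    show ?thesis
    proof (rule main[OF st(3,4,1,2) tJ])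
      show "\<exists>a\<in>EE. \<exists>b\<in>EE. v = a * d 1 + b * d 0" if "v \<in> XX" for v using dgen[OF that] add.commute by metis
      show "\<exists>m\<in>FF. \<exists>b\<in>EE. \<exists>b'\<in>EE. 0 = d 1 * m + b * x \<and> q = d 0 * m + b' * x" if "q \<in> XX" for q
        using cm[OF that Co_zero] by blast
    qed
  qed
  then show ?thesis by blast
qed

end

subsection \<open>Exchanging the two idempotents\<close>

text \<open>Exchanging \<open>e1\<close> and \<open>e2\<close> leaves all matrices as they are and
  negates the labels, so each notion transfers by unfolding its definition.\<close>

definition relab :: "'a cplx \<Rightarrow> 'a cplx" where
  "relab C = (\<lambda>n. map Not (fst C n), snd C)"

lemma fst_relab [simp]: "fst (relab C) n = map Not (fst C n)" and snd_relab [simp]: "snd (relab C) = snd C"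
  by (simp_all add: relab_def)

lemma relab_relab [simp]: "relab (relab C) = C"
  by (simp add: relab_def comp_def prod_eq_iff)

lemma lab_swap: "lab e2 e1 (\<not> b) = lab e1 e2 b" by (simp add: lab_def)

lemma hom_mat_relab [simp]: "hom_mat e2 e1 (map Not s) (map Not t) M = hom_mat e1 e2 s t M"
proof -
  have "(if i < length (map Not t) \<and> j < length (map Not s)
      then M i j \<in> corner (lab e2 e1 (map Not t ! i)) (lab e2 e1 (map Not s ! j)) else M i j = 0)
     = (if i < length t \<and> j < length s
      then M i j \<in> corner (lab e1 e2 (t ! i)) (lab e1 e2 (s ! j)) else M i j = 0)" for i j
    by (simp add: lab_swap)
  then show ?thesis unfolding hom_mat_def by presburger
qed

lemma id_mat_relab [simp]: "id_mat e2 e1 (map Not l) = id_mat e1 e2 l"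
  unfolding id_mat_def by (intro ext) (simp add: lab_swap)

lemma is_cplx_relab [simp]: "is_cplx e2 e1 (relab C) = is_cplx e1 e2 C"
  unfolding is_cplx_def by simp

lemma chain_map_relab [simp]: "chain_map e2 e1 (relab C) (relab D) f = chain_map e1 e2 C D f"
  unfolding chain_map_def by simp

lemma null_homotopic_relab [simp]: "null_homotopic e2 e1 (relab C) (relab D) f = null_homotopic e1 e2 C D f"
  unfolding null_homotopic_def by simp

lemma homotopic_relab [simp]: "homotopic e2 e1 (relab C) (relab D) f g = homotopic e1 e2 C D f g"
  unfolding homotopic_def by simp

lemma htpy_equiv_relab [simp]: "htpy_equiv e2 e1 (relab C) (relab D) = htpy_equiv e1 e2 C D"
  unfolding htpy_equiv_def by (simp add: comp_map_def)

lemma relab_ops [simp]: "relab (shift C) = shift (relab C)" "relab (unshift C) = unshift (relab C)"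
  "relab (dsum C D) = dsum (relab C) (relab D)" "relab (cone C D f) = cone (relab C) (relab D) f"
  "relab zero_cplx = zero_cplx"
  by (simp_all add: relab_def shift_def unshift_def dsum_def cone_def zero_cplx_def)

lemma relab_shift_pow [simp]: "relab ((shift ^^ l) C) = (shift ^^ l) (relab C)"
  by (induction l) simp_all

lemma thick_relab: "C \<in> thick e1 e2 S \<Longrightarrow> relab C \<in> thick e2 e1 (relab ` S)"
proof (induction rule: thick.induct)
  case (base C) then show ?case by (rule thick.base[OF imageI])
next
  case (iso C D) then show ?case by (simp add: thick.iso[of "relab C"])
next
  case (shift C) then show ?case by (simp add: thick.shift)
next
  case (unshift C) then show ?case by (simp add: thick.unshift)
next
  case (cone C D f) then show ?case by (simp add: thick.cone)
next
  case (summand X Y)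
  show ?case by (rule thick.summand[of _ _ _ "relab Y"]) (use summand in simp_all)
qed

lemma two_term_relab: "two_term e1 e2 C \<Longrightarrow> two_term e2 e1 (relab C)"
  by (simp add: two_term_def)

lemma silting_relab: assumes "silting e1 e2 T" shows "silting e2 e1 (relab T)"
  unfolding silting_def
proof (intro conjI allI impI)
  show "is_cplx e2 e1 (relab T)" using assms by (simp add: silting_def)
next
  fix l :: nat and f assume "l > 0" "chain_map e2 e1 (relab T) ((shift ^^ l) (relab T)) f"
  then have "chain_map e1 e2 T ((shift ^^ l) T) f" by (simp flip: relab_shift_pow)
  then have "null_homotopic e1 e2 T ((shift ^^ l) T) f" using assms \<open>l > 0\<close> by (simp add: silting_def)
  then show "null_homotopic e2 e1 (relab T) ((shift ^^ l) (relab T)) f" by (simp flip: relab_shift_pow)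
next
  fix C assume "is_cplx e2 e1 C"
  then have "is_cplx e1 e2 (relab C)" using is_cplx_relab[of e2 e1 "relab C"] by simp
  then have "relab C \<in> thick e1 e2 {T}" using assms unfolding silting_def by blast
  then show "C \<in> thick e2 e1 {relab T}" using thick_relab[of "relab C" e1 e2 "{T}"] by simp
qed

lemma indecomposable_relab: assumes "indecomposable e1 e2 C" shows "indecomposable e2 e1 (relab C)"
  unfolding indecomposable_def
proof (intro conjI allI impI)
  show "is_cplx e2 e1 (relab C)" using assms by (simp add: indecomposable_def)
  show "\<not> htpy_equiv e2 e1 (relab C) zero_cplx"
    using assms htpy_equiv_relab[of e2 e1 C zero_cplx] unfolding indecomposable_def by simp
  fix X Y assume "is_cplx e2 e1 X \<and> is_cplx e2 e1 Y \<and> htpy_equiv e2 e1 (relab C) (dsum X Y)"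
  then have "is_cplx e1 e2 (relab X) \<and> is_cplx e1 e2 (relab Y) \<and> htpy_equiv e1 e2 C (dsum (relab X) (relab Y))"
    using is_cplx_relab[of e2 e1 "relab X"] is_cplx_relab[of e2 e1 "relab Y"]
      htpy_equiv_relab[of e2 e1 C "dsum (relab X) (relab Y)"] by simp
  then have "htpy_equiv e1 e2 (relab X) zero_cplx \<or> htpy_equiv e1 e2 (relab Y) zero_cplx"
    using assms unfolding indecomposable_def by blast
  then show "htpy_equiv e2 e1 X zero_cplx \<or> htpy_equiv e2 e1 Y zero_cplx"
    using htpy_equiv_relab[of e2 e1 "relab X" zero_cplx] htpy_equiv_relab[of e2 e1 "relab Y" zero_cplx] by simp
qed

lemma basic_silting_pair_relab:
  assumes "basic_silting_pair e1 e2 T1 T2"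
  shows "basic_silting_pair e2 e1 (relab T1) (relab T2)"
  using assms two_term_relab[of e1 e2] indecomposable_relab[of e1 e2] silting_relab[of e1 e2 "dsum T1 T2"]
  unfolding basic_silting_pair_def relab_ops htpy_equiv_relab by blast

lemma cnt_Not: "cnt b (map Not l) = cnt (\<not> b) l"
proof -
  have "((\<lambda>x. x = b) \<circ> Not) = (\<lambda>x. x = (\<not> b))" by (auto simp: fun_eq_iff)
  then show ?thesis by (simp add: cnt_def filter_map)
qed

lemma K0class_relab: "K0class (relab C) = prod.swap (K0class C)"
  by (simp add: K0class_def cnt_Not)

text \<open>Relabelling preserves silting pairs and swaps the coordinates of classes. Both
  inclusions are the same statement for the two orders of the idempotents.\<close>

lemma gpoly_swap: "gpoly e2 e1 = prod.swap ` gpoly e1 e2"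
proof -
  have lin: "linear (prod.swap :: real \<times> real \<Rightarrow> _)" by (rule linearI) (auto simp: prod_eq_iff)
  have hull: "prod.swap ` (convex hull {0, u, v}) = convex hull {0, prod.swap u, prod.swap v}" for u v :: "real \<times> real"
    using convex_hull_linear_image[OF lin, of "{0, u, v}"] by (simp add: zero_prod_def)
  have sub: "prod.swap ` gpoly e1 e2 \<subseteq> gpoly e2 e1" for e1 e2 :: 'a
  proof
    fix p assume "p \<in> prod.swap ` gpoly e1 e2"
    then obtain T1 T2 where T: "basic_silting_pair e1 e2 T1 T2"
      "p \<in> prod.swap ` (convex hull {0, K0class T1, K0class T2})" unfolding gpoly_def by blast
    have "p \<in> convex hull {0, K0class (relab T1), K0class (relab T2)}"
      using T(2) unfolding hull K0class_relab .
    then show "p \<in> gpoly e2 e1" unfolding gpoly_def using basic_silting_pair_relab[OF T(1)] by blast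
  qed
  have "gpoly e2 e1 = prod.swap ` prod.swap ` gpoly e2 e1" by (simp add: image_image)
  then show ?thesis using sub[of e1 e2] sub[of e2 e1] by blast
qed

section \<open>The silting pairs of stalk complexes\<close>

context alg_pair
begin

lemma swap_alg_pair: "alg_pair sc e2 e1"
proof (intro alg_pair.intro alg_pair_axioms.intro)
  show "two_idem e2 e1" using ee e_sum by unfold_locales (simp_all add: add.commute)
  show "vspace sc" by (rule vspace_axioms)
  show "basic_alg e2 e1" using basic unfolding basic_alg_def by blast
qed (use sc_mult findim_UNIV prim in auto)

text \<open>Between stalks in one degree all homotopies vanish, so an equivalence would write
  \<open>L True\<close> as a product through the other idempotent, which is a nonunit.\<close>

lemma stalk_not_heq:
  assumes m: "m \<in> {0, -1}" shows "\<not> heq (stalk m [True]) (stalk m [False])"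
proof
  assume h: "heq (stalk m [True]) (stalk m [False])"
  let ?s = "\<lambda>b. if m = 0 then [] else [b::bool]" and ?t = "\<lambda>b. if m = 0 then [b::bool] else []"
  have e: "stalk m [b] = tt (?s b) (?t b) 0" for b using m by (auto simp: stalk_tt)
  obtain f g where fg: "cm (stalk m [True]) (stalk m [False]) f" "cm (stalk m [False]) (stalk m [True]) g"
    "hty (stalk m [True]) (stalk m [True]) (comp_map (stalk m [False]) g f) (idc (stalk m [True]))"
    using h by (rule heqE)
  obtain q p where f: "f = mp q p" "hm (?s True) (?s False) q" "hm (?t True) (?t False) p"
    using fg(1) unfolding e cm_tt_iff by blast
  obtain q' p' where g: "g = mp q' p'" "hm (?s False) (?s True) q'" "hm (?t False) (?t True) p'"
    using fg(2) unfolding e cm_tt_iff by blast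
  obtain M where M: "mp (mmul (length (?s False)) q' q - idm (?s True)) (mmul (length (?t False)) p' p - idm (?t True)) =
     mp (mmul (length (?t True)) M 0) (mmul (length (?s True)) 0 M)"
    using fg(3) unfolding e homotopic_alt f(1) g(1) comp_mp idc_tt mp_diff nh_tt_iff by blast
  have ex: "\<exists>s\<in>Co True False. \<exists>t\<in>Co False True. L True = s * t"
  proof (cases "m = 0")
    case True
    have "mmul 1 p' p - idm [True] = 0" using M True by (simp add: mp_eq_iff)
    then have "(mmul 1 p' p - idm [True]) 0 0 = 0" by simp
    then have "L True = p' 0 0 * p 0 0" by (simp add: mmul_def id_mat_def)
    moreover have "p' 0 0 \<in> Co True False" "p 0 0 \<in> Co False True"
      using hmD[OF f(3), of 0 0] hmD[OF g(3), of 0 0] True by simp_all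
    ultimately show ?thesis by blast
  next
    case False
    have "mmul 1 q' q - idm [True] = 0" using M False by (simp add: mp_eq_iff)
    then have "(mmul 1 q' q - idm [True]) 0 0 = 0" by simp
    then have "L True = q' 0 0 * q 0 0" by (simp add: mmul_def id_mat_def)
    moreover have "q' 0 0 \<in> Co True False" "q 0 0 \<in> Co False True"
      using hmD[OF f(2), of 0 0] hmD[OF g(2), of 0 0] False by simp_all
    ultimately show ?thesis by blast
  qed
  then show False using off_diag_nonunit[of _ True False] lc.inv_el_u[of True] unfolding lc.nonunits_def by fastforce
qed

lemma stalk_indec: "indecomposable e1 e2 (stalk 0 [True])" "indecomposable e1 e2 (stalk (-1) [False])"
  using loc_indec[OF loc_P(1)] loc_indec[OF loc_P(2)] unfolding ctt_P .

lemma relab_stalk: "relab (stalk m l) = stalk m (map Not l)"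
  by (auto simp: relab_def stalk_def fun_eq_iff)

end

context alg_pair
begin

interpretation S: alg_pair sc e2 e1 by (rule swap_alg_pair)

text \<open>\<open>P1\<close> in degree 0 and \<open>P2\<close> in degree -1 are the complexes of
  \<open>P1o\<close> and \<open>P2o\<close>; the other two stalks come from these after exchanging
  the idempotents.\<close>

lemma stalk_indec': "m \<in> {0, -1} \<Longrightarrow> indecomposable e1 e2 (stalk m [b])"
  using stalk_indec indecomposable_relab[OF S.stalk_indec(1)] indecomposable_relab[OF S.stalk_indec(2)]
  by (cases b) (auto simp: S.relab_stalk)

lemma stalk_pair:
  assumes m: "m \<in> {0, -1}"
  shows "basic_silting_pair e1 e2 (stalk m [True]) (stalk m [False])"
proof -
  let ?s = "if m = 0 then [] else [True, False]" and ?t = "if m = 0 then [True, False] else []"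
  let ?D = "dsum (stalk m [True]) (stalk m [False])"
  have D: "?D = tt ?s ?t 0" using m by (auto simp: stalk_append stalk_tt)
  have two: "two_term e1 e2 (stalk m [b])" for b
    unfolding two_term_def using m cx_stalk by (auto simp: stalk_def)
  have "hv ?D ((shift ^^ k) ?D)" if "k > 0" for k
  proof (cases "k = 1")
    case True
    have "cmp ?s ?t 0 ?s ?t 0" unfolding cmp_def
      by (auto simp: hm_empty intro!: exI[of _ 0])
    then have "hv ?D (shift ?D)" unfolding D hv_shift_tt_iff .
    then show ?thesis using True by simp
  next
    case False
    then have "k \<ge> 2" using that by simp
    then show ?thesis unfolding D by (rule hv_shift_pow_tt)
  qed
  moreover have "C \<in> thick e1 e2 {?D}" if "cx C" for C
  proof -
    have "?D \<in> thick e1 e2 {?D}" by (rule thick.base) simp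
    then have "stalk m [True] \<in> thick e1 e2 {?D}" "stalk m [False] \<in> thick e1 e2 {?D}"
      using thick_dsum cx_stalk by blast+
    then have "stalk 0 [True] \<in> thick e1 e2 {?D}" "stalk 0 [False] \<in> thick e1 e2 {?D}"
      using m unshift_thick by auto
    then show ?thesis using cx_in_thick that by blast
  qed
  ultimately have "silting e1 e2 ?D" unfolding silting_def hv_def using cx_dsum cx_stalk by blast
  then show ?thesis unfolding basic_silting_pair_def
    using two stalk_indec'[OF m] stalk_not_heq[OF m] by blast
qed

lemma K0class_stalk: "K0class (stalk 0 [True]) = (1, 0)" "K0class (stalk 0 [False]) = (0, 1)"
  "K0class (stalk (-1) [True]) = (-1, 0)" "K0class (stalk (-1) [False]) = (0, -1)"
  unfolding stalk_tt K0class_tt by (simp_all add: cnt_def)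

subsection \<open>The classes that can occur\<close>

lemma iso_cls: "iso U V \<Longrightarrow> (na U, nb U) = (na V, nb V)" using iso_ab by blast

lemma class_in_first_cone: assumes "loc U" "cmpo U U" "numL * nb U \<le> na U" shows "(na U, nb U) \<in> {(1, 0), (numL, 1)}"
proof -
  obtain c where c: "gensL numL c" using numL(1) by blast
  show ?thesis using first_cone[OF c assms] iso_cls[of U P1o] iso_cls[of U "colob numL c"] by auto
qed

lemma class_in_last_cone: assumes "loc U" "cmpo U U" "numR * na U \<le> nb U" shows "(na U, nb U) \<in> {(1, numR), (0, 1)}"
proof -
  obtain c where c: "gensR numR c" using numR(1) by blast
  show ?thesis using last_cone[OF c assms] iso_cls[of U "rowob numR c"] iso_cls[of U P2o] by auto
qed

lemma class_on_axis:
  assumes "loc U" "cmpo U U"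
  shows "nb U = 0 \<Longrightarrow> na U = 1" "na U = 0 \<Longrightarrow> nb U = 1"
  using class_in_first_cone[OF assms] class_in_last_cone[OF assms] by auto

lemma classes_0: assumes "numL = 0" "loc U" "cmpo U U" shows "(na U, nb U) \<in> {(1, 0), (0, 1)}"
  using class_in_first_cone[OF assms(2,3)] assms(1) by auto

lemma classes_1_1: assumes "numL = 1" "numR = 1" "loc U" "cmpo U U" shows "(na U, nb U) \<in> {(1, 0), (1, 1), (0, 1)}"
  using class_in_first_cone[OF assms(3,4)] class_in_last_cone[OF assms(3,4)] assms(1,2) by (cases "nb U \<le> na U") auto

lemma classes_L:
  assumes n: "numL = 1" "numR = 2" and l: "LL x u" and U: "loc U" "cmpo U U"
  shows "(na U, nb U) \<in> {(1, 0), (1, 1), (1, 2), (0, 1)}"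
proof -
  consider "nb U \<le> na U" | "2 * na U \<le> nb U" | "na U < nb U" "nb U < 2 * na U" by linarith
  then show ?thesis
  proof cases
    case 1 then show ?thesis using class_in_first_cone[OF U] n by auto
  next
    case 2 then show ?thesis using class_in_last_cone[OF U] n by auto
  next
    case 3
    \<comment> \<open>The weights are the coordinates of the class in the basis
      \<open>(1, 1)\<close>, \<open>(1, 2)\<close> of the middle cone.\<close>
    have "iso U (colob 1 (\<lambda>_. x)) \<or> iso U (rowob 2 (\<lambda>j. if j = 0 then x else u * x))"
      by (rule gpair_cone[OF gpair_L(1)[OF l n] U, of "2 * na U - nb U" "nb U - na U"])
        (use 3 in \<open>simp_all add: algebra_simps\<close>)
    then show ?thesis using iso_cls[of U "colob 1 (\<lambda>_. x)"] iso_cls[of U "rowob 2 (\<lambda>j. if j = 0 then x else u * x)"] by auto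
  qed
qed

lemma classes_R:
  assumes n: "numR = 1" "numL = 2" and l: "RR x u" and U: "loc U" "cmpo U U"
  shows "(na U, nb U) \<in> {(1, 0), (2, 1), (1, 1), (0, 1)}"
proof -
  consider "na U \<le> nb U" | "2 * nb U \<le> na U" | "nb U < na U" "na U < 2 * nb U" by linarith
  then show ?thesis
  proof cases
    case 1 then show ?thesis using class_in_last_cone[OF U] n by auto
  next
    case 2 then show ?thesis using class_in_first_cone[OF U] n by auto
  next
    case 3
    have "iso U (rowob 1 (\<lambda>_. x)) \<or> iso U (colob 2 (\<lambda>j. if j = 0 then x else x * u))"
      by (rule gpair_cone[OF gpair_R(1)[OF l n] U, of "2 * nb U - na U" "na U - nb U"])
        (use 3 in \<open>simp_all add: algebra_simps\<close>)
    then show ?thesis using iso_cls[of U "rowob 1 (\<lambda>_. x)"] iso_cls[of U "colob 2 (\<lambda>j. if j = 0 then x else x * u)"] by auto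
  qed
qed

end

subsection \<open>Plane geometry\<close>

definition half :: "real \<Rightarrow> real \<Rightarrow> real \<Rightarrow> (real \<times> real) set" where
  "half a b c = {p. a * fst p + b * snd p \<le> c}"

lemma mem_half [simp]: "(x, y) \<in> half a b c \<longleftrightarrow> a * x + b * y \<le> c" by (simp add: half_def)

lemma convex_half: "convex (half a b c)"
proof -
  have "half a b c = {p. inner (a, b) p \<le> c}" by (auto simp: half_def inner_prod_def)
  then show ?thesis by (simp add: convex_halfspace_le)
qed

lemma Qreg_half: "Qreg = half (-1) 0 0 \<inter> half 0 1 0" by (auto simp: Qreg_def)

text \<open>The stalk pairs contribute edges on \<open>x + y = 1\<close> and
  \<open>x + y = -1\<close> for every \<open>A\<close>. Describing the part in \<open>Qreg\<close>
  by this strip and one more convex set lets the pieces of opposite quadrants be glued by plain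
  intersection.\<close>

definition strip :: "(real \<times> real) set" where "strip = half 1 1 1 \<inter> half (-1) (-1) 1"

lemma convex_Qreg: "convex Qreg" and convex_strip: "convex strip"
  unfolding Qreg_half strip_def by (intro convex_Int convex_half)+

lemma mem_strip [simp]: "(x, y) \<in> strip \<longleftrightarrow> \<bar>x + y\<bar> \<le> 1" by (auto simp: strip_def)
lemma mem_Qreg [simp]: "(x, y) \<in> Qreg \<longleftrightarrow> 0 \<le> x \<and> y \<le> 0" by (simp add: Qreg_def)

lemma tri_iff: "(x, y) \<in> convex hull {0, (a, b), (c, d :: real)} \<longleftrightarrow>
   (\<exists>i j. 0 \<le> i \<and> 0 \<le> j \<and> i + j \<le> 1 \<and> x = i * a + j * c \<and> y = i * b + j * (d :: real))"
proof
  assume "(x, y) \<in> convex hull {0, (a, b), (c, d)}"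
  then obtain t i j where *: "0 \<le> t" "0 \<le> i" "0 \<le> j" "t + i + j = 1"
    "(x, y) = t *\<^sub>R 0 + i *\<^sub>R (a, b) + j *\<^sub>R (c, d)" unfolding convex_hull_3 by blast
  then have "x = i * a + j * c \<and> y = i * b + j * d" by (simp add: zero_prod_def)
  moreover have "i + j \<le> 1" using * by linarith
  ultimately show "\<exists>i j. 0 \<le> i \<and> 0 \<le> j \<and> i + j \<le> 1 \<and> x = i * a + j * c \<and> y = i * b + j * d" using * by blast
next
  assume "\<exists>i j. 0 \<le> i \<and> 0 \<le> j \<and> i + j \<le> 1 \<and> x = i * a + j * c \<and> y = i * b + j * d"
  then obtain i j where *: "0 \<le> i" "0 \<le> j" "i + j \<le> 1" "x = i * a + j * c" "y = i * b + j * d" by blast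
  have "(x, y) = (1 - i - j) *\<^sub>R 0 + i *\<^sub>R (a, b) + j *\<^sub>R (c, d)" using * by (simp add: zero_prod_def)
  moreover have "0 \<le> 1 - i - j" "1 - i - j + i + j = 1" using * by linarith+
  ultimately show "(x, y) \<in> convex hull {0, (a, b), (c, d)}" unfolding convex_hull_3 using *(1,2) by blast
qed

lemma triI: "0 \<le> i \<Longrightarrow> 0 \<le> j \<Longrightarrow> i + j \<le> 1 \<Longrightarrow> x = i * a + j * c \<Longrightarrow> y = i * b + j * d \<Longrightarrow>
   (x, y) \<in> convex hull {0, (a, b), (c, d :: real)}"
  unfolding tri_iff by blast

lemma Delta_Cons: "Delta [u, v] = convex hull {0, u, v}"
  "Delta (u # v # w # us) = convex hull {0, u, v} \<union> Delta (v # w # us)"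
proof -
  have "{1..<length [u, v]} = {1::nat}" by auto
  then show "Delta [u, v] = convex hull {0, u, v}" by (simp add: Delta_def)
  define A where "A = {1..<length (v # w # us)}"
  have e: "{1..<length (u # v # w # us)} = insert 1 (Suc ` A)"
    by (auto simp: A_def image_Suc_atLeastLessThan)
  have "(u # v # w # us) ! (Suc t - 1) = (v # w # us) ! (t - 1)" if "t \<in> A" for t
    using that by (cases t) (auto simp: A_def)
  then have "(\<Union>t\<in>A. convex hull {0, (u # v # w # us) ! (Suc t - 1), (u # v # w # us) ! Suc t})
     = (\<Union>t\<in>A. convex hull {0, (v # w # us) ! (t - 1), (v # w # us) ! t})"
    by (intro SUP_cong refl) (simp only: nth_Cons_Suc)
  then show "Delta (u # v # w # us) = convex hull {0, u, v} \<union> Delta (v # w # us)"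
    unfolding Delta_def e A_def[symmetric] by (simp add: image_image)
qed

lemma tri_sub: assumes "convex S" "0 \<in> S" "u \<in> S" "v \<in> S" shows "convex hull {0, u, v} \<subseteq> S"
  using assms by (intro hull_minimal) auto

abbreviation "quad H \<equiv> Qreg \<inter> strip \<inter> H"

lemma convex_quad: "convex H \<Longrightarrow> convex (quad H)" by (intro convex_Int convex_Qreg convex_strip)

text \<open>Here and in the next three lemmas, the arguments of \<open>triI\<close> are the
  coordinates of the point in the basis spanning its triangle.\<close>

lemma Delta_a: "Delta [(1, 0), (0, -1)] = quad (half 1 (-1) 1)"
  unfolding Delta_Cons
proof (intro subset_antisym tri_sub convex_quad convex_half)
  show "quad (half 1 (-1) 1) \<subseteq> convex hull {0, (1, 0), (0, -1)}"
  proof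
    fix p assume p: "p \<in> quad (half 1 (-1) 1)"
    obtain x y where xy: "p = (x, y)" by (cases p)
    show "p \<in> convex hull {0, (1, 0), (0, -1)}" unfolding xy by (rule triI[of x "- y"]) (use p xy in auto)
  qed
qed (simp_all add: zero_prod_def)

lemma Delta_b: "Delta [(1, 0), (1, -1), (0, -1)] = quad (half 1 0 1 \<inter> half 0 (-1) 1)"
  unfolding Delta_Cons
proof (intro subset_antisym Un_least tri_sub convex_quad convex_Int convex_half)
  show "quad (half 1 0 1 \<inter> half 0 (-1) 1) \<subseteq> convex hull {0, (1, 0), (1, -1)} \<union> convex hull {0, (1, -1), (0, -1)}"
  proof
    fix p assume p: "p \<in> quad (half 1 0 1 \<inter> half 0 (-1) 1)"
    obtain x y where xy: "p = (x, y)" by (cases p)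
    have b: "0 \<le> x" "y \<le> 0" "x \<le> 1" "- y \<le> 1" using p xy by auto
    consider "- y \<le> x" | "x \<le> - y" by linarith
    then show "p \<in> convex hull {0, (1, 0), (1, -1)} \<union> convex hull {0, (1, -1), (0, -1)}"
    proof cases
      case 1
      have "(x, y) \<in> convex hull {0, (1, 0), (1, -1)}" by (rule triI[of "x + y" "- y"]) (use b 1 in auto)
      then show ?thesis unfolding xy by blast
    next
      case 2
      have "(x, y) \<in> convex hull {0, (1, -1), (0, -1)}" by (rule triI[of x "- y - x"]) (use b 2 in auto)
      then show ?thesis unfolding xy by blast
    qed
  qed
qed (simp_all add: zero_prod_def)

lemma Delta_c: "Delta [(1, 0), (1, -1), (1, -2), (0, -1)] = quad (half 1 0 1)"
  unfolding Delta_Cons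
proof (intro subset_antisym Un_least tri_sub convex_quad convex_half)
  let ?U = "convex hull {0, (1, 0), (1, -1)} \<union> (convex hull {0, (1, -1), (1, -2)} \<union> convex hull {0, (1, -2), (0, -1 :: real)})"
  show "quad (half 1 0 1) \<subseteq> ?U"
  proof
    fix p assume p: "p \<in> quad (half 1 0 1)"
    obtain x y where xy: "p = (x, y)" by (cases p)
    have b: "0 \<le> x" "y \<le> 0" "x \<le> 1" "- y \<le> 1 + x" using p xy by auto
    consider "- y \<le> x" | "x \<le> - y" "- y \<le> 2 * x" | "2 * x \<le> - y" by linarith
    then show "p \<in> ?U"
    proof cases
      case 1
      have "(x, y) \<in> convex hull {0, (1, 0), (1, -1)}" by (rule triI[of "x + y" "- y"]) (use b 1 in auto)
      then show ?thesis unfolding xy by blast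
    next
      case 2
      have "(x, y) \<in> convex hull {0, (1, -1), (1, -2)}" by (rule triI[of "2 * x + y" "- y - x"]) (use b 2 in auto)
      then show ?thesis unfolding xy by blast
    next
      case 3
      have "(x, y) \<in> convex hull {0, (1, -2), (0, -1)}" by (rule triI[of x "- y - 2 * x"]) (use b 3 in auto)
      then show ?thesis unfolding xy by blast
    qed
  qed
qed (simp_all add: zero_prod_def)

lemma Delta_d: "Delta [(1, 0), (2, -1), (1, -1), (0, -1)] = quad (half 0 (-1) 1)"
  unfolding Delta_Cons
proof (intro subset_antisym Un_least tri_sub convex_quad convex_half)
  let ?U = "convex hull {0, (1, 0), (2, -1)} \<union> (convex hull {0, (2, -1), (1, -1)} \<union> convex hull {0, (1, -1), (0, -1 :: real)})"
  show "quad (half 0 (-1) 1) \<subseteq> ?U"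
  proof
    fix p assume p: "p \<in> quad (half 0 (-1) 1)"
    obtain x y where xy: "p = (x, y)" by (cases p)
    have b: "0 \<le> x" "y \<le> 0" "- y \<le> 1" "x \<le> 1 - y" using p xy by auto
    consider "- 2 * y \<le> x" | "- y \<le> x" "x \<le> - 2 * y" | "x \<le> - y" by linarith
    then show "p \<in> ?U"
    proof cases
      case 1
      have "(x, y) \<in> convex hull {0, (1, 0), (2, -1)}" by (rule triI[of "x + 2 * y" "- y"]) (use b 1 in auto)
      then show ?thesis unfolding xy by blast
    next
      case 2
      have "(x, y) \<in> convex hull {0, (2, -1), (1, -1)}" by (rule triI[of "x + y" "- 2 * y - x"]) (use b 2 in auto)
      then show ?thesis unfolding xy by blast
    next
      case 3
      have "(x, y) \<in> convex hull {0, (1, -1), (0, -1)}" by (rule triI[of x "- y - x"]) (use b 3 in auto)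
      then show ?thesis unfolding xy by blast
    qed
  qed
qed (simp_all add: zero_prod_def)

text \<open>Cramer's rule: the determinant \<open>d\<close> satisfies \<open>d d = 1\<close>, so the
  real coefficients are integers, and they are nonnegative by hypothesis.\<close>

lemma lattice_coefficients:
  fixes a1 b1 a2 b2 P Z :: nat and i j :: real
  assumes D: "\<bar>int a1 * int b2 - int a2 * int b1\<bar> = 1" and ij: "0 \<le> i" "0 \<le> j"
    and P: "real P = i * real a1 + j * real a2" and Z: "real Z = i * real b1 + j * real b2"
  obtains m n :: nat where "i = real m" "j = real n" "P = m * a1 + n * a2" "Z = m * b1 + n * b2"
proof -
  define d where "d = int a1 * int b2 - int a2 * int b1"
  have dd: "d * d = 1" using D unfolding d_def[symmetric] by (metis abs_mult_self_eq mult_1)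
  have rd: "real_of_int d = real a1 * real b2 - real a2 * real b1" by (simp add: d_def)
  have "real_of_int d * i = real P * real b2 - real Z * real a2" unfolding rd P Z by (simp add: algebra_simps)
  then have "real_of_int (d * d) * i = real_of_int (d * (int P * int b2 - int Z * int a2))" by simp
  then have i: "i = real_of_int (d * (int P * int b2 - int Z * int a2))" unfolding dd by simp
  have "real_of_int d * j = real Z * real a1 - real P * real b1" unfolding rd P Z by (simp add: algebra_simps)
  then have "real_of_int (d * d) * j = real_of_int (d * (int Z * int a1 - int P * int b1))" by simp
  then have j: "j = real_of_int (d * (int Z * int a1 - int P * int b1))" unfolding dd by simp
  obtain m where m: "i = real m" using i ij(1) by (metis of_int_0_le_iff of_int_of_nat_eq zero_le_imp_eq_int)
  obtain n where n: "j = real n" using j ij(2) by (metis of_int_0_le_iff of_int_of_nat_eq zero_le_imp_eq_int)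
  have "real P = real (m * a1 + n * a2)" "real Z = real (m * b1 + n * b2)" using P Z m n by simp_all
  then show thesis using that[OF m n] by (simp only: of_nat_eq_iff)
qed

subsection \<open>Determining the polygon\<close>

context alg_pair
begin

lemma mem_swap: "(y, x) \<in> gpoly e2 e1 \<longleftrightarrow> (x, y) \<in> gpoly e1 e2"
  unfolding gpoly_swap[of e2 e1] by force

lemma tri_gpoly: "basic_silting_pair e1 e2 T1 T2 \<Longrightarrow> convex hull {0, K0class T1, K0class T2} \<subseteq> gpoly e1 e2"
  unfolding gpoly_def by blast

text \<open>The first alternative also records that the two classes are themselves points of the
  polygon. This is what later excludes \<open>(2, -3)\<close> and \<open>(3, -2)\<close> as
  vertices.\<close>

lemma gpoly_cases:
  assumes "(x, y) \<in> gpoly e1 e2"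
  shows "(\<exists>U1 U2 i j. gpair U1 U2 \<and> gvec U1 \<in> gpoly e1 e2 \<and> gvec U2 \<in> gpoly e1 e2 \<and> 0 \<le> i \<and> 0 \<le> j \<and> i + j \<le> 1 \<and>
      x = i * real (na U1) + j * real (na U2) \<and> - y = i * real (nb U1) + j * real (nb U2))
    \<or> x \<le> 0 \<and> y \<ge> 0 \<or> x \<ge> 0 \<and> y \<ge> 0 \<and> x + y \<le> 1 \<or> x \<le> 0 \<and> y \<le> 0 \<and> x + y \<ge> -1"
proof -
  obtain T1 T2 where T: "basic_silting_pair e1 e2 T1 T2" "(x, y) \<in> convex hull {0, K0class T1, K0class T2}"
    using assms unfolding gpoly_def by blast
  have in1: "K0class T1 \<in> gpoly e1 e2" "K0class T2 \<in> gpoly e1 e2"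
    using tri_gpoly[OF T(1)] hull_subset[of "{0, K0class T1, K0class T2}" convex] by auto
  have out: "(x, y) \<in> S" if "convex S" "0 \<in> S" "K0class T1 \<in> S" "K0class T2 \<in> S" for S
    using tri_sub[OF that] T(2) by blast
  note * = silting_cases[OF T(1)]
  show ?thesis
  proof (rule disjE[OF *], goal_cases)
    case 1
    then obtain U1 U2 where U: "gpair U1 U2" "K0class T1 = gvec U1" "K0class T2 = gvec U2" by blast
    obtain i j where ij: "0 \<le> i" "0 \<le> j" "i + j \<le> 1" "x = i * real (na U1) + j * real (na U2)"
      "y = i * (- real (nb U1)) + j * (- real (nb U2))" using T(2) unfolding U gvec_def tri_iff by blast
    then have y: "- y = i * real (nb U1) + j * real (nb U2)" by simp
    show ?thesis
      by (rule disjI1, intro exI conjI, rule U(1)) (use in1 U ij y in auto)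
  next
    case 2
    then show ?thesis
    proof (elim disjE)
      assume a: "\<forall>T\<in>{T1, T2}. fst (K0class T) \<le> 0 \<and> snd (K0class T) \<ge> 0"
      have "(x, y) \<in> half 1 0 0 \<inter> half 0 (-1) 0"
        by (rule out[OF convex_Int[OF convex_half convex_half]]) (use a in \<open>auto simp: half_def\<close>)
      then show ?thesis by auto
    next
      assume a: "\<forall>T\<in>{T1, T2}. K0class T \<in> {(1, 0), (0, 1)}"
      have "(x, y) \<in> half (-1) 0 0 \<inter> half 0 (-1) 0 \<inter> half 1 1 1"
        by (rule out) (use a in \<open>auto intro!: convex_Int convex_half simp: zero_prod_def\<close>)
      then show ?thesis by auto
    next
      assume a: "\<forall>T\<in>{T1, T2}. K0class T \<in> {(-1, 0), (0, -1)}"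
      have "(x, y) \<in> half 1 0 0 \<inter> half 0 1 0 \<inter> half (-1) (-1) 1"
        by (rule out) (use a in \<open>auto intro!: convex_Int convex_half simp: zero_prod_def\<close>)
      then show ?thesis by auto
    qed
  qed
qed

lemma gpairD: "gpair U1 U2 \<Longrightarrow> loc U1 \<and> loc U2 \<and> cmpo U1 U1 \<and> cmpo U2 U2"
  by (simp add: gpair_def)

text \<open>A combination on the axis only involves classes on the axis, and there the single rigid
  class is \<open>(1, 0)\<close>; the other sign patterns respect the bound by their
  inequalities.\<close>

lemma axis_bound:
  assumes "(s, 0) \<in> gpoly e1 e2" shows "s \<le> 1"
  using gpoly_cases[OF assms]
proof (elim disjE exE conjE)
  fix U1 U2 i j assume g: "gpair U1 U2" and ij: "0 \<le> i" "0 \<le> j" "i + j \<le> 1"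
    and s: "s = i * real (na U1) + j * real (na U2)" and z: "- 0 = i * real (nb U1) + j * real (nb U2)"
  have "i * real (nb U1) = 0" "j * real (nb U2) = 0"
    using z ij mult_nonneg_nonneg[of i "real (nb U1)"] mult_nonneg_nonneg[of j "real (nb U2)"] by linarith+
  then have "i * real (na U1) = i" "j * real (na U2) = j"
    using class_on_axis(1)[of U1] class_on_axis(1)[of U2] gpairD[OF g] by auto
  then show ?thesis using s ij by linarith
qed auto

lemma axis_bound':
  assumes "(0, - s) \<in> gpoly e1 e2" shows "s \<le> 1"
  using gpoly_cases[OF assms]
proof (elim disjE exE conjE)
  fix U1 U2 i j assume g: "gpair U1 U2" and ij: "0 \<le> i" "0 \<le> j" "i + j \<le> 1"
    and s: "- (- s) = i * real (nb U1) + j * real (nb U2)" and z: "0 = i * real (na U1) + j * real (na U2)"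
  have "i * real (na U1) = 0" "j * real (na U2) = 0"
    using z ij mult_nonneg_nonneg[of i "real (na U1)"] mult_nonneg_nonneg[of j "real (na U2)"] by linarith+
  then have "i * real (nb U1) = i" "j * real (nb U2) = j"
    using class_on_axis(2)[of U1] class_on_axis(2)[of U2] gpairD[OF g] by auto
  then show ?thesis using s ij by linarith
qed auto

lemma tri_first: "convex hull {0, (1, 0), (real numL, -1)} \<subseteq> gpoly e1 e2"
proof -
  obtain c where c: "gensL numL c" using numL(1) by blast
  show ?thesis using tri_gpoly[OF gpair_first(2)[OF c]] unfolding K0class_ctt gvec_def by simp
qed

lemma tri_last: "convex hull {0, (1, - real numR), (0, -1)} \<subseteq> gpoly e1 e2"
proof -
  obtain c where c: "gensR numR c" using numR(1) by blast
  show ?thesis using tri_gpoly[OF gpair_last(2)[OF c]] unfolding K0class_ctt gvec_def by simp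
qed

lemma tri_stalk: "convex hull {0, (1, 0), (0, 1)} \<subseteq> gpoly e1 e2" "convex hull {0, (-1, 0), (0, -1)} \<subseteq> gpoly e1 e2"
  using tri_gpoly[OF stalk_pair[of 0]] tri_gpoly[OF stalk_pair[of "-1"]] unfolding K0class_stalk by simp_all

lemma gpoly_vertices: "(1, 0) \<in> gpoly e1 e2" "(0, 1) \<in> gpoly e1 e2" "(-1, 0) \<in> gpoly e1 e2" "(0, -1) \<in> gpoly e1 e2"
  "(real numL, -1) \<in> gpoly e1 e2" "(1, - real numR) \<in> gpoly e1 e2"
proof -
  have h: "u \<in> convex hull {0, u, v}" "v \<in> convex hull {0, u, v}" for u v :: "real \<times> real"
    by (auto intro: hull_inc)
  show "(1, 0) \<in> gpoly e1 e2" "(0, 1) \<in> gpoly e1 e2" "(-1, 0) \<in> gpoly e1 e2" "(0, -1) \<in> gpoly e1 e2"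
    "(real numL, -1) \<in> gpoly e1 e2" "(1, - real numR) \<in> gpoly e1 e2"
    using tri_stalk tri_first tri_last h by blast+
qed

text \<open>Points of \<open>Qreg\<close> that come from the other sign patterns lie on its boundary
  and satisfy \<open>x - y \<le> 1\<close>; the second hypothesis covers them.\<close>

lemma gpoly_Qreg_subset:
  assumes H: "convex H" "quad (half 1 (-1) 1) \<subseteq> H"
    and v: "\<And>U. loc U \<Longrightarrow> cmpo U U \<Longrightarrow> gvec U \<in> quad H"
  shows "gpoly e1 e2 \<inter> Qreg \<subseteq> quad H"
proof
  fix p assume p: "p \<in> gpoly e1 e2 \<inter> Qreg"
  obtain x y where xy: "p = (x, y)" by (cases p)
  have q: "0 \<le> x" "y \<le> 0" "(x, y) \<in> gpoly e1 e2" using p xy by auto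
  have "0 \<in> quad H" using H(2) by (auto simp: zero_prod_def)
  have sm: "(x, y) \<in> quad H" if "x - y \<le> 1" using that q H(2) by auto
  show "p \<in> quad H" using gpoly_cases[OF q(3)] unfolding xy
  proof (elim disjE exE conjE)
    fix U1 U2 i j assume g: "gpair U1 U2" and ij: "0 \<le> i" "0 \<le> j" "i + j \<le> 1"
      and s: "x = i * real (na U1) + j * real (na U2)" "- y = i * real (nb U1) + j * real (nb U2)"
    have "(x, y) \<in> convex hull {0, gvec U1, gvec U2}"
      unfolding gvec_def by (rule triI[OF ij s(1)]) (use s(2) in simp)
    moreover have "\<dots> \<subseteq> quad H" by (rule tri_sub[OF convex_quad[OF H(1)] \<open>0 \<in> quad H\<close>]) (use v gpairD[OF g] in blast)+
    ultimately show "(x, y) \<in> quad H" by blast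
  qed (use sm q in auto)
qed

section \<open>The four shapes in \<open>Qreg\<close> and the consequences of convexity\<close>

lemma gpoly_shape_a: assumes "numL = 0" shows "gpoly e1 e2 \<inter> Qreg = quad (half 1 (-1) 1)"
proof (rule subset_antisym)
  show "gpoly e1 e2 \<inter> Qreg \<subseteq> quad (half 1 (-1) 1)"
  proof (rule gpoly_Qreg_subset[OF convex_half])
    fix U assume "loc U" "cmpo U U"
    then show "gvec U \<in> quad (half 1 (-1) 1)" using classes_0[OF assms, of U] by (auto simp: gvec_def)
  qed auto
  have "quad (half 1 (-1) 1) \<subseteq> gpoly e1 e2"
    unfolding Delta_a[symmetric] Delta_Cons using tri_first assms by simp
  then show "quad (half 1 (-1) 1) \<subseteq> gpoly e1 e2 \<inter> Qreg" by blast
qed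

lemma gpoly_shape_b: assumes "numL = 1" "numR = 1" shows "gpoly e1 e2 \<inter> Qreg = quad (half 1 0 1 \<inter> half 0 (-1) 1)"
proof (rule subset_antisym)
  show "gpoly e1 e2 \<inter> Qreg \<subseteq> quad (half 1 0 1 \<inter> half 0 (-1) 1)"
  proof (rule gpoly_Qreg_subset)
    fix U assume "loc U" "cmpo U U"
    then show "gvec U \<in> quad (half 1 0 1 \<inter> half 0 (-1) 1)" using classes_1_1[OF assms, of U] by (auto simp: gvec_def)
  qed (auto intro: convex_Int convex_half)
  have "quad (half 1 0 1 \<inter> half 0 (-1) 1) \<subseteq> gpoly e1 e2"
    unfolding Delta_b[symmetric] Delta_Cons using tri_first tri_last assms by simp
  then show "quad (half 1 0 1 \<inter> half 0 (-1) 1) \<subseteq> gpoly e1 e2 \<inter> Qreg" by blast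
qed

lemma gpoly_shape_c: assumes "numL = 1" "numR = 2" "LL x u" shows "gpoly e1 e2 \<inter> Qreg = quad (half 1 0 1)"
proof (rule subset_antisym)
  show "gpoly e1 e2 \<inter> Qreg \<subseteq> quad (half 1 0 1)"
  proof (rule gpoly_Qreg_subset)
    fix U assume "loc U" "cmpo U U"
    then show "gvec U \<in> quad (half 1 0 1)" using classes_L[OF assms, of U] by (auto simp: gvec_def)
  qed (auto intro: convex_half)
  have "convex hull {0, (1, -1), (1, -2)} \<subseteq> gpoly e1 e2"
    using tri_gpoly[OF gpair_L(2)[OF assms(3,1,2)]] unfolding K0class_ctt gvec_def by simp
  then have "quad (half 1 0 1) \<subseteq> gpoly e1 e2"
    unfolding Delta_c[symmetric] Delta_Cons using tri_first tri_last assms by simp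
  then show "quad (half 1 0 1) \<subseteq> gpoly e1 e2 \<inter> Qreg" by blast
qed

lemma gpoly_shape_d: assumes "numR = 1" "numL = 2" "RR x u" shows "gpoly e1 e2 \<inter> Qreg = quad (half 0 (-1) 1)"
proof (rule subset_antisym)
  show "gpoly e1 e2 \<inter> Qreg \<subseteq> quad (half 0 (-1) 1)"
  proof (rule gpoly_Qreg_subset)
    fix U assume "loc U" "cmpo U U"
    then show "gvec U \<in> quad (half 0 (-1) 1)" using classes_R[OF assms, of U] by (auto simp: gvec_def)
  qed (auto intro: convex_half)
  have "convex hull {0, (1, -1), (2, -1)} \<subseteq> gpoly e1 e2"
    using tri_gpoly[OF gpair_R(2)[OF assms(3,1,2)]] unfolding K0class_ctt gvec_def by simp
  then have "convex hull {0, (2, -1), (1, -1)} \<subseteq> gpoly e1 e2" by (simp add: insert_commute)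
  then have "quad (half 0 (-1) 1) \<subseteq> gpoly e1 e2"
    unfolding Delta_d[symmetric] Delta_Cons using tri_first tri_last assms by simp
  then show "quad (half 0 (-1) 1) \<subseteq> gpoly e1 e2 \<inter> Qreg" by blast
qed

text \<open>Scaled by \<open>2/3\<close> the point is \<open>(1, -1)\<close>, a lattice point.
  Unimodularity makes its coefficients natural numbers, but their sum is at most
  \<open>2/3\<close>.\<close>

lemma not_three_halves: "(3/2, -(3/2)) \<notin> gpoly e1 e2"
proof
  assume "(3/2, -(3/2)) \<in> gpoly e1 e2"
  from gpoly_cases[OF this] obtain U1 U2 i j where g: "gpair U1 U2" and ij: "0 \<le> i" "0 \<le> j" "i + j \<le> 1"
    "3/2 = i * real (na U1) + j * real (na U2)" "3/2 = i * real (nb U1) + j * real (nb U2)" by auto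
  have D: "\<bar>int (na U1) * int (nb U2) - int (na U2) * int (nb U1)\<bar> = 1"
    by (rule compatible_pair_unimodular) (use g in \<open>auto simp: gpair_def\<close>)
  have e: "real 1 = (2/3 * i) * real (na U1) + (2/3 * j) * real (na U2)"
    "real 1 = (2/3 * i) * real (nb U1) + (2/3 * j) * real (nb U2)" using ij(4,5) by (simp_all add: algebra_simps)
  have "0 \<le> 2/3 * i" "0 \<le> 2/3 * j" using ij by auto
  then obtain m n :: nat where mn: "2/3 * i = real m" "2/3 * j = real n" "1 = m * na U1 + n * na U2"
    using lattice_coefficients[OF D _ _ e] by blast
  have "real m + real n < 1" using mn(1,2) ij(3) by linarith
  then have "m = 0" "n = 0" by linarith+
  then show False using mn(3) by simp
qed

lemma midpoint_in:
  fixes a b c d :: real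
  assumes "convex G" "(a, b) \<in> G" "(c, d) \<in> G" shows "((a + c) / 2, (b + d) / 2) \<in> G"
proof -
  have "(1/2) *\<^sub>R (a, b) + (1/2) *\<^sub>R (c, d) \<in> G" by (rule convexD[OF assms]) simp_all
  then show ?thesis by (simp add: add_divide_distrib)
qed

lemma gpair_sym: "gpair U1 U2 \<Longrightarrow> gpair U2 U1"
  unfolding gpair_def iso_def by blast

text \<open>\<open>(P/2, Z/2)\<close> lies in the triangle, so \<open>(P, Z)\<close> is a nonnegative integral combination of the two vertices with
  coefficient sum at most \<open>2\<close>.\<close>

lemma gpair_at:
  assumes g: "gpair U1 U2" and ij: "0 \<le> i" "0 \<le> j" "i + j \<le> 1"
    and e: "real P / 2 = i * real (na U1) + j * real (na U2)" "real Z / 2 = i * real (nb U1) + j * real (nb U2)"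
    and odd: "odd P \<or> odd Z" and nz: "P + Z > 0"
  shows "(na U1, nb U1) = (P, Z) \<or> (na U2, nb U2) = (P, Z) \<or> P = na U1 + na U2 \<and> Z = nb U1 + nb U2"
proof -
  have D: "\<bar>int (na U1) * int (nb U2) - int (na U2) * int (nb U1)\<bar> = 1"
    by (rule compatible_pair_unimodular) (use g in \<open>auto simp: gpair_def\<close>)
  have e': "real P = (2 * i) * real (na U1) + (2 * j) * real (na U2)"
    "real Z = (2 * i) * real (nb U1) + (2 * j) * real (nb U2)" using e by (simp_all add: algebra_simps)
  have "0 \<le> 2 * i" "0 \<le> 2 * j" using ij by auto
  then obtain m n :: nat where mn: "2 * i = real m" "2 * j = real n" "P = m * na U1 + n * na U2" "Z = m * nb U1 + n * nb U2"
    using lattice_coefficients[OF D _ _ e'] by blast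
  have "m + n \<le> 2" using mn(1,2) ij(3) by linarith
  then consider "m = 0" "n = 0" | "m = 1" "n = 0" | "m = 0" "n = 1" | "m = 1" "n = 1" | "m = 2" "n = 0" | "m = 0" "n = 2"
    by linarith
  then show ?thesis using mn(3,4) odd nz by cases auto
qed

text \<open>Twice the point is \<open>(2, -3)\<close>, which is either the class of a member of the
  pair, forbidden by \<open>q\<close>, or the sum of both classes. Unimodularity and the known class
  on the axis then leave only \<open>(1, 1)\<close> and \<open>(1, 2)\<close>.\<close>

lemma LL_exists:
  assumes n: "numL = 1" "numR = 2" and p: "(1, -(3/2)) \<in> gpoly e1 e2" and q: "(2, -3) \<notin> gpoly e1 e2"
  shows "\<exists>x u. LL x u"
proof -
  from gpoly_cases[OF p] obtain U1 U2 i j where g: "gpair U1 U2" and v: "gvec U1 \<in> gpoly e1 e2" "gvec U2 \<in> gpoly e1 e2"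
    and ij: "0 \<le> i" "0 \<le> j" "i + j \<le> 1"
    "1 = i * real (na U1) + j * real (na U2)" "3/2 = i * real (nb U1) + j * real (nb U2)" by auto
  have "(na U1, nb U1) = (2, 3) \<or> (na U2, nb U2) = (2, 3) \<or> 2 = na U1 + na U2 \<and> 3 = nb U1 + nb U2"
    by (rule gpair_at[OF g ij(1-3)]) (use ij in auto)
  then have s: "2 = na U1 + na U2" "3 = nb U1 + nb U2" using v q by (auto simp: gvec_def)
  have D: "\<bar>int (na U1) * int (nb U2) - int (na U2) * int (nb U1)\<bar> = 1"
    by (rule compatible_pair_unimodular) (use g in \<open>auto simp: gpair_def\<close>)
  have ax: "na U1 = 0 \<Longrightarrow> nb U1 = 1" "na U2 = 0 \<Longrightarrow> nb U2 = 1" using class_on_axis(2) gpairD[OF g] by auto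
  consider "na U1 = 0" "na U2 = 2" | "na U1 = 2" "na U2 = 0" | "na U1 = 1" "na U2 = 1" using s(1) by linarith
  then show ?thesis
  proof cases
    case 1 then show ?thesis using ax s(2) D by auto
  next
    case 2 then show ?thesis using ax s(2) D by auto
  next
    case 3
    then have "nb U1 = 1 \<and> nb U2 = 2 \<or> nb U1 = 2 \<and> nb U2 = 1" using D s(2) by auto
    then show ?thesis using gpair_imp_LL[OF g] gpair_imp_LL[OF gpair_sym[OF g]] 3 n by blast
  qed
qed

lemma RR_exists:
  assumes n: "numR = 1" "numL = 2" and p: "(3/2, -1) \<in> gpoly e1 e2" and q: "(3, -2) \<notin> gpoly e1 e2"
  shows "\<exists>x u. RR x u"
proof -
  from gpoly_cases[OF p] obtain U1 U2 i j where g: "gpair U1 U2" and v: "gvec U1 \<in> gpoly e1 e2" "gvec U2 \<in> gpoly e1 e2"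
    and ij: "0 \<le> i" "0 \<le> j" "i + j \<le> 1"
    "3/2 = i * real (na U1) + j * real (na U2)" "1 = i * real (nb U1) + j * real (nb U2)" by auto
  have "(na U1, nb U1) = (3, 2) \<or> (na U2, nb U2) = (3, 2) \<or> 3 = na U1 + na U2 \<and> 2 = nb U1 + nb U2"
    by (rule gpair_at[OF g ij(1-3)]) (use ij in auto)
  then have s: "3 = na U1 + na U2" "2 = nb U1 + nb U2" using v q by (auto simp: gvec_def)
  have D: "\<bar>int (na U1) * int (nb U2) - int (na U2) * int (nb U1)\<bar> = 1"
    by (rule compatible_pair_unimodular) (use g in \<open>auto simp: gpair_def\<close>)
  have ax: "nb U1 = 0 \<Longrightarrow> na U1 = 1" "nb U2 = 0 \<Longrightarrow> na U2 = 1" using class_on_axis(1) gpairD[OF g] by auto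
  consider "nb U1 = 0" "nb U2 = 2" | "nb U1 = 2" "nb U2 = 0" | "nb U1 = 1" "nb U2 = 1" using s(2) by linarith
  then show ?thesis
  proof cases
    case 1 then show ?thesis using ax s(1) D by auto
  next
    case 2 then show ?thesis using ax s(1) D by auto
  next
    case 3
    then have "na U1 = 1 \<and> na U2 = 2 \<or> na U1 = 2 \<and> na U2 = 1" using D s(1) by auto
    then show ?thesis using gpair_imp_RR[OF g] gpair_imp_RR[OF gpair_sym[OF g]] 3 n by blast
  qed
qed

definition caseL :: bool where "caseL \<longleftrightarrow> numL = 1 \<and> numR = 2 \<and> (\<exists>x u. LL x u)"
definition caseR :: bool where "caseR \<longleftrightarrow> numR = 1 \<and> numL = 2 \<and> (\<exists>x u. RR x u)"

lemma num_zero_iff: "numL = 0 \<longleftrightarrow> numR = 0" using num_zero by simp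

text \<open>For \<open>numL = 1\<close>, condition \<open>(L)\<close> exhibits \<open>x\<close> and
  \<open>u x\<close> as right generators, so \<open>numR \<le> 2\<close>; the value \<open>2\<close>
  is the only case beyond two-sided cyclicity.\<close>

lemma condL_cases: "condL e1 e2 \<longleftrightarrow> numL \<le> 1 \<and> numR \<le> 1 \<or> caseL"
proof
  assume c: "condL e1 e2"
  then obtain x u where l: "numL \<le> 1" "LL x u" unfolding condL_iff by blast
  show "numL \<le> 1 \<and> numR \<le> 1 \<or> caseL"
  proof (cases "numL = 1")
    case True
    then have "numR \<le> 2" using numR(2)[OF LL_gens(2)[OF l(2)]] by blast
    then show ?thesis using True l unfolding caseL_def by fastforce
  next
    case False then show ?thesis using l num_zero_iff by auto
  qed
next
  assume "numL \<le> 1 \<and> numR \<le> 1 \<or> caseL"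
  then show "condL e1 e2" using cyclic_conds(1) unfolding caseL_def condL_iff by auto
qed

lemma condR_cases: "condR e1 e2 \<longleftrightarrow> numL \<le> 1 \<and> numR \<le> 1 \<or> caseR"
proof
  assume c: "condR e1 e2"
  then obtain x u where l: "numR \<le> 1" "RR x u" unfolding condR_iff by blast
  show "numL \<le> 1 \<and> numR \<le> 1 \<or> caseR"
  proof (cases "numR = 1")
    case True
    then have "numL \<le> 2" using numL(2)[OF RR_gens(2)[OF l(2)]] by blast
    then show ?thesis using True l unfolding caseR_def by fastforce
  next
    case False then show ?thesis using l num_zero_iff by auto
  qed
next
  assume "numL \<le> 1 \<and> numR \<le> 1 \<or> caseR"
  then show "condR e1 e2" using cyclic_conds(2) unfolding caseR_def condR_iff by auto
qed

lemma only_L: "condL e1 e2 \<and> \<not> condR e1 e2 \<longleftrightarrow> caseL" and only_R: "condR e1 e2 \<and> \<not> condL e1 e2 \<longleftrightarrow> caseR"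
  unfolding condL_cases condR_cases unfolding caseL_def caseR_def by auto

lemma gpoly_shape_a_iff: "gpoly e1 e2 \<inter> Qreg = quad (half 1 (-1) 1) \<longleftrightarrow> numL = 0"
proof
  assume e: "gpoly e1 e2 \<inter> Qreg = quad (half 1 (-1) 1)"
  have "(real numL, -1) \<in> gpoly e1 e2 \<inter> Qreg" using gpoly_vertices(5) by simp
  then show "numL = 0" unfolding e by simp
qed (rule gpoly_shape_a)

lemma gpoly_shape_b_iff: "gpoly e1 e2 \<inter> Qreg = quad (half 1 0 1 \<inter> half 0 (-1) 1) \<longleftrightarrow> numL = 1 \<and> numR = 1"
proof
  assume e: "gpoly e1 e2 \<inter> Qreg = quad (half 1 0 1 \<inter> half 0 (-1) 1)"
  have "(real numL, -1) \<in> gpoly e1 e2 \<inter> Qreg" "(1, - real numR) \<in> gpoly e1 e2 \<inter> Qreg" using gpoly_vertices(5,6) by simp_all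
  then have "numL \<le> 1" "numR \<le> 1" unfolding e by simp_all
  moreover have "numL \<noteq> 0"
  proof
    assume "numL = 0"
    then have "quad (half 1 0 1 \<inter> half 0 (-1) 1) = quad (half 1 (-1) 1)" using gpoly_shape_a e by simp
    moreover have "(1, -1) \<in> quad (half 1 0 1 \<inter> half 0 (-1) 1)" "(1, -1) \<notin> quad (half 1 (-1) 1)" by simp_all
    ultimately show False by blast
  qed
  ultimately show "numL = 1 \<and> numR = 1" using num_zero_iff by linarith
qed (use gpoly_shape_b in blast)

lemma gpoly_shape_c_iff: "gpoly e1 e2 \<inter> Qreg = quad (half 1 0 1) \<longleftrightarrow> caseL"
proof
  assume e: "gpoly e1 e2 \<inter> Qreg = quad (half 1 0 1)"
  have "(real numL, -1) \<in> gpoly e1 e2 \<inter> Qreg" "(1, - real numR) \<in> gpoly e1 e2 \<inter> Qreg" using gpoly_vertices(5,6) by simp_all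
  then have le: "numL \<le> 1" "numR \<le> 2" unfolding e by simp_all
  have ex: "(1, -2) \<in> quad (half 1 0 1)" "(1, -2) \<notin> quad (half 1 (-1) 1)" "(1, -2) \<notin> quad (half 1 0 1 \<inter> half 0 (-1) 1)"
    by simp_all
  have n: "numL = 1" "numR = 2"
  proof -
    have "numL \<noteq> 0" using gpoly_shape_a e ex(1,2) by metis
    then show "numL = 1" using le by linarith
    then have "numR \<noteq> 1" using gpoly_shape_b e ex(1,3) by metis
    then show "numR = 2" using le num_zero_iff \<open>numL \<noteq> 0\<close> by linarith
  qed
  have "(1, -(3/2)) \<in> gpoly e1 e2 \<inter> Qreg" unfolding e by simp
  moreover have "(2, -3) \<notin> gpoly e1 e2 \<inter> Qreg" unfolding e by simp
  ultimately show caseL unfolding caseL_def using LL_exists n by auto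
next
  assume caseL
  then show "gpoly e1 e2 \<inter> Qreg = quad (half 1 0 1)" unfolding caseL_def using gpoly_shape_c by blast
qed

lemma gpoly_shape_d_iff: "gpoly e1 e2 \<inter> Qreg = quad (half 0 (-1) 1) \<longleftrightarrow> caseR"
proof
  assume e: "gpoly e1 e2 \<inter> Qreg = quad (half 0 (-1) 1)"
  have "(real numL, -1) \<in> gpoly e1 e2 \<inter> Qreg" "(1, - real numR) \<in> gpoly e1 e2 \<inter> Qreg" using gpoly_vertices(5,6) by simp_all
  then have le: "numL \<le> 2" "numR \<le> 1" unfolding e by simp_all
  have ex: "(2, -1) \<in> quad (half 0 (-1) 1)" "(2, -1) \<notin> quad (half 1 (-1) 1)" "(2, -1) \<notin> quad (half 1 0 1 \<inter> half 0 (-1) 1)"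
    by simp_all
  have n: "numL = 2" "numR = 1"
  proof -
    have "numL \<noteq> 0" using gpoly_shape_a e ex(1,2) by metis
    then show "numR = 1" using le num_zero_iff by linarith
    then have "numL \<noteq> 1" using gpoly_shape_b e ex(1,3) \<open>numR = 1\<close> by metis
    then show "numL = 2" using le \<open>numL \<noteq> 0\<close> by linarith
  qed
  have "(3/2, -1) \<in> gpoly e1 e2 \<inter> Qreg" unfolding e by simp
  moreover have "(3, -2) \<notin> gpoly e1 e2 \<inter> Qreg" unfolding e by simp
  ultimately show caseR unfolding caseR_def using RR_exists n by auto
next
  assume caseR
  then show "gpoly e1 e2 \<inter> Qreg = quad (half 0 (-1) 1)" unfolding caseR_def using gpoly_shape_d by blast
qed

lemma convex_imp_conds:
  assumes C: "convex (gpoly e1 e2)" shows "condL e1 e2 \<or> condR e1 e2"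
proof -
  note mid = midpoint_in[OF C]
  \<comment> \<open>This is the midpoint of \<open>(numL, -1)\<close> and
    \<open>(0, 1)\<close>.\<close>
  have "(real numL / 2, 0) \<in> gpoly e1 e2" using mid[OF gpoly_vertices(5,2)] by simp
  then have k: "numL \<le> 2" using axis_bound by force
  have "(0, - (real numR / 2)) \<in> gpoly e1 e2" using mid[OF gpoly_vertices(6,3)] by simp
  then have l: "numR \<le> 2" using axis_bound' by force
  consider "numL \<le> 1" "numR \<le> 1" | "numL = 2" "numR = 2" | "numL = 1" "numR = 2" | "numL = 2" "numR = 1"
    using k l num_zero_iff by linarith
  then show ?thesis
  proof cases
    case 1 then show ?thesis using condL_cases by blast
  next
    case 2
    then have "(2, -1) \<in> gpoly e1 e2" "(1, -2) \<in> gpoly e1 e2" using gpoly_vertices(5,6) by simp_all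
    then show ?thesis using mid[of 2 "-1" 1 "-2"] not_three_halves by simp
  next
    case 3
    then have "(1, -1) \<in> gpoly e1 e2" "(1, -2) \<in> gpoly e1 e2" using gpoly_vertices(5,6) by simp_all
    then have "(1, -(3/2)) \<in> gpoly e1 e2" using mid[of 1 "-1" 1 "-2"] by simp
    \<comment> \<open>Its midpoint with \<open>(1, 0)\<close> would be the excluded point
      \<open>(3/2, -3/2)\<close>.\<close>
    moreover have "(2, -3) \<notin> gpoly e1 e2" using mid[of 2 "-3" 1 0] gpoly_vertices(1) not_three_halves by auto
    ultimately have caseL unfolding caseL_def using LL_exists 3 by blast
    then show ?thesis using condL_cases by blast
  next
    case 4
    then have "(2, -1) \<in> gpoly e1 e2" "(1, -1) \<in> gpoly e1 e2" using gpoly_vertices(5,6) by simp_all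
    then have "(3/2, -1) \<in> gpoly e1 e2" using mid[of 2 "-1" 1 "-1"] by simp
    \<comment> \<open>Its midpoint with \<open>(0, -1)\<close> would again be
      \<open>(3/2, -3/2)\<close>.\<close>
    moreover have "(3, -2) \<notin> gpoly e1 e2" using mid[of 3 "-2" 0 "-1"] gpoly_vertices(4) not_three_halves by auto
    ultimately have caseR unfolding caseR_def using RR_exists 4 by blast
    then show ?thesis using condR_cases by blast
  qed
qed

text \<open>The last clause says that within the strip \<open>H\<close> cuts away nothing outside
  the interior of \<open>Qreg\<close>; this is what permits intersecting it with the corresponding
  set of the opposite quadrant.\<close>

lemma conds_imp_shape:
  assumes "condL e1 e2 \<or> condR e1 e2"
  obtains H where "convex H" "gpoly e1 e2 \<inter> Qreg = quad H"
    "\<And>x y. \<bar>x + y\<bar> \<le> 1 \<Longrightarrow> x \<le> 0 \<or> y \<ge> 0 \<Longrightarrow> (x, y) \<in> H"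
proof -
  have "numL = 0 \<or> numL = 1 \<and> numR = 1 \<or> caseL \<or> caseR"
    using assms num_zero_iff unfolding condL_cases condR_cases by linarith
  then show thesis
  proof (elim disjE)
    assume "numL = 0"
    then show thesis using that[of "half 1 (-1) 1"] gpoly_shape_a_iff convex_half by force
  next
    assume "numL = 1 \<and> numR = 1"
    then show thesis
      using that[of "half 1 0 1 \<inter> half 0 (-1) 1"] gpoly_shape_b_iff convex_Int[OF convex_half convex_half] by force
  next
    assume caseL
    then show thesis using that[of "half 1 0 1"] gpoly_shape_c_iff convex_half by force
  next
    assume caseR
    then show thesis using that[of "half 0 (-1) 1"] gpoly_shape_d_iff convex_half by force
  qed
qed

end

section \<open>Gluing the quadrants\<close>

context alg_pair
begin

interpretation S: alg_pair sc e2 e1 by (rule swap_alg_pair)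

text \<open>The polygon is the intersection of the strip, the set \<open>H\<close> of
  \<open>Qreg\<close> and the reflection of the set \<open>K\<close> of the opposite quadrant. The
  equality is checked quadrant by quadrant, and convexity is inherited from the three sets.\<close>

lemma conds_imp_convex:
  assumes "condL e1 e2 \<or> condR e1 e2" "condL e2 e1 \<or> condR e2 e1"
  shows "convex (gpoly e1 e2)"
proof -
  obtain H where H: "convex H" "gpoly e1 e2 \<inter> Qreg = quad H"
    "\<And>x y. \<bar>x + y\<bar> \<le> 1 \<Longrightarrow> x \<le> 0 \<or> y \<ge> 0 \<Longrightarrow> (x, y) \<in> H" using conds_imp_shape[OF assms(1)] by blast
  obtain K where K: "convex K" "gpoly e2 e1 \<inter> Qreg = quad K"
    "\<And>x y. \<bar>x + y\<bar> \<le> 1 \<Longrightarrow> x \<le> 0 \<or> y \<ge> 0 \<Longrightarrow> (x, y) \<in> K" using S.conds_imp_shape[OF assms(2)] by blast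
  have lin: "linear (prod.swap :: real \<times> real \<Rightarrow> _)" by (rule linearI) (auto simp: prod_eq_iff)
  have mK: "(x, y) \<in> prod.swap -` K \<longleftrightarrow> (y, x) \<in> K" for x y by simp
  have Hq: "(x, y) \<in> gpoly e1 e2 \<longleftrightarrow> \<bar>x + y\<bar> \<le> 1 \<and> (x, y) \<in> H" if "x \<ge> 0" "y \<le> 0" for x y
    using H(2) that by (auto simp: set_eq_iff)
  have Kq: "(x, y) \<in> gpoly e1 e2 \<longleftrightarrow> \<bar>x + y\<bar> \<le> 1 \<and> (y, x) \<in> K" if "x \<le> 0" "y \<ge> 0" for x y
  proof -
    have "(y, x) \<in> gpoly e2 e1 \<inter> Qreg \<longleftrightarrow> (y, x) \<in> quad K" unfolding K(2) ..
    then show ?thesis using that by (simp add: mem_swap add.commute[of y x])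
  qed
  have "(x, y) \<in> gpoly e1 e2 \<longleftrightarrow> \<bar>x + y\<bar> \<le> 1 \<and> (x, y) \<in> H \<and> (y, x) \<in> K" for x y
  proof -
    consider "x \<ge> 0" "y \<le> 0" | "x \<le> 0" "y \<ge> 0" | "x > 0" "y > 0" | "x < 0" "y < 0" by linarith
    then show ?thesis
    proof cases
      case 1 then show ?thesis using Hq[OF 1] K(3)[of y x] by (auto simp: add.commute)
    next
      case 2 then show ?thesis using Kq[OF 2] H(3)[of x y] by auto
    next
      case 3
      have "(x, y) \<in> gpoly e1 e2 \<longleftrightarrow> x + y \<le> 1"
      proof
        assume p: "(x, y) \<in> gpoly e1 e2"
        have "\<not> - y = i * real a + j * real b" if "0 \<le> i" "0 \<le> j" for i j a b
          using 3 that by (smt (verit) mult_nonneg_nonneg of_nat_0_le_iff)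
        then show "x + y \<le> 1" using gpoly_cases[OF p] 3 by auto
      next
        assume "x + y \<le> 1"
        then have "(x, y) \<in> convex hull {0, (1, 0), (0, 1)}" using 3 by (intro triI[of x y]) auto
        then show "(x, y) \<in> gpoly e1 e2" using tri_stalk by blast
      qed
      then show ?thesis using 3 H(3)[of x y] K(3)[of y x] by (auto simp: add.commute)
    next
      case 4
      have "(x, y) \<in> gpoly e1 e2 \<longleftrightarrow> - x - y \<le> 1"
      proof
        assume p: "(x, y) \<in> gpoly e1 e2"
        have "\<not> x = i * real a + j * real b" if "0 \<le> i" "0 \<le> j" for i j a b
          using 4 that by (smt (verit) mult_nonneg_nonneg of_nat_0_le_iff)
        then show "- x - y \<le> 1" using gpoly_cases[OF p] 4 by auto
      next
        assume "- x - y \<le> 1"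
        then have "(x, y) \<in> convex hull {0, (-1, 0), (0, -1)}" using 4 by (intro triI[of "- x" "- y"]) auto
        then show "(x, y) \<in> gpoly e1 e2" using tri_stalk by blast
      qed
      then show ?thesis using 4 H(3)[of x y] K(3)[of y x] by (auto simp: add.commute)
    qed
  qed
  then have "gpoly e1 e2 = strip \<inter> H \<inter> prod.swap -` K" by (auto simp: set_eq_iff)
  then show ?thesis using convex_strip H(1) convex_linear_vimage[OF lin K(1)] by (simp add: convex_Int)
qed

lemma gpoly_classification:
  "(convex (gpoly e1 e2) \<longleftrightarrow> ((condL e1 e2 \<or> condR e1 e2) \<and> (condL e2 e1 \<or> condR e2 e1)))
    \<and> (gpoly e1 e2 \<inter> Qreg = Delta [(1, 0), (0, -1)] \<longleftrightarrow> corner e1 e2 = {0})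
    \<and> (gpoly e1 e2 \<inter> Qreg = Delta [(1, 0), (1, -1), (0, -1)] \<longleftrightarrow>
         corner e1 e2 \<noteq> {0} \<and> left_cyclic e1 e2 \<and> right_cyclic e1 e2)
    \<and> (gpoly e1 e2 \<inter> Qreg = Delta [(1, 0), (1, -1), (1, -2), (0, -1)] \<longleftrightarrow> condL e1 e2 \<and> \<not> condR e1 e2)
    \<and> (gpoly e1 e2 \<inter> Qreg = Delta [(1, 0), (2, -1), (1, -1), (0, -1)] \<longleftrightarrow> condR e1 e2 \<and> \<not> condL e1 e2)"
  unfolding Delta_a Delta_b Delta_c Delta_d gpoly_shape_a_iff gpoly_shape_b_iff gpoly_shape_c_iff gpoly_shape_d_iff only_L only_R cyclic_num corners num_zero(1)[symmetric]
proof (intro conjI iffI refl)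
  have "linear (prod.swap :: real \<times> real \<Rightarrow> _)" by (rule linearI) (auto simp: prod_eq_iff)
  then have sw: "convex (gpoly e1 e2) \<Longrightarrow> convex (gpoly e2 e1)"
    unfolding gpoly_swap[of e2 e1] by (rule convex_linear_image)
  show "condL e1 e2 \<or> condR e1 e2" "condL e2 e1 \<or> condR e2 e1" if "convex (gpoly e1 e2)"
    using convex_imp_conds[OF that] S.convex_imp_conds[OF sw[OF that]] .
  show "convex (gpoly e1 e2)" if "(condL e1 e2 \<or> condR e1 e2) \<and> (condL e2 e1 \<or> condR e2 e1)"
    using conds_imp_convex that by blast
qed (use num_zero_iff in linarith)+

end

theorem theorem6p5:
  fixes sc :: "'k::field \<Rightarrow> 'a::ring_1 \<Rightarrow> 'a" and e1 e2 :: 'a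
  assumes "fd_algebra sc"
    and "complete_prim_orth_idems e1 e2"
    and "basic_alg e1 e2"
  shows "(convex (gpoly e1 e2) \<longleftrightarrow>
            ((condL e1 e2 \<or> condR e1 e2) \<and> (condL e2 e1 \<or> condR e2 e1)))
    \<and> (gpoly e1 e2 \<inter> Qreg = Delta [(1, 0), (0, -1)] \<longleftrightarrow> corner e1 e2 = {0})
    \<and> (gpoly e1 e2 \<inter> Qreg = Delta [(1, 0), (1, -1), (0, -1)] \<longleftrightarrow>
         corner e1 e2 \<noteq> {0} \<and> left_cyclic e1 e2 \<and> right_cyclic e1 e2)
    \<and> (gpoly e1 e2 \<inter> Qreg = Delta [(1, 0), (1, -1), (1, -2), (0, -1)] \<longleftrightarrow>
         condL e1 e2 \<and> \<not> condR e1 e2)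
    \<and> (gpoly e1 e2 \<inter> Qreg = Delta [(1, 0), (2, -1), (1, -1), (0, -1)] \<longleftrightarrow>
         condR e1 e2 \<and> \<not> condL e1 e2)"
proof -
  have vs: "vector_space sc" and m: "\<And>c x y. sc c (x * y) = sc c x * y" "\<And>c x y. sc c (x * y) = x * sc c y"
    using assms(1) unfolding fd_algebra_def by blast+
  obtain B where B: "finite B" "module.span sc B = UNIV" using assms(1) unfolding fd_algebra_def by blast
  interpret V: vspace sc using vs unfolding vspace_def .
  have "alg_pair sc e1 e2"
  proof (intro alg_pair.intro alg_pair_axioms.intro)
    show "two_idem e1 e2"
      using assms(2) unfolding complete_prim_orth_idems_def primitive_idem_def idempotent_def two_idem_def by simp
    show "vspace sc" by (rule V.vspace_axioms)
    show "V.findim UNIV" using B unfolding V.findim_def by blast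
  qed (use m assms(2,3) in \<open>auto simp: complete_prim_orth_idems_def\<close>)
  then show ?thesis by (rule alg_pair.gpoly_classification)
qed

end
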